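(* Let $F(u)$ be a power-type nonlinearity with exponent $p\ge1$, namely of the form $|u|^p$. Assume $s\in(0,1)$, $1<t,q<\infty$ with $1=\frac{p-1}{t}+\frac1q$. Then, for functions $u$ on $\mathbb{R}^d$, $$\|D^sF(u)\|_{F^0_{1,2}(\mathbb{R}^d)}\lesssim \|u\|_{L^t}^{p-1}\,\|D^su\|_{L^q}.$$
   Context: $X\lesssim Y$ means $X\le CY$ for some constant $C>0$, here independent of $u$. $\mathcal{F}f(\xi)=\int_{\mathbb{R}^d}e^{-ix\cdot\xi}f(x)\,dx$ is the Fourier transform and $D^s=\mathcal{F}^{-1}|\xi|^s\mathcal{F}$. Fix $\eta\in C_0^\infty(\mathbb{R}^d)$ non-negative, radial, radially decreasing, with $\operatorname{supp}\eta\subset\{|\xi|\le1.1\}$ and $\eta\equiv1$ on $\{|\xi|\le1\}$, and let $\chi(\xi)=\eta(\xi)-\eta(2\xi)$. Set $P_k=\mathcal{F}^{-1}\chi(\xi/2^k)\mathcal{F}$ for integers $k>0$ and $P_0=\mathcal{F}^{-1}\eta(\xi)\mathcal{F}$. The Triebel-Lizorkin norm is $$\|h\|_{F^0_{1,2}(\mathbb{R}^d)}=\Big\|\Big(\sum_{k\ge0}|P_kh|^2\Big)^{1/2}\Big\|_{L^1(\mathbb{R}^d)},$$ which is equivalent to the norm of the local Hardy space $h^1$. *)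

theory Defs
  imports "HOL-Analysis.Analysis"
begin

section \<open>Lebesgue spaces\<close>

definition in_Lp :: "real \<Rightarrow> ('a::euclidean_space \<Rightarrow> complex) \<Rightarrow> bool" where
  "in_Lp r f \<longleftrightarrow> f \<in> borel_measurable lborel \<and> integrable lborel (\<lambda>x. cmod (f x) powr r)"

definition Lp_norm :: "real \<Rightarrow> ('a::euclidean_space \<Rightarrow> complex) \<Rightarrow> real" where
  "Lp_norm r f = (LINT x|lborel. cmod (f x) powr r) powr (1 / r)"


section \<open>Smooth functions and Schwartz functions\<close>

definition dir_deriv ::
  "'a::euclidean_space \<Rightarrow> ('a \<Rightarrow> 'b::real_normed_vector) \<Rightarrow> 'a \<Rightarrow> 'b" where
  "dir_deriv b f = (\<lambda>x. frechet_derivative f (at x) b)"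

definition iter_deriv ::
  "'a::euclidean_space list \<Rightarrow> ('a \<Rightarrow> 'b::real_normed_vector) \<Rightarrow> 'a \<Rightarrow> 'b" where
  "iter_deriv bs f = foldr dir_deriv bs f"

text \<open>Lists of basis vectors play the role of multi-indices. All iterated partial derivatives are
  required to be totally differentiable everywhere, hence continuous; this is $C^\infty$.\<close>

definition smooth :: "('a::euclidean_space \<Rightarrow> 'b::real_normed_vector) \<Rightarrow> bool" where
  "smooth f \<longleftrightarrow> (\<forall>bs. set bs \<subseteq> Basis \<longrightarrow> (\<forall>x. iter_deriv bs f differentiable (at x)))"

definition schwartz :: "('a::euclidean_space \<Rightarrow> complex) \<Rightarrow> bool" where
  "schwartz f \<longleftrightarrow> smooth f \<and>
     (\<forall>bs n. set bs \<subseteq> Basis \<longrightarrow> bounded (range (\<lambda>x. norm x ^ n *\<^sub>R iter_deriv bs f x)))"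


section \<open>Fourier transform and Fourier multipliers\<close>

definition fourier :: "('a::euclidean_space \<Rightarrow> complex) \<Rightarrow> 'a \<Rightarrow> complex" where
  "fourier f \<xi> = (LINT x|lborel. exp (- (\<i> * complex_of_real (x \<bullet> \<xi>))) * f x)"

definition inv_fourier :: "('a::euclidean_space \<Rightarrow> complex) \<Rightarrow> 'a \<Rightarrow> complex" where
  "inv_fourier f x = complex_of_real (1 / (2 * pi) ^ DIM('a)) *
     (LINT \<xi>|lborel. exp (\<i> * complex_of_real (x \<bullet> \<xi>)) * f \<xi>)"

text \<open>A distribution is its (bilinear) pairing with test functions. Functionals are not cut down to
  Schwartz test functions, because the symbol $|\xi|^s$ is not smooth at the origin: for Schwartz
  $\varphi$, the transposed operator sends $\varphi$ to $\mathcal{F}(|\xi|^s\mathcal{F}^{-1}\varphi)$,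
  which is only $O(|x|^{-d-s})$ at infinity. It is bounded and integrable, so it still pairs
  absolutely with every function in $L^r$, $1 \le r \le \infty$.\<close>

type_synonym 'a distr = "('a \<Rightarrow> complex) \<Rightarrow> complex"

definition distr_of :: "('a::euclidean_space \<Rightarrow> complex) \<Rightarrow> 'a distr" where
  "distr_of f \<phi> = (LINT x|lborel. f x * \<phi> x)"

definition distr_fourier :: "'a::euclidean_space distr \<Rightarrow> 'a distr" where
  "distr_fourier T \<phi> = T (fourier \<phi>)"

definition distr_inv_fourier :: "'a::euclidean_space distr \<Rightarrow> 'a distr" where
  "distr_inv_fourier T \<phi> = T (inv_fourier \<phi>)"

definition distr_mult :: "('a::euclidean_space \<Rightarrow> real) \<Rightarrow> 'a distr \<Rightarrow> 'a distr" where
  "distr_mult m T \<phi> = T (\<lambda>\<xi>. complex_of_real (m \<xi>) * \<phi> \<xi>)"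

definition fourier_multiplier :: "('a::euclidean_space \<Rightarrow> real) \<Rightarrow> 'a distr \<Rightarrow> 'a distr" where
  "fourier_multiplier m T = distr_inv_fourier (distr_mult m (distr_fourier T))"

text \<open>The distribution \<open>T\<close> is given by the function \<open>g\<close> (unique up to null sets). The
  integrability clause is needed because the Bochner integral of a non-integrable function is 0.\<close>

definition represents :: "'a::euclidean_space distr \<Rightarrow> ('a \<Rightarrow> complex) \<Rightarrow> bool" where
  "represents T g \<longleftrightarrow> g \<in> borel_measurable lborel \<and>
     (\<forall>\<phi>. schwartz \<phi> \<longrightarrow> integrable lborel (\<lambda>x. g x * \<phi> x) \<and> T \<phi> = distr_of g \<phi>)"

definition Dpow :: "real \<Rightarrow> 'a::euclidean_space distr \<Rightarrow> 'a distr" where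
  "Dpow s = fourier_multiplier (\<lambda>\<xi>. norm \<xi> powr s)"


section \<open>Littlewood-Paley projections and the Triebel-Lizorkin norm\<close>

definition lp_bump :: "('a::euclidean_space \<Rightarrow> real) \<Rightarrow> bool" where
  "lp_bump \<eta> \<longleftrightarrow>
     smooth \<eta> \<and>
     (\<forall>\<xi>. 0 \<le> \<eta> \<xi>) \<and>
     (\<forall>\<xi> \<zeta>. norm \<xi> = norm \<zeta> \<longrightarrow> \<eta> \<xi> = \<eta> \<zeta>) \<and>
     (\<forall>\<xi> \<zeta>. norm \<xi> \<le> norm \<zeta> \<longrightarrow> \<eta> \<zeta> \<le> \<eta> \<xi>) \<and>
     closure {\<xi>. \<eta> \<xi> \<noteq> 0} \<subseteq> cball 0 (11 / 10) \<and>
     (\<forall>\<xi>\<in>cball 0 1. \<eta> \<xi> = 1)"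

definition lp_chi :: "('a::euclidean_space \<Rightarrow> real) \<Rightarrow> 'a \<Rightarrow> real" where
  "lp_chi \<eta> \<xi> = \<eta> \<xi> - \<eta> (2 *\<^sub>R \<xi>)"

definition lp_proj :: "('a::euclidean_space \<Rightarrow> real) \<Rightarrow> nat \<Rightarrow> 'a distr \<Rightarrow> 'a distr" where
  "lp_proj \<eta> k = fourier_multiplier (if k = 0 then \<eta> else (\<lambda>\<xi>. lp_chi \<eta> (\<xi> /\<^sub>R 2 ^ k)))"

definition ennreal_sqrt :: "ennreal \<Rightarrow> ennreal" where
  "ennreal_sqrt y = (if y = \<infinity> then \<infinity> else ennreal (sqrt (enn2real y)))"

text \<open>The functions \<open>g k\<close> representing the pieces $P_k h$ are unique almost everywhere, so the
  infimum merely selects the common value of the integral; it is \<open>\<infinity>\<close> if some $P_k h$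
  is not a function.\<close>

definition F012_norm :: "('a::euclidean_space \<Rightarrow> real) \<Rightarrow> 'a distr \<Rightarrow> ennreal" where
  "F012_norm \<eta> h =
     (INF g \<in> {g :: nat \<Rightarrow> 'a \<Rightarrow> complex. \<forall>k. represents (lp_proj \<eta> k h) (g k)}.
        \<integral>\<^sup>+ x. ennreal_sqrt (\<Sum>k. ennreal ((cmod (g k x))\<^sup>2)) \<partial>lborel)"


section \<open>The nonlinearity\<close>

definition power_nl :: "real \<Rightarrow> complex \<Rightarrow> complex" where
  "power_nl p z = complex_of_real (cmod z powr p)"

end

theory Submission
  imports Defs "HOL-Probability.Probability"
begin

text \<open>Write $f=|u|^p$, $v=D^su$, and let $K_k$ be the kernel of $D^sP_k$, which has integral $0$. Then
 $P_kD^sf(x)=\int K_k(x-z)(f(z)-f(x))\,dz$, and $f(z)-f(x)$ is the real differential of $|w|^p$ at $w=u(x)$,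
 applied to $u(z)-u(x)$, plus a remainder $R(x,z)$.

 The linear part is real linear in \<open>u\<close>, so its integral against $K_k$ is the differential at $u(x)$
 applied to $K_k*u(x)=P_kv(x)$ (\<open>representation_identity\<close>); it is at most $p|u(x)|^{p-1}|P_kv(x)|$.
 Summing squares over \<open>k\<close>, Hoelder's inequality with exponents $t/(p-1)$ and \<open>q\<close> and
 the Littlewood-Paley square function estimate (\<open>square_function_complex\<close>) give the claimed bound.

 For the remainder no cancellation between the pieces is needed: $\ell^2\le\ell^1$ in \<open>k\<close> and
 $\sum_k|K_k(y)|\lesssim|y|^{-d-s}$ (\<open>Ks_sum\<close>) leave $\int\!\int|R(x,z)||x-z|^{-d-s}\,dz\,dx$. By
 \<open>power_rem_bound\<close>, $|R|\lesssim|u(z)-u(x)|^{1+\epsilon}\max(|u(x)|,|u(z)|)^{p-1-\epsilon}$, and by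
 symmetry only $|u(z)|\le|u(x)|$ matters. There two bounds are available: $|u(z)-u(x)|\le2|u(x)|$, and
 $|u(x)-u(z)|\lesssim|x-z|^s(Mv(x)+Mv(z))$ with the maximal function \<open>M\<close>
 (\<open>difference_estimate\<close>). Using the second for $|x-z|<\rho$ and the first for $|x-z|\ge\rho$, with
 $\rho^s$ the quotient of $|u(x)|$ and a maximal function \<open>H\<close> built from $Mv$, yields
 $\int|R(x,z)||x-z|^{-d-s}\,dz\lesssim|u(x)|^{p-1}H(x)$ (\<open>lower_rem_integral\<close>). Hoelder's inequality
 and the maximal theorem finish the proof. An exponent $p=1$ cannot occur, since then $1=1/q$.

 The tools are developed on the way: the maximal theorem by Vitali's lemma; the $L^q$ theory of even singular
 kernels by the Calderon-Zygmund decomposition (\<open>cz_strong_low\<close>) and duality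
 (\<open>cz_strong\<close>); square functions by random signs and Khintchine's inequality; decay of kernels by
 integration by parts; Fourier inversion by Gaussian regularisation. The identity $D^su=v$ may be tested with
 Schwartz functions only, which is why it always enters through kernels with smooth compactly supported symbols.\<close>

section \<open>Notation\<close>

text \<open>All integrals are over Lebesgue measure: \<open>\<integral>\<close> of extended nonnegative functions, \<open>LINT\<close> of absolutely integrable
 ones with values in a Banach space.\<close>

abbreviation nn_lborel :: "('a::euclidean_space => ennreal) => ennreal" (binder "\<integral>" 10)
 where "nn_lborel f \<equiv> nn_integral lborel f"

abbreviation lint_lborel :: "('a::euclidean_space => 'b::{banach, second_countable_topology}) => 'b" (binder "LINT " [60] 60)
 where "lint_lborel f \<equiv> integral\<^sup>L lborel f"

abbreviation L1 :: "('a::euclidean_space => 'b::{banach, second_countable_topology}) => bool"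
 where "L1 \<equiv> integrable lborel"

abbreviation borel_fns :: "('a::topological_space => 'b::topological_space) set" ("\<B>")
 where "\<B> \<equiv> borel_measurable borel"

abbreviation en :: "real => ennreal" where "en \<equiv> ennreal"

abbreviation vol :: "'a::euclidean_space set => ennreal" where "vol \<equiv> emeasure lborel"

abbreviation ind :: "'a set => 'a => 'b::zero_neq_one" where "ind \<equiv> indicator"

abbreviation cr :: "real => complex" where "cr \<equiv> complex_of_real"

abbreviation ex :: "real => complex" where "ex t \<equiv> exp (\<i> * complex_of_real t)"

section \<open>Integrals over Euclidean space\<close>

lemma nn_integral_lborel_affine:
 fixes f :: "'a::euclidean_space => ennreal"
 assumes [measurable]: "f \<in> \<B>" and c: "c \<noteq> 0"
 shows "(\<integral>x. f x) = en (\<bar>c\<bar> ^ DIM('a)) * (\<integral>x. f (t + c *\<^sub>R x))"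
 by (subst lborel_affine[OF c, of t])
   (simp add: nn_integral_density nn_integral_distr nn_integral_cmult)

lemma nn_integral_lborel_shift:
 fixes f :: "'a::euclidean_space => ennreal"
 assumes "f \<in> \<B>"
 shows "(\<integral>x. f (t + x)) = (\<integral>x. f x)"
 using nn_integral_lborel_affine[OF assms, of 1 t] by simp

lemma nn_integral_lborel_reflect:
 fixes f :: "'a::euclidean_space => ennreal"
 assumes "f \<in> \<B>"
 shows "(\<integral>x. f (t - x)) = (\<integral>x. f x)"
 using nn_integral_lborel_affine[OF assms, of "-1" t] by simp

lemma integrable_lborel_affine:
 fixes f :: "'a::euclidean_space => 'b :: {banach, second_countable_topology}"
 assumes f: "L1 f" and c: "c \<noteq> 0"
 shows "L1 (\<lambda>x. f (t + c *\<^sub>R x))"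
proof -
 have [measurable]: "f \<in> \<B>" using borel_measurable_integrable[OF f] by simp
 from f have "integrable (density (distr lborel borel (\<lambda>x. t + c *\<^sub>R x)) (\<lambda>_. \<bar>c\<bar>^DIM('a))) f"
  using lborel_affine[OF c, of t] by simp
 then have "L1 (\<lambda>x. \<bar>c\<bar>^DIM('a) *\<^sub>R f (t + c *\<^sub>R x))"
  by (simp add: integrable_density integrable_distr_eq)
 from integrable_scaleR_right[of "inverse (\<bar>c\<bar>^DIM('a))", OF this] show ?thesis using c by simp
qed

lemma integral_lborel_affine:
 fixes f :: "'a::euclidean_space => 'b :: {banach, second_countable_topology}"
 assumes f[measurable]: "f \<in> \<B>" and c: "c \<noteq> 0"
 shows "(\<integral>x. f x \<partial>lborel) = \<bar>c\<bar>^DIM('a) *\<^sub>R (\<integral>x. f (t + c *\<^sub>R x) \<partial>lborel)"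
proof -
 have "(\<integral>x. f x \<partial>lborel) = integral\<^sup>L (density (distr lborel borel (\<lambda>x. t + c *\<^sub>R x)) (\<lambda>_. \<bar>c\<bar>^DIM('a))) f"
  using lborel_affine[OF c, of t] by simp
 also have "... = \<bar>c\<bar>^DIM('a) *\<^sub>R (\<integral>x. f (t + c *\<^sub>R x) \<partial>lborel)"
  by (simp add: integral_density integral_distr)
 finally show ?thesis .
qed

lemma integrable_lborel_reflect:
 fixes f :: "'a::euclidean_space => 'b :: {banach, second_countable_topology}"
 assumes "L1 f"
 shows "L1 (\<lambda>x. f (t - x))"
 using integrable_lborel_affine[OF assms, of "-1" t] by simp

lemma integral_lborel_reflect:
 fixes f :: "'a::euclidean_space => 'b :: {banach, second_countable_topology}"
 assumes "f \<in> \<B>"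
 shows "(\<integral>x. f (t - x) \<partial>lborel) = (\<integral>x. f x \<partial>lborel)"
 using integral_lborel_affine[OF assms, of "-1" t] by simp

lemma integrable_lborel_shift:
 fixes f :: "'a::euclidean_space => 'b :: {banach, second_countable_topology}"
 assumes "L1 f"
 shows "L1 (\<lambda>x. f (t + x))"
 using integrable_lborel_affine[OF assms, of "1" t] by simp

lemma integral_lborel_shift:
 fixes f :: "'a::euclidean_space => 'b :: {banach, second_countable_topology}"
 assumes "f \<in> \<B>"
 shows "(\<integral>x. f (t + x) \<partial>lborel) = (\<integral>x. f x \<partial>lborel)"
 using integral_lborel_affine[OF assms, of "1" t] by simp

section \<open>Real powers of extended nonnegative reals and the layer-cake formula\<close>

text \<open>The power of \<open>\<infinity>\<close> is \<open>\<infinity>\<close> and that of \<open>0\<close> is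
 \<open>0\<close>, whatever the exponent; only positive exponents are of interest.\<close>

definition epow :: "ennreal => real => ennreal" where
 "epow x q = (if x = \<top> then \<top> else en (enn2real x powr q))"

lemma epow_ennreal: "x \<ge> 0 ==> epow (en x) q = en (x powr q)"
 by (simp add: epow_def)

lemma epow_measurable [measurable]: "(\<lambda>x. epow x q) \<in> \<B>"
 unfolding epow_def by measurable

lemma epow_mono:
 assumes "x \<le> y" "q > 0" shows "epow x q \<le> epow y q"
proof (cases "y = \<top>")
 case False
 then have "x \<noteq> \<top>" using assms(1) by (auto simp: top_unique)
 with False have "enn2real x \<le> enn2real y"
  using assms by (simp add: enn2real_mono less_top)
 with False \<open>x \<noteq> \<top>\<close> show ?thesis using assms
  by (auto simp: epow_def intro!: ennreal_leI powr_mono2)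
qed (simp add: epow_def)

lemma nn_integral_powr_from0:
 assumes "a > 0" "m \<ge> 0"
 shows "(\<integral>l. en (l powr (a - 1)) * ind {0<..<m} l) = en (m powr a / a)"
proof -
 have "((\<lambda>x. x powr (a - 1)) has_integral (m powr (a - 1 + 1) / (a - 1 + 1))) {0..m}"
  by (rule has_integral_powr_from_0) (use assms in auto)
 then have "((\<lambda>x. x powr (a - 1)) has_integral (m powr a / a)) {0<..<m}"
  by (simp add: has_integral_Icc_iff_Ioo)
 from nn_integral_has_integral_lebesgue[OF _ this]
 have "(\<integral>x. en (ind {0<..<m} x * x powr (a - 1))) = en (m powr a / a)" by simp
 then show ?thesis by (subst (asm) nn_integral_cong[where v="\<lambda>l. en (l powr (a - 1)) * ind {0<..<m} l"])
   (auto simp: indicator_def)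
qed

lemma nn_integral_powr_to_inf:
 assumes "a > 0" "m > 0"
 shows "(\<integral>l. en (l powr (- a - 1)) * ind {m..} l) = en (m powr (- a) / a)"
proof -
 have "((\<lambda>x. x powr (- a - 1)) has_integral - (m powr (- a - 1 + 1)) / (- a - 1 + 1)) {m..}"
  by (rule has_integral_powr_to_inf) (use assms in auto)
 then have "((\<lambda>x. x powr (- a - 1)) has_integral (m powr (- a) / a)) {m..}"
  by (simp add: )
 from nn_integral_has_integral_lebesgue[OF _ this]
 have "(\<integral>x. en (ind {m..} x * x powr (- a - 1))) = en (m powr (- a) / a)" by simp
 then show ?thesis by (subst (asm) nn_integral_cong[where v="\<lambda>l. en (l powr (- a - 1)) * ind {m..} l"])
   (auto simp: indicator_def)
qed

text \<open>The integral of $ql^{q-1}$ over $0<l<x$. At $x=\infty$ it exceeds its values at all natural numbers.\<close>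

lemma layer_cake_point:
 assumes "q > 0"
 shows "(\<integral>l. en (q * l powr (q - 1)) * ind {0<..} l * ind {l. en l < x} l)
      = epow x q"
proof (cases "x = \<top>")
 case False
 then obtain m where m: "m \<ge> 0" "x = en m" by (metis ennreal_cases)
 have "(\<integral>l. en (q * l powr (q - 1)) * ind {0<..} l * ind {l. en l < x} l)
  = (\<integral>l. en q * (en (l powr (q - 1)) * ind {0<..<m} l))"
  using m assms by (intro nn_integral_cong) (auto simp: indicator_def ennreal_mult ennreal_less_iff)
 also have "... = en q * en (m powr q / q)"
  using m assms by (subst nn_integral_cmult) (auto simp: nn_integral_powr_from0)
 also have "... = epow x q" using m assms by (simp add: epow_ennreal flip: ennreal_mult')
 finally show ?thesis .
next
 case True
 have "en (m powr q) \<le> (\<integral>l. en (q * l powr (q - 1)) * ind {0<..} l * ind {l. en l < x} l)"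
  (is "_ \<le> ?I") if m: "m > 0" for m :: real
 proof -
  have "en (m powr q) = en q * en (m powr q / q)"
   using m assms by (simp flip: ennreal_mult')
  also have "... = (\<integral>l. en q * (en (l powr (q - 1)) * ind {0<..<m} l))"
   using m assms by (subst nn_integral_cmult) (auto simp: nn_integral_powr_from0)
  also have "... \<le> ?I" using True m assms
   by (intro nn_integral_mono) (auto simp: indicator_def ennreal_mult)
  finally show ?thesis .
 qed
 then have "en ((real n powr (1/q)) powr q) \<le> ?I" if "n > 0" for n
  using that by (intro \<open>\<And>m. m > 0 ==> _\<close>) auto
 then have "of_nat n \<le> ?I" for n
  using assms by (cases "n = 0") (auto simp: powr_powr ennreal_of_nat_eq_real_of_nat)
 then have "(SUP n::nat. of_nat n) \<le> ?I" by (intro SUP_least)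
 then have "?I = \<top>" by (simp add: ennreal_SUP_of_nat_eq_top top_unique)
 then show ?thesis using True by (simp add: epow_def)
qed

text \<open>Fubini's theorem for the region below the graph, one level at a time.\<close>

lemma layer_cake:
 fixes g :: "'a::euclidean_space => ennreal"
 assumes [measurable]: "g \<in> \<B>" and q: "q > 0"
 shows "(\<integral>x. epow (g x) q) =
  (\<integral>l. en (q * l powr (q - 1)) * ind {0<..} l * vol {x. en l < g x})"
proof -
 have "(\<integral>x. epow (g x) q) = (\<integral>x. (\<integral>l. en (q * l powr (q - 1)) * ind {0<..} l * ind {l. en l < g x} l))"
  by (simp add: layer_cake_point[OF q])
 also have "... = (\<integral>l. (\<integral>x. en (q * l powr (q - 1)) * ind {0<..} l * ind {l. en l < g x} l))"
  by (rule lborel_pair.Fubini') measurable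
 also have "... = (\<integral>l. en (q * l powr (q - 1)) * ind {0<..} l * vol {x. en l < g x})"
 proof (intro nn_integral_cong)
  fix l :: real
  have "(\<integral>x. en (q * l powr (q - 1)) * ind {0<..} l * ind {l. en l < g x} l)
   = (\<integral>x. en (q * l powr (q - 1)) * ind {0<..} l * ind {x. en l < g x} x)"
   by (intro nn_integral_cong) (auto simp: indicator_def)
  also have "... = en (q * l powr (q - 1)) * ind {0<..} l * vol {x. en l < g x}"
   by (subst nn_integral_cmult) auto
  finally show "(\<integral>x. en (q * l powr (q - 1)) * ind {0<..} l * ind {l. en l < g x} l) = ..." .
 qed
 finally show ?thesis .
qed


section \<open>Hoelder's inequality\<close>

text \<open>The graph of \<open>exp\<close> lies above its tangent at the weighted mean $ax+by$, and the weighted average of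
 the tangent line is its value there.\<close>

lemma weighted_exp_convex:
 fixes x y a b :: real
 assumes "a \<ge> 0" "b \<ge> 0" "a + b = 1"
 shows "exp (a * x + b * y) \<le> a * exp x + b * exp y"
proof -
 define m where "m = a * x + b * y"
 have t: "exp m * (1 + (z - m)) \<le> exp z" for z
 proof -
  have "exp m * (1 + (z - m)) \<le> exp m * exp (z - m)" by (intro mult_left_mono) auto
  also have "... = exp z" by (simp flip: exp_add)
  finally show ?thesis .
 qed
 have "exp m * (a + b) + exp m * (a * x + b * y - (a + b) * m) = a * (exp m * (1 + (x - m))) + b * (exp m * (1 + (y - m)))"
  by (simp add: algebra_simps)
 also have "... \<le> a * exp x + b * exp y"
  using t assms by (intro add_mono mult_left_mono) auto
 finally show ?thesis using assms by (simp add: m_def)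
qed

lemma young_powr:
 fixes x y P Q :: real
 assumes "x \<ge> 0" "y \<ge> 0" "P > 0" "Q > 0" "1 / P + 1 / Q = 1"
 shows "x * y \<le> x powr P / P + y powr Q / Q"
proof (cases "x = 0 \<or> y = 0")
 case False
 then have pos: "x > 0" "y > 0" using assms by auto
 have "x * y = exp ((1/P) * (P * ln x) + (1/Q) * (Q * ln y))"
  using pos assms by (simp add: exp_add)
 also have "... \<le> (1/P) * exp (P * ln x) + (1/Q) * exp (Q * ln y)"
  using assms by (intro weighted_exp_convex) auto
 finally show ?thesis using pos by (simp add: powr_def)
qed (use assms in auto)

lemma epow_eq_0_iff: "q > 0 ==> epow x q = 0 \<longleftrightarrow> x = 0"
 by (cases x) (auto simp: epow_def)

lemma epow_eq_top_iff [simp]: "epow x q = \<top> \<longleftrightarrow> x = \<top>"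
 by (simp add: epow_def)

lemma epow_0 [simp]: "epow 0 q = 0"
 using epow_ennreal[of 0 q] by simp

lemma epow_top [simp]: "epow \<top> q = \<top>"
 by (simp add: epow_def)

lemma epow_epow: "epow (epow x a) b = epow x (a * b)"
 by (cases x) (auto simp: epow_ennreal powr_powr)

lemma epow_one [simp]: "epow x 1 = x"
 by (cases x) (auto simp: epow_ennreal)

lemma epow_mult:
 assumes "q > 0" shows "epow (x * y) q = epow x q * epow y q"
proof (cases "x = \<top> \<or> y = \<top>")
 case True
 then show ?thesis using assms
  by (cases "x = 0"; cases "y = 0") (auto simp: ennreal_top_mult ennreal_mult_top epow_eq_0_iff)
next
 case False
 then obtain a b where "x = en a" "y = en b" "a \<ge> 0" "b \<ge> 0" by (metis ennreal_cases)
 then show ?thesis by (simp add: epow_ennreal powr_mult flip: ennreal_mult)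
qed

lemma epow_sum_le:
 assumes "q > 0" shows "epow (x + y) q \<le> en (2 powr q) * (epow x q + epow y q)"
proof -
 have "x + y \<le> en 2 * max x y"
 proof -
  have "x + y \<le> max x y + max x y" by (intro add_mono) auto
  then show ?thesis by (simp add: mult_2)
 qed
 then have "epow (x + y) q \<le> epow (en 2 * max x y) q" using assms by (rule epow_mono)
 also have "... = en (2 powr q) * epow (max x y) q" using assms
  by (subst epow_mult) (auto simp: epow_ennreal simp del: ennreal_numeral)
 also have "... \<le> en (2 powr q) * (epow x q + epow y q)"
  by (intro mult_left_mono) (auto simp: max_def)
 finally show ?thesis .
qed

text \<open>Young's inequality, integrated after both factors are normalised to have integral $1$.\<close>

lemma nn_hoelder:
 fixes f g :: "'b => ennreal"
 assumes [measurable]: "f \<in> borel_measurable M" "g \<in> borel_measurable M"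
  and PQ: "P > 0" "Q > 0" "1 / P + 1 / Q = 1"
 shows "(\<integral>\<^sup>+x. f x * g x \<partial>M) \<le> epow (\<integral>\<^sup>+x. epow (f x) P \<partial>M) (1 / P) * epow (\<integral>\<^sup>+x. epow (g x) Q \<partial>M) (1 / Q)"
proof -
 define A where "A = (\<integral>\<^sup>+x. epow (f x) P \<partial>M)"
 define B where "B = (\<integral>\<^sup>+x. epow (g x) Q \<partial>M)"
 have z: "(\<integral>\<^sup>+x. f x * g x \<partial>M) = 0" if "A = 0 \<or> B = 0"
 proof -
  have "(AE x in M. epow (f x) P = 0) \<or> (AE x in M. epow (g x) Q = 0)"
   using that unfolding A_def B_def by (subst (asm) (1 2) nn_integral_0_iff_AE) auto
  then have "AE x in M. f x * g x = 0" using PQ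
   by (elim disjE) (auto elim!: eventually_mono simp: epow_eq_0_iff)
  then show ?thesis by (subst nn_integral_0_iff_AE) auto
 qed
 consider "A = 0 \<or> B = 0" | "A \<noteq> 0" "B \<noteq> 0" "A = \<top> \<or> B = \<top>" | "A \<noteq> 0" "B \<noteq> 0" "A \<noteq> \<top>" "B \<noteq> \<top>" by blast
 then show ?thesis
 proof cases
  case 1
  then show ?thesis using z by simp
 next
  case 2
  then have "epow A (1 / P) * epow B (1 / Q) = \<top>" using PQ
   by (auto simp: ennreal_top_mult ennreal_mult_top epow_eq_0_iff)
  then show ?thesis by (simp add: A_def B_def)
 next
  case 3
  then obtain a b where ab: "A = en a" "B = en b" "a > 0" "b > 0"
   by (metis ennreal_cases ennreal_0 less_eq_real_def)
  define c where "c = a powr (1 / P) * b powr (1 / Q)"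
  have pt: "f x * g x \<le> en c * (en (1 / (P * a)) * epow (f x) P + en (1 / (Q * b)) * epow (g x) Q)" for x
  proof (cases "f x = \<top> \<or> g x = \<top>")
   case True
   then have "en (1 / (P * a)) * epow (f x) P + en (1 / (Q * b)) * epow (g x) Q = \<top>"
    using ab PQ by (auto simp: ennreal_mult_top)
   moreover have "en c \<noteq> 0" using ab by (simp add: c_def)
   ultimately show ?thesis by (simp only: ennreal_mult_top) simp
  next
   case False
   then obtain u v where uv: "f x = en u" "g x = en v" "u \<ge> 0" "v \<ge> 0" by (metis ennreal_cases)
   have "(u / a powr (1 / P)) * (v / b powr (1 / Q)) \<le> (u / a powr (1 / P)) powr P / P + (v / b powr (1 / Q)) powr Q / Q"
    using PQ uv by (intro young_powr) auto
   also have "... = u powr P / (P * a) + v powr Q / (Q * b)"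
    using PQ ab uv by (simp add: powr_divide powr_powr mult.commute)
   finally have "u * v \<le> c * (u powr P / (P * a) + v powr Q / (Q * b))"
    using ab by (simp add: c_def field_simps)
   then have "en (u * v) \<le> en (c * (u powr P / (P * a) + v powr Q / (Q * b)))" by (rule ennreal_leI)
   also have "... = en c * (en (1 / (P * a)) * epow (f x) P + en (1 / (Q * b)) * epow (g x) Q)"
    using uv ab PQ by (simp add: epow_ennreal c_def flip: ennreal_mult ennreal_plus)
   finally show ?thesis using uv by (simp add: ennreal_mult)
  qed
  have "(\<integral>\<^sup>+x. f x * g x \<partial>M) \<le> (\<integral>\<^sup>+x. en c * (en (1 / (P * a)) * epow (f x) P + en (1 / (Q * b)) * epow (g x) Q) \<partial>M)"
   by (intro nn_integral_mono pt)
  also have "... = en c * (en (1 / (P * a)) * A + en (1 / (Q * b)) * B)"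
   by (simp add: nn_integral_cmult nn_integral_add A_def B_def)
  also have "... = en (c * (1 / P + 1 / Q))"
   using ab PQ by (simp add: c_def flip: ennreal_mult ennreal_plus)
  also have "... = epow A (1 / P) * epow B (1 / Q)"
   using ab PQ by (simp add: c_def epow_ennreal flip: ennreal_mult)
  finally show ?thesis by (simp add: A_def B_def)
 qed
qed

section \<open>The Hardy-Littlewood maximal function\<close>

lemma ball_in_borel [measurable]: "ball (x::'a::metric_space) r \<in> sets borel"
 by (rule borel_open) simp

text \<open>A countable subfamily from Vitali's covering lemma, listed as a sequence. Indices not in use get radius $0$,
 hence empty balls, so that later sums may run over all indices.\<close>

lemma vitali_sequence:
 fixes a :: "'b => 'a::euclidean_space"
 assumes S: "S \<subseteq> (\<Union>i\<in>K. ball (a i) (r i))" and r: "\<And>i. i \<in> K ==> 0 < r i \<and> r i \<le> B"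
 obtains x :: "nat => 'a" and \<rho> where "\<And>n. \<rho> n \<ge> 0" "disjoint_family (\<lambda>n. ball (x n) (\<rho> n))"
  "S \<subseteq> (\<Union>n. ball (x n) (5 * \<rho> n))" "\<And>n. \<rho> n > 0 ==> \<exists>i\<in>K. x n = a i \<and> \<rho> n = r i"
proof -
 obtain C where C: "countable C" "C \<subseteq> K"
   "pairwise (\<lambda>i j. disjnt (ball (a i) (r i)) (ball (a j) (r j))) C"
   "S \<subseteq> (\<Union>i\<in>C. ball (a i) (5 * r i))"
  using Vitali_covering_lemma_balls[OF S r] by blast
 define e where "e = to_nat_on C"
 define g where "g = from_nat_into C"
 define N where "N = e ` C"
 have ge: "g (e i) = i" if "i \<in> C" for i using that C by (simp add: g_def e_def)
 have N: "\<exists>i\<in>C. n = e i" if "n \<in> N" for n using that by (auto simp: N_def)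
 show ?thesis
 proof (rule that[of "\<lambda>n. if n \<in> N then r (g n) else 0" "\<lambda>n. a (g n)"])
  show "0 \<le> (if n \<in> N then r (g n) else 0)" for n
   using N[of n] r ge C(2) by (auto simp: less_imp_le subset_eq)
  show "disjoint_family (\<lambda>n. ball (a (g n)) (if n \<in> N then r (g n) else 0))"
   unfolding disjoint_family_on_def
  proof safe
   fix m n :: nat and x assume mn: "m \<noteq> n"
    "x \<in> ball (a (g m)) (if m \<in> N then r (g m) else 0)"
    "x \<in> ball (a (g n)) (if n \<in> N then r (g n) else 0)"
   then have "m \<in> N" "n \<in> N" by (auto split: if_splits simp: not_less dest: order_le_less_trans[OF zero_le_dist])
   with mn N ge obtain i j where ij: "i \<in> C" "j \<in> C" "m = e i" "n = e j" by metis
   with mn have "i \<noteq> j" by auto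
   with C(3) ij have "disjnt (ball (a i) (r i)) (ball (a j) (r j))" by (auto simp: pairwise_def)
   with mn ij ge \<open>m \<in> N\<close> \<open>n \<in> N\<close> show "x \<in> {}" by (auto simp: disjnt_def)
  qed
  show "S \<subseteq> (\<Union>n. ball (a (g n)) (5 * (if n \<in> N then r (g n) else 0)))"
  proof
   fix x assume "x \<in> S"
   then obtain i where i: "i \<in> C" "x \<in> ball (a i) (5 * r i)" using C by blast
   then show "x \<in> (\<Union>n. ball (a (g n)) (5 * (if n \<in> N then r (g n) else 0)))"
    using ge by (intro UN_I[of "e i"]) (auto simp: N_def)
  qed
  show "\<exists>i\<in>K. a (g n) = a i \<and> (if n \<in> N then r (g n) else 0) = r i"
   if "0 < (if n \<in> N then r (g n) else 0)" for n
   using that N[of n] ge C(2) by (auto split: if_splits)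
 qed
qed

definition mx :: "('a::euclidean_space => ennreal) => 'a => ennreal" where
 "mx f x = (SUP r\<in>{0<..}. en (1 / measure lborel (ball x r)) * (\<integral>y. f y * ind (ball x r) y))"

text \<open>The volume of the unit ball, which only depends on the type.\<close>

definition ubv :: "'a::euclidean_space itself => real" where
 "ubv _ = measure lborel (ball (0::'a) 1)"

lemma ubv_pos: "ubv TYPE('a::euclidean_space) > 0"
 by (simp add: ubv_def)

lemma measure_ball_ubv:
 "r \<ge> 0 ==> measure lborel (ball (x::'a::euclidean_space) r) = ubv TYPE('a) * r ^ DIM('a)"
 using content_ball_conv_unit_ball[of r x] by (simp add: ubv_def mult.commute)

lemma emeasure_ball_ubv:
 "r \<ge> 0 ==> vol (ball (x::'a::euclidean_space) r) = en (ubv TYPE('a) * r ^ DIM('a))"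
 using emeasure_lborel_ball_finite[of x r] by (subst emeasure_eq_ennreal_measure) (auto simp: measure_ball_ubv)

lemma mx_ball:
 fixes x :: "'a::euclidean_space"
 assumes "r > 0"
 shows "(\<integral>y. f y * ind (ball x r) y) \<le> en (ubv TYPE('a) * r ^ DIM('a)) * mx f x"
proof -
 let ?I = "(\<integral>y. f y * ind (ball x r) y)" and ?m = "ubv TYPE('a) * r ^ DIM('a)"
 have m: "?m > 0" using ubv_pos[where 'a='a] assms by simp
 have "en (1 / ?m) * ?I \<le> mx f x"
  unfolding mx_def using assms by (intro SUP_upper2[of r]) (auto simp: measure_ball_ubv)
 then have "en ?m * (en (1 / ?m) * ?I) \<le> en ?m * mx f x" by (rule mult_left_mono) simp
 moreover have "en ?m * (en (1 / ?m) * ?I) = ?I"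
  using m ubv_pos[where 'a='a] by (simp flip: mult.assoc ennreal_mult)
 ultimately show ?thesis by simp
qed

lemma mx_lessD:
 fixes x :: "'a::euclidean_space"
 assumes "c < mx f x"
 obtains r where "r > 0" "c < en (1 / (ubv TYPE('a) * r ^ DIM('a))) * (\<integral>y. f y * ind (ball x r) y)"
 using assms unfolding mx_def less_SUP_iff by (auto simp: measure_ball_ubv)

lemma mx_mono_AE:
 assumes "AE y in lborel. f y \<le> g y" shows "mx f x \<le> mx g x"
 unfolding mx_def
 by (intro SUP_mono' mult_left_mono nn_integral_mono_AE) (use assms in \<open>auto elim!: eventually_mono simp: indicator_def\<close>)

lemma mx_mono: "(\<And>y. f y \<le> g y) ==> mx f x \<le> mx g x"
 by (rule mx_mono_AE) auto

lemma mx_add_le: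
 assumes [measurable]: "f \<in> \<B>" "g \<in> \<B>"
 shows "mx (\<lambda>y. f y + g y) x \<le> mx f x + mx g x"
proof -
 have "en (1 / measure lborel (ball x r)) * (\<integral>y. (f y + g y) * ind (ball x r) y) \<le> mx f x + mx g x"
  if "r > 0" for r
 proof -
  have "en (1 / measure lborel (ball x r)) * (\<integral>y. (f y + g y) * ind (ball x r) y)
   = en (1 / measure lborel (ball x r)) * (\<integral>y. f y * ind (ball x r) y)
   + en (1 / measure lborel (ball x r)) * (\<integral>y. g y * ind (ball x r) y)"
   unfolding distrib_right distrib_left[symmetric] by (subst nn_integral_add) auto
  also have "... \<le> mx f x + mx g x" unfolding mx_def
   using that by (intro add_mono SUP_upper) auto
  finally show ?thesis .
 qed
 then show ?thesis by (subst (1) mx_def) (auto intro!: SUP_least)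
qed

lemma mx_const_le: "mx (\<lambda>y. c) (x::'a::euclidean_space) \<le> c"
proof -
 have "en (1 / measure lborel (ball x r)) * (\<integral>y. c * ind (ball x r) y) \<le> c" if "r > 0" for r
  using that ubv_pos[where 'a='a] by (simp add: nn_integral_cmult_indicator emeasure_ball_ubv measure_ball_ubv mult.left_commute flip: ennreal_mult)
 then show ?thesis by (auto simp: mx_def intro!: SUP_least)
qed

text \<open>Replacing the radius \<open>r\<close> by $r+\delta$ hardly changes the average, and the ball of radius
 $r+\delta$ around any point at distance less than $\delta$ contains the original ball.\<close>

lemma open_mx_gt: "open {x::'a::euclidean_space. c < mx f x}"
 unfolding open_contains_ball
proof safe
 fix x :: 'a assume "c < mx f x"
 then obtain r where r: "r > 0" "c < en (1 / (ubv TYPE('a) * r ^ DIM('a))) * (\<integral>y. f y * ind (ball x r) y)"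
  (is "_ < _ * ?I") by (rule mx_lessD)
 have "((\<lambda>\<delta>. en (1 / (ubv TYPE('a) * (r + \<delta>) ^ DIM('a))) * ?I) \<longlongrightarrow> en (1 / (ubv TYPE('a) * (r + 0) ^ DIM('a))) * ?I) (at_right 0)"
  using r ubv_pos[where 'a='a]
  by (intro tendsto_mult_ennreal tendsto_intros) auto
 from order_tendstoD(1)[OF this, of c] r(2)
 have "\<forall>\<^sub>F \<delta> in at_right 0. c < en (1 / (ubv TYPE('a) * (r + \<delta>) ^ DIM('a))) * ?I" by simp
 then obtain e where e: "e > 0" "\<And>\<delta>. 0 < \<delta> ==> \<delta> < e ==> c < en (1 / (ubv TYPE('a) * (r + \<delta>) ^ DIM('a))) * ?I"
  unfolding eventually_at_right_field by auto
 define \<delta> where "\<delta> = e / 2"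
 have \<delta>: "\<delta> > 0" "c < en (1 / (ubv TYPE('a) * (r + \<delta>) ^ DIM('a))) * ?I" using e by (auto simp: \<delta>_def)
 show "\<exists>e>0. ball x e \<subseteq> {x. c < mx f x}"
 proof (intro exI conjI subsetI CollectI)
  show "\<delta> > 0" by fact
  fix y assume y: "y \<in> ball x \<delta>"
  note \<delta>(2)
  also have "en (1 / (ubv TYPE('a) * (r + \<delta>) ^ DIM('a))) * ?I \<le>
    en (1 / (ubv TYPE('a) * (r + \<delta>) ^ DIM('a))) * (\<integral>z. f z * ind (ball y (r + \<delta>)) z)"
  proof (rule mult_left_mono[OF nn_integral_mono])
   fix z show "f z * ind (ball x r) z \<le> f z * ind (ball y (r + \<delta>)) z"
   proof (cases "z \<in> ball x r")
    case True
    then have "z \<in> ball y (r + \<delta>)" using y dist_triangle[of y z x] by (auto simp: dist_commute)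
    with True show ?thesis by simp
   qed simp
  qed simp
  also have "... \<le> mx f y" unfolding mx_def using \<delta> r
   by (intro SUP_upper2[of "r + \<delta>"]) (auto simp: measure_ball_ubv)
  finally show "c < mx f y" .
 qed
qed

lemma mx_measurable [measurable]: "mx f \<in> \<B>"
 by (rule borel_measurableI_greater) (simp add: borel_open open_mx_gt)

text \<open>Each point of the level set is the centre of a ball of average greater than \<open>c\<close>. The volumes of
 these balls are at most the integral of \<open>f\<close> divided by \<open>c\<close>, so their radii are bounded
 and Vitali's lemma applies; the fivefold dilates of disjoint ones cover.\<close>

lemma mx_weak_type:
 fixes f :: "'a::euclidean_space => ennreal"
 assumes [measurable]: "f \<in> \<B>" and c: "c > 0"
 shows "en c * vol {x. en c < mx f x} \<le> en (5 ^ DIM('a)) * (\<integral>x. f x)"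
proof (cases "(\<integral>x. f x) = \<top>")
 case True
 then show ?thesis by (simp add: ennreal_mult_top)
next
 case False
 then obtain i where i: "(\<integral>x. f x) = en i" "i \<ge> 0" by (metis ennreal_cases)
 define S where "S = {x. en c < mx f x}"
 define w where "w = ubv TYPE('a)"
 have w: "w > 0" by (simp add: w_def ubv_pos)
 have "\<exists>r>0. en c < en (1 / (w * r ^ DIM('a))) * (\<integral>y. f y * ind (ball x r) y)" if "x \<in> S" for x
  using that mx_lessD[of "en c" f x] by (auto simp: S_def w_def)
 then obtain r where r: "\<And>x. x \<in> S ==> r x > 0"
  "\<And>x. x \<in> S ==> en c < en (1 / (w * r x ^ DIM('a))) * (\<integral>y. f y * ind (ball x (r x)) y)"
  by metis
 have rI: "en (c * (w * r x ^ DIM('a))) \<le> (\<integral>y. f y * ind (ball x (r x)) y)" if "x \<in> S" for x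
 proof -
  let ?I = "(\<integral>y. f y * ind (ball x (r x)) y)"
  have p: "w * r x ^ DIM('a) > 0" using r(1)[OF that] w by simp
  have "en (w * r x ^ DIM('a)) * en c \<le> en (w * r x ^ DIM('a)) * (en (1 / (w * r x ^ DIM('a))) * ?I)"
   using r(2)[OF that] by (intro mult_left_mono) auto
  also have "... = ?I" using p w by (simp flip: mult.assoc ennreal_mult)
  finally show ?thesis using p c by (simp add: ennreal_mult' mult.commute)
 qed
 have bnd: "r x \<le> max 1 (i / (c * w))" if "x \<in> S" for x
 proof (cases "r x \<le> 1")
  case False
  have "en (c * (w * r x ^ DIM('a))) \<le> (\<integral>y. f y)"
   using rI[OF that] by (rule order_trans) (auto intro!: nn_integral_mono simp: indicator_def)
  then have "c * (w * r x ^ DIM('a)) \<le> i" using i by (simp add: ennreal_le_iff)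
  moreover have "r x \<le> r x ^ DIM('a)" using False by (intro self_le_power) auto
  moreover have "(c * w) * r x \<le> (c * w) * r x ^ DIM('a)" if "r x \<le> r x ^ DIM('a)"
   using that c w by (intro mult_left_mono) auto
  ultimately have "(c * w) * r x \<le> i" by (simp add: mult.assoc)
  then have "r x \<le> i / (c * w)" using c w by (simp add: pos_le_divide_eq mult.commute)
  then show ?thesis by simp
 qed simp
 obtain x \<rho> where V: "\<And>n. \<rho> n \<ge> 0" "disjoint_family (\<lambda>n. ball (x n) (\<rho> n))"
  "S \<subseteq> (\<Union>n::nat. ball (x n) (5 * \<rho> n))" "\<And>n. \<rho> n > 0 ==> \<exists>i\<in>S. x n = i \<and> \<rho> n = r i"
 proof (rule vitali_sequence[where S=S and K=S and a="\<lambda>x. x" and r=r and B="max 1 (i / (c * w))"])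
  show "S \<subseteq> (\<Union>i\<in>S. ball i (r i))" using r by force
 qed (use r bnd in auto)
 have Bn: "en c * vol (ball (x n) (5 * \<rho> n)) \<le> en (5 ^ DIM('a)) * (\<integral>y. f y * ind (ball (x n) (\<rho> n)) y)" for n
 proof (cases "\<rho> n > 0")
  case True
  then have xS: "x n \<in> S" "\<rho> n = r (x n)" using V(4)[of n] by auto
  have "en c * vol (ball (x n) (5 * \<rho> n)) = en (5 ^ DIM('a)) * en (c * (w * r (x n) ^ DIM('a)))"
   using xS r(1) c w by (simp add: emeasure_ball_ubv w_def power_mult_distrib mult_ac less_imp_le flip: ennreal_mult)
  also have "... \<le> en (5 ^ DIM('a)) * (\<integral>y. f y * ind (ball (x n) (\<rho> n)) y)"
   using rI[OF xS(1)] xS(2) by (intro mult_left_mono) auto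
  finally show ?thesis .
 next
  case False
  then have "\<rho> n = 0" using V(1)[of n] by simp
  then show ?thesis by simp
 qed
 have "en c * emeasure lborel S \<le> en c * (\<Sum>n. vol (ball (x n) (5 * \<rho> n)))"
  using V(3) by (intro mult_left_mono order_trans[OF emeasure_mono emeasure_subadditive_countably]) auto
 also have "... = (\<Sum>n. en c * vol (ball (x n) (5 * \<rho> n)))" by simp
 also have "... \<le> (\<Sum>n. en (5 ^ DIM('a)) * (\<integral>y. f y * ind (ball (x n) (\<rho> n)) y))"
  by (intro suminf_le Bn) auto
 also have "... = en (5 ^ DIM('a)) * (\<Sum>n. (\<integral>y. f y * ind (ball (x n) (\<rho> n)) y))" by simp
 also have "(\<Sum>n. (\<integral>y. f y * ind (ball (x n) (\<rho> n)) y)) = (\<integral>y. (\<Sum>n. f y * ind (ball (x n) (\<rho> n)) y))"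
  by (rule nn_integral_suminf[symmetric]) auto
 also have "... = (\<integral>y. f y * ind (\<Union>n. ball (x n) (\<rho> n)) y)"
  using suminf_indicator[OF V(2)] by simp
 also have "... \<le> (\<integral>y. f y)" by (intro nn_integral_mono) (auto simp: indicator_def)
 finally show ?thesis by (simp add: S_def mult_left_mono)
qed

text \<open>Where $Mf>l$, the part of \<open>f\<close> above $l/2$ has a maximal function above $l/2$. The weak type bound
 for that part is integrated against $ql^{q-1}$; the $l$-integral converges at $0$ as $q>1$.\<close>

lemma mx_strong_type:
 assumes q: "q > 1"
 shows "\<exists>C>0. \<forall>f :: 'a::euclidean_space => ennreal. f \<in> \<B> -->
  (\<integral>x. epow (mx f x) q) \<le> en C * (\<integral>x. epow (f x) q)"
proof (intro exI conjI allI impI)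
 let ?K = "2 * 5 ^ DIM('a) * (q / (q - 1)) :: real"
 show "?K * 2 powr (q - 1) > 0" using q by simp
 fix f :: "'a => ennreal" assume [measurable]: "f \<in> \<B>"
 let ?t = "\<lambda>l y. f y * ind {y. en l < 2 * f y} y"
 let ?w = "\<lambda>l y. en ?K * f y * (en ((q - 1) * l powr (q - 1 - 1)) * ind {0<..} l * ind {l. en l < 2 * f y} l)"
 let ?e = "\<lambda>l. vol {x. en l < mx f x}"
 let ?a = "\<lambda>l. en (2 * q * l powr (q - 2))"
 have lev: "en (q * l powr (q - 1)) * ind {0<..} l * ?e l
  \<le> (\<integral>y. ?w l y)" for l
 proof (cases "l > 0")
  case True
  have "f y \<le> ?t l y + en (l / 2)" for y
  proof (cases "en l < 2 * f y")
   case False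
   then have "en 2 * f y \<le> en 2 * en (l / 2)" using True by (simp flip: ennreal_mult ennreal_numeral)
   then have "f y \<le> en (l / 2)" by (subst (asm) ennreal_mult_le_mult_iff) auto
   then show ?thesis by (rule order_trans) simp
  qed simp
  then have le: "mx f x \<le> mx (?t l) x + en (l / 2)" for x
   by (rule order_trans[OF mx_mono order_trans[OF mx_add_le add_left_mono[OF mx_const_le]]]) auto
  have "?e l \<le> vol {x. en (l / 2) < mx (?t l) x}"
  proof (intro emeasure_mono subsetI CollectI)
   fix x assume "x \<in> {x. en l < mx f x}"
   then have "en l < mx (?t l) x + en (l / 2)" using le[of x] by auto
   moreover have "en l = en (l/2) + en (l / 2)" using True by (simp flip: ennreal_plus)
   ultimately show "en (l / 2) < mx (?t l) x" by (metis add_right_mono not_le)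
  qed auto
  then have "en (l / 2) * ?e l \<le> en (l / 2) * vol {x. en (l / 2) < mx (?t l) x}"
   by (rule mult_left_mono) simp
  also have "... \<le> en (5 ^ DIM('a)) * (\<integral>x. ?t l x)" using True by (intro mx_weak_type) auto
  finally have w: "en (l / 2) * ?e l \<le> en (5 ^ DIM('a)) * (\<integral>x. ?t l x)" .
  have "en (q * l powr (q - 1)) * ind {0<..} l * ?e l
   = ?a l * (en (l / 2) * ?e l)"
  proof -
   have "l * l powr (q - 2) = l powr (q - 1)" using True by (subst powr_mult_base) auto
   then have "q * l powr (q - 1) = (2 * q * l powr (q - 2)) * (l / 2)" by (simp add: mult_ac)
   then have "en (q * l powr (q - 1)) = ?a l * en (l / 2)"
    using q True by (metis ennreal_mult'' less_imp_le half_gt_zero)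
   then show ?thesis using True by (simp add: mult.assoc)
  qed
  also have "... \<le> ?a l * (en (5 ^ DIM('a)) * (\<integral>x. ?t l x))"
   by (intro mult_left_mono w) auto
  also have "... = (\<integral>y. ?a l * (en (5 ^ DIM('a)) * ?t l y))"
   by (simp add: nn_integral_cmult)
  also have "... = (\<integral>y. ?w l y)"
  proof (intro nn_integral_cong)
   fix y
   have "?a l * en (5 ^ DIM('a)) = en ?K * en ((q - 1) * l powr (q - 1 - 1))"
    using q by (simp add: mult_ac flip: ennreal_mult)
   then have "?a l * (en (5 ^ DIM('a)) * f y) = en ?K * f y * (en ((q - 1) * l powr (q - 1 - 1)))"
    by (simp add: mult_ac)
   then show "?a l * (en (5 ^ DIM('a)) * ?t l y) = ?w l y"
    using True by (auto simp: indicator_def)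
  qed
  finally show ?thesis .
 qed simp
 have "(\<integral>x. epow (mx f x) q) = (\<integral>l. en (q * l powr (q - 1)) * ind {0<..} l * ?e l)"
  using q by (intro layer_cake) auto
 also have "... \<le> (\<integral>l. (\<integral>y. ?w l y))"
  by (intro nn_integral_mono lev)
 also have "... = (\<integral>y. (\<integral>l. ?w l y))"
  by (rule lborel_pair.Fubini') measurable
 also have "... = (\<integral>y. en ?K * f y * epow (2 * f y) (q - 1))"
  using q by (subst nn_integral_cmult) (auto simp: layer_cake_point[of "q - 1", simplified])
 also have "... = (\<integral>y. en (?K * 2 powr (q - 1)) * epow (f y) q)"
 proof (intro nn_integral_cong)
  fix y
  show "en ?K * f y * epow (2 * f y) (q - 1) = en (?K * 2 powr (q - 1)) * epow (f y) q"
  proof (cases "f y")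
   case (real v)
   have "v * (2 * v) powr (q - 1) = 2 powr (q - 1) * v powr q"
    using real q by (cases "v = 0") (auto simp: powr_mult powr_diff)
   then show ?thesis using real q
    by (simp add: epow_ennreal mult.assoc flip: ennreal_mult ennreal_numeral)
  qed (use q in \<open>auto simp: ennreal_mult_top\<close>)
 qed
 also have "... = en (?K * 2 powr (q - 1)) * (\<integral>y. epow (f y) q)"
  by (simp add: nn_integral_cmult)
 finally show "(\<integral>x. epow (mx f x) q) \<le> en (?K * 2 powr (q - 1)) * (\<integral>y. epow (f y) q)" .
qed


text \<open>Kernels dominated by positive combinations of indicators of balls around \<open>x\<close> are controlled by the
 maximal function. Power kernels are cut into dyadic shells, with geometric coefficients (\<open>mx_near\<close>,
 \<open>mx_far\<close>).\<close>

lemma mx_shells: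
 fixes f :: "'a::euclidean_space => ennreal"
 assumes [measurable]: "f \<in> \<B>"
  and k: "\<And>z. k z \<le> (\<Sum>n. en (c n) * ind (ball x (r n)) z)"
  and r: "\<And>n. r n > 0" and c: "\<And>n. c n \<ge> 0" and S: "(\<lambda>n. c n * r n ^ DIM('a)) sums S"
 shows "(\<integral>z. k z * f z) \<le> en (ubv TYPE('a) * S) * mx f x"
proof -
 have "(\<integral>z. k z * f z) \<le> (\<integral>z. (\<Sum>n. en (c n) * (f z * ind (ball x (r n)) z)))"
 proof (rule nn_integral_mono)
  fix z
  have "k z * f z \<le> (\<Sum>n. en (c n) * ind (ball x (r n)) z) * f z" by (rule mult_right_mono[OF k]) simp
  also have "... = (\<Sum>n. en (c n) * (f z * ind (ball x (r n)) z))"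
   unfolding ennreal_suminf_multc[symmetric] by (simp add: mult_ac)
  finally show "k z * f z \<le> ..." .
 qed
 also have "... = (\<Sum>n. en (c n) * (\<integral>z. f z * ind (ball x (r n)) z))"
  by (subst nn_integral_suminf) (auto simp: nn_integral_cmult)
 also have "... \<le> (\<Sum>n. en (c n) * (en (ubv TYPE('a) * r n ^ DIM('a)) * mx f x))"
  by (intro suminf_le mult_left_mono mx_ball r) auto
 also have "... = (\<Sum>n. en (ubv TYPE('a)) * en (c n * r n ^ DIM('a)) * mx f x)"
  using r c ubv_pos[where 'a='a]
  by (intro suminf_cong) (simp add: ennreal_mult less_imp_le mult_ac)
 also have "... = en (ubv TYPE('a)) * (\<Sum>n. en (c n * r n ^ DIM('a))) * mx f x" by simp
 also have "(\<Sum>n. en (c n * r n ^ DIM('a))) = en S"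
  using S r c by (intro suminf_ennreal_eq) (auto simp: less_imp_le)
 also have "en (ubv TYPE('a)) * en S = en (ubv TYPE('a) * S)"
  using ubv_pos[where 'a='a] by (simp add: ennreal_mult')
 finally show ?thesis .
qed

lemma ennreal_le_suminf: "(f :: nat => ennreal) n \<le> (\<Sum>n. f n)"
 using sum_le_suminf[of f "{n}"] by simp

lemma mx_near:
 fixes a :: real
 assumes a: "a > 0" "a \<le> real DIM('a)"
 shows "\<exists>C>0. \<forall>f \<rho> (x::'a::euclidean_space). f \<in> \<B> --> \<rho> > 0 -->
  (\<integral>z. en (dist x z powr (a - DIM('a))) * ind (ball x \<rho>) z * f z) \<le> en (C * \<rho> powr a) * mx f x"
proof (intro exI conjI allI impI)
 let ?C = "ubv TYPE('a) * (2 powr (DIM('a) - a) * (1 / (1 - 2 powr (- a))))"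
 have lt: "2 powr (- a) < 1" using a by (simp add: powr_less_one)
 show "?C > 0" using lt ubv_pos[where 'a='a] by simp
 fix f :: "'a => ennreal" and \<rho> :: real and x :: 'a
 assume f: "f \<in> \<B>" and \<rho>: "\<rho> > 0"
 let ?c = "\<lambda>n. (\<rho> / 2 ^ Suc n) powr (a - DIM('a))"
 have eq: "?c n * (\<rho> / 2 ^ n) ^ DIM('a) = 2 powr (DIM('a) - a) * \<rho> powr a * (2 powr (- a)) ^ n" for n
 proof -
  have "(\<rho> / 2 ^ n) ^ DIM('a) = (\<rho> / 2 ^ n) powr DIM('a)" using \<rho> by (simp add: powr_realpow)
  moreover have "?c n = 2 powr (DIM('a) - a) * (\<rho> / 2 ^ n) powr (a - DIM('a))"
  proof -
   have "?c n = ((\<rho> / 2 ^ n) * (1/2)) powr (a - DIM('a))" by (simp add: mult.commute)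
   also have "... = (\<rho> / 2 ^ n) powr (a - DIM('a)) * (1/2) powr (a - DIM('a))" using \<rho> by (intro powr_mult)
   also have "(1/2::real) powr (a - DIM('a)) = 2 powr (DIM('a) - a)"
    by (simp add: powr_divide powr_minus_divide[symmetric])
   finally show ?thesis by simp
  qed
  moreover have "(\<rho> / 2 ^ n) powr (a - DIM('a)) * (\<rho> / 2 ^ n) powr DIM('a) = (\<rho> / 2 ^ n) powr a"
   by (simp flip: powr_add)
  moreover have "(\<rho> / 2 ^ n) powr a = \<rho> powr a * (2 powr (- a)) ^ n"
  proof -
   have "(2 powr (- a)) ^ n = (2 ^ n) powr (- a)"
    by (simp add: powr_realpow[symmetric] powr_powr mult.commute)
   then show ?thesis using \<rho> by (simp only: powr_divide powr_minus divide_inverse[of "\<rho> powr a"])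
  qed
  ultimately show ?thesis by simp
 qed
 have "(\<integral>z. en (dist x z powr (a - DIM('a))) * ind (ball x \<rho>) z * f z)
   \<le> en (ubv TYPE('a) * (2 powr (DIM('a) - a) * \<rho> powr a * (1 / (1 - 2 powr (- a))))) * mx f x"
 proof (rule mx_shells[OF f, where c="?c" and r="\<lambda>n. \<rho> / 2 ^ n"])
  show "(\<lambda>n. ?c n * (\<rho> / 2 ^ n) ^ DIM('a)) sums (2 powr (DIM('a) - a) * \<rho> powr a * (1 / (1 - 2 powr (- a))))"
   unfolding eq using lt by (intro sums_mult geometric_sums) auto
  fix z
  show "en (dist x z powr (a - DIM('a))) * ind (ball x \<rho>) z \<le> (\<Sum>n. en (?c n) * ind (ball x (\<rho> / 2 ^ n)) z)"
  proof (cases "z \<in> ball x \<rho> \<and> z \<noteq> x")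
   case True
   then have d: "0 < dist x z" "dist x z < \<rho>" by auto
   then have "\<exists>n. \<rho> / 2 ^ n \<le> dist x z"
   proof -
    obtain n where "(1/2) ^ n < dist x z / \<rho>" using d \<rho> real_arch_pow_inv[of "dist x z / \<rho>" "1/2"] by auto
    then show ?thesis using \<rho> by (intro exI[of _ n]) (simp add: field_simps power_divide)
   qed
   define n where "n = (LEAST n. \<rho> / 2 ^ n \<le> dist x z)"
   have n: "\<rho> / 2 ^ n \<le> dist x z" unfolding n_def using \<open>\<exists>n. _\<close> by (rule LeastI_ex)
   with d have "n \<noteq> 0" by (auto simp: not_le intro!: Nat.gr0I)
   then obtain m where m: "n = Suc m" by (cases n) auto
   have "\<not> \<rho> / 2 ^ m \<le> dist x z" using not_less_Least[of m "\<lambda>n. \<rho> / 2 ^ n \<le> dist x z"] m by (simp add: n_def)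
   then have zm: "z \<in> ball x (\<rho> / 2 ^ m)" by (simp add: )
   have "dist x z powr (a - DIM('a)) \<le> ?c m"
    using n m a \<rho> by (intro powr_mono2') auto
   then have "en (dist x z powr (a - DIM('a))) * ind (ball x \<rho>) z \<le> en (?c m) * ind (ball x (\<rho> / 2 ^ m)) z"
    using zm True by (auto intro: ennreal_leI)
   also have "... \<le> (\<Sum>n. en (?c n) * ind (ball x (\<rho> / 2 ^ n)) z)"
    by (rule ennreal_le_suminf)
   finally show ?thesis .
  qed (auto simp: indicator_def)
 qed (use \<rho> in auto)
 then show "(\<integral>z. en (dist x z powr (a - DIM('a))) * ind (ball x \<rho>) z * f z) \<le> en (?C * \<rho> powr a) * mx f x"
  by (simp add: mult_ac)
qed

lemma mx_far:
 fixes a :: real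
 assumes a: "a > 0"
 shows "\<exists>C>0. \<forall>f \<rho> (x::'a::euclidean_space). f \<in> \<B> --> \<rho> > 0 -->
  (\<integral>z. en (dist x z powr (- a - DIM('a))) * ind (- ball x \<rho>) z * f z) \<le> en (C * \<rho> powr (- a)) * mx f x"
proof (intro exI conjI allI impI)
 let ?C = "ubv TYPE('a) * (2 ^ DIM('a) * (1 / (1 - 2 powr (- a))))"
 have lt: "2 powr (- a) < 1" using a by (simp add: powr_less_one)
 show "?C > 0" using lt ubv_pos[where 'a='a] by simp
 fix f :: "'a => ennreal" and \<rho> :: real and x :: 'a
 assume f: "f \<in> \<B>" and \<rho>: "\<rho> > 0"
 let ?c = "\<lambda>n. (\<rho> * 2 ^ n) powr (- a - DIM('a))"
 have eq: "?c n * (\<rho> * 2 ^ Suc n) ^ DIM('a) = 2 ^ DIM('a) * \<rho> powr (- a) * (2 powr (- a)) ^ n" for n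
 proof -
  have "(\<rho> * 2 ^ Suc n) ^ DIM('a) = 2 ^ DIM('a) * (\<rho> * 2 ^ n) powr DIM('a)"
   using \<rho> by (simp add: powr_realpow power_mult_distrib)
  moreover have "(\<rho> * 2 ^ n) powr (- a - DIM('a)) * (\<rho> * 2 ^ n) powr DIM('a) = (\<rho> * 2 ^ n) powr (- a)"
   by (simp flip: powr_add)
  moreover have "(\<rho> * 2 ^ n) powr (- a) = \<rho> powr (- a) * (2 powr (- a)) ^ n"
  proof -
   have "(2 powr (- a)) ^ n = (2 ^ n) powr (- a)"
    by (simp add: powr_realpow[symmetric] powr_powr mult.commute)
   then show ?thesis using \<rho> by (simp add: powr_mult)
  qed
  ultimately show ?thesis by simp
 qed
 have "(\<integral>z. en (dist x z powr (- a - DIM('a))) * ind (- ball x \<rho>) z * f z)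
   \<le> en (ubv TYPE('a) * (2 ^ DIM('a) * \<rho> powr (- a) * (1 / (1 - 2 powr (- a))))) * mx f x"
 proof (rule mx_shells[OF f, where c="?c" and r="\<lambda>n. \<rho> * 2 ^ Suc n"])
  show "(\<lambda>n. ?c n * (\<rho> * 2 ^ Suc n) ^ DIM('a)) sums (2 ^ DIM('a) * \<rho> powr (- a) * (1 / (1 - 2 powr (- a))))"
   unfolding eq using lt by (intro sums_mult geometric_sums) auto
  fix z
  show "en (dist x z powr (- a - DIM('a))) * ind (- ball x \<rho>) z \<le> (\<Sum>n. en (?c n) * ind (ball x (\<rho> * 2 ^ Suc n)) z)"
  proof (cases "z \<in> ball x \<rho>")
   case False
   then have d: "\<rho> \<le> dist x z" by auto
   obtain n where "dist x z / \<rho> < 2 ^ n" using real_arch_pow[of 2 "dist x z / \<rho>"] by auto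
   then have ex: "\<exists>n. dist x z < \<rho> * 2 ^ n" using \<rho> by (intro exI[of _ n]) (simp add: field_simps)
   define n where "n = (LEAST n. dist x z < \<rho> * 2 ^ n)"
   have n: "dist x z < \<rho> * 2 ^ n" unfolding n_def using ex by (rule LeastI_ex)
   with d have "n \<noteq> 0" by (cases n) auto
   then obtain m where m: "n = Suc m" by (cases n) auto
   have "\<not> dist x z < \<rho> * 2 ^ m" using not_less_Least[of m "\<lambda>n. dist x z < \<rho> * 2 ^ n"] m by (simp add: n_def)
   then have "dist x z powr (- a - DIM('a)) \<le> ?c m"
    using a \<rho> by (intro powr_mono2') auto
   then have "en (dist x z powr (- a - DIM('a))) * ind (- ball x \<rho>) z \<le> en (?c m) * ind (ball x (\<rho> * 2 ^ Suc m)) z"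
    using n m False by (auto intro: ennreal_leI)
   also have "... \<le> (\<Sum>n. en (?c n) * ind (ball x (\<rho> * 2 ^ Suc n)) z)"
    by (rule ennreal_le_suminf)
   finally show ?thesis .
  qed (auto simp: indicator_def)
 qed (use \<rho> in auto)
 then show "(\<integral>z. en (dist x z powr (- a - DIM('a))) * ind (- ball x \<rho>) z * f z) \<le> en (?C * \<rho> powr (- a)) * mx f x"
  by (simp add: mult_ac)
qed

section \<open>Convolution of bounded integrable functions\<close>

text \<open>A class of functions closed under convolution and pointwise products, on which all integrals below converge
 absolutely.\<close>

definition nice :: "('a::euclidean_space => real) => bool" where
 "nice f \<longleftrightarrow> L1 f \<and> (\<exists>B. \<forall>x. \<bar>f x\<bar> \<le> B)"

definition conv :: "('a::euclidean_space => real) => ('a => real) => 'a => real" where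
 "conv K f x = (LINT y. K (x - y) * f y)"

lemma nice_integrable [simp]: "nice f ==> L1 f" by (simp add: nice_def)

lemma nice_measurable [measurable_dest]: "nice f ==> f \<in> \<B>"
 using borel_measurable_integrable[of lborel f] by (simp add: nice_def)

lemma nice_bound:
 assumes "nice f" obtains B where "B > 0" "\<And>x. \<bar>f x\<bar> \<le> B"
proof -
 obtain B where "\<And>x. \<bar>f x\<bar> \<le> B" using assms by (auto simp: nice_def)
 then have "\<bar>f x\<bar> \<le> max B 1" for x by (simp add: le_max_iff_disj)
 then show ?thesis by (intro that[of "max B 1"]) auto
qed

lemma integrable_bounded_mult:
 fixes g f :: "'a::euclidean_space => real"
 assumes "L1 f" "g \<in> \<B>" "\<And>x. \<bar>g x\<bar> \<le> B"
 shows "L1 (\<lambda>x. g x * f x)"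
proof (rule Bochner_Integration.integrable_bound[of lborel "\<lambda>x. B * f x"])
 show "L1 (\<lambda>x. B * f x)" using assms by simp
 show "(\<lambda>x. g x * f x) \<in> borel_measurable lborel"
  using assms borel_measurable_integrable[OF assms(1)] by simp
 show "AE x in lborel. norm (g x * f x) \<le> norm (B * f x)"
 proof (rule AE_I2)
  fix x
  have "\<bar>g x\<bar> \<le> \<bar>B\<bar>" using assms(3)[of x] by linarith
  then show "norm (g x * f x) \<le> norm (B * f x)" by (simp add: abs_mult mult_right_mono)
 qed
qed

lemma conv_integrable:
 assumes "nice K" "L1 f"
 shows "L1 (\<lambda>y. K (x - y) * f y)"
proof -
 obtain B where "\<And>x. \<bar>K x\<bar> \<le> B" using nice_bound[OF assms(1)] by blast
 moreover have [measurable]: "K \<in> \<B>" using assms nice_measurable by auto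
 ultimately show ?thesis using assms by (intro integrable_bounded_mult) auto
qed

lemma nice_mult: "nice f ==> nice g ==> nice (\<lambda>x. f x * g x)"
proof -
 assume fg: "nice f" "nice g"
 obtain B where B: "B > 0" "\<And>x. \<bar>f x\<bar> \<le> B" using nice_bound[OF fg(1)] by blast
 obtain C where C: "C > 0" "\<And>x. \<bar>g x\<bar> \<le> C" using nice_bound[OF fg(2)] by blast
 show ?thesis unfolding nice_def
 proof (intro conjI exI allI)
  show "L1 (\<lambda>x. f x * g x)"
   using fg B by (intro integrable_bounded_mult) auto
  show "\<bar>f x * g x\<bar> \<le> B * C" for x using B C by (simp add: abs_mult mult_mono less_imp_le)
 qed
qed

lemma nice_add: "nice f ==> nice g ==> nice (\<lambda>x. f x + g x)"
proof -
 assume fg: "nice f" "nice g"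
 obtain B where B: "B > 0" "\<And>x. \<bar>f x\<bar> \<le> B" using nice_bound[OF fg(1)] by blast
 obtain C where C: "C > 0" "\<And>x. \<bar>g x\<bar> \<le> C" using nice_bound[OF fg(2)] by blast
 have "\<bar>f x + g x\<bar> \<le> B + C" for x using B(2)[of x] C(2)[of x] by linarith
 then show ?thesis using fg unfolding nice_def by auto
qed

lemma nice_cmult: "nice f ==> nice (\<lambda>x. c * f x)"
proof -
 assume fg: "nice f"
 obtain B where B: "B > 0" "\<And>x. \<bar>f x\<bar> \<le> B" using nice_bound[OF fg(1)] by blast
 have "\<bar>c * f x\<bar> \<le> \<bar>c\<bar> * B" for x using B(2)[of x] by (simp add: abs_mult mult_left_mono)
 then show ?thesis using fg unfolding nice_def by auto
qed

lemma nice_zero [simp]: "nice (\<lambda>x. 0)" by (auto simp: nice_def)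

lemma nice_diff: "nice f ==> nice g ==> nice (\<lambda>x. f x - g x)"
 using nice_add[of f "\<lambda>x. (-1) * g x"] nice_cmult[of g "-1"] by simp

lemma nice_sum: "(\<And>i. i \<in> I ==> nice (f i)) ==> nice (\<lambda>x. \<Sum>i\<in>I. f i x)"
 by (induction I rule: infinite_finite_induct) (auto intro: nice_add)

lemma conv_measurable [measurable]:
 assumes [measurable]: "K \<in> \<B>" "f \<in> \<B>"
 shows "conv K f \<in> \<B>"
 unfolding conv_def by (intro lborel.borel_measurable_lebesgue_integral) measurable

lemma integrable_conv_pair:
 fixes K f :: "'a::euclidean_space => real"
 assumes K: "L1 K" and f: "L1 f"
 shows "integrable (lborel \<Otimes>\<^sub>M lborel) (\<lambda>(x, y). K (x - y) * f y)"
proof -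
 have [measurable]: "K \<in> \<B>" "f \<in> \<B>"
  using K f borel_measurable_integrable by auto
 have "integrable (lborel \<Otimes>\<^sub>M lborel) (\<lambda>(y, x). K (x - y) * f y)"
 proof (rule lborel_pair.Fubini_integrable)
  show "(\<lambda>(y, x). K (x - y) * f y) \<in> borel_measurable (lborel \<Otimes>\<^sub>M lborel)" by measurable
  have "(\<lambda>x. K (x - y)) = (\<lambda>x. K (- y + x))" for y by (simp add: algebra_simps)
  then have i: "L1 (\<lambda>x. K (x - y))" "(LINT x. \<bar>K (x - y)\<bar>) = (LINT x. \<bar>K x\<bar>)" for y
   using integrable_lborel_shift[OF K, of "-y"] integral_lborel_shift[of "\<lambda>x. \<bar>K x\<bar>" "-y"] by (auto simp: )
  show "AE y in lborel. L1 (\<lambda>x. case (y, x) of (y, x) => K (x - y) * f y)"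
   using i by simp
  show "L1 (\<lambda>y. LINT x. norm (case (y, x) of (y, x) => K (x - y) * f y))"
   using f by (simp add: abs_mult i)
 qed
 from lborel_pair.integrable_product_swap[OF this] show ?thesis by simp
qed

lemma conv_nice:
 assumes K: "nice K" and f: "nice f" shows "nice (conv K f)"
 unfolding nice_def
proof
 show "L1 (conv K f)"
  unfolding conv_def using lborel_pair.integrable_fst[OF integrable_conv_pair[of K f]] K f by simp
 obtain B where B: "B > 0" "\<And>x. \<bar>K x\<bar> \<le> B" using nice_bound[OF K] by blast
 have "\<bar>conv K f x\<bar> \<le> (LINT y. B * \<bar>f y\<bar>)" for x
  unfolding conv_def using integrable_abs[OF conv_integrable[OF K, of f x]] f B
  by (intro order_trans[OF integral_abs_bound] integral_mono) (auto simp: abs_mult mult_right_mono)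
 then show "\<exists>B. \<forall>x. \<bar>conv K f x\<bar> \<le> B" by blast
qed

lemma conv_add:
 assumes "nice K" "L1 f" "L1 g"
 shows "conv K (\<lambda>x. f x + g x) x = conv K f x + conv K g x"
 unfolding conv_def using conv_integrable[OF assms(1,2)] conv_integrable[OF assms(1,3)]
 by (simp add: distrib_left)

lemma conv_kernel_sum:
 assumes "\<And>i. i \<in> I ==> nice (K i)" "L1 f"
 shows "conv (\<lambda>x. \<Sum>i\<in>I. c i * K i x) f x = (\<Sum>i\<in>I. c i * conv (K i) f x)"
 unfolding conv_def using conv_integrable[OF assms(1) assms(2)]
 by (simp add: sum_distrib_right mult.assoc)

lemma conv_adjoint:
 assumes K: "nice K" "\<And>x. K (- x) = K x" and f: "nice f" and g: "nice g"
 shows "(LINT x. conv K f x * g x) = (LINT x. f x * conv K g x)"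
proof -
 obtain B where B: "B > 0" "\<And>x. \<bar>g x\<bar> \<le> B" using nice_bound[OF g] by blast
 have [measurable]: "K \<in> \<B>" "f \<in> \<B>" "g \<in> \<B>"
  using K f g nice_measurable by auto
 have I: "integrable (lborel \<Otimes>\<^sub>M lborel) (\<lambda>(x, y). K (x - y) * f y * g x)"
 proof (rule Bochner_Integration.integrable_bound)
  show "integrable (lborel \<Otimes>\<^sub>M lborel) (\<lambda>z. B * (case z of (x, y) => K (x - y) * f y))"
   using K f by (intro integrable_mult_right integrable_conv_pair) auto
  show "(\<lambda>(x, y). K (x - y) * f y * g x) \<in> borel_measurable (lborel \<Otimes>\<^sub>M lborel)" by measurable
  show "AE z in lborel \<Otimes>\<^sub>M lborel. norm (case z of (x, y) => K (x - y) * f y * g x) \<le> norm (B * (case z of (x, y) => K (x - y) * f y))"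
  proof (rule AE_I2, clarify)
   fix x y
   have "\<bar>g x\<bar> * \<bar>K (x - y) * f y\<bar> \<le> B * \<bar>K (x - y) * f y\<bar>" using B by (intro mult_right_mono) auto
   then show "norm (K (x - y) * f y * g x) \<le> norm (B * (K (x - y) * f y))" using B by (simp add: abs_mult mult_ac)
  qed
 qed
 have "(LINT x. conv K f x * g x) = (LINT x. LINT y. K (x - y) * f y * g x)"
  unfolding conv_def by simp
 also have "... = (LINT y. LINT x. K (x - y) * f y * g x)"
  using lborel_pair.Fubini_integral[OF I] by simp
 also have "... = (LINT y. f y * (LINT x. K (x - y) * g x))"
  by (simp add: mult_ac)
 also have "... = (LINT x. f x * conv K g x)"
 proof -
  have "K (x - y) = K (y - x)" for x y using K(2)[of "y - x"] by simp
  then show ?thesis unfolding conv_def by simp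
 qed
 finally show ?thesis .
qed

lemma conv_assoc:
 assumes K: "nice K" and L: "nice L" and f: "nice f"
 shows "conv K (conv L f) x = conv (conv K L) f x"
proof -
 have [measurable]: "K \<in> \<B>" "f \<in> \<B>" "L \<in> \<B>"
  using K f L nice_measurable by auto
 obtain B where B: "B > 0" "\<And>x. \<bar>K x\<bar> \<le> B" using nice_bound[OF K] by blast
 have I: "integrable (lborel \<Otimes>\<^sub>M lborel) (\<lambda>(y, z). K (x - y) * (L (y - z) * f z))"
 proof (rule Bochner_Integration.integrable_bound)
  show "integrable (lborel \<Otimes>\<^sub>M lborel) (\<lambda>w. B * (case w of (y, z) => L (y - z) * f z))"
   using L f by (intro integrable_mult_right integrable_conv_pair) auto
  show "(\<lambda>(y, z). K (x - y) * (L (y - z) * f z)) \<in> borel_measurable (lborel \<Otimes>\<^sub>M lborel)" by measurable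
  show "AE w in lborel \<Otimes>\<^sub>M lborel. norm (case w of (y, z) => K (x - y) * (L (y - z) * f z)) \<le> norm (B * (case w of (y, z) => L (y - z) * f z))"
  proof (rule AE_I2, clarify)
   fix y z
   have "\<bar>K (x - y)\<bar> * \<bar>L (y - z) * f z\<bar> \<le> B * \<bar>L (y - z) * f z\<bar>" using B by (intro mult_right_mono) auto
   then show "norm (K (x - y) * (L (y - z) * f z)) \<le> norm (B * (L (y - z) * f z))" using B by (simp add: abs_mult mult_ac)
  qed
 qed
 have "conv K (conv L f) x = (LINT y. LINT z. K (x - y) * (L (y - z) * f z))"
  unfolding conv_def by simp
 also have "... = (LINT z. LINT y. K (x - y) * (L (y - z) * f z))"
  using lborel_pair.Fubini_integral[OF I] by simp
 also have "... = (LINT z. conv K L (x - z) * f z)"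
 proof (rule Bochner_Integration.integral_cong)
  fix z
  have "(LINT y. K (x - y) * (L (y - z) * f z)) = (LINT y. K (x - y) * L (y - z)) * f z"
   by (simp flip: mult.assoc)
  also have "(LINT y. K (x - y) * L (y - z)) = (LINT y. K (x - (z + y)) * L (z + y - z))"
   by (rule integral_lborel_shift[symmetric]) simp
  also have "... = conv K L (x - z)" by (simp add: conv_def algebra_simps)
  finally show "(LINT y. K (x - y) * (L (y - z) * f z)) = conv K L (x - z) * f z" .
 qed simp
 finally show ?thesis by (simp add: conv_def)
qed

lemma conv_commute:
 assumes [measurable]: "K \<in> \<B>" "f \<in> \<B>"
 shows "conv K f x = conv f K x"
 using integral_lborel_reflect[of "\<lambda>y. K (x - y) * f y" x] by (simp add: conv_def mult.commute)

lemma continuous_conv: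
 assumes K: "nice K" and f: "nice f" "continuous_on UNIV f"
 shows "continuous_on UNIV (conv K f)"
proof -
 obtain B where B: "B > 0" "\<And>x. \<bar>f x\<bar> \<le> B" using nice_bound[OF f(1)] by blast
 have [measurable]: "K \<in> \<B>" "f \<in> \<B>"
  using K f nice_measurable by auto
 have eq: "conv K f = (\<lambda>x. LINT y. f (x - y) * K y)"
  by (rule ext, subst conv_commute) (auto simp: conv_def)
 show ?thesis unfolding eq continuous_on_sequentially comp_def
 proof safe
  fix X :: "nat => 'a" and a assume X: "X \<longlonglongrightarrow> a"
  show "(\<lambda>n. LINT y. f (X n - y) * K y) \<longlonglongrightarrow> (LINT y. f (a - y) * K y)"
  proof (rule integral_dominated_convergence[where w="\<lambda>y. B * \<bar>K y\<bar>"])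
   show "L1 (\<lambda>y. B * \<bar>K y\<bar>)" using K by auto
   show "AE y in lborel. (\<lambda>n. f (X n - y) * K y) \<longlonglongrightarrow> f (a - y) * K y"
    using f(2) X by (intro AE_I2 tendsto_intros) (auto intro!: isCont_tendsto_compose[where g=f] tendsto_intros simp: continuous_on_eq_continuous_at)
   show "AE y in lborel. norm (f (X n - y) * K y) \<le> B * \<bar>K y\<bar>" for n
    using B by (auto simp: abs_mult intro!: AE_I2 mult_right_mono)
  qed measurable
 qed
qed

text \<open>The Cauchy-Schwarz inequality for $|K|=|K|^{1/2}|K|^{1/2}$, then Fubini's theorem.\<close>

lemma nn_young_L2:
 fixes K f :: "'a::euclidean_space => real"
 assumes K: "nice K" and f: "nice f"
 shows "(\<integral>x. en ((conv K f x)\<^sup>2)) \<le> en ((LINT x. \<bar>K x\<bar>)\<^sup>2) * (\<integral>x. en ((f x)\<^sup>2))"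
proof -
 define k where "k = (LINT x. \<bar>K x\<bar>)"
 have k0: "k \<ge> 0" by (simp add: k_def)
 let ?k = "\<lambda>x y. en (\<bar>K (x - y)\<bar> * (f y)\<^sup>2)"
 have [measurable]: "K \<in> \<B>" "f \<in> \<B>"
  using K f nice_measurable by auto
 have kI: "(\<integral>y. en \<bar>K y\<bar>) = en k"
  unfolding k_def using K by (intro nn_integral_eq_integral) auto
 have kx: "(\<integral>y. en \<bar>K (x - y)\<bar>) = en k" for x
  using nn_integral_lborel_reflect[of "\<lambda>y. en \<bar>K y\<bar>" x] kI by simp
 have ky: "(\<integral>x. en \<bar>K (x - y)\<bar>) = en k" for y
  using nn_integral_lborel_shift[of "\<lambda>y. en \<bar>K y\<bar>" "-y"] kI by simp
 have pt: "en ((conv K f x)\<^sup>2) \<le> en k * (\<integral>y. ?k x y)" for x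
 proof -
  have "en \<bar>conv K f x\<bar> \<le> (\<integral>y. en \<bar>K (x - y) * f y\<bar>)"
   unfolding conv_def using conv_integrable[OF K nice_integrable[OF f], of x]
   by (subst nn_integral_eq_integral) (auto intro!: ennreal_leI integral_abs_bound)
  also have "... = (\<integral>y. en (sqrt \<bar>K (x - y)\<bar>) * en (sqrt \<bar>K (x - y)\<bar> * \<bar>f y\<bar>))"
   by (intro nn_integral_cong) (simp add: abs_mult flip: ennreal_mult)
  also have "... \<le> epow (\<integral>y. epow (en (sqrt \<bar>K (x - y)\<bar>)) 2) (1/2)
    * epow (\<integral>y. epow (en (sqrt \<bar>K (x - y)\<bar> * \<bar>f y\<bar>)) 2) (1/2)"
   by (rule nn_hoelder) auto
  also have "(\<lambda>y. epow (en (sqrt \<bar>K (x - y)\<bar>)) 2) = (\<lambda>y. en \<bar>K (x - y)\<bar>)"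
   by (auto simp: epow_ennreal powr_numeral)
  also have "(\<lambda>y. epow (en (sqrt \<bar>K (x - y)\<bar> * \<bar>f y\<bar>)) 2) = (\<lambda>y. ?k x y)"
   by (auto simp: epow_ennreal powr_numeral power_mult_distrib)
  also note kx
  finally have "epow (en \<bar>conv K f x\<bar>) 2 \<le> epow (epow (en k) (1/2) * epow (\<integral>y. ?k x y) (1/2)) 2"
   by (rule epow_mono) simp
  then show ?thesis by (simp add: epow_mult epow_epow) (simp add: epow_ennreal powr_numeral)
 qed
 have "(\<integral>x. en ((conv K f x)\<^sup>2)) \<le> (\<integral>x. en k * (\<integral>y. ?k x y))"
  by (intro nn_integral_mono pt)
 also have "... = en k * (\<integral>x. (\<integral>y. ?k x y))"
  by (intro nn_integral_cmult) measurable
 also have "(\<integral>x. (\<integral>y. ?k x y)) = (\<integral>y. (\<integral>x. ?k x y))"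
  by (rule lborel_pair.Fubini') measurable
 also have "... = (\<integral>y. en k * en ((f y)\<^sup>2))"
  by (intro nn_integral_cong) (simp add: ennreal_mult nn_integral_multc ky)
 also have "... = en k * (\<integral>y. en ((f y)\<^sup>2))"
  by (rule nn_integral_cmult) measurable
 finally show ?thesis using k0 by (simp add: k_def power2_eq_square mult.assoc ennreal_mult)
qed

section \<open>Calderon-Zygmund operators\<close>

text \<open>Vitali's lemma for the balls whose radius is a tenth of the distance to the complement: their fivefold dilates
 stay inside, their elevenfold dilates meet the complement. Finite volume of \<open>\<Omega>\<close> bounds the
 radii.\<close>

lemma whitney_balls:
 fixes \<Omega> :: "'a::euclidean_space set"
 assumes op: "open \<Omega>" and fin: "vol \<Omega> < \<top>"
 obtains x :: "nat => 'a" and \<rho> where "\<And>n. \<rho> n \<ge> 0" "disjoint_family (\<lambda>n. ball (x n) (\<rho> n))"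
  "\<Omega> = (\<Union>n. ball (x n) (5 * \<rho> n))" "\<And>n. \<rho> n > 0 ==> \<exists>z. z \<notin> \<Omega> \<and> dist (x n) z < 11 * \<rho> n"
proof -
 have [measurable]: "\<Omega> \<in> sets borel" using op by simp
 have "\<Omega> \<noteq> UNIV" using fin by auto
 then have ne: "- \<Omega> \<noteq> {}" by auto
 have cl: "closed (- \<Omega>)" using op by (simp add: closed_Compl)
 define r where "r x = infdist x (- \<Omega>) / 10" for x
 have rpos: "r x > 0" if "x \<in> \<Omega>" for x
  using that ne cl infdist_nonneg[of x "- \<Omega>"] in_closed_iff_infdist_zero[OF cl ne, of x] by (auto simp: r_def)
 have sub: "ball x (10 * r x) \<subseteq> \<Omega>" for x
 proof
  fix y assume y: "y \<in> ball x (10 * r x)"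
  show "y \<in> \<Omega>"
  proof (rule ccontr)
   assume "y \<notin> \<Omega>"
   then have "infdist x (- \<Omega>) \<le> dist x y" by (intro infdist_le) auto
   with y show False by (simp add: r_def)
  qed
 qed
 define w where "w = ubv TYPE('a)"
 have w: "w > 0" by (simp add: w_def ubv_pos)
 obtain M where M: "vol \<Omega> = en M" "M \<ge> 0" using fin by (metis ennreal_cases less_top)
 have bnd: "r x \<le> max 1 (M / w)" if "x \<in> \<Omega>" for x
 proof (cases "10 * r x \<le> 1")
  case False
  have "vol (ball x (10 * r x)) \<le> en M" unfolding M(1)[symmetric] by (intro emeasure_mono sub) auto
  then have "w * (10 * r x) ^ DIM('a) \<le> M" using rpos[OF that] M(2) by (simp add: emeasure_ball_ubv w_def)
  moreover have "w * (10 * r x) \<le> w * (10 * r x) ^ DIM('a)"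
   using False w by (intro mult_left_mono self_le_power) auto
  ultimately have "w * (10 * r x) \<le> M" by simp
  then have "10 * r x \<le> M / w" using w by (simp add: field_simps)
  then show ?thesis using rpos[OF that] by linarith
 qed (use rpos[OF that] in linarith)
 obtain x \<rho> where V: "\<And>n. \<rho> n \<ge> 0" "disjoint_family (\<lambda>n. ball (x n) (\<rho> n))"
  "\<Omega> \<subseteq> (\<Union>n::nat. ball (x n) (5 * \<rho> n))" "\<And>n. \<rho> n > 0 ==> \<exists>i\<in>\<Omega>. x n = i \<and> \<rho> n = r i"
 proof (rule vitali_sequence[where S=\<Omega> and K=\<Omega> and a="\<lambda>x. x" and r=r and B="max 1 (M / w)"])
  show "\<Omega> \<subseteq> (\<Union>i\<in>\<Omega>. ball i (r i))" using rpos by force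
 qed (use rpos bnd in auto)
 show ?thesis
 proof (rule that[OF V(1,2)])
  have "ball (x n) (5 * \<rho> n) \<subseteq> \<Omega>" for n
  proof (cases "\<rho> n > 0")
   case True
   then have "\<rho> n = r (x n)" using V(4)[of n] by auto
   then show ?thesis using sub[of "x n"] True subset_ball[of "5 * \<rho> n" "10 * \<rho> n" "x n"] by auto
  qed (use V(1)[of n] in auto)
  then show "\<Omega> = (\<Union>n. ball (x n) (5 * \<rho> n))" using V(3) by auto
  fix n assume pos: "\<rho> n > 0"
  then have xn: "\<rho> n = r (x n)" using V(4)[of n] by auto
  obtain z where "z \<in> - \<Omega>" "infdist (x n) (- \<Omega>) = dist (x n) z"
   using infdist_attains_inf[OF cl ne, of "x n"] by blast
  then show "\<exists>z. z \<notin> \<Omega> \<and> dist (x n) z < 11 * \<rho> n"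
   using xn pos by (intro exI[of _ z]) (auto simp: r_def)
 qed
qed

lemma sums_disjoint_indicator:
 fixes c :: "nat => real"
 assumes "disjoint_family B" "y \<in> B n"
 shows "(\<lambda>k. c k * ind (B k) y) sums c n"
proof -
 have "(\<lambda>k. c k * ind (B k) y) = (\<lambda>k. if k = n then c k else 0)"
  using assms by (auto simp: fun_eq_iff disjoint_family_on_def indicator_def)
 then show ?thesis using sums_single[of n c] by simp
qed

lemma sums_indicator_outside:
 fixes c :: "nat => real"
 assumes "y \<notin> (\<Union>n. B n)"
 shows "(\<lambda>k. c k * ind (B k) y) sums 0"
 using assms by (simp add: indicator_def)

text \<open>The Calderon-Zygmund decomposition at height \<open>l\<close>. Let \<open>\<Omega>\<close> be the open set where
 the maximal function exceeds \<open>l\<close>, covered by fivefold dilates of disjoint balls $B_n$, and $E_n$ a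
 partition of \<open>\<Omega>\<close> into parts of these dilates. On $E_n$ the bad part is \<open>f\<close>,
 corrected by a constant on $B_n$ to have mean zero. (The correction lives on $B_n$, not on $E_n$, because $E_n$
 may be too small for a bounded constant; a point outside \<open>\<Omega>\<close> within $11\rho_n$ bounds the
 integral of $|f|$ over $E_n$.) The good part is square integrable with the bounds that the $L^2$ estimate needs.
 The bad part is estimated off the tenfold dilates, where the mean zero property brings the smoothness of
 \<open>K\<close> into play.\<close>

lemma cz_distribution:
 fixes A :: real
 assumes A: "A > 0"
 shows "\<exists>C>0. \<forall>(K :: 'a::euclidean_space => real) f l. nice K -->
  (\<forall>g. nice g --> (\<integral>x. en ((conv K g x)\<^sup>2)) \<le> en A * (\<integral>x. en ((g x)\<^sup>2))) -->
  (\<forall>x h. x \<noteq> 0 --> 2 * norm h \<le> norm x --> \<bar>K (x - h) - K x\<bar> \<le> A * norm h * norm x powr (- 1 - DIM('a))) -->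
  nice f --> continuous_on UNIV f --> l > 0 -->
  vol {x. l < \<bar>conv K f x\<bar>} \<le> en C *
   (vol {x. en l < mx (\<lambda>y. en \<bar>f y\<bar>) x}
    + en (1 / l\<^sup>2) * (\<integral>x. en ((f x)\<^sup>2) * ind {x. mx (\<lambda>y. en \<bar>f y\<bar>) x \<le> en l} x)
    + en (1 / l) * (\<integral>x. en \<bar>f x\<bar> * ind {x. en l < mx (\<lambda>y. en \<bar>f y\<bar>) x} x))"
proof -
 obtain Cf where Cf: "Cf > 0" "\<And>f \<rho> (x::'a). f \<in> \<B> ==> \<rho> > 0 ==>
  (\<integral>z. en (dist x z powr (- 1 - DIM('a))) * ind (- ball x \<rho>) z * f z) \<le> en (Cf * \<rho> powr (- 1)) * mx f x"
  using mx_far[of 1, where 'a='a] by auto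
 define d where "d = DIM('a)"
 define C where "C = 10 ^ d + 4 * A * (16 ^ d)\<^sup>2 + 4 * A + 2 * A * Cf"
 have C0: "C > 0" using A Cf by (auto simp: C_def intro!: add_pos_pos)
 show ?thesis
 proof (intro exI[of _ C] conjI allI impI)
  show "C > 0" by fact
  fix K f :: "'a => real" and l :: real
  assume K: "nice K" and L2: "\<forall>g. nice g --> (\<integral>x. en ((conv K g x)\<^sup>2)) \<le> en A * (\<integral>x. en ((g x)\<^sup>2))"
   and ker: "\<forall>x h. x \<noteq> 0 --> 2 * norm h \<le> norm x --> \<bar>K (x - h) - K x\<bar> \<le> A * norm h * norm x powr (- 1 - DIM('a))"
   and f: "nice f" "continuous_on UNIV f" and l: "l > 0"
  define m where "m = mx (\<lambda>y. en \<bar>f y\<bar>)"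
  have [measurable]: "f \<in> \<B>" "K \<in> \<B>" using f K nice_measurable by auto
  define \<Omega> where "\<Omega> = {x. en l < m x}"
  have op: "open \<Omega>" unfolding \<Omega>_def m_def by (rule open_mx_gt)
  have [measurable]: "\<Omega> \<in> sets borel" using op by simp
  let ?F2 = "(\<integral>x. en ((f x)\<^sup>2) * ind (- \<Omega>) x)"
  let ?F1 = "(\<integral>y. en \<bar>f y\<bar> * ind \<Omega> y)"
  let ?P = "\<lambda>x::'a. norm x powr (- 1 - DIM('a))"
  have If: "(\<integral>x. en \<bar>f x\<bar>) < \<top>" using f by (subst nn_integral_eq_integral) auto
  have "en l * vol \<Omega> \<le> en (5 ^ DIM('a)) * (\<integral>x. en \<bar>f x\<bar>)"
   unfolding \<Omega>_def m_def by (rule mx_weak_type) (use l in auto)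
  also have "... < \<top>" using If by (simp add: ennreal_mult_less_top)
  finally have fin: "vol \<Omega> < \<top>" using l by (auto simp: ennreal_mult_less_top)
  obtain xx :: "nat => 'a" and \<rho> where W: "\<And>n. \<rho> n \<ge> 0" "disjoint_family (\<lambda>n. ball (xx n) (\<rho> n))"
   "\<Omega> = (\<Union>n. ball (xx n) (5 * \<rho> n))" "\<And>n. \<rho> n > 0 ==> \<exists>z. z \<notin> \<Omega> \<and> dist (xx n) z < 11 * \<rho> n"
   by (rule whitney_balls[OF op fin]) (rule that; assumption)
  define B where "B n = ball (xx n) (\<rho> n)" for n
  define E where "E = disjointed (\<lambda>n. ball (xx n) (5 * \<rho> n))"
  define w where "w = ubv TYPE('a)"
  have w: "w > 0" by (simp add: w_def ubv_pos)
  have Bm: "measure lborel (B n) = w * \<rho> n ^ d" "vol (B n) = en (w * \<rho> n ^ d)" for n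
   using W(1)[of n] by (simp_all add: B_def measure_ball_ubv emeasure_ball_ubv w_def d_def)
  have E_sub: "E n \<subseteq> ball (xx n) (5 * \<rho> n)" for n unfolding E_def by (rule disjointed_subset)
  have E_dis: "disjoint_family E" unfolding E_def by (rule disjoint_family_disjointed)
  have E_un: "(\<Union>n. E n) = \<Omega>" unfolding E_def UN_disjointed_eq W(3) ..
  have B_dis: "disjoint_family B" unfolding B_def by (rule W(2))
  have B_sub: "B n \<subseteq> \<Omega>" for n
  proof -
   have "B n \<subseteq> ball (xx n) (5 * \<rho> n)" unfolding B_def using W(1)[of n] by (intro subset_ball) auto
   then show ?thesis using W(3) by auto
  qed
  have [measurable]: "B n \<in> sets borel" for n by (simp add: B_def)
  have "range E \<subseteq> sets lborel"
   unfolding E_def by (rule sets.range_disjointed_sets) auto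
  then have [measurable]: "E n \<in> sets borel" for n by auto
  have iE: "L1 (\<lambda>y. f y * ind S y)" if "S \<in> sets borel" for S
   using f that integrable_mult_indicator[of S lborel f] by (simp add: mult.commute)
  have iB: "L1 (\<lambda>y. ind (B n) y :: real)" for n
   using Bm(2)[of n] by (intro integrable_real_indicator) auto
  define c where "c n = (LINT y. f y * ind (E n) y) / measure lborel (B n)" for n
  define a where "a n = (LINT y. \<bar>f y * ind (E n) y\<bar>)" for n
  have a0: "a n \<ge> 0" for n by (simp add: a_def)
  have a_nn: "en (a n) = (\<integral>y. en \<bar>f y\<bar> * ind (E n) y)" for n
  proof -
   have "en (a n) = (\<integral>y. en \<bar>f y * ind (E n) y\<bar>)"
    unfolding a_def by (rule nn_integral_eq_integral[symmetric]) (rule integrable_abs[OF iE], simp_all)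
   also have "... = (\<integral>y. en \<bar>f y\<bar> * ind (E n) y)"
    by (intro nn_integral_cong) (auto simp: indicator_def)
   finally show ?thesis .
  qed
  have a_sum: "(\<Sum>n. en (a n)) = ?F1"
  proof -
   have "(\<Sum>n. en (a n)) = (\<integral>y. (\<Sum>n. en \<bar>f y\<bar> * ind (E n) y))"
    unfolding a_nn by (rule nn_integral_suminf[symmetric]) auto
   also have "... = ?F1"
    using suminf_indicator[OF E_dis] by (simp add: E_un)
   finally show ?thesis .
  qed
  have a_summable: "summable a"
  proof (rule summable_suminf_not_top[OF a0])
   have "(\<Sum>n. en (a n)) \<le> (\<integral>y. en \<bar>f y\<bar>)"
    unfolding a_sum by (intro nn_integral_mono) (auto simp: indicator_def)
   then show "(\<Sum>n. en (a n)) \<noteq> \<top>" using If by auto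
  qed
  have c_le: "\<bar>c n\<bar> \<le> 16 ^ d * l" for n
  proof (cases "\<rho> n > 0")
   case True
   obtain z where z: "z \<notin> \<Omega>" "dist (xx n) z < 11 * \<rho> n" using W(4)[OF True] by blast
   have "en (a n) \<le> (\<integral>y. en \<bar>f y\<bar> * ind (ball z (16 * \<rho> n)) y)"
    unfolding a_nn
   proof (rule nn_integral_mono)
    fix y
    show "en \<bar>f y\<bar> * ind (E n) y \<le> en \<bar>f y\<bar> * ind (ball z (16 * \<rho> n)) y"
    proof (cases "y \<in> E n")
     case True
     then have "y \<in> ball (xx n) (5 * \<rho> n)" using E_sub[of n] by blast
     then have "dist (xx n) y < 5 * \<rho> n" by simp
     then have "y \<in> ball z (16 * \<rho> n)" using z(2) dist_triangle[of z y "xx n"] by (simp add: dist_commute)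
     then show ?thesis using True by simp
    qed simp
   qed
   also have "... \<le> en (w * (16 * \<rho> n) ^ d) * m z"
    unfolding m_def w_def d_def using True by (intro mx_ball) auto
   also have "... \<le> en (w * (16 * \<rho> n) ^ d) * en l"
    using z(1) by (intro mult_left_mono) (auto simp: \<Omega>_def)
   finally have "a n \<le> w * (16 * \<rho> n) ^ d * l"
    using w True l by (simp flip: ennreal_mult)
   then have "a n \<le> (16 ^ d * l) * (w * \<rho> n ^ d)" by (simp add: power_mult_distrib mult_ac)
   moreover have pos: "0 < w * \<rho> n ^ d" using w True by simp
   moreover have "\<bar>c n\<bar> \<le> a n / (w * \<rho> n ^ d)"
    unfolding c_def Bm(1) a_def abs_divide abs_of_pos[OF pos] using pos
    by (intro divide_right_mono integral_abs_bound) auto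
   ultimately show ?thesis by (metis (no_types, lifting) divide_le_eq order_trans pos_divide_le_eq)
  next
   case False
   then have "\<rho> n = 0" using W(1)[of n] by simp
   then show ?thesis using l by (simp add: c_def Bm d_def zero_power)
  qed
  define \<beta> where "\<beta> n y = f y * ind (E n) y - c n * ind (B n) y" for n y
  define G where "G y = (\<Sum>n. c n * ind (B n) y)" for y
  define g where "g y = f y * ind (- \<Omega>) y + G y" for y
  have G_in: "G y = c n" if "y \<in> B n" for y n
   unfolding G_def using sums_unique[OF sums_disjoint_indicator[OF B_dis that, of c]] by simp
  have G_out: "G y = 0" if "y \<notin> (\<Union>n. B n)" for y
   unfolding G_def using sums_unique[OF sums_indicator_outside[OF that, of c]] by simp
  have G_le: "\<bar>G y\<bar> \<le> 16 ^ d * l * ind \<Omega> y" for y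
  proof (cases "y \<in> (\<Union>n. B n)")
   case True
   then obtain n where n: "y \<in> B n" by auto
   then have "y \<in> \<Omega>" using B_sub by auto
   then show ?thesis using G_in[OF n] c_le[of n] by simp
  next
   case False
   then show ?thesis using G_out[OF False] l by simp
  qed
  have [measurable]: "G \<in> \<B>" unfolding G_def by measurable
  have niceG: "nice G" unfolding nice_def
  proof
   show "L1 G"
   proof (rule Bochner_Integration.integrable_bound)
    show "L1 (\<lambda>y. 16 ^ d * l * ind \<Omega> y :: real)"
     using fin by (intro integrable_mult_right integrable_real_indicator) auto
    show "AE y in lborel. norm (G y) \<le> norm (16 ^ d * l * ind \<Omega> y)"
     using G_le by (intro AE_I2) (simp add: order_trans[OF _ abs_ge_self])
   qed simp
   have "\<bar>G y\<bar> \<le> 16 ^ d * l" for y using G_le[of y] l by (cases "y \<in> \<Omega>") auto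
   then show "\<exists>b. \<forall>x. \<bar>G x\<bar> \<le> b" by blast
  qed
  have nicefO: "nice (\<lambda>y. f y * ind S y)" if "S \<in> sets borel" for S
  proof -
   obtain b where "\<And>x. \<bar>f x\<bar> \<le> b" "b > 0" using nice_bound[OF f(1)] by blast
   then have "\<bar>f x * ind S x\<bar> \<le> b" for x by (auto simp: indicator_def)
   then show ?thesis using iE[OF that] by (auto simp: nice_def)
  qed
  have niceg: "nice g" unfolding g_def by (intro nice_add nicefO niceG) measurable
  have [measurable]: "g \<in> \<B>" using niceg nice_measurable by auto
  define b where "b y = f y - g y" for y
  have niceb: "nice b" unfolding b_def by (intro nice_diff f niceg)
  have b_sums: "(\<lambda>n. \<beta> n y) sums b y" for y
  proof -
   have "(\<lambda>n. f y * ind (E n) y) sums (f y * ind \<Omega> y)"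
   proof (cases "y \<in> \<Omega>")
    case True
    then obtain n where "y \<in> E n" using E_un by auto
    from sums_disjoint_indicator[OF E_dis this, of "\<lambda>_. f y"] True show ?thesis by simp
   next
    case False
    then show ?thesis using sums_indicator_outside[of y E "\<lambda>_. f y"] E_un by simp
   qed
   moreover have "(\<lambda>n. c n * ind (B n) y) sums G y"
   proof (cases "y \<in> (\<Union>n. B n)")
    case True
    then obtain n where n: "y \<in> B n" by auto
    then show ?thesis using sums_disjoint_indicator[OF B_dis n, of c] G_in[OF n] by simp
   next
    case False
    then show ?thesis using sums_indicator_outside[OF False, of c] G_out[OF False] by simp
   qed
   ultimately have "(\<lambda>n. \<beta> n y) sums (f y * ind \<Omega> y - G y)"
    unfolding \<beta>_def by (rule sums_diff)
   also have "f y * ind \<Omega> y - G y = b y" by (simp add: b_def g_def indicator_def)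
   finally show ?thesis .
  qed
  have i\<beta>: "L1 (\<beta> n)" for n unfolding \<beta>_def by (intro Bochner_Integration.integrable_diff iE integrable_mult_right iB) measurable
  have [measurable]: "\<beta> n \<in> \<B>" for n using i\<beta>[of n] borel_measurable_integrable by auto
  have intB: "(LINT y. c n * ind (B n) y) = c n * measure lborel (B n)" for n by simp
  have a_c: "\<bar>c n\<bar> * measure lborel (B n) \<le> a n" for n
  proof (cases "\<rho> n > 0")
   case True
   then have "0 < w * \<rho> n ^ d" using w by simp
   then show ?thesis unfolding c_def a_def Bm(1) abs_divide
    using integral_abs_bound[of lborel "\<lambda>y. f y * ind (E n) y"] by simp
  qed (use Bm[of n] W(1)[of n] a0[of n] in \<open>simp add: d_def zero_power\<close>)
  have \<beta>_L1: "(LINT y. \<bar>\<beta> n y\<bar>) \<le> 2 * a n" for n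
  proof -
   have "(LINT y. \<bar>\<beta> n y\<bar>) \<le> (LINT y. \<bar>f y * ind (E n) y\<bar> + \<bar>c n\<bar> * ind (B n) y)"
   proof (rule integral_mono)
    show "L1 (\<lambda>y. \<bar>f y * ind (E n) y\<bar> + \<bar>c n\<bar> * ind (B n) y)"
     by (intro Bochner_Integration.integrable_add integrable_abs iE integrable_mult_right iB) measurable
    show "\<bar>\<beta> n y\<bar> \<le> \<bar>f y * ind (E n) y\<bar> + \<bar>c n\<bar> * ind (B n) y" for y
     unfolding \<beta>_def by (rule order_trans[OF abs_triangle_ineq4]) (simp add: abs_mult)
   qed (use i\<beta> in auto)
   also have "... = a n + \<bar>c n\<bar> * measure lborel (B n)"
    unfolding a_def by (subst Bochner_Integration.integral_add) (auto intro!: iE integrable_abs iB integrable_mult_right)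
   also have "... \<le> 2 * a n" using a_c[of n] by simp
   finally show ?thesis .
  qed
  have \<beta>_mean: "(LINT y. \<beta> n y) = 0" for n
  proof (cases "\<rho> n > 0")
   case True
   then have "0 < w * \<rho> n ^ d" using w by simp
   then have "c n * measure lborel (B n) = (LINT y. f y * ind (E n) y)"
    unfolding c_def Bm(1) by (metis less_irrefl nonzero_divide_eq_eq)
   then show ?thesis unfolding \<beta>_def
    by (subst Bochner_Integration.integral_diff) (auto intro!: iE iB)
  next
   case False
   then have "\<rho> n = 0" using W(1)[of n] by simp
   then have "E n = {}" "B n = {}" using E_sub[of n] by (auto simp: B_def)
   then show ?thesis by (simp add: \<beta>_def)
  qed
  have \<beta>_supp: "\<beta> n y = 0" if "y \<notin> ball (xx n) (5 * \<rho> n)" for n y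
  proof -
   have "y \<notin> E n" using that E_sub[of n] by blast
   moreover have "y \<notin> B n" using that W(1)[of n] by (auto simp: B_def)
   ultimately show ?thesis by (simp add: \<beta>_def)
  qed
  obtain bK where bK: "bK > 0" "\<And>x. \<bar>K x\<bar> \<le> bK" using nice_bound[OF K] by blast
  have conv_b: "en \<bar>conv K b x\<bar> \<le> (\<Sum>n. en \<bar>conv K (\<beta> n) x\<bar>)" for x
  proof -
   have le: "(LINT y. norm (K (x - y) * \<beta> n y)) \<le> bK * (2 * a n)" for n
   proof -
    have "(LINT y. norm (K (x - y) * \<beta> n y)) \<le> (LINT y. bK * \<bar>\<beta> n y\<bar>)"
     using bK i\<beta>[of n] integrable_norm[OF conv_integrable[OF K i\<beta>[of n], of x]]
     by (intro integral_mono) (auto simp: abs_mult mult_right_mono)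
    also have "... \<le> bK * (2 * a n)" using bK(1) \<beta>_L1[of n] by (simp add: mult_left_mono)
    finally show ?thesis .
   qed
   have "(\<lambda>n. LINT y. K (x - y) * \<beta> n y) sums (LINT y. (\<Sum>n. K (x - y) * \<beta> n y))"
   proof (rule sums_integral)
    show "L1 (\<lambda>y. K (x - y) * \<beta> n y)" for n by (rule conv_integrable[OF K i\<beta>])
    show "AE y in lborel. summable (\<lambda>n. norm (K (x - y) * \<beta> n y))"
    proof (rule AE_I2)
     fix y
     have "summable (\<lambda>n. \<bar>f y\<bar> * ind (E n) y)"
     proof (cases "y \<in> (\<Union>n. E n)")
      case True
      then obtain n where "y \<in> E n" by auto
      from sums_disjoint_indicator[OF E_dis this, of "\<lambda>_. \<bar>f y\<bar>"] show ?thesis by (rule sums_summable)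
     qed (use sums_indicator_outside[of y E "\<lambda>_. \<bar>f y\<bar>"] sums_summable in blast)
     moreover have "summable (\<lambda>n. \<bar>c n\<bar> * ind (B n) y)"
     proof (cases "y \<in> (\<Union>n. B n)")
      case True
      then obtain n where "y \<in> B n" by auto
      from sums_disjoint_indicator[OF B_dis this, of "\<lambda>n. \<bar>c n\<bar>"] show ?thesis by (rule sums_summable)
     qed (use sums_indicator_outside[of y B "\<lambda>n. \<bar>c n\<bar>"] sums_summable in blast)
     ultimately have "summable (\<lambda>n. \<bar>K (x - y)\<bar> * (\<bar>f y\<bar> * ind (E n) y + \<bar>c n\<bar> * ind (B n) y))"
      by (rule summable_mult[OF summable_add])
     then show "summable (\<lambda>n. norm (K (x - y) * \<beta> n y))"
     proof (rule summable_comparison_test[rotated], intro exI allI impI)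
      fix n
      have "\<bar>\<beta> n y\<bar> \<le> \<bar>f y\<bar> * ind (E n) y + \<bar>c n\<bar> * ind (B n) y"
       unfolding \<beta>_def by (rule order_trans[OF abs_triangle_ineq4]) (simp add: abs_mult)
      then show "norm (norm (K (x - y) * \<beta> n y)) \<le> \<bar>K (x - y)\<bar> * (\<bar>f y\<bar> * ind (E n) y + \<bar>c n\<bar> * ind (B n) y)"
       by (simp add: abs_mult mult_left_mono)
     qed
    qed
    show "summable (\<lambda>n. LINT y. norm (K (x - y) * \<beta> n y))"
     by (rule summable_comparison_test'[of "\<lambda>n. bK * (2 * a n)" 0])
       (use le a_summable in \<open>auto intro!: summable_mult simp: Bochner_Integration.integral_nonneg\<close>)
   qed
   moreover have "(\<lambda>y. \<Sum>n. K (x - y) * \<beta> n y) = (\<lambda>y. K (x - y) * b y)"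
    using sums_unique[OF sums_mult[OF b_sums]] by simp
   ultimately have s: "(\<lambda>n. conv K (\<beta> n) x) sums conv K b x" by (simp add: conv_def)
   have "en \<bar>conv K b x\<bar> \<le> (\<Sum>n. en \<bar>conv K (\<beta> n) x\<bar>)"
   proof (cases "(\<Sum>n. en \<bar>conv K (\<beta> n) x\<bar>) = \<top>")
    case False
    then have sm: "summable (\<lambda>n. \<bar>conv K (\<beta> n) x\<bar>)" by (intro summable_suminf_not_top) auto
    then have "\<bar>conv K b x\<bar> \<le> (\<Sum>n. \<bar>conv K (\<beta> n) x\<bar>)"
     using summable_rabs[OF sm] sums_unique[OF s] by simp
    then show ?thesis using sm by (subst suminf_ennreal2) (auto intro: ennreal_leI)
   qed simp
   then show ?thesis .
  qed
  define \<Omega>' where "\<Omega>' = (\<Union>n. ball (xx n) (10 * \<rho> n))"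
  let ?Tg = "{x. l / 2 < \<bar>conv K g x\<bar>}" and ?Tb = "{x. l / 2 < \<bar>conv K b x\<bar> \<and> x \<notin> \<Omega>'}"
  let ?N = "en ((16 ^ d * l)\<^sup>2) * vol \<Omega>"
  let ?b = "\<lambda>x. en \<bar>conv K b x\<bar> * ind (- \<Omega>') x"
  let ?\<beta> = "\<lambda>n x. en \<bar>conv K (\<beta> n) x\<bar> * ind (- \<Omega>') x"
  let ?D = "\<lambda>n x. en (dist (xx n) x powr (- 1 - DIM('a))) * ind (- ball (xx n) (10 * \<rho> n)) x * 1"
  let ?c = "\<lambda>n. A * (5 * \<rho> n) * (2 * a n)"
  have [measurable]: "\<Omega>' \<in> sets borel" unfolding \<Omega>'_def by measurable
  have \<beta>_off: "(\<integral>x. ?\<beta> n x) \<le> en (A * Cf) * en (a n)" for n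
  proof (cases "\<rho> n > 0")
   case True
   have pt: "\<bar>conv K (\<beta> n) x\<bar> \<le> (?c n) * dist (xx n) x powr (- 1 - DIM('a))"
    if x: "x \<notin> ball (xx n) (10 * \<rho> n)" for x
   proof -
    let ?X = "x - xx n"
    have X: "norm ?X \<ge> 10 * \<rho> n" using x by (simp add: dist_norm norm_minus_commute)
    have "conv K (\<beta> n) x = (LINT y. K (x - y) * \<beta> n y) - K ?X * (LINT y. \<beta> n y)"
     by (simp add: conv_def \<beta>_mean)
    also have "... = (LINT y. K (x - y) * \<beta> n y - K ?X * \<beta> n y)"
     using conv_integrable[OF K i\<beta>] i\<beta> by simp
    also have "\<bar>...\<bar> \<le> (LINT y. (A * (5 * \<rho> n) * ?P ?X) * \<bar>\<beta> n y\<bar>)"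
    proof (rule order_trans[OF integral_abs_bound integral_mono])
     show "L1 (\<lambda>y. \<bar>K (x - y) * \<beta> n y - K ?X * \<beta> n y\<bar>)"
      using conv_integrable[OF K i\<beta>, of x n] i\<beta>[of n] by auto
     show "L1 (\<lambda>y. (A * (5 * \<rho> n) * ?P ?X) * \<bar>\<beta> n y\<bar>)" using i\<beta> by auto
     fix y
     show "\<bar>K (x - y) * \<beta> n y - K ?X * \<beta> n y\<bar> \<le> (A * (5 * \<rho> n) * ?P ?X) * \<bar>\<beta> n y\<bar>"
     proof (cases "y \<in> ball (xx n) (5 * \<rho> n)")
      case True
      define h where "h = y - xx n"
      have h: "norm h \<le> 5 * \<rho> n" using True by (simp add: h_def dist_norm norm_minus_commute)
      have "\<bar>K (?X - h) - K ?X\<bar> \<le> A * norm h * ?P ?X"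
      proof (rule ker[rule_format])
       show "?X \<noteq> 0" using X \<open>\<rho> n > 0\<close> by (metis norm_zero mult_pos_pos not_le zero_less_numeral)
       show "2 * norm h \<le> norm ?X" using h X by linarith
      qed
      also have "... \<le> A * (5 * \<rho> n) * ?P ?X"
       using h A by (intro mult_right_mono mult_left_mono) auto
      finally have "\<bar>K (x - y) - K ?X\<bar> \<le> A * (5 * \<rho> n) * ?P ?X"
       by (simp add: h_def algebra_simps)
      then show ?thesis by (simp add: abs_mult mult_right_mono flip: left_diff_distrib)
     qed (simp add: \<beta>_supp)
    qed
    also have "... = (A * (5 * \<rho> n) * ?P ?X) * (LINT y. \<bar>\<beta> n y\<bar>)"
     by simp
    also have "... \<le> (A * (5 * \<rho> n) * ?P ?X) * (2 * a n)"
     using A True by (intro mult_left_mono \<beta>_L1) auto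
    finally show ?thesis by (simp add: dist_norm norm_minus_commute mult_ac)
   qed
   have "(\<integral>x. ?\<beta> n x)
    \<le> (\<integral>x. en (?c n) * ?D n x)"
   proof (rule nn_integral_mono)
    fix x
    show "?\<beta> n x \<le> en (?c n) * ?D n x"
    proof (cases "x \<in> \<Omega>'")
     case False
     then have "x \<notin> ball (xx n) (10 * \<rho> n)" by (auto simp: \<Omega>'_def)
     with pt[OF this] False A True a0[of n] show ?thesis
      by (simp flip: ennreal_mult)
    qed simp
   qed
   also have "... = en (?c n) * (\<integral>x. ?D n x)"
    by (rule nn_integral_cmult) measurable
   also have "... \<le> en (?c n) * (en (Cf * (10 * \<rho> n) powr (- 1)) * mx (\<lambda>_. 1) (xx n))"
    using True by (intro mult_left_mono Cf(2)) auto
   also have "... \<le> en (?c n) * (en (Cf * (10 * \<rho> n) powr (- 1)) * 1)"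
    by (intro mult_left_mono mx_const_le) auto
   also have "... = en (A * Cf) * en (a n)"
    using True A Cf(1) a0[of n] by (simp add: powr_minus flip: ennreal_mult)
   finally show ?thesis .
  next
   case False
   then have "\<rho> n = 0" using W(1)[of n] by simp
   then have "\<beta> n = (\<lambda>y. 0)" using \<beta>_supp[of _ n] by (auto simp: fun_eq_iff)
   then show ?thesis by (simp add: conv_def)
  qed
  have b_off: "(\<integral>x. ?b x) \<le> en (A * Cf) * ?F1"
  proof -
   have "(\<integral>x. ?b x) \<le> (\<integral>x. (\<Sum>n. ?\<beta> n x))"
    unfolding ennreal_suminf_multc by (intro nn_integral_mono mult_right_mono conv_b) auto
   also have "... = (\<Sum>n. (\<integral>x. ?\<beta> n x))"
    by (rule nn_integral_suminf) measurable
   also have "... \<le> (\<Sum>n. en (A * Cf) * en (a n))" by (intro suminf_le \<beta>_off) auto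
   also have "... = en (A * Cf) * ?F1" by (simp add: a_sum)
   finally show ?thesis .
  qed
  have \<Omega>'_le: "vol \<Omega>' \<le> en (10 ^ d) * vol \<Omega>"
  proof -
   have "vol \<Omega>' \<le> (\<Sum>n. vol (ball (xx n) (10 * \<rho> n)))"
    unfolding \<Omega>'_def by (rule emeasure_subadditive_countably) auto
   also have "... = (\<Sum>n. en (10 ^ d) * vol (B n))"
    using W(1) w by (intro suminf_cong) (simp add: Bm emeasure_ball_ubv power_mult_distrib w_def d_def mult_ac flip: ennreal_mult)
   also have "... = en (10 ^ d) * (\<Sum>n. vol (B n))" by simp
   also have "(\<Sum>n. vol (B n)) = vol (\<Union>n. B n)"
    using B_dis by (intro suminf_emeasure) auto
   also have "en (10 ^ d) * vol (\<Union>n. B n) \<le> en (10 ^ d) * vol \<Omega>"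
    using B_sub by (intro mult_left_mono emeasure_mono) auto
   finally show ?thesis .
  qed
  have g2: "(\<integral>x. en ((g x)\<^sup>2)) \<le> ?F2 + ?N"
  proof -
   have "(\<integral>x. en ((g x)\<^sup>2)) \<le> (\<integral>x. en ((f x)\<^sup>2) * ind (- \<Omega>) x + en ((16 ^ d * l)\<^sup>2) * ind \<Omega> x)"
   proof (rule nn_integral_mono)
    fix x
    show "en ((g x)\<^sup>2) \<le> en ((f x)\<^sup>2) * ind (- \<Omega>) x + en ((16 ^ d * l)\<^sup>2) * ind \<Omega> x"
    proof (cases "x \<in> \<Omega>")
     case True
     then have "\<bar>g x\<bar> \<le> 16 ^ d * l" using G_le[of x] by (simp add: g_def)
     then have "(g x)\<^sup>2 \<le> (16 ^ d * l)\<^sup>2" by (rule abs_le_square_iff[THEN iffD1, OF order_trans]) simp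
     then show ?thesis using True by (simp add: ennreal_leI)
    next
     case False
     then show ?thesis using G_le[of x] by (simp add: g_def)
    qed
   qed
   also have "... = ?F2 + ?N"
    by (subst nn_integral_add) (auto simp: nn_integral_cmult_indicator)
   finally show ?thesis .
  qed
  have Tg: "vol ?Tg \<le> en (4 / l\<^sup>2) * (en A * (?F2 + ?N))"
  proof -
   have "vol ?Tg \<le> vol ({x\<in>UNIV. 1 \<le> en (4 / l\<^sup>2) * en ((conv K g x)\<^sup>2)})"
   proof (rule emeasure_mono, safe)
    fix x assume "l / 2 < \<bar>conv K g x\<bar>"
    then have "(l / 2)\<^sup>2 \<le> (conv K g x)\<^sup>2" using l by (subst abs_le_square_iff[symmetric]) auto
    then have "1 \<le> 4 / l\<^sup>2 * (conv K g x)\<^sup>2" using l by (simp add: field_simps)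
    then have "en 1 \<le> en (4 / l\<^sup>2 * (conv K g x)\<^sup>2)" by (rule ennreal_leI)
    then show "1 \<le> en (4 / l\<^sup>2) * en ((conv K g x)\<^sup>2)" by (subst ennreal_mult[symmetric]) auto
   qed measurable
   also have "... \<le> en (4 / l\<^sup>2) * (\<integral>x. en ((conv K g x)\<^sup>2) * ind UNIV x)"
    using nn_integral_Markov_inequality[of "\<lambda>x. en ((conv K g x)\<^sup>2)" UNIV lborel "en (4 / l\<^sup>2)"] by simp
   also have "... \<le> en (4 / l\<^sup>2) * (en A * (\<integral>x. en ((g x)\<^sup>2)))"
    using L2 niceg by (intro mult_left_mono) auto
   also have "... \<le> en (4 / l\<^sup>2) * (en A * (?F2 + ?N))"
    by (intro mult_left_mono g2) auto
   finally show ?thesis .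
  qed
  have Tb: "vol ?Tb \<le> en (2 / l) * (en (A * Cf) * ?F1)"
  proof -
   have "vol ?Tb \<le> vol ({x\<in>UNIV. 1 \<le> en (2 / l) * (?b x)})"
   proof (rule emeasure_mono, safe)
    fix x assume x: "l / 2 < \<bar>conv K b x\<bar>" "x \<notin> \<Omega>'"
    then have "1 \<le> 2 / l * \<bar>conv K b x\<bar>" using l by (simp add: field_simps)
    then have "en 1 \<le> en (2 / l * \<bar>conv K b x\<bar>)" by (rule ennreal_leI)
    then show "1 \<le> en (2 / l) * (?b x)"
     using x l by (simp flip: ennreal_mult)
   qed (use niceb nice_measurable in measurable)
   also have "... \<le> en (2 / l) * (\<integral>x. ?b x * ind UNIV x)"
    using nn_integral_Markov_inequality[of "\<lambda>x. (?b x)" UNIV lborel "en (2 / l)"]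
     nice_measurable[OF niceb] by simp
   also have "... \<le> en (2 / l) * (en (A * Cf) * ?F1)"
    using b_off by (intro mult_left_mono) auto
   finally show ?thesis .
  qed
  have [measurable]: "b \<in> \<B>" using niceb nice_measurable by auto
  have "vol {x. l < \<bar>conv K f x\<bar>} \<le> vol (\<Omega>' \<union> (?Tg \<union> ?Tb))"
  proof (rule emeasure_mono)
   show "{x. l < \<bar>conv K f x\<bar>} \<subseteq> \<Omega>' \<union> (?Tg \<union> ?Tb)"
   proof (rule subsetI)
    fix x assume x: "x \<in> {x. l < \<bar>conv K f x\<bar>}"
    have "conv K f x = conv K g x + conv K b x"
     using conv_add[OF K nice_integrable[OF niceg] nice_integrable[OF niceb], of x] by (simp add: b_def)
    then have "l / 2 < \<bar>conv K g x\<bar> \<or> l / 2 < \<bar>conv K b x\<bar>" using x by auto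
    then show "x \<in> \<Omega>' \<union> (?Tg \<union> ?Tb)" by auto
   qed
  qed measurable
  also have "... \<le> vol \<Omega>' + (vol ?Tg + vol ?Tb)"
   by (intro order_trans[OF emeasure_subadditive] add_left_mono emeasure_subadditive) measurable
  also have "... \<le> en (10 ^ d) * vol \<Omega> + (en (4 / l\<^sup>2) * (en A * (?F2 + ?N)) + en (2 / l) * (en (A * Cf) * ?F1))"
   by (intro add_mono \<Omega>'_le Tg Tb)
  also have "... = en (10 ^ d + 4 * A * (16 ^ d)\<^sup>2) * vol \<Omega> + en (4 * A) * (en (1 / l\<^sup>2) * ?F2) + en (2 * A * Cf) * (en (1 / l) * ?F1)"
  proof -
   have e1: "en (4 / l\<^sup>2) * (en A * ?F2) = en (4 * A) * (en (1 / l\<^sup>2) * ?F2)"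
    using A l by (simp flip: mult.assoc ennreal_mult)
   have e2: "en (4 / l\<^sup>2) * (en A * (?N)) = en (4 * A * (16 ^ d)\<^sup>2) * vol \<Omega>"
    using A l by (simp add: power_mult_distrib flip: mult.assoc ennreal_mult)
   have e3: "en (2 / l) * (en (A * Cf) * ?F1) = en (2 * A * Cf) * (en (1 / l) * ?F1)"
    using A Cf l by (simp flip: mult.assoc ennreal_mult)
   have e4: "en (10 ^ d + 4 * A * (16 ^ d)\<^sup>2) = en (10 ^ d) + en (4 * A * (16 ^ d)\<^sup>2)"
    using A by (intro ennreal_plus) auto
   show ?thesis unfolding distrib_left e1 e2 e3 e4 distrib_right by (simp add: ac_simps)
  qed
  also have "... \<le> en C * vol \<Omega> + en C * (en (1 / l\<^sup>2) * ?F2) + en C * (en (1 / l) * ?F1)"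
   using A Cf by (intro add_mono mult_right_mono ennreal_leI) (auto simp: C_def)
  also have "... = en C * (vol \<Omega> + en (1 / l\<^sup>2) * ?F2 + en (1 / l) * ?F1)"
   by (simp add: distrib_left)
  also have "- \<Omega> = {x. m x \<le> en l}" by (auto simp: \<Omega>_def)
  finally show "vol {x. l < \<bar>conv K f x\<bar>} \<le> en C *
   (vol {x. en l < mx (\<lambda>y. en \<bar>f y\<bar>) x}
    + en (1 / l\<^sup>2) * (\<integral>x. en ((f x)\<^sup>2) * ind {x. mx (\<lambda>y. en \<bar>f y\<bar>) x \<le> en l} x)
    + en (1 / l) * (\<integral>x. en \<bar>f x\<bar> * ind {x. en l < mx (\<lambda>y. en \<bar>f y\<bar>) x} x))"
   unfolding \<Omega>_def m_def .
 qed
qed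

text \<open>The averages over small balls converge to $|f(x)|$. Continuity replaces Lebesgue's differentiation theorem here;
 continuous functions suffice, being dense.\<close>

lemma mx_ge_continuous:
 fixes f :: "'a::euclidean_space => real"
 assumes f: "continuous_on UNIV f"
 shows "en \<bar>f x\<bar> \<le> mx (\<lambda>y. en \<bar>f y\<bar>) x"
proof (cases "mx (\<lambda>y. en \<bar>f y\<bar>) x")
 case (real k)
 have "a \<le> k" if a: "a < \<bar>f x\<bar>" for a
 proof (cases "a \<ge> 0")
  case True
  have "continuous_on UNIV (\<lambda>y. \<bar>f y\<bar>)" using f by (intro continuous_intros)
  then have "open ((\<lambda>y. \<bar>f y\<bar>) -` {a<..})" by (intro open_vimage) auto
  then obtain r where r: "r > 0" "ball x r \<subseteq> (\<lambda>y. \<bar>f y\<bar>) -` {a<..}"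
   using a openE[of _ x] by blast
  define V where "V = ubv TYPE('a) * r ^ DIM('a)"
  have V: "V > 0" using r ubv_pos[where 'a='a] by (simp add: V_def)
  have "en a * en V = (\<integral>y. en a * ind (ball x r) y)"
   using r by (simp add: nn_integral_cmult_indicator emeasure_ball_ubv V_def)
  also have "... \<le> (\<integral>y. en \<bar>f y\<bar> * ind (ball x r) y)"
   using r(2) by (intro nn_integral_mono) (auto simp: indicator_def intro!: ennreal_leI less_imp_le)
  also have "... \<le> en V * mx (\<lambda>y. en \<bar>f y\<bar>) x"
   unfolding V_def by (rule mx_ball[OF r(1)])
  finally have "a * V \<le> V * k" using real True V by (simp flip: ennreal_mult)
  then show ?thesis using V by simp
 qed (use real in auto)
 then have "\<bar>f x\<bar> \<le> k" by (rule dense_le)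
 then show ?thesis using real by (simp add: ennreal_leI)
qed simp

text \<open>The $L^2$ bound and the regularity away from the origin that make the operator bounded on $L^q$, with one
 constant for both.\<close>

definition cz_kernel :: "real => ('a::euclidean_space => real) => bool" where
 "cz_kernel A K \<longleftrightarrow> nice K \<and>
  (\<forall>g. nice g --> (\<integral>x. en ((conv K g x)\<^sup>2)) \<le> en A * (\<integral>x. en ((g x)\<^sup>2))) \<and>
  (\<forall>x h. x \<noteq> 0 --> 2 * norm h \<le> norm x --> \<bar>K (x - h) - K x\<bar> \<le> A * norm h * norm x powr (- 1 - DIM('a)))"

text \<open>The distribution bound is integrated against $ql^{q-1}$. Where \<open>m\<close> is the maximal function of
 \<open>f\<close>, the quadratic term contributes $f^2\int_m^\infty l^{q-3}\,dl$, finite as $q<2$, and the linear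
 term $|f|\int_0^m l^{q-2}\,dl$, finite as $q>1$. Both are at most a multiple of $m^q$ because $|f|\le m$.\<close>

lemma cz_strong_low:
 fixes A q :: real
 assumes A: "A > 0" and q: "1 < q" "q < 2"
 shows "\<exists>C>0. \<forall>(K :: 'a::euclidean_space => real) f. cz_kernel A K --> nice f --> continuous_on UNIV f -->
  (\<integral>x. en (\<bar>conv K f x\<bar> powr q)) \<le> en C * (\<integral>x. en (\<bar>f x\<bar> powr q))"
proof -
 obtain C1 where C1: "C1 > 0" "\<And>(K :: 'a => real) f l. cz_kernel A K ==> nice f ==> continuous_on UNIV f ==> l > 0 ==>
  vol {x. l < \<bar>conv K f x\<bar>} \<le> en C1 *
   (vol {x. en l < mx (\<lambda>y. en \<bar>f y\<bar>) x}
    + en (1 / l\<^sup>2) * (\<integral>x. en ((f x)\<^sup>2) * ind {x. mx (\<lambda>y. en \<bar>f y\<bar>) x \<le> en l} x)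
    + en (1 / l) * (\<integral>x. en \<bar>f x\<bar> * ind {x. en l < mx (\<lambda>y. en \<bar>f y\<bar>) x} x))"
  using cz_distribution[OF A, where 'a='a] unfolding cz_kernel_def by blast
 obtain C2 where C2: "C2 > 0" "\<And>f :: 'a => ennreal. f \<in> \<B> ==>
  (\<integral>x. epow (mx f x) q) \<le> en C2 * (\<integral>x. epow (f x) q)"
  using mx_strong_type[OF q(1), where 'a='a] by blast
 define D where "D = C1 * (1 + q / (2 - q) + q / (q - 1)) * C2"
 have D: "D > 0" unfolding D_def using C1 C2 q by (intro mult_pos_pos add_pos_pos) auto
 show ?thesis
 proof (intro exI[of _ D] conjI allI impI)
  fix K f :: "'a => real"
  assume K: "cz_kernel A K" and f: "nice f" "continuous_on UNIV f"
  have [measurable]: "f \<in> \<B>" "K \<in> \<B>"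
   using f K nice_measurable by (auto simp: cz_kernel_def)
  define m where "m = mx (\<lambda>y. en \<bar>f y\<bar>)"
  have [measurable]: "m \<in> \<B>" unfolding m_def by measurable
  have fm: "en \<bar>f x\<bar> \<le> m x" for x unfolding m_def using f(2) by (rule mx_ge_continuous)
  let ?W = "\<lambda>l::real. en (q * l powr (q - 1)) * ind {0<..} l"
  let ?M = "(\<integral>x. epow (m x) q)"
  let ?A = "\<lambda>l. en (1 / l\<^sup>2) * (\<integral>x. en ((f x)\<^sup>2) * ind {x. m x \<le> en l} x)"
  let ?B = "\<lambda>l. en (1 / l) * (\<integral>x. en \<bar>f x\<bar> * ind {x. en l < m x} x)"
  let ?a = "\<lambda>l x. ?W l * (en (1 / l\<^sup>2) * (en ((f x)\<^sup>2) * ind {x. m x \<le> en l} x))"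
  let ?b = "\<lambda>l x. ?W l * (en (1 / l) * (en \<bar>f x\<bar> * ind {x. en l < m x} x))"
  have I2: "(\<integral>l. ?W l * ?A l)
   \<le> en (q / (2 - q)) * ?M"
  proof -
   have "(\<integral>l. ?W l * ?A l)
    = (\<integral>l. (\<integral>x. ?a l x))"
    by (simp add: nn_integral_cmult)
   also have "... = (\<integral>x. (\<integral>l. ?a l x))"
    by (rule lborel_pair.Fubini') measurable
   also have "... \<le> (\<integral>x. en (q / (2 - q)) * epow (m x) q)"
   proof (rule nn_integral_mono)
    fix x
    show "(\<integral>l. ?a l x) \<le> en (q / (2 - q)) * epow (m x) q"
    proof (cases "m x")
     case top
     then show ?thesis by (simp add: indicator_def top_unique)
    next
     case (real \<mu>)
     show ?thesis
     proof (cases "\<mu> = 0")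
      case True
      then have "f x = 0" using fm[of x] real by simp
      then show ?thesis by simp
     next
      case False
      then have \<mu>: "\<mu> > 0" using real by simp
      have "(\<integral>l. ?a l x)
       = (\<integral>l. en (q * (f x)\<^sup>2) * (en (l powr (- (2 - q) - 1)) * ind {\<mu>..} l))"
      proof (rule nn_integral_cong)
       fix l :: real
       show "?a l x = en (q * (f x)\<^sup>2) * (en (l powr (- (2 - q) - 1)) * ind {\<mu>..} l)"
       proof (cases "\<mu> \<le> l")
        case True
        then have l: "l > 0" using \<mu> by simp
        have "l powr (q - 1) * (1 / l\<^sup>2) = l powr (q - 1 - 2)"
         using l by (subst powr_diff) (auto simp: powr_numeral)
        also have "q - 1 - 2 = - (2 - q) - 1" by simp
        finally have e: "l powr (q - 1) * (1 / l\<^sup>2) = l powr (- (2 - q) - 1)" .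
        have "q * l powr (q - 1) * ((1 / l\<^sup>2) * (f x)\<^sup>2) = q * (f x)\<^sup>2 * (l powr (q - 1) * (1 / l\<^sup>2))" by (simp only: mult_ac)
        then have "q * l powr (q - 1) * ((1 / l\<^sup>2) * (f x)\<^sup>2) = q * (f x)\<^sup>2 * l powr (- (2 - q) - 1)" by (simp only: e)
        then have "en (q * l powr (q - 1)) * (en (1 / l\<^sup>2) * en ((f x)\<^sup>2)) = en (q * (f x)\<^sup>2) * en (l powr (- (2 - q) - 1))"
         using q by (simp flip: ennreal_mult)
        then show ?thesis using l True real by (simp add: ennreal_leI)
       next
        case False
        then show ?thesis using real \<mu> by (cases "l > 0") (auto simp: indicator_def)
       qed
      qed
      also have "... = en (q * (f x)\<^sup>2) * en (\<mu> powr (- (2 - q)) / (2 - q))"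
      proof -
       have "(\<integral>l. (en (l powr (- (2 - q) - 1)) * ind {\<mu>..} l)) = en (\<mu> powr (- (2 - q)) / (2 - q))"
        using q \<mu> by (intro nn_integral_powr_to_inf) auto
       then show ?thesis by (subst nn_integral_cmult) (auto simp del: minus_diff_eq)
      qed
      also have "... = en (q / (2 - q) * ((f x)\<^sup>2 * \<mu> powr (- (2 - q))))"
       using q by (simp add: mult_ac flip: ennreal_mult)
      also have "... \<le> en (q / (2 - q) * \<mu> powr q)"
      proof (intro ennreal_leI mult_left_mono)
       have "\<bar>f x\<bar> \<le> \<mu>" using fm[of x] real by simp
       then have "(f x)\<^sup>2 \<le> \<mu>\<^sup>2" using abs_le_square_iff[of "f x" \<mu>] \<mu> by simp
       then have "(f x)\<^sup>2 * \<mu> powr (- (2 - q)) \<le> \<mu>\<^sup>2 * \<mu> powr (- (2 - q))" by (intro mult_right_mono) auto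
       also have "... = \<mu> powr q" using \<mu> powr_add[of \<mu> 2 "- (2 - q)"] by (simp add: powr_numeral)
       finally show "(f x)\<^sup>2 * \<mu> powr (- (2 - q)) \<le> \<mu> powr q" .
      qed (use q in auto)
      also have "... = en (q / (2 - q)) * epow (m x) q"
       unfolding real(2) epow_ennreal[OF real(1)] using q by (intro ennreal_mult) auto
      finally show ?thesis .
     qed
    qed
   qed
   also have "... = en (q / (2 - q)) * ?M" by (simp add: nn_integral_cmult)
   finally show ?thesis .
  qed
  have I3: "(\<integral>l. ?W l * ?B l)
   \<le> en (q / (q - 1)) * ?M"
  proof -
   have "(\<integral>l. ?W l * ?B l)
    = (\<integral>l. (\<integral>x. ?b l x))"
    by (simp add: nn_integral_cmult)
   also have "... = (\<integral>x. (\<integral>l. ?b l x))"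
    by (rule lborel_pair.Fubini') measurable
   also have "... \<le> (\<integral>x. en (q / (q - 1)) * epow (m x) q)"
   proof (rule nn_integral_mono)
    fix x
    have "(\<integral>l. ?b l x)
     = (\<integral>l. en (q / (q - 1) * \<bar>f x\<bar>) * (en ((q - 1) * l powr (q - 1 - 1)) * ind {0<..} l * ind {l. en l < m x} l))"
    proof (rule nn_integral_cong)
     fix l :: real
     show "?b l x = en (q / (q - 1) * \<bar>f x\<bar>) * (en ((q - 1) * l powr (q - 1 - 1)) * ind {0<..} l * ind {l. en l < m x} l)"
     proof (cases "l > 0 \<and> en l < m x")
      case True
      then have l: "l > 0" by simp
      have "l powr (q - 1) * (1 / l) = l powr (q - 1 - 1)" using l by (subst (2) powr_diff) auto
      then have e: "l powr (q - 1 - 1) = l powr (q - 1) * (1 / l)" ..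
      have "q * l powr (q - 1) * (1 / l * \<bar>f x\<bar>) = q / (q - 1) * \<bar>f x\<bar> * ((q - 1) * l powr (q - 1 - 1))" unfolding e using q by simp
      then have "en (q * l powr (q - 1)) * (en (1 / l) * en \<bar>f x\<bar>) = en (q / (q - 1) * \<bar>f x\<bar>) * en ((q - 1) * l powr (q - 1 - 1))"
       using q l by (simp flip: ennreal_mult)
      then show ?thesis using True by simp
     qed (auto simp: indicator_def)
    qed
    also have "... = en (q / (q - 1) * \<bar>f x\<bar>) * epow (m x) (q - 1)"
     using q by (subst nn_integral_cmult) (auto simp: layer_cake_point[of "q - 1", simplified])
    also have "... \<le> en (q / (q - 1)) * epow (m x) q"
    proof (cases "m x")
     case top
     then show ?thesis using q by (simp add: ennreal_mult_top)
    next
     case (real \<mu>)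
     then have "\<bar>f x\<bar> \<le> \<mu>" using fm[of x] by simp
     then have "\<bar>f x\<bar> * \<mu> powr (q - 1) \<le> \<mu> * \<mu> powr (q - 1)" by (intro mult_right_mono) auto
     also have "... = \<mu> powr q" using real(1) by (subst powr_mult_base) auto
     finally have "q / (q - 1) * (\<bar>f x\<bar> * \<mu> powr (q - 1)) \<le> q / (q - 1) * \<mu> powr q" using q by (intro mult_left_mono) auto
     then show ?thesis using real q by (simp add: epow_ennreal mult.assoc flip: ennreal_mult)
    qed
    finally show "(\<integral>l. ?b l x) \<le> en (q / (q - 1)) * epow (m x) q" .
   qed
   also have "... = en (q / (q - 1)) * ?M" by (simp add: nn_integral_cmult)
   finally show ?thesis .
  qed
  have "(\<integral>x. en (\<bar>conv K f x\<bar> powr q)) = (\<integral>x. epow (en \<bar>conv K f x\<bar>) q)"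
   by (simp add: epow_ennreal)
  also have "... = (\<integral>l. ?W l * vol {x. en l < en \<bar>conv K f x\<bar>})"
   using q by (intro layer_cake) auto
  also have "... \<le> (\<integral>l. en C1 * (?W l * vol {x. en l < m x}
    + ?W l * ?A l
    + ?W l * ?B l))"
  proof (rule nn_integral_mono)
   fix l :: real
   show "?W l * vol {x. en l < en \<bar>conv K f x\<bar>} \<le> en C1 * (?W l * vol {x. en l < m x}
    + ?W l * ?A l
    + ?W l * ?B l)"
   proof (cases "l > 0")
    case True
    have "{x. en l < en \<bar>conv K f x\<bar>} = {x. l < \<bar>conv K f x\<bar>}" using True by (auto simp: ennreal_less_iff)
    then have "?W l * vol {x. en l < en \<bar>conv K f x\<bar>} \<le> ?W l * (en C1 *
   (vol {x. en l < m x}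
    + ?A l
    + ?B l))"
     using C1(2)[OF K f True] unfolding m_def by (intro mult_left_mono) auto
    then show ?thesis by (simp add: distrib_left mult.left_commute)
   qed simp
  qed
  also have "... = en C1 * ((\<integral>l. ?W l * vol {x. en l < m x})
   + (\<integral>l. ?W l * ?A l)
   + (\<integral>l. ?W l * ?B l))"
  proof -
   have [measurable]: "(\<lambda>l. vol {x. en l < m x}) \<in> \<B>"
   proof -
    have "(\<lambda>l. (\<integral>x. ind {x. en l < m x} x)) \<in> \<B>" by measurable
    then show ?thesis by simp
   qed
   show ?thesis by (simp add: nn_integral_cmult nn_integral_add)
  qed
  also have "(\<integral>l. ?W l * vol {x. en l < m x}) = ?M"
   using q by (intro layer_cake[symmetric]) auto
  also have "en C1 * (?M
   + (\<integral>l. ?W l * ?A l)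
   + (\<integral>l. ?W l * ?B l))
   \<le> en C1 * (?M + en (q / (2 - q)) * ?M + en (q / (q - 1)) * ?M)"
   by (intro mult_left_mono add_mono order_refl I2 I3) auto
  also have "... = en (C1 * (1 + q / (2 - q) + q / (q - 1))) * ?M"
   using q C1(1) by (simp add: ennreal_mult ennreal_plus distrib_right mult.assoc del: ennreal_plus[symmetric])
  also have "... \<le> en (C1 * (1 + q / (2 - q) + q / (q - 1))) * (en C2 * (\<integral>x. epow (en \<bar>f x\<bar>) q))"
   unfolding m_def by (intro mult_left_mono C2(2)) auto
  also have "... = en D * (\<integral>x. en (\<bar>f x\<bar> powr q))"
   using q C1(1) C2(1) by (simp add: D_def epow_ennreal ennreal_mult mult.assoc)
  finally show "(\<integral>x. en (\<bar>conv K f x\<bar> powr q)) \<le> en D * (\<integral>x. en (\<bar>f x\<bar> powr q))" .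
 qed (rule D)
qed

lemma nice_abs_powr:
 assumes f: "nice f" and q: "q \<ge> 1" shows "nice (\<lambda>x. \<bar>f x\<bar> powr q)"
proof -
 obtain B where B: "B > 0" "\<And>x. \<bar>f x\<bar> \<le> B" using nice_bound[OF f] by blast
 have [measurable]: "f \<in> \<B>" using f nice_measurable by auto
 have le: "\<bar>f x\<bar> powr q \<le> B powr (q - 1) * \<bar>f x\<bar>" for x
 proof -
  have "\<bar>f x\<bar> powr q = \<bar>f x\<bar> powr (q - 1) * \<bar>f x\<bar>"
   using powr_mult_base[of "\<bar>f x\<bar>" "q - 1"] by (simp add: mult.commute)
  also have "... \<le> B powr (q - 1) * \<bar>f x\<bar>" using B q by (intro mult_right_mono powr_mono2) auto
  finally show ?thesis .
 qed
 show ?thesis unfolding nice_def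
 proof (intro conjI exI allI)
  show "L1 (\<lambda>x. \<bar>f x\<bar> powr q)"
   by (rule Bochner_Integration.integrable_bound[of _ "\<lambda>x. B powr (q - 1) * \<bar>f x\<bar>"])
    (use f le in \<open>auto intro!: AE_I2 order_trans[OF _ abs_ge_self]\<close>)
  show "\<bar>\<bar>f x\<bar> powr q\<bar> \<le> B powr q" for x using B q by (auto intro: powr_mono2)
 qed
qed

text \<open>For $q>2$ by duality: the convolution with an even kernel is symmetric, and the $L^q$ norm of $T=K*f$ is
 attained by testing with $T|T|^{q-2}$, to which the case of the conjugate exponent below $2$ applies.\<close>

theorem cz_strong:
 fixes A q :: real
 assumes A: "A > 0" and q: "1 < q"
 shows "\<exists>C>0. \<forall>(K :: 'a::euclidean_space => real) f. cz_kernel A K --> (\<forall>x. K (- x) = K x) --> nice f --> continuous_on UNIV f -->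
  (\<integral>x. en (\<bar>conv K f x\<bar> powr q)) \<le> en C * (\<integral>x. en (\<bar>f x\<bar> powr q))"
proof -
 consider "q < 2" | "q = 2" | "q > 2" by linarith
 then show ?thesis
 proof cases
  case 1
  then show ?thesis using cz_strong_low[OF A q, where 'a='a] by blast
 next
  case 2
  then show ?thesis using A by (intro exI[of _ A]) (auto simp: cz_kernel_def powr_numeral)
 next
  case 3
  define Q where "Q = q / (q - 1)"
  have Q: "1 < Q" "Q < 2" "1 / q + 1 / Q = 1" "Q > 0" "(q - 1) * Q = q" using 3 by (auto simp: Q_def field_simps)
  obtain C where C: "C > 0" "\<And>(K :: 'a => real) f. cz_kernel A K ==> nice f ==> continuous_on UNIV f ==>
   (\<integral>x. en (\<bar>conv K f x\<bar> powr Q)) \<le> en C * (\<integral>x. en (\<bar>f x\<bar> powr Q))"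
   using cz_strong_low[OF A Q(1,2), where 'a='a] by blast
  show ?thesis
  proof (intro exI[of _ "C powr (q / Q)"] conjI allI impI)
   show "C powr (q / Q) > 0" using C by simp
   fix K f :: "'a => real"
   assume K: "cz_kernel A K" "\<forall>x. K (- x) = K x" and f: "nice f" "continuous_on UNIV f"
   have nK: "nice K" using K by (simp add: cz_kernel_def)
   have [measurable]: "f \<in> \<B>" "K \<in> \<B>"
    using f nK nice_measurable by auto
   define T where "T = conv K f"
   have nT: "nice T" unfolding T_def by (rule conv_nice[OF nK f(1)])
   have cT: "continuous_on UNIV T" unfolding T_def by (rule continuous_conv[OF nK f])
   have [measurable]: "T \<in> \<B>" using nT nice_measurable by auto
   define h where "h x = T x * \<bar>T x\<bar> powr (q - 2)" for x
   have absh: "\<bar>h x\<bar> = \<bar>T x\<bar> powr (q - 1)" for x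
    using powr_mult_base[of "\<bar>T x\<bar>" "q - 2"] by (simp add: h_def abs_mult)
   have [measurable]: "h \<in> \<B>" unfolding h_def by measurable
   have nh: "nice h"
   proof -
    have "nice (\<lambda>x. \<bar>T x\<bar> powr (q - 1))" using nT 3 by (intro nice_abs_powr) auto
    then show ?thesis unfolding nice_def absh[symmetric] by (simp add: integrable_abs_iff)
   qed
   have ch: "continuous_on UNIV h" unfolding h_def using cT 3
    by (intro continuous_on_mult continuous_on_powr' continuous_intros) auto
   define X where "X = (LINT x. \<bar>T x\<bar> powr q)"
   define F where "F = (LINT x. \<bar>f x\<bar> powr q)"
   have nTq: "nice (\<lambda>x. \<bar>T x\<bar> powr q)" using nT 3 by (intro nice_abs_powr) auto
   have nfq: "nice (\<lambda>x. \<bar>f x\<bar> powr q)" using f 3 by (intro nice_abs_powr) auto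
   have X: "(\<integral>x. en (\<bar>T x\<bar> powr q)) = en X" "X \<ge> 0"
    unfolding X_def using nTq by (auto intro!: nn_integral_eq_integral)
   have F: "(\<integral>x. en (\<bar>f x\<bar> powr q)) = en F" "F \<ge> 0"
    unfolding F_def using nfq by (auto intro!: nn_integral_eq_integral)
   have "X = (LINT x. T x * h x)"
    unfolding X_def
   proof (rule Bochner_Integration.integral_cong)
    fix x
    have "T x * h x = \<bar>T x\<bar> * \<bar>h x\<bar>" by (simp add: h_def abs_mult power2_eq_square mult.assoc[symmetric])
    then show "\<bar>T x\<bar> powr q = T x * h x" using powr_mult_base[of "\<bar>T x\<bar>" "q - 1"] by (simp add: absh)
   qed simp
   also have "... = (LINT x. f x * conv K h x)"
    unfolding T_def using K(2) by (intro conv_adjoint nK f nh) auto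
   finally have "en X \<le> en (LINT x. \<bar>f x * conv K h x\<bar>)"
    by (auto intro!: ennreal_leI order_trans[OF abs_ge_self integral_abs_bound])
   also have "... = (\<integral>x. en \<bar>f x * conv K h x\<bar>)"
    using nice_mult[OF f(1) conv_nice[OF nK nh]] by (subst nn_integral_eq_integral) auto
   also have "... = (\<integral>x. en \<bar>f x\<bar> * en \<bar>conv K h x\<bar>)"
    by (simp add: abs_mult ennreal_mult)
   also have "... \<le> epow (\<integral>x. epow (en \<bar>f x\<bar>) q) (1 / q) * epow (\<integral>x. epow (en \<bar>conv K h x\<bar>) Q) (1 / Q)"
    using Q 3 by (intro nn_hoelder) auto
   also have "(\<integral>x. epow (en \<bar>f x\<bar>) q) = en F" by (simp add: epow_ennreal F)
   also have "(\<integral>x. epow (en \<bar>conv K h x\<bar>) Q) = (\<integral>x. en (\<bar>conv K h x\<bar> powr Q))" by (simp add: epow_ennreal)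
   also have "epow (en F) (1 / q) * epow (\<integral>x. en (\<bar>conv K h x\<bar> powr Q)) (1 / Q) \<le> epow (en F) (1 / q) * epow (en C * (\<integral>x. en (\<bar>h x\<bar> powr Q))) (1 / Q)"
    using Q by (intro mult_left_mono epow_mono C(2) K nh ch) auto
   also have "(\<integral>x. en (\<bar>h x\<bar> powr Q)) = en X"
    using Q(5) by (simp add: absh powr_powr X(1))
   also have "epow (en F) (1 / q) * epow (en C * en X) (1 / Q) = en (F powr (1 / q) * (C * X) powr (1 / Q))"
    using F(2) X(2) C(1) by (simp add: epow_ennreal flip: ennreal_mult)
   finally have le: "X \<le> F powr (1 / q) * (C * X) powr (1 / Q)" by simp
   have "X \<le> C powr (q / Q) * F"
   proof (cases "X = 0")
    case True
    then show ?thesis using F C by simp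
   next
    case False
    then have Xp: "X > 0" using X by simp
    have "X = X powr (1 / q) * X powr (1 / Q)" using Xp Q(3) by (simp flip: powr_add)
    with le have "X powr (1 / q) * X powr (1 / Q) \<le> (F powr (1 / q) * C powr (1 / Q)) * X powr (1 / Q)"
     using C Xp by (simp add: powr_mult mult.assoc)
    then have "X powr (1 / q) \<le> F powr (1 / q) * C powr (1 / Q)" using Xp by simp
    then have "(X powr (1 / q)) powr q \<le> (F powr (1 / q) * C powr (1 / Q)) powr q" using 3 by (intro powr_mono2) auto
    then show ?thesis using Xp F C 3 by (simp add: powr_powr powr_mult mult.commute)
   qed
   then show "(\<integral>x. en (\<bar>conv K f x\<bar> powr q)) \<le> en (C powr (q / Q)) * (\<integral>x. en (\<bar>f x\<bar> powr q))"
    using F X by (simp add: T_def[symmetric] ennreal_leI flip: ennreal_mult)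
  qed
 qed
qed

lemma epow_less_top_iff [simp]: "epow x q < \<top> \<longleftrightarrow> x < \<top>"
 by (cases x) (simp_all add: epow_ennreal)

section \<open>Approximation in Lebesgue spaces\<close>

text \<open>Dominated convergence, in the form in which it provides approximants.\<close>

lemma small_integral:
 fixes F :: "nat => 'a => real"
 assumes [measurable]: "\<And>n. F n \<in> borel_measurable M" and F: "\<And>n x. 0 \<le> F n x" "\<And>n x. F n x \<le> w x" "integrable M w"
  "AE x in M. (\<lambda>n. F n x) \<longlonglongrightarrow> 0" and e: "e > 0"
 shows "\<exists>n. (\<integral>\<^sup>+x. en (F n x) \<partial>M) < en e"
proof -
 have "(\<lambda>n. LINT x|M. F n x) \<longlonglongrightarrow> (LINT x|M. 0)"
  by (rule integral_dominated_convergence[where w=w]) (use F in auto)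
 then have "\<forall>\<^sub>F n in sequentially. (LINT x|M. F n x) < e" using e by (intro order_tendstoD) auto
 then obtain n where n: "(LINT x|M. F n x) < e" by (auto simp: eventually_sequentially)
 have "integrable M (F n)"
  by (rule Bochner_Integration.integrable_bound[OF F(3)]) (use F in \<open>auto intro!: AE_I2 order_trans[OF _ abs_ge_self]\<close>)
 then have "(\<integral>\<^sup>+x. en (F n x) \<partial>M) = en (LINT x|M. F n x)" using F by (intro nn_integral_eq_integral) auto
 then show ?thesis using n e by (intro exI[of _ n]) (simp add: ennreal_less_iff F)
qed

definition lq :: "real => ('a::euclidean_space => real) => bool" where
 "lq q v \<longleftrightarrow> v \<in> \<B> \<and> (\<integral>x. en (\<bar>v x\<bar> powr q)) < \<top>"

lemma lq_integrable: "lq q v ==> L1 (\<lambda>x. \<bar>v x\<bar> powr q)"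
 by (rule integrableI_bounded) (auto simp: lq_def)

lemma powr_add_le:
 fixes a b q :: real
 assumes "a \<ge> 0" "b \<ge> 0" "q \<ge> 0"
 shows "(a + b) powr q \<le> 2 powr q * (a powr q + b powr q)"
proof -
 have "(a + b) powr q \<le> (2 * max a b) powr q" using assms by (intro powr_mono2) auto
 also have "... = 2 powr q * max a b powr q" by (rule powr_mult)
 also have "... \<le> 2 powr q * (a powr q + b powr q)" by (intro mult_left_mono) (auto simp: max_def)
 finally show ?thesis .
qed

text \<open>\<open>v\<close> is first cut off in space and in value, up to a small error. Then \<open>v\<close> is replaced
 inside the cutoffs by continuous functions converging to it almost everywhere; the cutoffs provide the majorant.\<close>

lemma lq_dense:
 fixes v :: "'a::euclidean_space => real"
 assumes v: "lq q v" and q: "q \<ge> 1" and e: "e > 0"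
 shows "\<exists>g. nice g \<and> continuous_on UNIV g \<and> (\<integral>x. en (\<bar>v x - g x\<bar> powr q)) < en e"
proof -
 have [measurable]: "v \<in> \<B>" using v by (simp add: lq_def)
 have "v measurable_on UNIV"
  by (rule lebesgue_measurable_imp_measurable_on_real) (auto intro!: measurable_completion)
 then obtain N G where G: "negligible N" "\<And>n. continuous_on UNIV (G n)" "\<And>x. x \<notin> N ==> (\<lambda>n. G n x) \<longlonglongrightarrow> v x"
  unfolding measurable_on_def by auto
 have aeG: "AE x in lborel. (\<lambda>n. G n x) \<longlonglongrightarrow> v x"
 proof -
  have "AE x in lebesgue. x \<notin> N" using G(1) by (intro AE_not_in) (simp add: negligible_iff_null_sets)
  then show ?thesis using G(3) by (auto simp: AE_completion_iff elim!: eventually_mono)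
 qed
 define \<theta> where "\<theta> k x = max 0 (min 1 (real k + 1 - norm x))" for k :: nat and x :: 'a
 define cl where "cl k y = max (- real k) (min (real k) y)" for k :: nat and y :: real
 let ?w = "\<lambda>k x. \<theta> k x * cl k (v x)"
 have \<theta>: "0 \<le> \<theta> k x" "\<theta> k x \<le> 1" for k x by (auto simp: \<theta>_def)
 have \<theta>c: "continuous_on UNIV (\<theta> k)" for k unfolding \<theta>_def by (intro continuous_intros)
 have clc: "continuous_on UNIV (cl k)" for k unfolding cl_def by (intro continuous_intros)
 have cl: "\<bar>cl k y\<bar> \<le> real k" "\<bar>cl k y\<bar> \<le> \<bar>y\<bar>" "\<bar>y - cl k y\<bar> \<le> \<bar>y\<bar>" for k y by (auto simp: cl_def)
 have [measurable]: "\<theta> k \<in> \<B>" for k by (intro borel_measurable_continuous_onI \<theta>c)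
 have [measurable]: "cl k \<in> \<B>" for k by (intro borel_measurable_continuous_onI clc)
 have [measurable]: "G n \<in> \<B>" for n by (intro borel_measurable_continuous_onI G)
 define e' where "e' = e / (2 powr q * 2)"
 have e': "e' > 0" using e by (simp add: e'_def)
 have "\<exists>k. (\<integral>x. en (\<bar>v x - ?w k x\<bar> powr q)) < en e'"
 proof (rule small_integral[where w="\<lambda>x. 2 powr q * \<bar>v x\<bar> powr q"])
  show "L1 (\<lambda>x. 2 powr q * \<bar>v x\<bar> powr q)" using lq_integrable[OF v] by simp
  show "\<bar>v x - ?w k x\<bar> powr q \<le> 2 powr q * \<bar>v x\<bar> powr q" for k x
  proof -
   have "\<bar>?w k x\<bar> \<le> 1 * \<bar>v x\<bar>" unfolding abs_mult using \<theta> cl(2) by (intro mult_mono) auto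
   then have "\<bar>v x - ?w k x\<bar> \<le> 2 * \<bar>v x\<bar>" by linarith
   then have "\<bar>v x - ?w k x\<bar> powr q \<le> (2 * \<bar>v x\<bar>) powr q" using q by (intro powr_mono2) auto
   then show ?thesis by (simp add: powr_mult)
  qed
  show "AE x in lborel. (\<lambda>k. \<bar>v x - ?w k x\<bar> powr q) \<longlonglongrightarrow> 0"
  proof (rule AE_I2)
   fix x
   obtain k0 :: nat where k0: "norm x + \<bar>v x\<bar> \<le> real k0" using real_arch_simple by blast
   have "\<forall>\<^sub>F k in sequentially. \<bar>v x - ?w k x\<bar> powr q = 0"
    using eventually_ge_at_top[of k0]
   proof eventually_elim
    case (elim k)
    then have "norm x + \<bar>v x\<bar> \<le> real k" using k0 by simp
    then have "norm x \<le> real k" "\<bar>v x\<bar> \<le> real k" using norm_ge_zero[of x] by linarith+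
    then have "\<theta> k x = 1" "cl k (v x) = v x" by (auto simp: \<theta>_def cl_def)
    then show ?case by simp
   qed
   then show "(\<lambda>k. \<bar>v x - ?w k x\<bar> powr q) \<longlonglongrightarrow> 0" by (rule tendsto_eventually)
  qed
 qed (use e' in auto)
 then obtain k where k: "(\<integral>x. en (\<bar>v x - ?w k x\<bar> powr q)) < en e'" by blast
 define g where "g n x = \<theta> k x * cl k (G n x)" for n x
 have gb: "\<bar>g n x\<bar> \<le> real k * ind (cball 0 (real k + 1)) x" for n x
 proof (cases "norm x \<le> real k + 1")
  case True
  have "\<bar>g n x\<bar> \<le> 1 * real k" unfolding g_def abs_mult using \<theta> cl(1) by (intro mult_mono) auto
  then show ?thesis using True by simp
 qed (auto simp: g_def \<theta>_def)
 have ib: "L1 (\<lambda>x. c * ind (cball 0 (real k + 1)) (x::'a) :: real)" for c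
  using emeasure_lborel_cball_finite[of "0::'a" "real k + 1"]
  by (intro integrable_mult_right integrable_real_indicator) auto
 have gc: "continuous_on UNIV (g n)" for n
  unfolding g_def by (intro continuous_on_mult \<theta>c continuous_on_compose2[OF clc G(2)]) auto
 have [measurable]: "g n \<in> \<B>" for n by (intro borel_measurable_continuous_onI gc)
 have gn: "nice (g n)" for n unfolding nice_def
 proof
  show "L1 (g n)"
   by (rule Bochner_Integration.integrable_bound[OF ib[of "real k"]]) (use gb in \<open>auto intro!: AE_I2 order_trans[OF _ abs_ge_self]\<close>)
  have "\<bar>g n x\<bar> \<le> real k" for x using gb[of n x] by (cases "x \<in> cball 0 (real k + 1)") auto
  then show "\<exists>B. \<forall>x. \<bar>g n x\<bar> \<le> B" by blast
 qed
 have "\<exists>n. (\<integral>x. en (\<bar>?w k x - g n x\<bar> powr q)) < en e'"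
 proof (rule small_integral[where w="\<lambda>x. (2 * real k) powr q * ind (cball 0 (real k + 1)) x"])
  show "L1 (\<lambda>x::'a. (2 * real k) powr q * ind (cball 0 (real k + 1)) x)" by (rule ib)
  show "\<bar>?w k x - g n x\<bar> powr q \<le> (2 * real k) powr q * ind (cball 0 (real k + 1)) x" for n x
  proof (cases "norm x \<le> real k + 1")
   case True
   have "\<bar>?w k x\<bar> \<le> 1 * real k" unfolding abs_mult using \<theta> cl(1) by (intro mult_mono) auto
   then have "\<bar>?w k x - g n x\<bar> \<le> 2 * real k" using gb[of n x] True by simp
   then show ?thesis using True q by (auto intro: powr_mono2)
  qed (auto simp: g_def \<theta>_def)
  show "AE x in lborel. (\<lambda>n. \<bar>?w k x - g n x\<bar> powr q) \<longlonglongrightarrow> 0"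
   using aeG
  proof eventually_elim
   case (elim x)
   have "(\<lambda>n. cl k (G n x)) \<longlonglongrightarrow> cl k (v x)"
    using clc elim by (auto intro!: isCont_tendsto_compose[where g="cl k"] simp: continuous_on_eq_continuous_at)
   then have "(\<lambda>n. \<bar>?w k x - g n x\<bar>) \<longlonglongrightarrow> \<bar>?w k x - ?w k x\<bar>"
    unfolding g_def by (intro tendsto_intros)
   then have "(\<lambda>n. \<bar>?w k x - g n x\<bar>) \<longlonglongrightarrow> 0" by simp
   then have "(\<lambda>n. \<bar>?w k x - g n x\<bar> powr q) \<longlonglongrightarrow> 0 powr q"
    using q by (intro tendsto_powr') auto
   then show ?case using q by simp
  qed
 qed (use e' in auto)
 then obtain n where n: "(\<integral>x. en (\<bar>?w k x - g n x\<bar> powr q)) < en e'" by blast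
 have "(\<integral>x. en (\<bar>v x - g n x\<bar> powr q)) \<le> (\<integral>x. en (2 powr q) * (en (\<bar>v x - ?w k x\<bar> powr q) + en (\<bar>?w k x - g n x\<bar> powr q)))"
 proof (rule nn_integral_mono)
  fix x
  have "\<bar>v x - g n x\<bar> powr q \<le> (\<bar>v x - ?w k x\<bar> + \<bar>?w k x - g n x\<bar>) powr q"
   using q by (intro powr_mono2) auto
  also have "... \<le> 2 powr q * (\<bar>v x - ?w k x\<bar> powr q + \<bar>?w k x - g n x\<bar> powr q)"
   using q by (intro powr_add_le) auto
  finally show "en (\<bar>v x - g n x\<bar> powr q) \<le> en (2 powr q) * (en (\<bar>v x - ?w k x\<bar> powr q) + en (\<bar>?w k x - g n x\<bar> powr q))"
   by (simp add: ennreal_leI flip: ennreal_mult ennreal_plus)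
 qed
 also have "... = en (2 powr q) * ((\<integral>x. en (\<bar>v x - ?w k x\<bar> powr q)) + (\<integral>x. en (\<bar>?w k x - g n x\<bar> powr q)))"
  by (simp add: nn_integral_cmult nn_integral_add)
 also have "... < en (2 powr q) * (en e' + en e')"
  by (intro ennreal_mult_strict_left_mono add_strict_mono k n) auto
 also have "... = en e" using e' by (simp add: e'_def flip: ennreal_mult ennreal_plus)
 finally show ?thesis using gn gc by blast
qed

section \<open>Khintchine's inequality\<close>

text \<open>A choice of signs for the indices below \<open>N\<close> is given by the set of those with sign $+1$;
 expectations over independent random signs become averages over the power set.\<close>

definition sgnset :: "nat set => nat => real" where
 "sgnset B k = (if k \<in> B then 1 else - 1)"

definition radsum :: "(nat => real) => nat => nat set => real" where
 "radsum a N B = (\<Sum>k<N. sgnset B k * a k)"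

lemma sum_Pow_Suc:
 "(\<Sum>B\<in>Pow {..<Suc N}. \<phi> B) = (\<Sum>B\<in>Pow {..<N}. \<phi> B + \<phi> (insert N B))"
proof -
 have "Pow {..<Suc N} = Pow {..<N} \<union> insert N ` Pow {..<N}"
  by (simp add: lessThan_Suc Pow_insert)
 moreover have "Pow {..<N} \<inter> insert N ` Pow {..<N} = {}" by auto
 moreover have "inj_on (insert N) (Pow {..<N})" by (auto simp: inj_on_def)
 ultimately have "(\<Sum>B\<in>Pow {..<Suc N}. \<phi> B) = (\<Sum>B\<in>Pow {..<N}. \<phi> B) + (\<Sum>B\<in>insert N ` Pow {..<N}. \<phi> B)"
  by (subst sum.union_disjoint[symmetric]) auto
 also have "(\<Sum>B\<in>insert N ` Pow {..<N}. \<phi> B) = (\<Sum>B\<in>Pow {..<N}. \<phi> (insert N B))"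
  using \<open>inj_on _ _\<close> by (simp add: sum.reindex)
 finally show ?thesis by (simp only: sum.distrib)
qed

lemma radsum_Suc:
 assumes "B \<subseteq> {..<N}"
 shows "radsum a (Suc N) B = radsum a N B - a N" "radsum a (Suc N) (insert N B) = radsum a N B + a N"
proof -
 have "N \<notin> B" using assms by auto
 then show "radsum a (Suc N) B = radsum a N B - a N" by (simp add: radsum_def sgnset_def)
 have "(\<Sum>k<N. sgnset (insert N B) k * a k) = (\<Sum>k<N. sgnset B k * a k)"
  by (intro sum.cong) (auto simp: sgnset_def)
 then show "radsum a (Suc N) (insert N B) = radsum a N B + a N" by (simp add: radsum_def sgnset_def)
qed

lemma radsum_moment2: "(\<Sum>B\<in>Pow {..<N}. (radsum a N B)\<^sup>2) = 2 ^ N * (\<Sum>k<N. (a k)\<^sup>2)"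
proof (induction N)
 case (Suc N)
 have "(\<Sum>B\<in>Pow {..<Suc N}. (radsum a (Suc N) B)\<^sup>2) = (\<Sum>B\<in>Pow {..<N}. (radsum a N B - a N)\<^sup>2 + (radsum a N B + a N)\<^sup>2)"
  unfolding sum_Pow_Suc by (intro sum.cong refl) (simp add: radsum_Suc)
 also have "... = (\<Sum>B\<in>Pow {..<N}. 2 * (radsum a N B)\<^sup>2 + 2 * (a N)\<^sup>2)"
  by (intro sum.cong refl) (simp add: power2_eq_square algebra_simps)
 also have "... = 2 * (\<Sum>B\<in>Pow {..<N}. (radsum a N B)\<^sup>2) + 2 ^ N * (2 * (a N)\<^sup>2)"
  by (simp add: sum.distrib sum_distrib_left card_Pow)
 also have "... = 2 ^ Suc N * (\<Sum>k<Suc N. (a k)\<^sup>2)" by (simp add: Suc.IH algebra_simps)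
 finally show ?case .
qed (simp add: radsum_def)

lemma radsum_moment4: "(\<Sum>B\<in>Pow {..<N}. (radsum a N B) ^ 4) \<le> 2 ^ N * (3 * (\<Sum>k<N. (a k)\<^sup>2)\<^sup>2)"
proof (induction N)
 case (Suc N)
 define s where "s = (\<Sum>k<N. (a k)\<^sup>2)"
 have "(\<Sum>B\<in>Pow {..<Suc N}. (radsum a (Suc N) B) ^ 4) = (\<Sum>B\<in>Pow {..<N}. (radsum a N B - a N) ^ 4 + (radsum a N B + a N) ^ 4)"
  unfolding sum_Pow_Suc by (intro sum.cong refl) (simp add: radsum_Suc)
 also have "... = (\<Sum>B\<in>Pow {..<N}. 2 * (radsum a N B) ^ 4 + 12 * (a N)\<^sup>2 * (radsum a N B)\<^sup>2 + 2 * (a N) ^ 4)"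
  by (intro sum.cong refl) (simp add: power2_eq_square power4_eq_xxxx algebra_simps)
 also have "... = 2 * (\<Sum>B\<in>Pow {..<N}. (radsum a N B) ^ 4) + 12 * (a N)\<^sup>2 * (\<Sum>B\<in>Pow {..<N}. (radsum a N B)\<^sup>2) + 2 ^ N * (2 * (a N) ^ 4)"
  by (simp add: sum.distrib sum_distrib_left card_Pow)
 also have "... \<le> 2 * (2 ^ N * (3 * s\<^sup>2)) + 12 * (a N)\<^sup>2 * (2 ^ N * s) + 2 ^ N * (2 * (a N) ^ 4)"
  using Suc.IH unfolding radsum_moment2 s_def by simp
 also have "... = 2 ^ Suc N * (3 * s\<^sup>2 + 6 * (a N)\<^sup>2 * s + ((a N)\<^sup>2)\<^sup>2)"
  by (simp add: algebra_simps)
 also have "... \<le> 2 ^ Suc N * (3 * (s + (a N)\<^sup>2)\<^sup>2)"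
  by (intro mult_left_mono) (simp_all add: power2_sum algebra_simps)
 also have "s + (a N)\<^sup>2 = (\<Sum>k<Suc N. (a k)\<^sup>2)" by (simp add: s_def)
 finally show ?case .
qed (simp add: radsum_def)

text \<open>A random variable whose fourth moment is comparable to the square of its second moment has a comparable first
 moment, by integrating $x^2/l-x^4/(4l^3)\le|x|$.\<close>

lemma khintchine_L1:
 "sqrt (\<Sum>k<N. (a k)\<^sup>2) * 2 ^ N \<le> 3 * (\<Sum>B\<in>Pow {..<N}. \<bar>radsum a N B\<bar>)"
proof (cases "(\<Sum>k<N. (a k)\<^sup>2) = 0")
 case True
 then show ?thesis by (simp add: sum_nonneg)
next
 case False
 define s where "s = sqrt (\<Sum>k<N. (a k)\<^sup>2)"
 have "(\<Sum>k<N. (a k)\<^sup>2) > 0" using False sum_nonneg[of "{..<N}" "\<lambda>k. (a k)\<^sup>2"] by simp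
 then have s: "s > 0" "(\<Sum>k<N. (a k)\<^sup>2) = s\<^sup>2" by (simp_all add: s_def)
 (* With the moments $s^2$ and at most $3s^4$ this value of l gives 52/125 s, which is more than s/3. *)
 define l where "l = s * 5 / 4"
 have l: "l > 0" using s by (simp add: l_def)
 have pt: "x\<^sup>2 / l - x ^ 4 / (4 * l ^ 3) \<le> \<bar>x\<bar>" for x :: real
 proof -
  define y where "y = \<bar>x\<bar> / l"
  have y: "y \<ge> 0" using l by (simp add: y_def)
  have "0 \<le> y * (1 - y + y ^ 3 / 4)"
  proof -
   have "0 \<le> (y - 1)\<^sup>2 * (y + 2) / 4 + (1/2 - y / 4)"  if "y \<le> 2"
    using y that by (intro add_nonneg_nonneg divide_nonneg_nonneg mult_nonneg_nonneg) auto
   moreover have "(y - 1)\<^sup>2 * (y + 2) / 4 + (1/2 - y / 4) = 1 - y + y ^ 3 / 4"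
    by (simp add: power2_eq_square power3_eq_cube field_simps)
   moreover have "0 \<le> 1 - y + y ^ 3 / 4" if "y > 2"
   proof -
    have "y * 4 \<le> y * y\<^sup>2" using that power_mono[of 2 y 2] by (intro mult_left_mono) auto
    then show ?thesis by (simp add: power2_eq_square power3_eq_cube)
   qed
   ultimately have "0 \<le> 1 - y + y ^ 3 / 4" by (cases "y \<le> 2") auto
   then show ?thesis using y by simp
  qed
  then have "l * (y\<^sup>2 - y ^ 4 / 4) \<le> l * y" using l
   by (intro mult_left_mono) (auto simp: power2_eq_square power3_eq_cube power4_eq_xxxx algebra_simps)
  moreover have "l * y = \<bar>x\<bar>" using l by (simp add: y_def)
  moreover have "l * (y\<^sup>2 - y ^ 4 / 4) = x\<^sup>2 / l - x ^ 4 / (4 * l ^ 3)"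
   using l by (simp add: y_def power_divide field_simps power2_eq_square power3_eq_cube power4_eq_xxxx)
  ultimately show ?thesis by simp
 qed
 have "2 ^ N * s\<^sup>2 / l - 2 ^ N * (3 * (s\<^sup>2)\<^sup>2) / (4 * l ^ 3) \<le> (\<Sum>B\<in>Pow {..<N}. (radsum a N B)\<^sup>2) / l - (\<Sum>B\<in>Pow {..<N}. (radsum a N B) ^ 4) / (4 * l ^ 3)"
  using radsum_moment2[of a N] radsum_moment4[of a N] l unfolding s(2) by (intro diff_mono divide_right_mono) auto
 also have "... = (\<Sum>B\<in>Pow {..<N}. (radsum a N B)\<^sup>2 / l - (radsum a N B) ^ 4 / (4 * l ^ 3))"
  by (simp add: sum_subtractf sum_divide_distrib)
 also have "... \<le> (\<Sum>B\<in>Pow {..<N}. \<bar>radsum a N B\<bar>)" by (intro sum_mono pt)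
 finally have "2 ^ N * s\<^sup>2 / l - 2 ^ N * (3 * (s\<^sup>2)\<^sup>2) / (4 * l ^ 3) \<le> (\<Sum>B\<in>Pow {..<N}. \<bar>radsum a N B\<bar>)" .
 moreover have "2 ^ N * s\<^sup>2 / l - 2 ^ N * (3 * (s\<^sup>2)\<^sup>2) / (4 * l ^ 3) = 2 ^ N * s * (52 / 125)"
  using s(1) by (simp add: l_def field_simps power2_eq_square power3_eq_cube)
 ultimately have "2 ^ N * s * (52 / 125) \<le> (\<Sum>B\<in>Pow {..<N}. \<bar>radsum a N B\<bar>)" by simp
 moreover have "2 ^ N * s * (1 / 3) \<le> 2 ^ N * s * (52 / 125)" using s(1) by (intro mult_left_mono) auto
 ultimately show ?thesis unfolding s_def[symmetric] by (simp add: mult.commute)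
qed

text \<open>The first moment is at most the $L^q$ average; Young's inequality against the constant $t^{q-1}$.\<close>

lemma khintchine:
 fixes q :: real
 assumes q: "q > 1"
 shows "sqrt (\<Sum>k<N. (a k)\<^sup>2) powr q \<le> 3 powr q * ((\<Sum>B\<in>Pow {..<N}. \<bar>radsum a N B\<bar> powr q) / 2 ^ N)"
proof -
 define t where "t = (\<Sum>B\<in>Pow {..<N}. \<bar>radsum a N B\<bar>) / 2 ^ N"
 define Q where "Q = q / (q - 1)"
 have Q: "Q > 0" "1 / q + 1 / Q = 1" "(q - 1) * Q = q" using q by (auto simp: Q_def field_simps)
 have t0: "t \<ge> 0" by (simp add: t_def sum_nonneg)
 define X where "X = (\<Sum>B\<in>Pow {..<N}. \<bar>radsum a N B\<bar> powr q) / 2 ^ N"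
 have "(\<Sum>B\<in>Pow {..<N}. \<bar>radsum a N B\<bar> * t powr (q - 1)) \<le> (\<Sum>B\<in>Pow {..<N}. \<bar>radsum a N B\<bar> powr q / q + t powr q / Q)"
 proof (rule sum_mono)
  fix B
  show "\<bar>radsum a N B\<bar> * t powr (q - 1) \<le> \<bar>radsum a N B\<bar> powr q / q + t powr q / Q"
   using young_powr[of "\<bar>radsum a N B\<bar>" "t powr (q - 1)" q Q] q Q by (simp add: powr_powr)
 qed
 then have "(t * 2 ^ N) * t powr (q - 1) \<le> (X * 2 ^ N) / q + 2 ^ N * (t powr q / Q)"
  by (simp add: t_def X_def sum.distrib card_Pow flip: sum_distrib_right sum_divide_distrib)
 then have "2 ^ N * (t * t powr (q - 1)) \<le> 2 ^ N * (X / q + t powr q / Q)" by (simp add: algebra_simps)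
 then have "t * t powr (q - 1) \<le> X / q + t powr q / Q" by (subst (asm) mult_le_cancel_left_pos) auto
 moreover have "t * t powr (q - 1) = t powr q" using t0 by (subst powr_mult_base) auto
 moreover have "t powr q = t powr q * (1 / q + 1 / Q)" using Q by simp
 ultimately have "t powr q / q \<le> X / q" by (simp add: distrib_left)
 then have "t powr q \<le> X" using q by (simp add: divide_le_cancel)
 have "sqrt (\<Sum>k<N. (a k)\<^sup>2) \<le> 3 * t" using khintchine_L1[of a N] by (simp add: t_def field_simps)
 then have "sqrt (\<Sum>k<N. (a k)\<^sup>2) powr q \<le> (3 * t) powr q" using q by (intro powr_mono2) (auto simp: sum_nonneg)
 also have "... = 3 powr q * t powr q" by (rule powr_mult)
 also have "... \<le> 3 powr q * X" using \<open>t powr q \<le> X\<close> by (intro mult_left_mono) auto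
 finally show ?thesis by (simp add: X_def)
qed

section \<open>Square functions\<close>

text \<open>Khintchine's inequality turns the square function into an average over signs of the operators with kernels
 $\sum_k\pm\psi_k$, which are bounded on $L^q$ uniformly in the signs.\<close>

lemma square_function_nice:
 fixes A q :: real and \<psi> :: "nat => 'a::euclidean_space => real"
 assumes A: "A > 0" and q: "1 < q" and \<psi>: "\<And>k. nice (\<psi> k)" "\<And>k x. \<psi> k (- x) = \<psi> k x"
  and K: "\<And>N B. cz_kernel A (\<lambda>x. \<Sum>k<N. sgnset B k * \<psi> k x)"
 shows "\<exists>C>0. \<forall>f N. nice f --> continuous_on UNIV f -->
  (\<integral>x. en (sqrt (\<Sum>k<N. (conv (\<psi> k) f x)\<^sup>2) powr q)) \<le> en C * (\<integral>x. en (\<bar>f x\<bar> powr q))"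
proof -
 obtain C where C: "C > 0" "\<And>(K :: 'a => real) f. cz_kernel A K ==> (\<forall>x. K (- x) = K x) ==> nice f ==> continuous_on UNIV f ==>
  (\<integral>x. en (\<bar>conv K f x\<bar> powr q)) \<le> en C * (\<integral>x. en (\<bar>f x\<bar> powr q))"
  using cz_strong[OF A q, where 'a='a] by blast
 show ?thesis
 proof (intro exI[of _ "3 powr q * C"] conjI allI impI)
  show "3 powr q * C > 0" using C by simp
  fix f :: "'a => real" and N assume f: "nice f" "continuous_on UNIV f"
  have [measurable]: "f \<in> \<B>" "\<psi> k \<in> \<B>" for k
   using f \<psi> nice_measurable by auto
  let ?F = "(\<integral>x. en (\<bar>f x\<bar> powr q))"
  let ?R = "\<lambda>B x. radsum (\<lambda>k. conv (\<psi> k) f x) N B"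
  let ?s = "\<lambda>x. en (sqrt (\<Sum>k<N. (conv (\<psi> k) f x)\<^sup>2) powr q)"
  have rs: "?R B x = conv (\<lambda>x. \<Sum>k<N. sgnset B k * \<psi> k x) f x" for x B
   unfolding radsum_def using \<psi> f by (intro conv_kernel_sum[symmetric]) auto
  have [measurable]: "(\<lambda>x. ?R B x) \<in> \<B>" for B
   unfolding radsum_def by measurable
  have "(\<integral>x. ?s x)
   \<le> (\<integral>x. en (3 powr q / 2 ^ N) * (\<Sum>B\<in>Pow {..<N}. en (\<bar>?R B x\<bar> powr q)))"
  proof (rule nn_integral_mono)
   fix x
   have "?s x \<le> en (3 powr q * ((\<Sum>B\<in>Pow {..<N}. \<bar>?R B x\<bar> powr q) / 2 ^ N))"
    by (intro ennreal_leI khintchine q)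
   also have "... = en (3 powr q / 2 ^ N) * (\<Sum>B\<in>Pow {..<N}. en (\<bar>?R B x\<bar> powr q))"
    by (subst sum_ennreal) (simp_all add: sum_nonneg flip: ennreal_mult)
   finally show "?s x \<le> ..." .
  qed
  also have "... = en (3 powr q / 2 ^ N) * (\<Sum>B\<in>Pow {..<N}. (\<integral>x. en (\<bar>?R B x\<bar> powr q)))"
   by (simp add: nn_integral_cmult nn_integral_sum del: sum_ennreal)
  also have "... \<le> en (3 powr q / 2 ^ N) * (\<Sum>B\<in>Pow {..<N}. en C * ?F)"
   unfolding rs using K f \<psi> by (intro mult_left_mono sum_mono C(2)) auto
  also have "... = en (3 powr q / 2 ^ N) * (en (2 ^ N) * (en C * ?F))"
   by (simp add: card_Pow flip: ennreal_power)
  also have "... = en (3 powr q * C) * ?F" using C by (simp flip: mult.assoc ennreal_mult)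
  finally show "(\<integral>x. ?s x) \<le> en (3 powr q * C) * ?F" .
 qed
qed

lemma conv_lq_bound:
 fixes v K :: "'a::euclidean_space => real"
 assumes K: "nice K" and v: "lq q v" and q: "q > 1"
 shows "L1 (\<lambda>y. K (x - y) * v y)"
  and "en \<bar>conv K v x\<bar> \<le> epow (\<integral>y. en (\<bar>K y\<bar> powr (q / (q - 1)))) ((q - 1) / q) * epow (\<integral>y. en (\<bar>v y\<bar> powr q)) (1 / q)"
  and "(\<integral>y. en (\<bar>K y\<bar> powr (q / (q - 1)))) < \<top>"
proof -
 define Q where "Q = q / (q - 1)"
 have Q: "Q > 1" "1 / Q + 1 / q = 1" "(q - 1) / q = 1 / Q" using q by (auto simp: Q_def field_simps)
 have [measurable]: "v \<in> \<B>" "K \<in> \<B>" using v K nice_measurable by (auto simp: lq_def)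
 have "nice (\<lambda>y. \<bar>K y\<bar> powr Q)" using K Q by (intro nice_abs_powr) auto
 then have fin: "(\<integral>y. en (\<bar>K y\<bar> powr Q)) < \<top>" by (subst nn_integral_eq_integral) auto
 then show "(\<integral>y. en (\<bar>K y\<bar> powr (q / (q - 1)))) < \<top>" by (simp add: Q_def)
 have "(\<integral>y. en \<bar>K (x - y) * v y\<bar>) = (\<integral>y. en \<bar>K (x - y)\<bar> * en \<bar>v y\<bar>)"
  by (simp add: abs_mult ennreal_mult)
 also have "... \<le> epow (\<integral>y. epow (en \<bar>K (x - y)\<bar>) Q) (1 / Q) * epow (\<integral>y. epow (en \<bar>v y\<bar>) q) (1 / q)"
  using Q q by (intro nn_hoelder) auto
 also have "(\<integral>y. epow (en \<bar>K (x - y)\<bar>) Q) = (\<integral>y. en (\<bar>K y\<bar> powr Q))"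
  using nn_integral_lborel_reflect[of "\<lambda>y. en (\<bar>K y\<bar> powr Q)" x] by (simp add: epow_ennreal)
 finally have le: "(\<integral>y. en \<bar>K (x - y) * v y\<bar>) \<le> epow (\<integral>y. en (\<bar>K y\<bar> powr Q)) (1 / Q) * epow (\<integral>y. en (\<bar>v y\<bar> powr q)) (1 / q)"
  by (simp add: epow_ennreal)
 also have "... < \<top>" using fin v by (auto simp: ennreal_mult_less_top lq_def)
 finally have lt: "(\<integral>y. en \<bar>K (x - y) * v y\<bar>) < \<top>" .
 show int: "L1 (\<lambda>y. K (x - y) * v y)"
  using lt by (intro integrableI_bounded) auto
 have "en \<bar>conv K v x\<bar> \<le> (\<integral>y. en \<bar>K (x - y) * v y\<bar>)"
  unfolding conv_def using int by (subst nn_integral_eq_integral) (auto intro!: ennreal_leI integral_abs_bound)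
 also note le
 finally show "en \<bar>conv K v x\<bar> \<le> epow (\<integral>y. en (\<bar>K y\<bar> powr (q / (q - 1)))) ((q - 1) / q) * epow (\<integral>y. en (\<bar>v y\<bar> powr q)) (1 / q)"
  unfolding Q(3) Q_def[symmetric] .
qed

text \<open>Convolution with a bounded integrable function maps $L^q$ continuously to bounded functions, by Hoelder's
 inequality. Here approximants converge at every single point, as Fatou's lemma requires below.\<close>

lemma conv_lq_tendsto:
 fixes v K :: "'a::euclidean_space => real"
 assumes K: "nice K" and v: "lq q v" and q: "q > 1" and g: "\<And>n. nice (g n)"
  and lim: "\<And>n. (\<integral>x. en (\<bar>v x - g n x\<bar> powr q)) < en (1 / real (Suc n))"
 shows "(\<lambda>n. conv K (g n) x) \<longlonglongrightarrow> conv K v x"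
proof -
 have [measurable]: "v \<in> \<B>" "g n \<in> \<B>" for n using v g nice_measurable by (auto simp: lq_def)
 obtain k where k: "(\<integral>y. en (\<bar>K y\<bar> powr (q / (q - 1)))) = en k" "k \<ge> 0"
  using conv_lq_bound(3)[OF K v q] by (metis ennreal_cases less_top)
 have dl: "lq q (\<lambda>x. v x - g n x)" for n
  using order_less_trans[OF lim[of n] ennreal_less_top] by (simp add: lq_def)
 have "\<bar>conv K v x - conv K (g n) x\<bar> \<le> k powr ((q - 1) / q) * (1 / real (Suc n)) powr (1 / q)" for n
 proof -
  have "conv K v x - conv K (g n) x = conv K (\<lambda>x. v x - g n x) x"
   unfolding conv_def using conv_lq_bound(1)[OF K v q] conv_integrable[OF K nice_integrable[OF g]]
   by (simp add: right_diff_distrib)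
  then have "en \<bar>conv K v x - conv K (g n) x\<bar> \<le> epow (en k) ((q - 1) / q) * epow (\<integral>y. en (\<bar>v y - g n y\<bar> powr q)) (1 / q)"
   using conv_lq_bound(2)[OF K dl q, where x=x and n1=n] k by simp
  also have "... \<le> epow (en k) ((q - 1) / q) * epow (en (1 / real (Suc n))) (1 / q)"
   using lim[of n] q by (intro mult_left_mono epow_mono) auto
  also have "... = en (k powr ((q - 1) / q) * (1 / real (Suc n)) powr (1 / q))"
   using k by (simp add: epow_ennreal flip: ennreal_mult)
  finally show ?thesis by simp
 qed
 moreover have "(\<lambda>n. k powr ((q - 1) / q) * (1 / real (Suc n)) powr (1 / q)) \<longlonglongrightarrow> k powr ((q - 1) / q) * 0 powr (1 / q)"
  using q by (intro tendsto_intros tendsto_powr' LIMSEQ_Suc[OF lim_1_over_n]) auto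
 ultimately have "(\<lambda>n. conv K v x - conv K (g n) x) \<longlonglongrightarrow> 0"
  using q by (intro Lim_null_comparison[where f="\<lambda>n. conv K v x - conv K (g n) x" and g="\<lambda>n. k powr ((q - 1) / q) * (1 / real (Suc n)) powr (1 / q)"]) auto
 then have "(\<lambda>n. conv K v x - (conv K v x - conv K (g n) x)) \<longlonglongrightarrow> conv K v x - 0" by (intro tendsto_intros)
 then show ?thesis by simp
qed

lemma nn_integral_epow_suminf_le:
 assumes [measurable]: "\<And>k. a k \<in> borel_measurable M" and r: "r > 0"
  and le: "\<And>N. (\<integral>\<^sup>+x. epow (\<Sum>k<N. a k x) r \<partial>M) \<le> B"
 shows "(\<integral>\<^sup>+x. epow (\<Sum>k. a k x) r \<partial>M) \<le> B"
proof -
 let ?S = "\<lambda>N x. epow (\<Sum>k<N. a k x) r"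
 have "epow (\<Sum>k. a k x) r \<le> (SUP N. ?S N x)" for x
 proof -
  have "(\<Sum>k<N. a k x) \<le> epow (SUP N. ?S N x) (1 / r)" for N
  proof -
   have "epow (?S N x) (1 / r) \<le> epow (SUP N. ?S N x) (1 / r)" using r by (intro epow_mono SUP_upper) auto
   then show ?thesis using r by (simp add: epow_epow)
  qed
  then have "(\<Sum>k. a k x) \<le> epow (SUP N. ?S N x) (1 / r)" unfolding suminf_eq_SUP by (rule SUP_least)
  then have "epow (\<Sum>k. a k x) r \<le> epow (epow (SUP N. ?S N x) (1 / r)) r" using r by (rule epow_mono)
  then show ?thesis using r by (simp add: epow_epow)
 qed
 then have "(\<integral>\<^sup>+x. epow (\<Sum>k. a k x) r \<partial>M) \<le> (\<integral>\<^sup>+x. (SUP N. ?S N x) \<partial>M)" by (intro nn_integral_mono)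
 also have "... = (SUP N. \<integral>\<^sup>+x. ?S N x \<partial>M)"
  using r by (intro nn_integral_monotone_convergence_SUP incseq_SucI) (auto simp: le_fun_def intro!: epow_mono)
 also have "... \<le> B" by (intro SUP_least le)
 finally show ?thesis .
qed

text \<open>Approximation of \<open>v\<close>, Fatou's lemma for finitely many pieces, monotone convergence for all of them.\<close>

lemma square_function_lq:
 fixes A q :: real and \<psi> :: "nat => 'a::euclidean_space => real"
 assumes A: "A > 0" and q: "1 < q" and \<psi>: "\<And>k. nice (\<psi> k)" "\<And>k x. \<psi> k (- x) = \<psi> k x"
  and K: "\<And>N B. cz_kernel A (\<lambda>x. \<Sum>k<N. sgnset B k * \<psi> k x)"
 shows "\<exists>C>0. \<forall>v. lq q v -->
  (\<integral>x. epow (\<Sum>k. en ((conv (\<psi> k) v x)\<^sup>2)) (q / 2)) \<le> en C * (\<integral>x. en (\<bar>v x\<bar> powr q))"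
proof -
 obtain C where C: "C > 0" "\<And>f N. nice f ==> continuous_on UNIV f ==>
  (\<integral>x. en (sqrt (\<Sum>k<N. (conv (\<psi> k) f x)\<^sup>2) powr q)) \<le> en C * (\<integral>x. en (\<bar>f x\<bar> powr q))"
  using square_function_nice[OF A q \<psi> K] by blast
 show ?thesis
 proof (intro exI[of _ "C * 2 powr q"] conjI allI impI)
  show "C * 2 powr q > 0" using C by simp
  fix v :: "'a => real" assume v: "lq q v"
  have [measurable]: "v \<in> \<B>" "\<psi> k \<in> \<B>" for k
   using v \<psi> nice_measurable by (auto simp: lq_def)
  let ?I = "\<lambda>f. (\<integral>x. en (\<bar>f x\<bar> powr q))"
  have "\<exists>g. nice g \<and> continuous_on UNIV g \<and> ?I (\<lambda>x. v x - g x) < en (1 / real (Suc n))" for n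
   using q by (intro lq_dense v) auto
  then obtain g where g: "\<And>n. nice (g n)" "\<And>n. continuous_on UNIV (g n)" "\<And>n. ?I (\<lambda>x. v x - g n x) < en (1 / real (Suc n))"
   by metis
  have [measurable]: "g n \<in> \<B>" for n using g nice_measurable by auto
  have gle: "?I (g n) \<le> en (2 powr q) * (?I v + en (1 / real (Suc n)))" for n
  proof -
   have "?I (g n) \<le> (\<integral>x. en (2 powr q) * (en (\<bar>v x\<bar> powr q) + en (\<bar>v x - g n x\<bar> powr q)))"
   proof (rule nn_integral_mono)
    fix x
    have "\<bar>g n x\<bar> powr q \<le> (\<bar>v x\<bar> + \<bar>v x - g n x\<bar>) powr q" using q by (intro powr_mono2) auto
    also have "... \<le> 2 powr q * (\<bar>v x\<bar> powr q + \<bar>v x - g n x\<bar> powr q)" using q by (intro powr_add_le) auto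
    finally show "en (\<bar>g n x\<bar> powr q) \<le> en (2 powr q) * (en (\<bar>v x\<bar> powr q) + en (\<bar>v x - g n x\<bar> powr q))"
     by (simp add: ennreal_leI flip: ennreal_mult ennreal_plus)
   qed
   also have "... = en (2 powr q) * (?I v + ?I (\<lambda>x. v x - g n x))"
    by (simp add: nn_integral_cmult nn_integral_add)
   also have "... \<le> en (2 powr q) * (?I v + en (1 / real (Suc n)))"
    using g(3)[of n] by (intro mult_left_mono add_left_mono) auto
   finally show ?thesis .
  qed
  have fin: "(\<integral>x. epow (\<Sum>k<N. en ((conv (\<psi> k) v x)\<^sup>2)) (q / 2)) \<le> en (C * 2 powr q) * ?I v" for N
  proof -
   let ?s = "\<lambda>f x. en (sqrt (\<Sum>k<N. (conv (\<psi> k) f x)\<^sup>2) powr q)"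
   have pt: "(\<lambda>n. ?s (g n) x) \<longlonglongrightarrow> ?s v x" for x
    using \<psi> g q by (intro tendsto_ennrealI tendsto_powr' tendsto_intros conv_lq_tendsto[OF _ v q]) (auto simp: sum_nonneg)
   have "epow (\<Sum>k<N. en ((conv (\<psi> k) v x)\<^sup>2)) (q / 2) = ?s v x" for x
    by (simp add: sum_ennreal epow_ennreal sum_nonneg powr_half_sqrt[symmetric] powr_powr)
   then have "(\<integral>x. epow (\<Sum>k<N. en ((conv (\<psi> k) v x)\<^sup>2)) (q / 2)) = (\<integral>x. liminf (\<lambda>n. ?s (g n) x))"
    by (intro nn_integral_cong) (simp add: lim_imp_Liminf[OF _ pt])
   also have "... \<le> liminf (\<lambda>n. (\<integral>x. ?s (g n) x))"
    by (rule nn_integral_liminf) measurable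
   also have "... \<le> liminf (\<lambda>n. en C * (en (2 powr q) * (?I v + en (1 / real (Suc n)))))"
    using \<psi> K g by (intro Liminf_mono always_eventually allI order_trans[OF C(2)] mult_left_mono gle) auto
   also have "... = en C * (en (2 powr q) * (?I v + en 0))"
    using v C(1) by (intro lim_imp_Liminf tendsto_mult_ennreal tendsto_add tendsto_const tendsto_ennrealI LIMSEQ_Suc[OF lim_1_over_n])
     (auto simp: lq_def less_top ennreal_mult_less_top)
   also have "... = en (C * 2 powr q) * ?I v" using C by (simp add: ennreal_mult mult.assoc)
   finally show ?thesis .
  qed
  show "(\<integral>x. epow (\<Sum>k. en ((conv (\<psi> k) v x)\<^sup>2)) (q / 2)) \<le> en (C * 2 powr q) * ?I v"
   using q by (intro nn_integral_epow_suminf_le fin) auto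
 qed
qed

section \<open>Functions with finitely many derivatives\<close>

text \<open>An induction on the order of differentiability needs a notion for finitely many derivatives; smooth functions
 are those which are \<open>Cn n\<close> for all \<open>n\<close>. Existence of the total derivative at the next
 order gives continuity, hence no continuity clause.\<close>

fun Cn :: "nat => ('a::euclidean_space => 'b::real_normed_vector) => bool" where
 "Cn 0 f = True"
| "Cn (Suc n) f = ((\<forall>x. f differentiable (at x)) \<and> (\<forall>b\<in>Basis. Cn n (dir_deriv b f)))"

lemma dir_deriv_eq:
 assumes "\<And>x. (f has_derivative f' x) (at x)"
 shows "dir_deriv b f = (\<lambda>x. f' x b)"
 unfolding dir_deriv_def using frechet_derivative_at[OF assms] by metis

lemma dir_deriv_has_derivative:
 "f differentiable (at x) ==> (f has_derivative frechet_derivative f (at x)) (at x)"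
 by (simp add: frechet_derivative_works)

lemma iter_deriv_snoc: "iter_deriv (bs @ [b]) f = iter_deriv bs (dir_deriv b f)"
 by (simp add: iter_deriv_def)

lemma smooth_dir_deriv: "smooth f ==> b \<in> Basis ==> smooth (dir_deriv b f)"
 unfolding smooth_def by (metis iter_deriv_snoc set_append Un_least list.set(1,2) empty_subsetI insert_subset)

lemma smooth_differentiable: "smooth f ==> f differentiable (at x)"
 unfolding smooth_def iter_deriv_def by (metis empty_set empty_subsetI foldr.simps(1) id_apply)

lemma smooth_imp_Cn: "smooth f ==> Cn n f"
 by (induction n arbitrary: f) (auto simp: smooth_differentiable smooth_dir_deriv)

lemma Cn_iter_deriv:
 "set bs \<subseteq> Basis ==> Cn (length bs + n) f ==> Cn n (iter_deriv bs f)"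
proof (induction bs arbitrary: f rule: rev_induct)
 case (snoc b bs)
 then show ?case by (auto simp: iter_deriv_snoc)
qed (simp add: iter_deriv_def)

lemma Cn_imp_smooth:
 assumes "\<And>n. Cn n f" shows "smooth f"
 unfolding smooth_def
proof (intro allI impI)
 fix bs :: "'a list" and x assume "set bs \<subseteq> Basis"
 then have "Cn 1 (iter_deriv bs f)" by (rule Cn_iter_deriv) (rule assms)
 then show "iter_deriv bs f differentiable at x" by simp
qed

lemma Cn_Suc_imp: "Cn (Suc n) f ==> Cn n f"
 by (induction n arbitrary: f) auto

lemma Cn_const: "Cn n (\<lambda>x. c)"
proof (induction n arbitrary: c)
 case (Suc n)
 have "dir_deriv b (\<lambda>x. c) = (\<lambda>x. 0)" for b :: 'a
  by (subst dir_deriv_eq[where f'="\<lambda>x h. 0"]) auto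
 then show ?case using Suc by simp
qed simp

lemma Cn_add:
 "Cn n f ==> Cn n g ==> Cn n (\<lambda>x. f x + g x)"
proof (induction n arbitrary: f g)
 case (Suc n)
 have "dir_deriv b (\<lambda>x. f x + g x) = (\<lambda>x. dir_deriv b f x + dir_deriv b g x)" for b
  unfolding dir_deriv_def[of b f] dir_deriv_def[of b g]
  by (subst dir_deriv_eq[where f'="\<lambda>x h. frechet_derivative f (at x) h + frechet_derivative g (at x) h"])
    (use Suc in \<open>auto intro!: has_derivative_add dir_deriv_has_derivative\<close>)
 then show ?case using Suc by (auto intro: differentiable_add)
qed simp

lemma Cn_mult:
 fixes f g :: "'a::euclidean_space => 'b::real_normed_algebra"
 shows "Cn n f ==> Cn n g ==> Cn n (\<lambda>x. f x * g x)"
proof (induction n arbitrary: f g)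
 case (Suc n)
 have "dir_deriv b (\<lambda>x. f x * g x) = (\<lambda>x. f x * dir_deriv b g x + dir_deriv b f x * g x)" for b
  unfolding dir_deriv_def[of b f] dir_deriv_def[of b g]
  by (subst dir_deriv_eq[where f'="\<lambda>x h. f x * frechet_derivative g (at x) h + frechet_derivative f (at x) h * g x"])
    (use Suc in \<open>auto intro!: has_derivative_mult dir_deriv_has_derivative\<close>)
 moreover have "Cn n f" "Cn n g" using Suc.prems by (auto intro: Cn_Suc_imp)
 ultimately show ?case using Suc by (auto intro!: Cn_add)
qed simp

lemma Cn_inner: "Cn n (\<lambda>x. x \<bullet> c)"
proof (cases n)
 case (Suc m)
 have "dir_deriv b (\<lambda>x. x \<bullet> c) = (\<lambda>x. b \<bullet> c)" for b :: 'a
  by (subst dir_deriv_eq[where f'="\<lambda>x h. h \<bullet> c"]) (auto intro!: derivative_eq_intros)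
 moreover have "(\<lambda>x. x \<bullet> c) differentiable (at x)" for x
  by (rule differentiableI) (auto intro!: derivative_eq_intros)
 ultimately show ?thesis using Suc by (simp add: Cn_const)
qed simp

lemma Cn_bounded_linear:
 assumes T: "bounded_linear T" shows "Cn n f ==> Cn n (\<lambda>x. T (f x))"
proof (induction n arbitrary: f)
 case (Suc n)
 have d: "((\<lambda>x. T (f x)) has_derivative (\<lambda>h. T (frechet_derivative f (at x) h))) (at x)" for x
  using Suc.prems by (auto intro!: bounded_linear.has_derivative[OF T] dir_deriv_has_derivative)
 then have "dir_deriv b (\<lambda>x. T (f x)) = (\<lambda>x. T (dir_deriv b f x))" for b
  unfolding dir_deriv_def[of b f] by (rule dir_deriv_eq)
 then show ?case using Suc d by (auto intro: differentiableI)
qed simp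

lemma Cn_dilate: "Cn n f ==> Cn n (\<lambda>x. f (c *\<^sub>R x))"
proof (induction n arbitrary: f)
 case (Suc n)
 have d: "((\<lambda>x. f (c *\<^sub>R x)) has_derivative (\<lambda>h. frechet_derivative f (at (c *\<^sub>R x)) (c *\<^sub>R h))) (at x)" for x
  using Suc.prems by (intro has_derivative_compose[where g=f and f="\<lambda>x. c *\<^sub>R x"] dir_deriv_has_derivative)
   (auto intro!: derivative_eq_intros)
 have "dir_deriv b (\<lambda>x. f (c *\<^sub>R x)) = (\<lambda>x. c *\<^sub>R dir_deriv b f (c *\<^sub>R x))" for b
 proof -
  have "dir_deriv b (\<lambda>x. f (c *\<^sub>R x)) = (\<lambda>x. frechet_derivative f (at (c *\<^sub>R x)) (c *\<^sub>R b))"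
   by (rule dir_deriv_eq[OF d])
  also have "... = (\<lambda>x. c *\<^sub>R dir_deriv b f (c *\<^sub>R x))"
  proof
   fix x
   have "linear (frechet_derivative f (at (c *\<^sub>R x)))"
    using Suc.prems by (intro linear_frechet_derivative) auto
   then show "frechet_derivative f (at (c *\<^sub>R x)) (c *\<^sub>R b) = c *\<^sub>R dir_deriv b f (c *\<^sub>R x)"
    by (simp add: dir_deriv_def linear_cmul)
  qed
  finally show ?thesis .
 qed
 moreover have "Cn n (\<lambda>x. c *\<^sub>R dir_deriv b f (c *\<^sub>R x))" if "b \<in> Basis" for b
  using Suc that by (intro Cn_bounded_linear[OF bounded_linear_scaleR_right]) auto
 ultimately show ?case using d by (auto intro: differentiableI)
qed simp

lemma Cn_iexp: "Cn n (\<lambda>\<xi>. ex (x \<bullet> \<xi>))"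
proof (induction n)
 case (Suc n)
 have d: "((\<lambda>\<xi>. ex (x \<bullet> \<xi>)) has_derivative (\<lambda>h. \<i> * cr (x \<bullet> h) * ex (x \<bullet> \<xi>))) (at \<xi>)" for \<xi>
 proof -
  have l: "((\<lambda>\<xi>. \<i> * cr (x \<bullet> \<xi>)) has_derivative (\<lambda>h. \<i> * cr (x \<bullet> h))) (at \<xi>)"
   by (intro has_derivative_mult_right has_derivative_of_real has_derivative_inner_right has_derivative_ident)
  have "(exp has_derivative (*) (ex (x \<bullet> \<xi>))) (at (\<i> * cr (x \<bullet> \<xi>)))"
   using DERIV_exp[of "\<i> * cr (x \<bullet> \<xi>)"] by (simp add: has_field_derivative_def)
  from has_derivative_compose[OF l this] show ?thesis by (simp add: mult_ac)
 qed
 have "dir_deriv b (\<lambda>\<xi>. ex (x \<bullet> \<xi>)) = (\<lambda>\<xi>. \<i> * cr (x \<bullet> b) * ex (x \<bullet> \<xi>))" for b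
  by (rule dir_deriv_eq[OF d])
 then show ?case using Suc d by (auto intro: differentiableI Cn_mult Cn_const)
qed simp

lemma dir_deriv_local_zero:
 assumes "open S" "x \<in> S" "\<And>y. y \<in> S ==> f y = 0"
 shows "dir_deriv b f x = 0" "(f has_derivative (\<lambda>h. 0)) (at x)"
proof -
 have "((\<lambda>y. 0) has_derivative (\<lambda>h. 0)) (at x)" by simp
 then show d: "(f has_derivative (\<lambda>h. 0)) (at x)"
  by (rule has_derivative_transform_within_open[OF _ assms(1,2)]) (use assms(3) in simp)
 show "dir_deriv b f x = 0" unfolding dir_deriv_def using frechet_derivative_at[OF d] by metis
qed

text \<open>As \<open>g\<close> vanishes near the origin, the singularity of the power there is invisible. A derivative is a
 sum of two products of the same form, with exponents \<open>\<sigma>\<close> and $\sigma-2$; hence the induction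
 over all exponents.\<close>

lemma Cn_norm_powr:
 fixes g :: "'a::euclidean_space => real"
 assumes r: "r > 0"
 shows "Cn n g ==> (\<And>x. norm x < r ==> g x = 0) ==> Cn n (\<lambda>x. norm x powr \<sigma> * g x)"
proof (induction n arbitrary: g \<sigma>)
 case (Suc n)
 have z: "dir_deriv b g x = 0" "(g has_derivative (\<lambda>h. 0)) (at x)" if "norm x < r" for x b
  using dir_deriv_local_zero[of "ball 0 r" x g] that Suc.prems(2) by auto
 have d: "((\<lambda>x. norm x powr \<sigma> * g x) has_derivative
   (\<lambda>h. norm x powr \<sigma> * frechet_derivative g (at x) h + norm x powr (\<sigma> - 2) * (\<sigma> * (x \<bullet> h) * g x))) (at x)" for x
 proof (cases "norm x < r")
  case True
  have "((\<lambda>x. norm x powr \<sigma> * g x) has_derivative (\<lambda>h. 0)) (at x)"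
   by (rule dir_deriv_local_zero(2)[of "ball 0 r"]) (use True Suc.prems(2) in auto)
  moreover have "frechet_derivative g (at x) = (\<lambda>h. 0)" using frechet_derivative_at[OF z(2)[OF True]] by simp
  ultimately show ?thesis using Suc.prems(2)[OF True] by simp
 next
  case False
  then have x: "x \<noteq> 0" "norm x > 0" using r by auto
  have n: "(norm has_derivative (\<lambda>h. (x \<bullet> h) / norm x)) (at x)"
   using has_derivative_norm[OF x(1)] by (simp add: sgn_div_norm inverse_eq_divide inner_commute)
  have p: "((\<lambda>x. norm x powr \<sigma>) has_derivative (\<lambda>h. (x \<bullet> h) / norm x * (\<sigma> * norm x powr (\<sigma> - 1)))) (at x)"
  proof -
   have "((\<lambda>t. t powr \<sigma>) has_real_derivative \<sigma> * norm x powr (\<sigma> - 1)) (at (norm x))"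
    using x(2) by (rule has_real_derivative_powr)
   from has_derivative_compose[OF n this[unfolded has_field_derivative_def]] show ?thesis by (simp add: mult.commute)
  qed
  have g: "(g has_derivative frechet_derivative g (at x)) (at x)"
   using Suc.prems by (intro dir_deriv_has_derivative) auto
  have e: "norm x powr (\<sigma> - 1) / norm x = norm x powr (\<sigma> - 2)"
  proof -
   have "norm x powr (\<sigma> - 1) = norm x powr (1 + (\<sigma> - 2))" by simp
   also have "... = norm x * norm x powr (\<sigma> - 2)" by (rule powr_mult_base[symmetric]) simp
   finally show ?thesis using x by simp
  qed
  have "(\<lambda>h. norm x powr \<sigma> * frechet_derivative g (at x) h + (x \<bullet> h) / norm x * (\<sigma> * norm x powr (\<sigma> - 1)) * g x)
   = (\<lambda>h. norm x powr \<sigma> * frechet_derivative g (at x) h + norm x powr (\<sigma> - 2) * (\<sigma> * (x \<bullet> h) * g x))"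
   unfolding e[symmetric] by (auto simp: fun_eq_iff)
  with has_derivative_mult[OF p g] show ?thesis by simp
 qed
 have "dir_deriv b (\<lambda>x. norm x powr \<sigma> * g x) = (\<lambda>x. norm x powr \<sigma> * dir_deriv b g x + norm x powr (\<sigma> - 2) * (\<sigma> * (x \<bullet> b) * g x))" for b
  unfolding dir_deriv_def[of b g] by (rule dir_deriv_eq[OF d])
 moreover have "Cn n (\<lambda>x. norm x powr \<sigma> * dir_deriv b g x + norm x powr (\<sigma> - 2) * (\<sigma> * (x \<bullet> b) * g x))" if b: "b \<in> Basis" for b
 proof (intro Cn_add Suc.IH)
  show "Cn n (dir_deriv b g)" using Suc.prems b by simp
  show "Cn n (\<lambda>x. \<sigma> * (x \<bullet> b) * g x)" by (rule Cn_mult[OF Cn_mult[OF Cn_const Cn_inner] Cn_Suc_imp[OF Suc.prems(1)]])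
 qed (use z Suc.prems in auto)
 ultimately show ?case using d by (auto intro: differentiableI)
qed simp

lemma Cn_continuous: "Cn (Suc n) f ==> continuous_on UNIV f"
 by (simp add: continuous_on_eq_continuous_at differentiable_imp_continuous_within)

section \<open>Oscillatory integrals of smooth compactly supported functions\<close>

text \<open>The inverse Fourier integral without its constant. Both transforms are instances, up to a constant and a
 reflection, so that decay and smoothness are only proved once.\<close>

definition osc :: "('a::euclidean_space => complex) => 'a => complex" where
 "osc g x = (LINT \<xi>. ex (x \<bullet> \<xi>) * g \<xi>)"

lemma inv_fourier_osc: "inv_fourier g x = cr (1 / (2 * pi) ^ DIM('a)) * osc g (x::'a::euclidean_space)"
 by (simp add: inv_fourier_def osc_def)

lemma fourier_osc: "fourier g x = osc g (- x)"
 by (simp add: fourier_def osc_def inner_commute)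

definition csupp :: "real => ('a::euclidean_space => 'b::zero) => bool" where
 "csupp R g \<longleftrightarrow> (\<forall>x. norm x > R --> g x = 0)"

lemma csupp_bounded:
 fixes g :: "'a::euclidean_space => 'b::{euclidean_space}"
 assumes "csupp R g" "continuous_on UNIV g"
 obtains B where "B > 0" "\<And>x. norm (g x) \<le> B * ind (cball 0 R) x"
proof -
 have "compact (g ` cball 0 R)" using assms by (intro compact_continuous_image) (auto intro: continuous_on_subset)
 then obtain B where B: "\<And>x. x \<in> cball 0 R ==> norm (g x) \<le> B"
  using compact_imp_bounded[of "g ` cball 0 R"] unfolding bounded_iff by blast
 show ?thesis
 proof (rule that[of "max B 1"])
  show "norm (g x) \<le> max B 1 * ind (cball 0 R) x" for x
   using B[of x] assms(1) by (auto simp: csupp_def indicator_def)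
 qed simp
qed

lemma integrable_indicator_cball: "L1 (\<lambda>x. c * ind (cball (0::'a::euclidean_space) R) x :: real)"
 using emeasure_lborel_cball_finite[of "0::'a" R]
 by (intro integrable_mult_right integrable_real_indicator) auto

lemma csupp_integrable:
 fixes g :: "'a::euclidean_space => 'b::{euclidean_space}"
 assumes "csupp R g" "continuous_on UNIV g"
 shows "L1 g"
proof -
 obtain B where B: "B > 0" "\<And>x. norm (g x) \<le> B * ind (cball 0 R) x" using csupp_bounded[OF assms] by blast
 show ?thesis
 proof (rule Bochner_Integration.integrable_bound[OF integrable_indicator_cball[of B R]])
  show "g \<in> borel_measurable lborel" using assms(2) by (simp add: borel_measurable_continuous_onI)
  show "AE x in lborel. norm (g x) \<le> norm (B * ind (cball 0 R) x)"
   using B by (intro AE_I2) (auto intro: order_trans[OF _ abs_ge_self])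
 qed
qed

lemma csupp_dir_deriv:
 fixes g :: "'a::euclidean_space => 'b::real_normed_vector"
 assumes "csupp R g" shows "csupp R (dir_deriv b g)"
 unfolding csupp_def
proof (intro allI impI)
 fix x :: 'a assume "norm x > R"
 moreover have "open {x::'a. norm x > R}" by (intro open_Collect_less continuous_intros)
 ultimately show "dir_deriv b g x = 0"
  by (intro dir_deriv_local_zero(1)[of "{x. norm x > R}"]) (use assms in \<open>auto simp: csupp_def\<close>)
qed

text \<open>The difference quotients have integral zero, by translation invariance, and converge boundedly with bounded
 support.\<close>

lemma integral_dir_deriv_zero:
 fixes f :: "'a::euclidean_space => complex"
 assumes f: "Cn 2 f" "csupp R f" and b: "b \<in> Basis"
 shows "(LINT x. dir_deriv b f x) = 0"
proof -
 have C1: "Cn (Suc 0) (dir_deriv b f)" using f b by (simp add: numeral_2_eq_2)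
 have c: "continuous_on UNIV (dir_deriv b f)" by (rule Cn_continuous[OF C1])
 have f1: "Cn (Suc 0) f" using f by (simp add: numeral_2_eq_2)
 have cf: "continuous_on UNIV f" by (rule Cn_continuous[OF f1])
 have [measurable]: "f \<in> \<B>" "dir_deriv b f \<in> \<B>"
  using c cf by (auto intro: borel_measurable_continuous_onI)
 obtain B where B: "B > 0" "\<And>x. norm (dir_deriv b f x) \<le> B * ind (cball 0 R) x"
  using csupp_bounded[OF csupp_dir_deriv[OF f(2)] c] by blast
 have line: "((\<lambda>t. f (x + t *\<^sub>R b)) has_vector_derivative dir_deriv b f (x + t *\<^sub>R b)) (at t within S)" for x t S
 proof -
  have d: "(f has_derivative frechet_derivative f (at (x + t *\<^sub>R b))) (at (x + t *\<^sub>R b))"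
   using f1 by (intro dir_deriv_has_derivative) auto
  have "((\<lambda>t. f (x + t *\<^sub>R b)) has_derivative (\<lambda>h. frechet_derivative f (at (x + t *\<^sub>R b)) (h *\<^sub>R b))) (at t within S)"
   by (rule has_derivative_compose[where g=f and f="\<lambda>t. x + t *\<^sub>R b", OF _ d]) (auto intro!: derivative_eq_intros)
  moreover have "linear (frechet_derivative f (at (x + t *\<^sub>R b)))" using f1 by (intro linear_frechet_derivative) auto
  ultimately show ?thesis unfolding has_vector_derivative_def dir_deriv_def by (simp add: linear_cmul)
 qed
 define Q where "Q n x = real (Suc n) *\<^sub>R (f (x + (1 / real (Suc n)) *\<^sub>R b) - f x)" for n x
 have Qb: "norm (Q n x) \<le> B * ind (cball 0 (R + 1)) x" for n x
 proof (cases "norm x \<le> R + 1")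
  case True
  have "norm (f (x + (1 / real (Suc n)) *\<^sub>R b) - f (x + 0 *\<^sub>R b)) \<le> B * \<bar>1 / real (Suc n) - 0\<bar>"
  proof -
   have "norm (f (x + (1 / real (Suc n)) *\<^sub>R b) - f (x + 0 *\<^sub>R b)) \<le> B * norm (1 / real (Suc n) - 0)"
   proof (rule differentiable_bound[where S=UNIV and f="\<lambda>t. f (x + t *\<^sub>R b)" and f'="\<lambda>t h. h *\<^sub>R dir_deriv b f (x + t *\<^sub>R b)"])
    show "((\<lambda>t. f (x + t *\<^sub>R b)) has_derivative (\<lambda>h. h *\<^sub>R dir_deriv b f (x + t *\<^sub>R b))) (at t within UNIV)" for t
     using line[of x t UNIV] by (simp add: has_vector_derivative_def)
    show "onorm (\<lambda>h. h *\<^sub>R dir_deriv b f (x + t *\<^sub>R b)) \<le> B" for t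
    proof (rule onorm_le)
     fix h :: real
     have "norm (dir_deriv b f (x + t *\<^sub>R b)) \<le> B" using B(2)[of "x + t *\<^sub>R b"] B(1) by (cases "x + t *\<^sub>R b \<in> cball 0 R") auto
     then show "norm (h *\<^sub>R dir_deriv b f (x + t *\<^sub>R b)) \<le> B * norm h" by (simp add: mult.commute[of B] mult_left_mono)
    qed
   qed auto
   then show ?thesis by simp
  qed
  then have "real (Suc n) * norm (f (x + (1 / real (Suc n)) *\<^sub>R b) - f x) \<le> real (Suc n) * (B * (1 / real (Suc n)))"
   by (intro mult_left_mono) auto
  then show ?thesis using True by (simp add: Q_def)
 next
  case False
  have "norm ((1 / real (Suc n)) *\<^sub>R b) \<le> 1" using b by simp
  then have "norm (x + (1 / real (Suc n)) *\<^sub>R b) > R" using False norm_diff_ineq[of x "(1 / real (Suc n)) *\<^sub>R b"] by linarith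
  moreover have "norm x > R" using False by simp
  ultimately show ?thesis using f(2) B(1) by (simp add: Q_def csupp_def)
 qed
 have "(\<lambda>n. LINT x. Q n x) \<longlonglongrightarrow> (LINT x. dir_deriv b f x)"
 proof (rule integral_dominated_convergence[where w="\<lambda>x. B * ind (cball 0 (R + 1)) x"])
  show "AE x in lborel. (\<lambda>n. Q n x) \<longlonglongrightarrow> dir_deriv b f x"
  proof (rule AE_I2)
   fix x
   let ?D = "dir_deriv b f x"
   have "((\<lambda>h. norm (f (x + h *\<^sub>R b) - f x - h *\<^sub>R ?D) / norm h) \<longlongrightarrow> 0) (at 0)"
    using line[of x 0 UNIV] by (simp add: has_vector_derivative_def has_derivative_at)
   moreover have "filterlim (\<lambda>n. 1 / real (Suc n)) (at 0) sequentially"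
    using LIMSEQ_Suc[OF lim_1_over_n] by (auto simp: filterlim_at)
   ultimately have "(\<lambda>n. norm (f (x + (1 / real (Suc n)) *\<^sub>R b) - f x - (1 / real (Suc n)) *\<^sub>R ?D) / norm (1 / real (Suc n))) \<longlonglongrightarrow> 0"
    by (rule filterlim_compose)
   moreover have "norm (f (x + (1 / real (Suc n)) *\<^sub>R b) - f x - (1 / real (Suc n)) *\<^sub>R ?D) / norm (1 / real (Suc n)) = norm (Q n x - ?D)" for n
   proof -
    let ?r = "real (Suc n)"
    have "Q n x - ?D = ?r *\<^sub>R (f (x + (1 / ?r) *\<^sub>R b) - f x - (1 / ?r) *\<^sub>R ?D)"
     unfolding Q_def by (subst scaleR_diff_right) simp
    then have "norm (Q n x - ?D) = ?r * norm (f (x + (1 / ?r) *\<^sub>R b) - f x - (1 / ?r) *\<^sub>R ?D)" by simp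
    then show ?thesis by simp
   qed
   ultimately have "(\<lambda>n. norm (Q n x - ?D)) \<longlonglongrightarrow> 0" by simp
   then show "(\<lambda>n. Q n x) \<longlonglongrightarrow> ?D" by (rule LIM_zero_cancel[OF tendsto_norm_zero_cancel])
  qed
  show "AE x in lborel. norm (Q n x) \<le> B * ind (cball 0 (R + 1)) x" for n using Qb by simp
  show "L1 (\<lambda>x::'a. B * ind (cball 0 (R + 1)) x)" by (rule integrable_indicator_cball)
 qed (auto simp: Q_def)
 moreover have "(LINT x. Q n x) = 0" for n
 proof -
  have i: "L1 f" by (rule csupp_integrable[OF f(2) cf])
  show ?thesis unfolding Q_def
   using integrable_lborel_shift[OF i, of "(1 / real (Suc n)) *\<^sub>R b"] i integral_lborel_shift[of f "(1 / real (Suc n)) *\<^sub>R b"]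
   by (simp add: add.commute)
 qed
 ultimately show ?thesis by (simp add: LIMSEQ_const_iff)
qed

lemma norm_iexp [simp]: "cmod (exp (\<i> * cr t)) = 1"
 by (simp add: norm_exp_eq_Re)

lemma iexp_measurable_pair [measurable]:
 "(\<lambda>\<xi>::'a::euclidean_space. ex (x \<bullet> \<xi>)) \<in> \<B>"
 by measurable

lemma osc_integrable:
 assumes "L1 g"
 shows "L1 (\<lambda>\<xi>. ex (x \<bullet> \<xi>) * g \<xi>)"
proof (rule Bochner_Integration.integrable_bound[OF assms])
 have [measurable]: "g \<in> \<B>" using assms borel_measurable_integrable by auto
 show "(\<lambda>\<xi>. ex (x \<bullet> \<xi>) * g \<xi>) \<in> borel_measurable lborel" by measurable
qed (simp add: norm_mult)

lemma osc_bound: "L1 g ==> cmod (osc g x) \<le> (LINT \<xi>. cmod (g \<xi>))"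
 unfolding osc_def by (rule order_trans[OF integral_norm_bound]) (simp add: norm_mult)

text \<open>Integration by parts: the derivative of the product with the exponential has integral zero.\<close>

lemma osc_dir_deriv:
 assumes g: "Cn 2 g" "csupp R g" and b: "b \<in> Basis"
 shows "osc (dir_deriv b g) x = - (\<i> * cr (x \<bullet> b)) * osc g x"
proof -
 define e where "e \<xi> = ex (x \<bullet> \<xi>)" for \<xi> :: 'a
 have Ce: "Cn n e" for n unfolding e_def by (rule Cn_iexp)
 have g1: "Cn (Suc 0) g" using g by (simp add: numeral_2_eq_2)
 have C1: "Cn (Suc 0) (dir_deriv b g)" using g b by (simp add: numeral_2_eq_2)
 have ig: "L1 g" by (rule csupp_integrable[OF g(2) Cn_continuous[OF g1]])
 have idg: "L1 (dir_deriv b g)" by (rule csupp_integrable[OF csupp_dir_deriv[OF g(2)] Cn_continuous[OF C1]])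
 have de: "(e has_derivative (\<lambda>h. \<i> * cr (x \<bullet> h) * e \<xi>)) (at \<xi>)" for \<xi>
 proof -
  have l: "((\<lambda>\<xi>. \<i> * cr (x \<bullet> \<xi>)) has_derivative (\<lambda>h. \<i> * cr (x \<bullet> h))) (at \<xi>)"
   by (intro has_derivative_mult_right has_derivative_of_real has_derivative_inner_right has_derivative_ident)
  have "(exp has_derivative (*) (ex (x \<bullet> \<xi>))) (at (\<i> * cr (x \<bullet> \<xi>)))"
   using DERIV_exp[of "\<i> * cr (x \<bullet> \<xi>)"] by (simp add: has_field_derivative_def)
  from has_derivative_compose[OF l this] show ?thesis by (simp add: mult_ac e_def[abs_def])
 qed
 have "dir_deriv b (\<lambda>\<xi>. e \<xi> * g \<xi>) = (\<lambda>\<xi>. e \<xi> * dir_deriv b g \<xi> + (\<i> * cr (x \<bullet> b) * e \<xi>) * g \<xi>)"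
  unfolding dir_deriv_def[of b g]
  by (subst dir_deriv_eq[where f'="\<lambda>\<xi> h. e \<xi> * frechet_derivative g (at \<xi>) h + (\<i> * cr (x \<bullet> h) * e \<xi>) * g \<xi>"])
    (use g1 in \<open>auto intro!: has_derivative_mult[OF de] dir_deriv_has_derivative\<close>)
 moreover have "(LINT \<xi>. dir_deriv b (\<lambda>\<xi>. e \<xi> * g \<xi>) \<xi>) = 0"
  by (rule integral_dir_deriv_zero[where R=R]) (use g b Ce in \<open>auto intro: Cn_mult simp: csupp_def\<close>)
 ultimately have "0 = (LINT \<xi>. e \<xi> * dir_deriv b g \<xi> + (\<i> * cr (x \<bullet> b)) * (e \<xi> * g \<xi>))"
  by (simp add: mult.assoc)
 also have "... = osc (dir_deriv b g) x + (\<i> * cr (x \<bullet> b)) * osc g x"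
  using osc_integrable[OF ig, of x] osc_integrable[OF idg, of x] unfolding osc_def e_def by simp
 finally show ?thesis by (simp add: eq_neg_iff_add_eq_0 add.commute)
qed

lemma osc_decay_coord:
 assumes "smooth g" "csupp R g" "b \<in> Basis"
 shows "\<exists>C. \<forall>x. \<bar>x \<bullet> b\<bar> ^ N * cmod (osc g x) \<le> C"
 using assms(1,2)
proof (induction N arbitrary: g)
 case 0
 have "L1 g"
  using 0 by (intro csupp_integrable[of R] Cn_continuous[of 0] smooth_imp_Cn)
 then show ?case using osc_bound[of g] by auto
next
 case (Suc N)
 have "\<exists>C. \<forall>x. \<bar>x \<bullet> b\<bar> ^ N * cmod (osc (dir_deriv b g) x) \<le> C"
  using Suc.prems assms(3) by (intro Suc.IH smooth_dir_deriv csupp_dir_deriv)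
 moreover have "cmod (osc (dir_deriv b g) x) = \<bar>x \<bullet> b\<bar> * cmod (osc g x)" for x
  using osc_dir_deriv[OF smooth_imp_Cn[OF Suc.prems(1)] Suc.prems(2) assms(3), of x] by (simp add: norm_mult)
 ultimately show ?case by (simp add: mult_ac)
qed

text \<open>Repeated integration by parts in one direction gains powers of one coordinate. The largest coordinate of
 \<open>x\<close> is comparable to its norm.\<close>

lemma osc_decay:
 fixes g :: "'a::euclidean_space => complex"
 assumes g: "smooth g" "csupp R g"
 shows "\<exists>C>0. \<forall>x. (1 + norm x) ^ N * cmod (osc g x) \<le> C"
proof -
 obtain C where C: "\<And>b x. b \<in> Basis ==> \<bar>x \<bullet> b\<bar> ^ N * cmod (osc g x) \<le> C b"
 proof -
  have "\<forall>b\<in>Basis. \<exists>C. \<forall>x. \<bar>x \<bullet> b\<bar> ^ N * cmod (osc g x) \<le> C" using osc_decay_coord[OF g] by blast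
  then obtain C where "\<forall>b\<in>Basis. \<forall>x. \<bar>x \<bullet> b\<bar> ^ N * cmod (osc g x) \<le> C b" using bchoice by metis
  then show ?thesis using that by blast
 qed
 obtain C0 where C0: "\<And>x. \<bar>x \<bullet> (SOME b. b \<in> Basis)\<bar> ^ 0 * cmod (osc g x) \<le> C0"
  using osc_decay_coord[OF g, of _ 0] by (metis SOME_Basis)
 define D where "D = 2 ^ N * (C0 + real DIM('a) ^ N * (\<Sum>b\<in>Basis. \<bar>C b\<bar>)) + 1"
 have le: "(1 + norm x) ^ N * cmod (osc g x) \<le> D - 1" for x
 proof -
  obtain b where b: "b \<in> Basis" "norm x \<le> real DIM('a) * \<bar>x \<bullet> b\<bar>"
  proof -
   define M where "M = Max ((\<lambda>b. \<bar>x \<bullet> b\<bar>) ` Basis)"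
   have "M \<in> (\<lambda>b. \<bar>x \<bullet> b\<bar>) ` Basis" unfolding M_def by (rule Max_in) auto
   then obtain b where b: "b \<in> Basis" "M = \<bar>x \<bullet> b\<bar>" by auto
   have "\<bar>x \<bullet> c\<bar> \<le> M" if "c \<in> Basis" for c unfolding M_def using that by (intro Max_ge) auto
   then have "b \<in> Basis \<and> (\<forall>c\<in>Basis. \<bar>x \<bullet> c\<bar> \<le> \<bar>x \<bullet> b\<bar>)" using b by auto
   moreover have "norm x \<le> (\<Sum>c\<in>Basis. \<bar>x \<bullet> c\<bar>)" by (rule norm_le_l1)
   moreover have "(\<Sum>c\<in>Basis. \<bar>x \<bullet> c\<bar>) \<le> real DIM('a) * \<bar>x \<bullet> b\<bar>"
    using calculation(1) by (intro sum_bounded_above) auto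
   ultimately show ?thesis using that by force
  qed
  have c1: "norm x ^ N * cmod (osc g x) \<le> real DIM('a) ^ N * (\<Sum>b\<in>Basis. \<bar>C b\<bar>)"
  proof -
   have "norm x ^ N * cmod (osc g x) \<le> (real DIM('a) * \<bar>x \<bullet> b\<bar>) ^ N * cmod (osc g x)"
    using b by (intro mult_right_mono power_mono) auto
   also have "... = real DIM('a) ^ N * (\<bar>x \<bullet> b\<bar> ^ N * cmod (osc g x))" by (simp add: power_mult_distrib)
   also have "... \<le> real DIM('a) ^ N * (\<Sum>b\<in>Basis. \<bar>C b\<bar>)"
   proof (intro mult_left_mono)
    have "\<bar>x \<bullet> b\<bar> ^ N * cmod (osc g x) \<le> \<bar>C b\<bar>" using C[OF b(1), of x] by linarith
    also have "... \<le> (\<Sum>b\<in>Basis. \<bar>C b\<bar>)" using b(1) by (intro member_le_sum) auto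
    finally show "\<bar>x \<bullet> b\<bar> ^ N * cmod (osc g x) \<le> (\<Sum>b\<in>Basis. \<bar>C b\<bar>)" .
   qed simp
   finally show ?thesis .
  qed
  have c0: "cmod (osc g x) \<le> C0" using C0[of x] by simp
  have "(1 + norm x) ^ N \<le> 2 ^ N * (1 + norm x ^ N)"
  proof -
   have "(1 + norm x) ^ N \<le> (2 * max 1 (norm x)) ^ N" by (intro power_mono) auto
   also have "... = 2 ^ N * max 1 (norm x) ^ N" by (rule power_mult_distrib)
   also have "... \<le> 2 ^ N * (1 + norm x ^ N)" by (intro mult_left_mono) (auto simp: max_def)
   finally show ?thesis .
  qed
  then have "(1 + norm x) ^ N * cmod (osc g x) \<le> 2 ^ N * (1 + norm x ^ N) * cmod (osc g x)"
   by (rule mult_right_mono) simp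
  also have "... = 2 ^ N * (cmod (osc g x) + norm x ^ N * cmod (osc g x))" by (simp add: algebra_simps)
  also have "... \<le> D - 1" unfolding D_def using c0 c1 by simp
  finally show ?thesis .
 qed
 have "0 \<le> (1 + norm (0::'a)) ^ N * cmod (osc g 0)" by (intro mult_nonneg_nonneg zero_le_power) auto
 then have "D > 0" using le[of 0] by linarith
 then show ?thesis using le by (intro exI[of _ D]) (auto intro: order_trans[OF le])
qed

text \<open>Differentiation under the integral; it multiplies \<open>g\<close> by a linear function, so that all derivatives
 are oscillatory integrals again.\<close>

lemma osc_has_derivative:
 fixes g :: "'a::euclidean_space => complex"
 assumes g: "continuous_on UNIV g" "csupp R g"
 shows "(osc g has_derivative (\<lambda>h. osc (\<lambda>\<xi>. \<i> * cr (h \<bullet> \<xi>) * g \<xi>) x)) (at x)"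
proof -
 let ?d = "\<lambda>h \<xi>. \<i> * cr (h \<bullet> \<xi>)"
 let ?O = "\<lambda>h. osc (\<lambda>\<xi>. ?d h \<xi> * g \<xi>) x"
 let ?r = "\<lambda>h. osc g (x + h) - osc g x - ?O h"
 let ?x = "\<lambda>h \<xi>. (exp (?d h \<xi>) - 1 - ?d h \<xi>) * g \<xi>"
 define R' where "R' = max R 1"
 have R': "R' > 0" by (simp add: R'_def)
 have gs: "csupp R' g" using g(2) by (auto simp: csupp_def R'_def)
 have [measurable]: "g \<in> \<B>" using g by (simp add: borel_measurable_continuous_onI)
 have ig: "L1 g" by (rule csupp_integrable[OF g(2,1)])
 have ih: "L1 (\<lambda>\<xi>. ?d h \<xi> * g \<xi>)" for h
  by (rule csupp_integrable[of R]) (use g in \<open>auto simp: csupp_def intro!: continuous_intros\<close>)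
 define G where "G = (LINT \<xi>. cmod (g \<xi>))"
 have G: "G \<ge> 0" by (simp add: G_def)
 have hb: "cmod (?d h \<xi> * g \<xi>) \<le> norm h * R' * cmod (g \<xi>)" for h \<xi>
 proof (cases "norm \<xi> \<le> R'")
  case True
  have "\<bar>h \<bullet> \<xi>\<bar> \<le> norm h * norm \<xi>" by (rule Cauchy_Schwarz_ineq2)
  also have "... \<le> norm h * R'" using True by (intro mult_left_mono) auto
  finally show ?thesis by (simp add: norm_mult mult_right_mono)
 qed (use gs in \<open>auto simp: csupp_def\<close>)
 have bl: "bounded_linear (\<lambda>h. ?O h)"
 proof (rule bounded_linear_intro[where K="R' * G"])
  show "?O (h + k) = ?O h + ?O k" for h k
   unfolding osc_def using osc_integrable[OF ih, of x h] osc_integrable[OF ih, of x k]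
   by (subst Bochner_Integration.integral_add[symmetric]) (auto simp: inner_add_left algebra_simps)
  show "?O (c *\<^sub>R h) = c *\<^sub>R ?O h" for c h
   unfolding osc_def by (subst integral_scaleR_right[symmetric]) (auto simp: scaleR_conv_of_real mult_ac)
  show "cmod (?O h) \<le> norm h * (R' * G)" for h
  proof -
   have "cmod (?O h) \<le> (LINT \<xi>. cmod (?d h \<xi> * g \<xi>))"
    by (rule osc_bound[OF ih])
   also have "... \<le> (LINT \<xi>. norm h * R' * cmod (g \<xi>))"
    using ih[of h] ig by (intro integral_mono hb) auto
   finally show ?thesis by (simp add: G_def mult.assoc)
  qed
 qed
 have rem: "cmod (?r h) \<le> (R'\<^sup>2 * G) * (norm h)\<^sup>2" for h
 proof -
  have "?r h
   = (LINT \<xi>. ex ((x + h) \<bullet> \<xi>) * g \<xi> - ex (x \<bullet> \<xi>) * g \<xi> - ex (x \<bullet> \<xi>) * (?d h \<xi> * g \<xi>))"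
   unfolding osc_def using osc_integrable[OF ig, of x] osc_integrable[OF ig, of "x + h"] osc_integrable[OF ih, of x h] by simp
  also have "... = osc (\<lambda>\<xi>. ?x h \<xi>) x"
   unfolding osc_def by (intro Bochner_Integration.integral_cong) (auto simp: inner_add_left algebra_simps exp_add)
  also have "cmod ... \<le> (LINT \<xi>. cmod (?x h \<xi>))"
   by (intro osc_bound csupp_integrable[of R]) (use g in \<open>auto simp: csupp_def intro!: continuous_intros\<close>)
  also have "... \<le> (LINT \<xi>. (R'\<^sup>2 * (norm h)\<^sup>2) * cmod (g \<xi>))"
  proof (rule integral_mono)
   show "L1 (\<lambda>\<xi>. cmod (?x h \<xi>))"
    by (intro integrable_norm csupp_integrable[of R]) (use g in \<open>auto simp: csupp_def intro!: continuous_intros\<close>)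
   show "L1 (\<lambda>\<xi>. (R'\<^sup>2 * (norm h)\<^sup>2) * cmod (g \<xi>))" using ig by auto
   fix \<xi>
   show "cmod (?x h \<xi>) \<le> (R'\<^sup>2 * (norm h)\<^sup>2) * cmod (g \<xi>)"
   proof (cases "norm \<xi> \<le> R'")
    case True
    have "\<bar>h \<bullet> \<xi>\<bar> \<le> norm h * norm \<xi>" by (rule Cauchy_Schwarz_ineq2)
    also have "... \<le> norm h * R'" using True by (intro mult_left_mono) auto
    finally have "\<bar>h \<bullet> \<xi>\<bar>\<^sup>2 \<le> (norm h * R')\<^sup>2" by (rule power_mono) simp
    moreover have "cmod (exp (?d h \<xi>) - 1 - ?d h \<xi>) \<le> \<bar>h \<bullet> \<xi>\<bar>\<^sup>2 / 2"
     using iexp_approx1[of "h \<bullet> \<xi>" 1] by (simp add: algebra_simps numeral_2_eq_2)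
    ultimately have "cmod (exp (?d h \<xi>) - 1 - ?d h \<xi>) \<le> R'\<^sup>2 * (norm h)\<^sup>2"
     by (simp add: power_mult_distrib mult.commute) (smt (verit) zero_le_power2)
    then show ?thesis by (simp add: norm_mult mult_right_mono)
   qed (use gs in \<open>auto simp: csupp_def\<close>)
  qed
  finally show ?thesis by (simp add: G_def mult_ac)
 qed
 show ?thesis unfolding has_derivative_at
 proof (intro conjI bl)
  show "(\<lambda>h. cmod (?r h) / norm h) \<midarrow>0\<rightarrow> 0"
  proof (rule Lim_null_comparison)
   show "\<forall>\<^sub>F h in at 0. norm (cmod (?r h) / norm h) \<le> (R'\<^sup>2 * G) * norm h"
   proof (rule eventuallyI)
    fix h :: 'a
    show "norm (cmod (?r h) / norm h) \<le> (R'\<^sup>2 * G) * norm h"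
     using rem[of h] by (cases "h = 0") (simp_all add: divide_le_eq power2_eq_square mult.assoc)
   qed
   show "((\<lambda>h. (R'\<^sup>2 * G) * norm h) \<longlongrightarrow> 0) (at (0::'a))"
    by (rule tendsto_eq_intros | simp)+
  qed
 qed
qed

lemma smooth_inner_mult:
 assumes "smooth g" shows "smooth (\<lambda>\<xi>. \<i> * cr (b \<bullet> \<xi>) * g \<xi>)"
proof (rule Cn_imp_smooth)
 fix n
 have "Cn n (\<lambda>\<xi>. cr (\<xi> \<bullet> b))" by (rule Cn_bounded_linear[OF bounded_linear_of_real Cn_inner])
 from Cn_mult[OF Cn_mult[OF Cn_const[of n \<i>] this] smooth_imp_Cn[OF assms]]
 show "Cn n (\<lambda>\<xi>. \<i> * cr (b \<bullet> \<xi>) * g \<xi>)" by (simp add: inner_commute)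
qed

lemma smooth_dilate: "smooth g ==> smooth (\<lambda>\<xi>. g (c *\<^sub>R \<xi>))"
 by (rule Cn_imp_smooth[OF Cn_dilate[OF smooth_imp_Cn]])

lemma smooth_continuous: "smooth g ==> continuous_on UNIV g"
 by (rule Cn_continuous[OF smooth_imp_Cn])

lemma dir_deriv_osc:
 assumes "smooth g" "csupp R g"
 shows "dir_deriv b (osc g) = osc (\<lambda>\<xi>. \<i> * cr (b \<bullet> \<xi>) * g \<xi>)"
 by (subst dir_deriv_eq[OF osc_has_derivative[OF smooth_continuous[OF assms(1)] assms(2)]]) simp

lemma Cn_osc: "smooth g ==> csupp R g ==> Cn n (osc g)"
proof (induction n arbitrary: g)
 case (Suc n)
 have "(osc g) differentiable (at x)" for x
  using osc_has_derivative[OF smooth_continuous[OF Suc.prems(1)] Suc.prems(2)] by (rule differentiableI)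
 moreover have "Cn n (dir_deriv b (osc g))" for b
  unfolding dir_deriv_osc[OF Suc.prems] using Suc.prems by (intro Suc.IH[OF smooth_inner_mult]) (auto simp: csupp_def)
 ultimately show ?case by simp
qed simp

lemma iter_deriv_osc: "smooth g ==> csupp R g ==> \<exists>g'. smooth g' \<and> csupp R g' \<and> iter_deriv bs (osc g) = osc g'"
proof (induction bs arbitrary: g rule: rev_induct)
 case (snoc b bs)
 have "csupp R (\<lambda>\<xi>. \<i> * cr (b \<bullet> \<xi>) * g \<xi>)" using snoc.prems by (auto simp: csupp_def)
 from snoc.IH[OF smooth_inner_mult[OF snoc.prems(1)] this] show ?case
  by (simp add: iter_deriv_snoc dir_deriv_osc[OF snoc.prems])
qed (auto simp: iter_deriv_def)

lemma schwartz_osc: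
 assumes "smooth g" "csupp R g" shows "schwartz (osc g)"
 unfolding schwartz_def
proof (intro conjI allI impI)
 show "smooth (osc g)" by (rule Cn_imp_smooth[OF Cn_osc[OF assms]])
 fix bs :: "'a list" and n
 obtain g' where g': "smooth g'" "csupp R g'" "iter_deriv bs (osc g) = osc g'" using iter_deriv_osc[OF assms] by blast
 obtain C where C: "\<And>x. (1 + norm x) ^ n * cmod (osc g' x) \<le> C" using osc_decay[OF g'(1,2)] by blast
 have "norm (norm x ^ n *\<^sub>R osc g' x) \<le> C" for x
 proof -
  have "norm x ^ n * cmod (osc g' x) \<le> (1 + norm x) ^ n * cmod (osc g' x)" by (intro mult_right_mono power_mono) auto
  then show ?thesis using C[of x] by simp
 qed
 then show "bounded (range (\<lambda>x. norm x ^ n *\<^sub>R iter_deriv bs (osc g) x))"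
  unfolding g'(3) bounded_iff by blast
qed

lemma osc_reflect: "osc g (- x) = osc (\<lambda>\<xi>. g (- \<xi>)) x"
 if [measurable]: "g \<in> \<B>"
 using integral_lborel_reflect[of "\<lambda>\<xi>. ex ((- x) \<bullet> \<xi>) * g \<xi>" 0]
 by (simp add: osc_def)

lemma schwartz_fourier:
 assumes "smooth g" "csupp R g" shows "schwartz (fourier g)"
proof -
 have [measurable]: "g \<in> \<B>" by (intro borel_measurable_continuous_onI smooth_continuous assms)
 have "fourier g = osc (\<lambda>\<xi>. g ((-1) *\<^sub>R \<xi>))" by (auto simp: fourier_osc osc_reflect)
 moreover have "smooth (\<lambda>\<xi>. g ((-1) *\<^sub>R \<xi>))" by (rule smooth_dilate[OF assms(1)])
 ultimately show ?thesis using assms by (auto intro!: schwartz_osc[where R=R] simp: csupp_def)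
qed

section \<open>Fourier inversion\<close>

text \<open>The common form of all exchanges of integrals that involve an oscillating factor.\<close>

lemma osc_fubini:
 fixes m \<phi> :: "'a::euclidean_space => complex" and \<theta> :: "'a => 'a => real"
 assumes m: "L1 m" and \<phi>: "L1 \<phi>"
  and \<theta>[measurable]: "(\<lambda>(\<xi>, z). \<theta> \<xi> z) \<in> borel_measurable (borel \<Otimes>\<^sub>M borel)"
 shows "(LINT \<xi>. m \<xi> * (LINT z. ex (\<theta> \<xi> z) * \<phi> z)) = (LINT z. \<phi> z * (LINT \<xi>. ex (\<theta> \<xi> z) * m \<xi>))"
  and "L1 (\<lambda>z. \<phi> z * (LINT \<xi>. ex (\<theta> \<xi> z) * m \<xi>))"
proof -
 have [measurable]: "m \<in> \<B>" "\<phi> \<in> \<B>" using m \<phi> borel_measurable_integrable by auto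
 have I: "integrable (lborel \<Otimes>\<^sub>M lborel) (\<lambda>(\<xi>, z). ex (\<theta> \<xi> z) * m \<xi> * \<phi> z)"
 proof (rule lborel_pair.Fubini_integrable)
  show "(\<lambda>(\<xi>, z). ex (\<theta> \<xi> z) * m \<xi> * \<phi> z) \<in> borel_measurable (lborel \<Otimes>\<^sub>M lborel)" by measurable
  show "L1 (\<lambda>\<xi>. LINT z. norm (case (\<xi>, z) of (\<xi>, z) => ex (\<theta> \<xi> z) * m \<xi> * \<phi> z))"
   using m by (simp add: norm_mult)
  show "AE \<xi> in lborel. L1 (\<lambda>z. case (\<xi>, z) of (\<xi>, z) => ex (\<theta> \<xi> z) * m \<xi> * \<phi> z)"
  proof (rule AE_I2)
   fix \<xi>
   show "L1 (\<lambda>z. case (\<xi>, z) of (\<xi>, z) => ex (\<theta> \<xi> z) * m \<xi> * \<phi> z)"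
    by (rule Bochner_Integration.integrable_bound[of _ "\<lambda>z. m \<xi> * \<phi> z"]) (use \<phi> in \<open>auto simp: norm_mult\<close>)
  qed
 qed
 have "(LINT \<xi>. m \<xi> * (LINT z. ex (\<theta> \<xi> z) * \<phi> z)) = (LINT \<xi>. LINT z. ex (\<theta> \<xi> z) * m \<xi> * \<phi> z)"
  by (simp add: mult_ac flip: integral_mult_right_zero)
 also have "... = (LINT z. LINT \<xi>. ex (\<theta> \<xi> z) * m \<xi> * \<phi> z)"
  using lborel_pair.Fubini_integral[OF I] by simp
 also have "... = (LINT z. \<phi> z * (LINT \<xi>. ex (\<theta> \<xi> z) * m \<xi>))"
  by (simp add: mult_ac)
 finally show "(LINT \<xi>. m \<xi> * (LINT z. ex (\<theta> \<xi> z) * \<phi> z)) = (LINT z. \<phi> z * (LINT \<xi>. ex (\<theta> \<xi> z) * m \<xi>))" .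
 show "L1 (\<lambda>z. \<phi> z * (LINT \<xi>. ex (\<theta> \<xi> z) * m \<xi>))"
  using lborel_pair.integrable_snd[OF I] by (simp add: mult.commute)
qed

lemma gauss_1d:
 "L1 (\<lambda>t. ex (s * t) * cr (exp (- t\<^sup>2 / 2)))"
 "(LINT t. ex (s * t) * cr (exp (- t\<^sup>2 / 2))) = cr (sqrt (2 * pi) * exp (- s\<^sup>2 / 2))"
proof -
 let ?c = "sqrt (2 * pi)"
 have c: "?c > 0" by simp
 have e: "exp (- t\<^sup>2 / 2) = ?c * std_normal_density t" for t
  by (simp add: std_normal_density_def)
 have i: "L1 std_normal_density" by (rule integrable_normal_density) simp
 show "L1 (\<lambda>t. ex (s * t) * cr (exp (- t\<^sup>2 / 2)))"
 proof (rule Bochner_Integration.integrable_bound[of _ "\<lambda>t. ?c * std_normal_density t"])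
  show "L1 (\<lambda>t. ?c * std_normal_density t)" using i by (rule integrable_mult_right)
 qed (auto simp: norm_mult std_normal_density_def)
 have "cr (exp (- s\<^sup>2 / 2)) = char std_normal_distribution s" by (simp add: char_std_normal_distribution)
 also have "... = (LINT t. std_normal_density t *\<^sub>R ex (s * t))"
  unfolding char_def by (subst integral_density) auto
 also have "cr ?c * ... = (LINT t. ex (s * t) * cr (exp (- t\<^sup>2 / 2)))"
  unfolding e by (simp add: scaleR_conv_of_real mult_ac flip: integral_mult_right_zero)
 finally show "(LINT t. ex (s * t) * cr (exp (- t\<^sup>2 / 2))) = cr (sqrt (2 * pi) * exp (- s\<^sup>2 / 2))"
  by simp
qed

lemma integral_prod_basis:
 fixes f :: "'a::euclidean_space => real => complex"
 assumes f: "\<And>b. b \<in> Basis ==> L1 (f b)"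
 shows "(LINT x. (\<Prod>b\<in>Basis. f b (x \<bullet> b))) = (\<Prod>b\<in>Basis. LINT t. f b t)"
  and "L1 (\<lambda>x::'a. (\<Prod>b\<in>Basis. f b (x \<bullet> b)))"
proof -
 interpret product_sigma_finite "\<lambda>b::'a. lborel :: real measure" ..
 have [measurable]: "f b \<in> \<B>" if "b \<in> Basis" for b using f[OF that] borel_measurable_integrable by auto
 have [measurable]: "(\<lambda>x::'a. (\<Prod>b\<in>Basis. f b (x \<bullet> b))) \<in> \<B>"
  by (intro borel_measurable_prod) measurable
 have s: "(\<Sum>c\<in>Basis. h c *\<^sub>R c) \<bullet> b = h b" if "b \<in> Basis" for h and b :: 'a
  using that by (simp add: inner_sum_left inner_Basis if_distrib cong: if_cong)
 have p: "(\<Prod>b\<in>Basis. f b ((\<Sum>c\<in>Basis. h c *\<^sub>R c) \<bullet> b)) = (\<Prod>b\<in>Basis. f b (h b))" for h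
  by (intro prod.cong) (auto simp: s)
 have "(LINT x. (\<Prod>b\<in>Basis. f b (x \<bullet> b))) = (LINT h|(\<Pi>\<^sub>M b\<in>Basis. lborel). (\<Prod>b\<in>Basis. f b (h b)))"
  by (subst lborel_eq, subst integral_distr) (auto simp: p)
 also have "... = (\<Prod>b\<in>Basis. LINT t. f b t)"
  by (rule product_integral_prod) (auto intro: f)
 finally show "(LINT x. (\<Prod>b\<in>Basis. f b (x \<bullet> b))) = (\<Prod>b\<in>Basis. LINT t. f b t)" .
 have "integrable (\<Pi>\<^sub>M b\<in>Basis. lborel) (\<lambda>h. \<Prod>b\<in>Basis. f b (h b))"
  by (rule product_integrable_prod) (auto intro: f)
 then show "L1 (\<lambda>x::'a. (\<Prod>b\<in>Basis. f b (x \<bullet> b)))"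
  by (subst lborel_eq, subst integrable_distr_eq) (auto simp: p)
qed

definition gauss :: "'a::euclidean_space => real" where
 "gauss x = exp (- (norm x)\<^sup>2 / 2)"

lemma gauss_prod: "ex (z \<bullet> x) * cr (gauss x) =
 (\<Prod>b\<in>Basis. ex ((z \<bullet> b) * (x \<bullet> b)) * cr (exp (- (x \<bullet> b)\<^sup>2 / 2)))"
proof -
 have "(norm x)\<^sup>2 = (\<Sum>b\<in>Basis. (x \<bullet> b)\<^sup>2)"
  unfolding power2_norm_eq_inner by (subst euclidean_inner) (simp add: power2_eq_square)
 then have "- (norm x)\<^sup>2 / 2 = (\<Sum>b\<in>Basis. - (x \<bullet> b)\<^sup>2 / 2)"
  by (simp add: sum_negf sum_divide_distrib)
 then have g: "gauss x = (\<Prod>b\<in>Basis. exp (- (x \<bullet> b)\<^sup>2 / 2))" by (simp add: gauss_def exp_sum)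
 have "\<i> * cr (z \<bullet> x) = (\<Sum>b\<in>Basis. \<i> * cr ((z \<bullet> b) * (x \<bullet> b)))"
  by (subst euclidean_inner) (simp add: sum_distrib_left)
 then have e: "ex (z \<bullet> x) = (\<Prod>b\<in>Basis. ex ((z \<bullet> b) * (x \<bullet> b)))"
  by (simp add: exp_sum)
 show ?thesis unfolding g e by (simp add: prod.distrib)
qed

lemma gauss_integrable: "L1 (\<lambda>x::'a::euclidean_space. cr (gauss x))"
proof -
 have eq: "(\<lambda>x::'a. cr (gauss x)) = (\<lambda>x. (\<Prod>b\<in>Basis. ex (0 * (x \<bullet> b)) * cr (exp (- (x \<bullet> b)\<^sup>2 / 2))))"
  using gauss_prod[of 0] by auto
 show ?thesis unfolding eq by (rule integral_prod_basis(2)) (rule gauss_1d(1))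
qed

lemma gauss_osc: "osc (\<lambda>x. cr (gauss x)) (z::'a::euclidean_space) = cr (sqrt (2 * pi) ^ DIM('a) * gauss z)"
proof -
 have "osc (\<lambda>x. cr (gauss x)) z = (\<Prod>b\<in>Basis. cr (sqrt (2 * pi) * exp (- (z \<bullet> b)\<^sup>2 / 2)))"
  unfolding osc_def gauss_prod by (subst integral_prod_basis(1), rule gauss_1d(1)) (simp only: gauss_1d(2))
 also have "... = cr (sqrt (2 * pi) ^ DIM('a)) * (\<Prod>b\<in>Basis. cr (exp (- (z \<bullet> b)\<^sup>2 / 2)))"
  by (simp add: prod.distrib)
 also have "(\<Prod>b\<in>Basis. cr (exp (- (z \<bullet> b)\<^sup>2 / 2))) = cr (gauss z)"
  using gauss_prod[of 0 z] by simp
 finally show ?thesis by simp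
qed

text \<open>A Gaussian factor, spread out more and more, is inserted into the outer integral. The Gaussian being its own
 Fourier transform, the regularised integral is the convolution of \<open>f\<close> with a concentrating
 Gaussian, which tends to $f(x)$ by continuity and boundedness.\<close>

theorem fourier_inversion:
 fixes f :: "'a::euclidean_space => complex"
 assumes f: "continuous_on UNIV f" "\<And>x. cmod (f x) \<le> B" "L1 f" and Ff: "L1 (fourier f)"
 shows "inv_fourier (fourier f) x = f x"
proof -
 define d where "d = DIM('a)"
 let ?c = "sqrt (2 * pi) ^ d"
 have [measurable]: "f \<in> \<B>" "fourier f \<in> \<B>"
  using f Ff borel_measurable_integrable by auto
 have [measurable]: "(gauss :: 'a => real) \<in> \<B>" unfolding gauss_def[abs_def] by measurable
 define I where "I n = (LINT \<xi>. ex (x \<bullet> \<xi>) * (cr (gauss ((1 / real (Suc n)) *\<^sub>R \<xi>)) * fourier f \<xi>))" for n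
 have lim0: "(\<lambda>n. (1 / real (Suc n)) *\<^sub>R (v::'a)) \<longlonglongrightarrow> 0" for v
  using tendsto_scaleR[OF LIMSEQ_Suc[OF lim_1_over_n] tendsto_const[of v]] by simp
 define S where "S n \<xi> = ex (x \<bullet> \<xi>) * (cr (gauss ((1 / real (Suc n)) *\<^sub>R \<xi>)) * fourier f \<xi>)" for n \<xi>
 define F where "F \<xi> = ex (x \<bullet> \<xi>) * fourier f \<xi>" for \<xi>
 have [measurable]: "F \<in> \<B>" unfolding F_def[abs_def] by measurable
 have [measurable]: "S n \<in> \<B>" for n unfolding S_def[abs_def] by measurable
 have "(\<lambda>n. integral\<^sup>L lborel (S n)) \<longlonglongrightarrow> integral\<^sup>L lborel F"
 proof (rule integral_dominated_convergence[where w="\<lambda>\<xi>. cmod (fourier f \<xi>)" and s=S and f=F])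
  show "AE \<xi> in lborel. (\<lambda>n. S n \<xi>) \<longlonglongrightarrow> F \<xi>"
  proof (rule AE_I2)
   fix \<xi> :: 'a
   have "continuous_on UNIV (gauss :: 'a => real)" unfolding gauss_def[abs_def] by (intro continuous_intros) auto
   then have "isCont (gauss :: 'a => real) 0" by (simp add: continuous_on_eq_continuous_at)
   from isCont_tendsto_compose[OF this lim0]
   have "(\<lambda>n. gauss ((1 / real (Suc n)) *\<^sub>R \<xi>)) \<longlonglongrightarrow> exp (- (norm (0::'a))\<^sup>2 / 2)"
    by (simp add: gauss_def)
   then have "(\<lambda>n. S n \<xi>) \<longlonglongrightarrow> ex (x \<bullet> \<xi>) * (cr (exp (- (norm (0::'a))\<^sup>2 / 2)) * fourier f \<xi>)"
    unfolding S_def by (intro tendsto_mult tendsto_const tendsto_of_real)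
   then show "(\<lambda>n. S n \<xi>) \<longlonglongrightarrow> F \<xi>" by (simp add: F_def)
  qed
  show "AE \<xi> in lborel. cmod (S n \<xi>) \<le> cmod (fourier f \<xi>)" for n
   by (intro AE_I2) (simp add: S_def norm_mult gauss_def mult_left_le_one_le)
 qed (use Ff in auto)
 then have "I \<longlonglongrightarrow> integral\<^sup>L lborel F" by (simp add: I_def[abs_def] S_def[abs_def])
 then have L1: "I \<longlonglongrightarrow> osc (fourier f) x" by (simp add: osc_def F_def[abs_def])
 have I_eq: "I n = cr ?c * (LINT z. cr (gauss z) * f (x - (1 / real (Suc n)) *\<^sub>R z))" for n
 proof -
  define N where "N = real (Suc n)"
  have N: "N > 0" by (simp add: N_def)
  define m where "m \<xi> = ex (x \<bullet> \<xi>) * cr (gauss ((1 / N) *\<^sub>R \<xi>))" for \<xi> :: 'a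
  have im0: "L1 (\<lambda>\<xi>::'a. cr (gauss ((1 / N) *\<^sub>R \<xi>)))"
   using integrable_lborel_affine[OF gauss_integrable, of "1 / N" 0] N by simp
  have im: "L1 m" unfolding m_def by (rule osc_integrable[OF im0])
  have "I n = (LINT \<xi>. m \<xi> * (LINT z. ex (- (z \<bullet> \<xi>)) * f z))"
   unfolding I_def m_def fourier_def N_def by (simp add: mult.assoc)
  also have "... = (LINT z. f z * (LINT \<xi>. ex (- (z \<bullet> \<xi>)) * m \<xi>))"
   by (rule osc_fubini(1)[OF im f(3), of "\<lambda>\<xi> z. - (z \<bullet> \<xi>)"]) measurable
  also have "... = (LINT z. f z * (cr (N ^ d * ?c * gauss (N *\<^sub>R (x - z)))))"
  proof (rule Bochner_Integration.integral_cong)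
   fix z
   have "(LINT \<xi>. ex (- (z \<bullet> \<xi>)) * m \<xi>) = (LINT \<xi>. ex ((x - z) \<bullet> \<xi>) * cr (gauss ((1 / N) *\<^sub>R \<xi>)))"
    by (intro Bochner_Integration.integral_cong) (auto simp: m_def inner_diff_left exp_add[symmetric] algebra_simps exp_diff divide_simps exp_minus)
   also have "... = \<bar>N\<bar> ^ DIM('a) *\<^sub>R (LINT \<xi>. ex ((x - z) \<bullet> (0 + N *\<^sub>R \<xi>)) * cr (gauss ((1 / N) *\<^sub>R (0 + N *\<^sub>R \<xi>))))"
    using N by (intro integral_lborel_affine) auto
   also have "... = N ^ d *\<^sub>R osc (\<lambda>\<xi>. cr (gauss \<xi>)) (N *\<^sub>R (x - z))"
    using N by (simp add: osc_def d_def)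
   also have "... = cr (N ^ d * ?c * gauss (N *\<^sub>R (x - z)))"
    unfolding gauss_osc by (simp add: d_def scaleR_conv_of_real)
   finally show "f z * (LINT \<xi>. ex (- (z \<bullet> \<xi>)) * m \<xi>) = f z * (cr (N ^ d * ?c * gauss (N *\<^sub>R (x - z))))" by simp
  qed simp
  also have "... = \<bar>- (1 / N)\<bar> ^ DIM('a) *\<^sub>R (LINT z. f (x + (- (1 / N)) *\<^sub>R z) * (cr (N ^ d * ?c * gauss (N *\<^sub>R (x - (x + (- (1 / N)) *\<^sub>R z))))))"
   using N by (intro integral_lborel_affine) auto
  also have "... = \<bar>- (1 / N)\<bar> ^ DIM('a) *\<^sub>R (LINT z. cr (N ^ d * ?c) * (cr (gauss z) * f (x - (1 / N) *\<^sub>R z)))"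
   using N by (simp add: mult_ac)
  also have "... = cr ((1 / N) ^ d * (N ^ d * ?c)) * (LINT z. cr (gauss z) * f (x - (1 / N) *\<^sub>R z))"
   using N by (simp add: scaleR_conv_of_real d_def)
  also have "(1 / N) ^ d * (N ^ d * ?c) = ?c" using N by (simp add: power_divide)
  finally show ?thesis unfolding N_def .
 qed
 have "(\<lambda>n. LINT z. cr (gauss z) * f (x - (1 / real (Suc n)) *\<^sub>R z)) \<longlonglongrightarrow> (LINT z. cr (gauss (z::'a)) * f x)"
 proof (rule integral_dominated_convergence[where w="\<lambda>z::'a. B * gauss z" and f="\<lambda>z::'a. cr (gauss z) * f x"
    and s="\<lambda>n (z::'a). cr (gauss z) * f (x - (1 / real (Suc n)) *\<^sub>R z)"])
  have "L1 (\<lambda>x::'a. cmod (cr (gauss x)))" using gauss_integrable by (rule integrable_norm)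
  then show "L1 (\<lambda>z::'a. B * gauss z)" by (simp add: gauss_def)
  show "AE z in lborel. (\<lambda>n. cr (gauss z) * f (x - (1 / real (Suc n)) *\<^sub>R z)) \<longlonglongrightarrow> cr (gauss z) * f x"
  proof (rule AE_I2)
   fix z :: 'a
   have "(\<lambda>n. x - (1 / real (Suc n)) *\<^sub>R z) \<longlonglongrightarrow> x - 0" by (intro tendsto_intros lim0)
   then have "(\<lambda>n. f (x - (1 / real (Suc n)) *\<^sub>R z)) \<longlonglongrightarrow> f x"
    using f(1) by (auto intro!: isCont_tendsto_compose[where g=f] simp: continuous_on_eq_continuous_at)
   then show "(\<lambda>n. cr (gauss z) * f (x - (1 / real (Suc n)) *\<^sub>R z)) \<longlonglongrightarrow> cr (gauss z) * f x"
    by (intro tendsto_intros)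
  qed
  show "AE z in lborel. cmod (cr (gauss z) * f (x - (1 / real (Suc n)) *\<^sub>R z)) \<le> B * gauss z" for n
   using f(2) by (intro AE_I2) (simp add: norm_mult gauss_def mult.commute mult_left_mono)
 qed auto
 moreover have "(LINT z. cr (gauss (z::'a)) * f x) = cr ?c * f x"
  using gauss_osc[of "0::'a"] by (simp add: osc_def d_def gauss_def)
 ultimately have "I \<longlonglongrightarrow> cr ?c * (cr ?c * f x)"
  unfolding I_eq by (auto intro!: tendsto_intros)
 with L1 have "osc (fourier f) x = cr ?c * (cr ?c * f x)" by (rule LIMSEQ_unique)
 also have "... = cr (?c * ?c) * f x" by simp
 also have "?c * ?c = (2 * pi) ^ d" unfolding power_mult_distrib[symmetric] by simp
 finally show ?thesis by (simp add: inv_fourier_osc d_def)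
qed

lemma fourier_inversion':
 fixes f :: "'a::euclidean_space => complex"
 assumes f: "continuous_on UNIV f" "\<And>x. cmod (f x) \<le> B" "L1 f" and Ff: "L1 (fourier f)"
 shows "fourier (inv_fourier f) x = f x"
proof -
 have [measurable]: "fourier f \<in> \<B>" using Ff borel_measurable_integrable by auto
 have "inv_fourier f = (\<lambda>y. cr (1 / (2 * pi) ^ DIM('a)) * fourier f (- y))"
  by (rule ext) (simp add: inv_fourier_osc fourier_osc)
 then have "fourier (inv_fourier f) x = cr (1 / (2 * pi) ^ DIM('a)) * osc (\<lambda>y. fourier f (- y)) (- x)"
  by (simp add: fourier_osc osc_def mult.left_commute)
 also have "osc (\<lambda>y. fourier f (- y)) (- x) = osc (fourier f) x" by (subst osc_reflect) auto
 also have "cr (1 / (2 * pi) ^ DIM('a)) * osc (fourier f) x = f x"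
  using fourier_inversion[OF assms, of x] unfolding inv_fourier_osc .
 finally show ?thesis .
qed

section \<open>Convolution kernels of dyadic multipliers\<close>

text \<open>The mean value inequality on the segment from \<open>x\<close> to $x+h$, all of whose points have norm at least
 half that of \<open>x\<close>.\<close>

lemma osc_diff:
 fixes g :: "'a::euclidean_space => complex"
 assumes g: "smooth g" "csupp R g"
 shows "\<exists>C>0. \<forall>x h. 2 * norm h \<le> norm x --> (1 + norm x) ^ N * cmod (osc g (x + h) - osc g x) \<le> C * norm h"
proof -
 define D where "D b = (\<lambda>\<xi>. \<i> * cr (b \<bullet> \<xi>) * g \<xi>)" for b
 have D: "smooth (D b)" "csupp R (D b)" for b
  unfolding D_def using g by (auto intro!: smooth_inner_mult simp: csupp_def)
 have "\<exists>C>0. \<forall>x. (1 + norm x) ^ N * cmod (osc (D b) x) \<le> C" for b by (rule osc_decay[OF D])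
 then obtain C where C: "\<And>b. C b > 0" "\<And>b x. (1 + norm x) ^ N * cmod (osc (D b) x) \<le> C b" by metis
 define S where "S = (\<Sum>b\<in>Basis. C b)"
 have S: "S > 0" unfolding S_def using C(1) by (intro sum_pos) auto
 show ?thesis
 proof (intro exI[of _ "2 ^ N * S"] conjI allI impI)
  show "2 ^ N * S > 0" using S by simp
  fix x h :: 'a assume h: "2 * norm h \<le> norm x"
  let ?B = "2 ^ N * S / (1 + norm x) ^ N"
  have der: "(osc g has_derivative (\<lambda>k. osc (D k) y)) (at y)" for y
   unfolding D_def by (rule osc_has_derivative[OF smooth_continuous[OF g(1)] g(2)])
  have on: "onorm (\<lambda>k. osc (D k) y) \<le> ?B" if y: "y \<in> closed_segment x (x + h)" for y
  proof (rule onorm_le)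
   fix k :: 'a
   have "norm (y - x) \<le> norm h" using segment_bound(1)[OF y] by simp
   then have "norm x - norm h \<le> norm y" using norm_triangle_ineq2[of x "x - y"] by (simp add: norm_minus_commute)
   then have ny: "1 + norm x \<le> 2 * (1 + norm y)" using h by (linarith | argo | (simp add: algebra_simps; linarith))
   interpret bounded_linear "\<lambda>k. osc (D k) y" using der by (rule has_derivative_bounded_linear)
   have b: "cmod (osc (D b) y) \<le> C b * (2 ^ N / (1 + norm x) ^ N)" for b
   proof -
    have "(1 + norm x) ^ N \<le> (2 * (1 + norm y)) ^ N" using ny by (intro power_mono) auto
    then have "(1 + norm x) ^ N * cmod (osc (D b) y) \<le> (2 * (1 + norm y)) ^ N * cmod (osc (D b) y)" by (intro mult_right_mono) auto
    also have "... = 2 ^ N * ((1 + norm y) ^ N * cmod (osc (D b) y))" by (simp only: power_mult_distrib mult.assoc)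
    also have "... \<le> 2 ^ N * C b" by (intro mult_left_mono C) auto
    finally show ?thesis by (simp add: pos_le_divide_eq add_pos_nonneg mult_ac)
   qed
   have "osc (D k) y = osc (D (\<Sum>b\<in>Basis. (k \<bullet> b) *\<^sub>R b)) y" by (simp add: euclidean_representation)
   also have "... = (\<Sum>b\<in>Basis. (k \<bullet> b) *\<^sub>R osc (D b) y)" by (simp add: sum scaleR)
   also have "cmod ... \<le> (\<Sum>b\<in>Basis. cmod ((k \<bullet> b) *\<^sub>R osc (D b) y))" by (rule norm_sum)
   also have "... \<le> (\<Sum>b\<in>Basis. norm k * (C b * (2 ^ N / (1 + norm x) ^ N)))"
    unfolding norm_scaleR by (intro sum_mono mult_mono b Basis_le_norm) (auto simp: norm_ge_zero)
   also have "... = ?B * norm k" by (simp add: S_def sum_distrib_left sum_distrib_right sum_divide_distrib mult_ac)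
   finally show "cmod (osc (D k) y) \<le> ?B * norm k" .
  qed
  have "cmod (osc g (x + h) - osc g x) \<le> ?B * norm ((x + h) - x)"
   by (rule differentiable_bound[where S="closed_segment x (x + h)" and f'="\<lambda>y k. osc (D k) y"])
    (use on der in \<open>auto intro: has_derivative_at_withinI\<close>)
  then show "(1 + norm x) ^ N * cmod (osc g (x + h) - osc g x) \<le> 2 ^ N * S * norm h"
   by (simp add: pos_le_divide_eq add_pos_nonneg mult_ac)
 qed
qed

lemma sum_geometric_int:
 fixes \<theta> :: real and j0 :: int
 assumes \<theta>: "0 < \<theta>" "\<theta> < 1" and J: "finite J"
 shows "(\<Sum>j\<in>J. \<theta> ^ nat \<bar>j - j0\<bar>) \<le> 2 / (1 - \<theta>)"
proof -
 have s: "(\<Sum>n\<in>M. \<theta> ^ n) \<le> 1 / (1 - \<theta>)" if "finite M" for M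
  using sum_le_suminf[of "\<lambda>n. \<theta> ^ n" M] that \<theta> by (simp add: suminf_geometric summable_geometric)
 have inj1: "inj_on (\<lambda>j. nat \<bar>j - j0\<bar>) (J \<inter> {j0..})" by (auto simp: inj_on_def)
 have inj2: "inj_on (\<lambda>j. nat \<bar>j - j0\<bar>) (J \<inter> {..<j0})" by (auto simp: inj_on_def)
 have "(\<Sum>j\<in>J. \<theta> ^ nat \<bar>j - j0\<bar>) = (\<Sum>j\<in>(J \<inter> {j0..}) \<union> (J \<inter> {..<j0}). \<theta> ^ nat \<bar>j - j0\<bar>)"
  by (intro sum.cong) auto
 also have "... = (\<Sum>j\<in>J \<inter> {j0..}. \<theta> ^ nat \<bar>j - j0\<bar>) + (\<Sum>j\<in>J \<inter> {..<j0}. \<theta> ^ nat \<bar>j - j0\<bar>)"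
  using J by (intro sum.union_disjoint) auto
 also have "(\<Sum>j\<in>J \<inter> {j0..}. \<theta> ^ nat \<bar>j - j0\<bar>) = (\<Sum>n\<in>(\<lambda>j. nat \<bar>j - j0\<bar>) ` (J \<inter> {j0..}). \<theta> ^ n)"
  by (subst sum.reindex[OF inj1]) (simp add: o_def)
 also have "(\<Sum>j\<in>J \<inter> {..<j0}. \<theta> ^ nat \<bar>j - j0\<bar>) = (\<Sum>n\<in>(\<lambda>j. nat \<bar>j - j0\<bar>) ` (J \<inter> {..<j0}). \<theta> ^ n)"
  by (subst sum.reindex[OF inj2]) (simp add: o_def)
 also have "(\<Sum>n\<in>(\<lambda>j. nat \<bar>j - j0\<bar>) ` (J \<inter> {j0..}). \<theta> ^ n) + (\<Sum>n\<in>(\<lambda>j. nat \<bar>j - j0\<bar>) ` (J \<inter> {..<j0}). \<theta> ^ n) \<le> 1 / (1 - \<theta>) + 1 / (1 - \<theta>)"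
  using J by (intro add_mono s) auto
 finally show ?thesis by simp
qed

text \<open>The terms decay geometrically in the distance of \<open>j\<close> to $j_0=\lfloor-\log_2r\rfloor$: like $2^{ja}$
 below $j_0$, where the denominator may be ignored, and like $2^{j(a-N)}$ above, where it dominates.\<close>

lemma dyadic_sum:
 fixes a :: real
 assumes a: "a > 0" "a < real N"
 shows "\<exists>C>0. \<forall>(J::int set) r. finite J --> r > 0 -->
  (\<Sum>j\<in>J. 2 powr (j * a) / (1 + 2 powr j * r) ^ N) \<le> C * r powr (- a)"
proof -
 define \<delta> where "\<delta> = min a (N - a)"
 have \<delta>: "\<delta> > 0" "\<delta> \<le> a" "\<delta> \<le> N - a" using a by (auto simp: \<delta>_def)
 define \<theta> where "\<theta> = 2 powr (- \<delta>)"
 have \<theta>: "0 < \<theta>" "\<theta> < 1" using \<delta> by (auto simp: \<theta>_def powr_less_one)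
 define C where "C = 2 powr (real N) * (2 / (1 - \<theta>))"
 show ?thesis
 proof (intro exI[of _ C] conjI allI impI)
  show "C > 0" using \<theta> by (simp add: C_def)
  fix J :: "int set" and r :: real assume J: "finite J" and r: "r > 0"
  define j0 where "j0 = \<lfloor>- log 2 r\<rfloor>"
  have j0: "real_of_int j0 \<le> - log 2 r" "- log 2 r < real_of_int j0 + 1" by (auto simp: j0_def)
  have t: "2 powr j * r = 2 powr (j + log 2 r)" for j :: int using r by (simp add: powr_add)
  have tm: "2 powr (j * a) / (1 + 2 powr j * r) ^ N \<le> r powr (- a) * (2 powr real N * \<theta> ^ nat \<bar>j - j0\<bar>)" for j :: int
  proof -
   define l where "l = j + log 2 r"
   have pos: "2 powr j * r > 0" using r by simp
   have ra: "2 powr (j * a) = r powr (- a) * 2 powr (l * a)"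
   proof -
    have "2 powr (l * a) = (2 powr j * r) powr a" unfolding l_def t powr_powr ..
    also have "... = 2 powr (j * a) * r powr a" using r by (simp add: powr_mult powr_powr)
    finally show ?thesis using r by (simp add: powr_minus field_simps)
   qed
   have th: "\<theta> ^ nat \<bar>j - j0\<bar> = 2 powr (- \<delta> * \<bar>real_of_int (j - j0)\<bar>)"
    unfolding \<theta>_def by (simp add: powr_realpow[symmetric] powr_powr)
   have "2 powr (l * a) / (1 + 2 powr l) ^ N \<le> 2 powr real N * 2 powr (- \<delta> * \<bar>real_of_int (j - j0)\<bar>)"
   proof (cases "j \<le> j0")
    case True
    have "2 powr (l * a) / (1 + 2 powr l) ^ N \<le> 2 powr (l * a) / 1"
     by (intro divide_left_mono one_le_power) (auto simp: add_pos_pos)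
    also have "... \<le> 2 powr (real N - \<delta> * \<bar>real_of_int (j - j0)\<bar>)"
    proof -
     have l1: "l \<le> - \<bar>real_of_int (j - j0)\<bar>" using True j0 by (simp add: l_def)
     have "l * a \<le> - \<bar>real_of_int (j - j0)\<bar> * a" using l1 a by (intro mult_right_mono) auto
     also have "... \<le> - \<bar>real_of_int (j - j0)\<bar> * \<delta>" using mult_left_mono[OF \<delta>(2), of "\<bar>real_of_int (j - j0)\<bar>"] by simp
     finally have "l * a \<le> real N - \<delta> * \<bar>real_of_int (j - j0)\<bar>" by (simp add: mult.commute)
     then show ?thesis by simp
    qed
    finally show ?thesis by (simp add: powr_diff powr_minus divide_inverse)
   next
    case False
    have "2 powr (l * a) / (1 + 2 powr l) ^ N \<le> 2 powr (l * a) / (2 powr l) ^ N"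
     by (intro divide_left_mono power_mono) (auto simp: add_pos_pos)
    also have "... = 2 powr (- l * (N - a))" by (simp add: powr_realpow[symmetric] powr_powr powr_diff[symmetric] algebra_simps)
    also have "... \<le> 2 powr (real N - \<delta> * \<bar>real_of_int (j - j0)\<bar>)"
    proof -
     define k where "k = \<bar>real_of_int (j - j0)\<bar>"
     have l1: "- l \<le> 1 - k" using False j0 by (simp add: l_def k_def)
     have "- l * (N - a) \<le> (1 - k) * (N - a)" using l1 a by (intro mult_right_mono) auto
     also have "... = (N - a) - k * (N - a)" by (simp add: algebra_simps)
     also have "... \<le> N - k * \<delta>" using a \<delta>(3) by (intro diff_mono mult_left_mono) (auto simp: k_def)
     finally show ?thesis by (simp add: k_def mult.commute)
    qed
    finally show ?thesis by (simp add: powr_diff powr_minus divide_inverse)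
   qed
   then have "r powr (- a) * (2 powr (l * a) / (1 + 2 powr l) ^ N) \<le> r powr (- a) * (2 powr real N * 2 powr (- \<delta> * \<bar>real_of_int (j - j0)\<bar>))"
    by (intro mult_left_mono) auto
   then show ?thesis unfolding ra th by (simp add: t l_def)
  qed
  have "(\<Sum>j\<in>J. 2 powr (j * a) / (1 + 2 powr j * r) ^ N) \<le> (\<Sum>j\<in>J. r powr (- a) * (2 powr real N * \<theta> ^ nat \<bar>j - j0\<bar>))"
   by (intro sum_mono tm)
  also have "... = r powr (- a) * (2 powr real N * (\<Sum>j\<in>J. \<theta> ^ nat \<bar>j - j0\<bar>))" by (simp add: sum_distrib_left)
  also have "... \<le> r powr (- a) * (2 powr real N * (2 / (1 - \<theta>)))"
   using sum_geometric_int[OF \<theta> J, of j0] by (intro mult_left_mono) auto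
  finally show "(\<Sum>j\<in>J. 2 powr (j * a) / (1 + 2 powr j * r) ^ N) \<le> C * r powr (- a)" by (simp add: C_def mult_ac)
 qed
qed

text \<open>The convolution kernel of the multiplier \<open>m\<close>. All symbols that occur are even, so that their
 kernels are real and the real part discards nothing; real kernels let the theory above apply.\<close>

definition ker :: "('a::euclidean_space => real) => 'a => real" where
 "ker m x = Re (inv_fourier (\<lambda>\<xi>. cr (m \<xi>)) x)"

lemma ker_complex:
 fixes m :: "'a::euclidean_space => real"
 assumes m: "L1 m" "\<And>\<xi>. m (- \<xi>) = m \<xi>"
 shows "inv_fourier (\<lambda>\<xi>. cr (m \<xi>)) x = cr (ker m x)"
proof -
 have [measurable]: "m \<in> \<B>" using m borel_measurable_integrable by auto
 have i: "L1 (\<lambda>\<xi>. cr (m \<xi>))" using m by simp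
 have "cnj (osc (\<lambda>\<xi>. cr (m \<xi>)) x) = osc (\<lambda>\<xi>. cr (m \<xi>)) (- x)"
  unfolding osc_def by (subst Bochner_Integration.integral_cnj[symmetric]) (auto simp: exp_cnj)
 also have "... = osc (\<lambda>\<xi>. cr (m \<xi>)) x" by (subst osc_reflect) (auto simp: m)
 finally have "cnj (inv_fourier (\<lambda>\<xi>. cr (m \<xi>)) x) = inv_fourier (\<lambda>\<xi>. cr (m \<xi>)) x"
  by (simp add: inv_fourier_osc)
 then have "Im (inv_fourier (\<lambda>\<xi>. cr (m \<xi>)) x) = 0"
  by (simp add: complex_eq_iff)
 then show ?thesis by (simp add: ker_def complex_eq_iff)
qed

lemma ker_even:
 assumes m: "L1 m" "\<And>\<xi>. m (- \<xi>) = m \<xi>"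
 shows "ker m (- x) = ker m (x::'a::euclidean_space)"
proof -
 have [measurable]: "m \<in> \<B>" using m borel_measurable_integrable by auto
 have "osc (\<lambda>\<xi>. cr (m \<xi>)) (- x) = osc (\<lambda>\<xi>. cr (m \<xi>)) x"
  by (subst osc_reflect) (auto simp: m)
 then show ?thesis by (simp add: ker_def inv_fourier_osc)
qed

lemma ker_le_osc: "\<bar>ker m x\<bar> \<le> cmod (osc (\<lambda>\<xi>. cr (m \<xi>)) (x::'a::euclidean_space))"
proof -
 have "\<bar>ker m x\<bar> \<le> cmod (inv_fourier (\<lambda>\<xi>. cr (m \<xi>)) x)" unfolding ker_def by (rule abs_Re_le_cmod)
 also have "... = 1 / (2 * pi) ^ DIM('a) * cmod (osc (\<lambda>\<xi>. cr (m \<xi>)) x)"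
  by (simp add: inv_fourier_osc norm_mult norm_divide norm_power)
 also have "... \<le> 1 * cmod (osc (\<lambda>\<xi>. cr (m \<xi>)) x)"
 proof (intro mult_right_mono)
  have "1 \<le> (2 * pi) ^ DIM('a)" using pi_gt3 by (intro one_le_power) auto
  then show "1 / (2 * pi) ^ DIM('a) \<le> 1" by simp
 qed simp
 finally show ?thesis by simp
qed

lemma ker_diff_le_osc: "\<bar>ker m x - ker m y\<bar> \<le> cmod (osc (\<lambda>\<xi>. cr (m \<xi>)) x - osc (\<lambda>\<xi>. cr (m \<xi>)) (y::'a::euclidean_space))"
proof -
 have "\<bar>ker m x - ker m y\<bar> \<le> cmod (inv_fourier (\<lambda>\<xi>. cr (m \<xi>)) x - inv_fourier (\<lambda>\<xi>. cr (m \<xi>)) y)"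
  unfolding ker_def using abs_Re_le_cmod by (metis minus_complex.sel(1))
 also have "... = cmod (cr (1 / (2 * pi) ^ DIM('a)) * (osc (\<lambda>\<xi>. cr (m \<xi>)) x - osc (\<lambda>\<xi>. cr (m \<xi>)) y))"
  unfolding inv_fourier_osc by (simp only: right_diff_distrib)
 also have "... = 1 / (2 * pi) ^ DIM('a) * cmod (osc (\<lambda>\<xi>. cr (m \<xi>)) x - osc (\<lambda>\<xi>. cr (m \<xi>)) y)"
  by (simp add: norm_mult norm_divide norm_power)
 also have "... \<le> 1 * cmod (osc (\<lambda>\<xi>. cr (m \<xi>)) x - osc (\<lambda>\<xi>. cr (m \<xi>)) y)"
 proof (intro mult_right_mono)
  have "1 \<le> (2 * pi) ^ DIM('a)" using pi_gt3 by (intro one_le_power) auto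
  then show "1 / (2 * pi) ^ DIM('a) \<le> 1" by simp
 qed simp
 finally show ?thesis by simp
qed

lemma ker_bounded: "L1 m ==> \<bar>ker m x\<bar> \<le> (LINT \<xi>. \<bar>m \<xi>\<bar>)"
 by (rule order_trans[OF ker_le_osc order_trans[OF osc_bound]]) auto

lemma ker_dilate:
 fixes m :: "'a::euclidean_space => real"
 assumes [measurable]: "m \<in> \<B>" and c: "c > 0"
 shows "ker (\<lambda>\<xi>. m ((1 / c) *\<^sub>R \<xi>)) x = c ^ DIM('a) * ker m (c *\<^sub>R x)"
proof -
 have "osc (\<lambda>\<xi>. cr (m ((1 / c) *\<^sub>R \<xi>))) x = \<bar>c\<bar> ^ DIM('a) *\<^sub>R (LINT \<xi>. ex (x \<bullet> (0 + c *\<^sub>R \<xi>)) * cr (m ((1 / c) *\<^sub>R (0 + c *\<^sub>R \<xi>))))"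
  unfolding osc_def using c by (intro integral_lborel_affine) auto
 also have "... = c ^ DIM('a) *\<^sub>R osc (\<lambda>\<xi>. cr (m \<xi>)) (c *\<^sub>R x)"
  using c by (simp add: osc_def)
 finally show ?thesis unfolding ker_def inv_fourier_osc
  by (simp add: scaleR_conv_of_real)
qed

lemma ker_cmult: "ker (\<lambda>\<xi>. c * m \<xi>) x = c * ker m (x::'a::euclidean_space)"
proof -
 have "osc (\<lambda>\<xi>. cr (c * m \<xi>)) x = cr c * osc (\<lambda>\<xi>. cr (m \<xi>)) x"
  unfolding osc_def by (simp add: mult.left_commute)
 then show ?thesis by (simp add: ker_def inv_fourier_osc)
qed

lemma ker_diff:
 assumes "L1 m" "L1 k"
 shows "ker (\<lambda>\<xi>. m \<xi> - k \<xi>) x = ker m x - ker k (x::'a::euclidean_space)"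
proof -
 have "osc (\<lambda>\<xi>. cr (m \<xi> - k \<xi>)) x = osc (\<lambda>\<xi>. cr (m \<xi>)) x - osc (\<lambda>\<xi>. cr (k \<xi>)) x"
  unfolding osc_def using osc_integrable[of "\<lambda>\<xi>. cr (m \<xi>)" x] osc_integrable[of "\<lambda>\<xi>. cr (k \<xi>)" x] assms
  by (simp add: right_diff_distrib)
 then have "inv_fourier (\<lambda>\<xi>. cr (m \<xi> - k \<xi>)) x = inv_fourier (\<lambda>\<xi>. cr (m \<xi>)) x - inv_fourier (\<lambda>\<xi>. cr (k \<xi>)) x"
  unfolding inv_fourier_osc by (simp only: right_diff_distrib)
 then show ?thesis by (simp add: ker_def)
qed

lemma continuous_osc:
 assumes g: "L1 g" shows "continuous_on UNIV (osc g)"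
 unfolding continuous_on_sequentially comp_def
proof safe
 fix X :: "nat => 'a" and a assume X: "X \<longlonglongrightarrow> a"
 have [measurable]: "g \<in> \<B>" using g borel_measurable_integrable by auto
 define F where "F x \<xi> = ex (x \<bullet> \<xi>) * g \<xi>" for x \<xi>
 have "(\<lambda>n. integral\<^sup>L lborel (F (X n))) \<longlonglongrightarrow> integral\<^sup>L lborel (F a)"
 proof (rule integral_dominated_convergence[where w="\<lambda>\<xi>. cmod (g \<xi>)" and s="\<lambda>n. F (X n)" and f="F a"])
  show "AE \<xi> in lborel. (\<lambda>n. F (X n) \<xi>) \<longlonglongrightarrow> F a \<xi>"
  proof (rule AE_I2)
   fix \<xi>
   have "(\<lambda>n. \<i> * cr (X n \<bullet> \<xi>)) \<longlonglongrightarrow> \<i> * cr (a \<bullet> \<xi>)"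
    by (intro tendsto_mult tendsto_const tendsto_of_real tendsto_inner X)
   then have "(\<lambda>n. ex (X n \<bullet> \<xi>)) \<longlonglongrightarrow> ex (a \<bullet> \<xi>)"
    by (rule tendsto_exp)
   then show "(\<lambda>n. F (X n) \<xi>) \<longlonglongrightarrow> F a \<xi>" unfolding F_def by (intro tendsto_mult tendsto_const)
  qed
  show "AE \<xi> in lborel. cmod (F (X n) \<xi>) \<le> cmod (g \<xi>)" for n by (simp add: F_def norm_mult)
 qed (use g in \<open>auto simp: F_def[abs_def]\<close>)
 then show "(\<lambda>n. osc g (X n)) \<longlonglongrightarrow> osc g a" by (simp add: osc_def F_def[abs_def])
qed

lemma continuous_ker:
 assumes "L1 m" shows "continuous_on UNIV (ker (m :: 'a::euclidean_space => real))"
proof -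
 have "continuous_on UNIV (osc (\<lambda>\<xi>::'a. cr (m \<xi>)))" using assms by (intro continuous_osc) auto
 then show ?thesis unfolding ker_def[abs_def] inv_fourier_osc by (intro continuous_on_Re continuous_on_mult continuous_on_const)
qed

text \<open>Inside the unit ball the function is bounded, and outside the tail of a power is integrated by
 \<open>mx_far\<close> for the constant function $1$.\<close>

lemma nice_decay:
 fixes f :: "'a::euclidean_space => real" and a B C :: real
 assumes [measurable]: "f \<in> \<B>" and B: "\<And>x. \<bar>f x\<bar> \<le> B" and a: "a > 0"
  and C: "\<And>x. x \<noteq> 0 ==> \<bar>f x\<bar> \<le> C * norm x powr (- a - DIM('a))"
 shows "nice f"
proof -
 obtain Cf where Cf: "Cf > 0" "\<And>f \<rho> (x::'a). f \<in> \<B> ==> \<rho> > 0 ==>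
  (\<integral>z. en (dist x z powr (- a - DIM('a))) * ind (- ball x \<rho>) z * f z) \<le> en (Cf * \<rho> powr (- a)) * mx f x"
  using mx_far[OF a, where 'a='a] by auto
 have B0: "B \<ge> 0" using B[of 0] by linarith
 have "\<bar>f x\<bar> \<le> \<bar>C\<bar> * norm x powr (- a - DIM('a))" if "x \<noteq> 0" for x
  using C[OF that] by (rule order_trans) (auto intro: mult_right_mono)
 then have "en \<bar>f x\<bar> \<le> en B * ind (ball 0 1) x + en \<bar>C\<bar> * (en (dist 0 x powr (- a - DIM('a))) * ind (- ball 0 1) x * 1)" for x
 proof (cases "x \<in> ball 0 1")
  case False
  then have "x \<noteq> 0" by auto
  with \<open>\<And>x. x \<noteq> 0 ==> \<bar>f x\<bar> \<le> \<bar>C\<bar> * norm x powr (- a - DIM('a))\<close> have "\<bar>f x\<bar> \<le> \<bar>C\<bar> * norm x powr (- a - DIM('a))" by blast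
  with False show ?thesis by (simp add: ennreal_leI flip: ennreal_mult)
 qed (use B[of x] in \<open>simp add: ennreal_leI\<close>)
 then have "(\<integral>x. en \<bar>f x\<bar>) \<le> (\<integral>x. en B * ind (ball (0::'a) 1) x + en \<bar>C\<bar> * (en (dist 0 x powr (- a - DIM('a))) * ind (- ball 0 1) x * 1))"
  by (intro nn_integral_mono)
 also have "... = en B * vol (ball (0::'a) 1) + en \<bar>C\<bar> * (\<integral>x. (en (dist 0 x powr (- a - DIM('a))) * ind (- ball (0::'a) 1) x * 1))"
  by (subst nn_integral_add) (auto simp: nn_integral_cmult)
 also have "... \<le> en B * vol (ball (0::'a) 1) + en \<bar>C\<bar> * (en (Cf * 1 powr (- a)) * mx (\<lambda>x. 1) (0::'a))"
  by (intro add_left_mono mult_left_mono Cf(2)) auto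
 also have "... \<le> en B * vol (ball (0::'a) 1) + en \<bar>C\<bar> * (en (Cf * 1 powr (- a)) * 1)"
  by (intro add_left_mono mult_left_mono mx_const_le) auto
 also have "... < \<top>" using emeasure_lborel_ball_finite[of "0::'a" 1] by (simp add: ennreal_mult_less_top)
 finally have "L1 f" by (intro integrableI_bounded) auto
 then show ?thesis using B by (auto simp: nice_def)
qed

lemma smooth_of_real: "smooth m ==> smooth (\<lambda>\<xi>. cr (m \<xi>))"
 by (rule Cn_imp_smooth[OF Cn_bounded_linear[OF bounded_linear_of_real smooth_imp_Cn]])

lemma csupp_of_real: "csupp R m ==> csupp R (\<lambda>\<xi>. cr (m \<xi>))"
 by (simp add: csupp_def)

lemma smooth_mult: "smooth (f :: 'a::euclidean_space => 'b::real_normed_algebra) ==> smooth g ==> smooth (\<lambda>x. f x * g x)"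
 by (rule Cn_imp_smooth[OF Cn_mult[OF smooth_imp_Cn smooth_imp_Cn]])

lemma smooth_const: "smooth (\<lambda>x. c)"
 by (rule Cn_imp_smooth[OF Cn_const])

lemma smooth_iexp: "smooth (\<lambda>\<xi>. ex (x \<bullet> \<xi>))"
 by (rule Cn_imp_smooth[OF Cn_iexp])

lemma ker_decay:
 fixes m :: "'a::euclidean_space => real"
 assumes m: "smooth m" "csupp R m"
 shows "\<exists>C>0. \<forall>x. \<bar>ker m x\<bar> \<le> C / (1 + norm x) ^ N"
proof -
 obtain C where C: "C > 0" "\<And>x. (1 + norm x) ^ N * cmod (osc (\<lambda>\<xi>. cr (m \<xi>)) x) \<le> C"
  using osc_decay[OF smooth_of_real[OF m(1)] csupp_of_real[OF m(2)]] by blast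
 have "\<bar>ker m x\<bar> \<le> C / (1 + norm x) ^ N" for x
 proof -
  have "(1 + norm x) ^ N * \<bar>ker m x\<bar> \<le> (1 + norm x) ^ N * cmod (osc (\<lambda>\<xi>. cr (m \<xi>)) x)"
   by (intro mult_left_mono ker_le_osc zero_le_power) auto
  then have "(1 + norm x) ^ N * \<bar>ker m x\<bar> \<le> C" using C(2)[of x] by linarith
  then show ?thesis by (simp add: pos_le_divide_eq add_pos_nonneg mult.commute)
 qed
 then show ?thesis using C(1) by blast
qed

lemma ker_diff_decay:
 fixes m :: "'a::euclidean_space => real"
 assumes m: "smooth m" "csupp R m"
 shows "\<exists>C>0. \<forall>x h. 2 * norm h \<le> norm x --> \<bar>ker m (x + h) - ker m x\<bar> \<le> C * norm h / (1 + norm x) ^ N"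
proof -
 obtain C where C: "C > 0" "\<And>x h. 2 * norm h \<le> norm x ==> (1 + norm x) ^ N * cmod (osc (\<lambda>\<xi>. cr (m \<xi>)) (x + h) - osc (\<lambda>\<xi>. cr (m \<xi>)) x) \<le> C * norm h"
  using osc_diff[OF smooth_of_real[OF m(1)] csupp_of_real[OF m(2)]] by blast
 have "\<bar>ker m (x + h) - ker m x\<bar> \<le> C * norm h / (1 + norm x) ^ N" if h: "2 * norm h \<le> norm x" for x h
 proof -
  have "(1 + norm x) ^ N * \<bar>ker m (x + h) - ker m x\<bar> \<le> (1 + norm x) ^ N * cmod (osc (\<lambda>\<xi>. cr (m \<xi>)) (x + h) - osc (\<lambda>\<xi>. cr (m \<xi>)) x)"
   by (intro mult_left_mono ker_diff_le_osc zero_le_power) auto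
  then have "(1 + norm x) ^ N * \<bar>ker m (x + h) - ker m x\<bar> \<le> C * norm h" using C(2)[OF h] by linarith
  then show ?thesis by (simp add: pos_le_divide_eq add_pos_nonneg mult.commute)
 qed
 then show ?thesis using C(1) by blast
qed

lemma smooth_csupp_integrable:
 fixes m :: "'a::euclidean_space => 'b::{euclidean_space}"
 shows "smooth m ==> csupp R m ==> L1 m"
 by (rule csupp_integrable[OF _ smooth_continuous])

lemma inverse_power_le_powr:
 fixes x :: "'a::euclidean_space"
 assumes "x \<noteq> 0" "e \<ge> 0" "e \<le> real N"
 shows "1 / (1 + norm x) ^ N \<le> norm x powr (- e)"
proof -
 have p: "norm x > 0" using assms by simp
 have "norm x powr e \<le> (1 + norm x) powr e" using assms by (intro powr_mono2) auto
 also have "... \<le> (1 + norm x) powr real N" using assms p by (intro powr_mono) auto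
 also have "... = (1 + norm x) ^ N" using p by (subst powr_realpow) (auto simp: add_pos_nonneg)
 finally have "1 / (1 + norm x) ^ N \<le> 1 / norm x powr e" using p by (intro divide_left_mono) (auto simp: add_pos_pos)
 then show ?thesis by (simp add: powr_minus divide_inverse)
qed

lemma nice_ker:
 fixes m :: "'a::euclidean_space => real"
 assumes m: "smooth m" "csupp R m"
 shows "nice (ker m)"
proof -
 obtain C where C: "C > 0" "\<And>x. \<bar>ker m x\<bar> \<le> C / (1 + norm x) ^ (DIM('a) + 1)"
  using ker_decay[OF m] by blast
 have im: "L1 m" by (rule smooth_csupp_integrable[OF m])
 show ?thesis
 proof (rule nice_decay[where a=1 and C=C and B="LINT \<xi>. \<bar>m \<xi>\<bar>"])
  show "ker m \<in> \<B>" by (rule borel_measurable_continuous_onI[OF continuous_ker[OF im]])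
  show "\<bar>ker m x\<bar> \<le> (LINT \<xi>. \<bar>m \<xi>\<bar>)" for x by (rule ker_bounded[OF im])
  fix x :: 'a assume "x \<noteq> 0"
  then have "1 / (1 + norm x) ^ (DIM('a) + 1) \<le> norm x powr (- (1 + real DIM('a)))" by (intro inverse_power_le_powr) auto
  then have "C * (1 / (1 + norm x) ^ (DIM('a) + 1)) \<le> C * norm x powr (- (1 + real DIM('a)))" using C(1) by (intro mult_left_mono) auto
  then show "\<bar>ker m x\<bar> \<le> C * norm x powr (- 1 - real DIM('a))" using C(2)[of x] by (simp add: algebra_simps)
 qed simp
qed

lemma schwartz_decay:
 assumes "schwartz \<phi>" shows "\<exists>C>0. \<forall>z. (1 + norm z) ^ M * cmod (\<phi> z) \<le> C"
proof -
 have "bounded (range (\<lambda>x. norm x ^ n *\<^sub>R \<phi> x))" for n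
  using assms unfolding schwartz_def by (auto simp: iter_deriv_def dest!: spec[of _ "[]"])
 then have "\<exists>B. \<forall>x. norm (norm x ^ n *\<^sub>R \<phi> x) \<le> B" for n unfolding bounded_iff by blast
 then obtain B where B: "\<And>n x. norm x ^ n * cmod (\<phi> x) \<le> B n" by (simp add: ) metis
 have "(1 + norm z) ^ M * cmod (\<phi> z) \<le> 2 ^ M * (B 0 + B M)" for z
 proof -
  have "(1 + norm z) ^ M \<le> (2 * max 1 (norm z)) ^ M" by (intro power_mono) auto
  also have "... = 2 ^ M * max 1 (norm z) ^ M" by (rule power_mult_distrib)
  also have "... \<le> 2 ^ M * (1 + norm z ^ M)" by (intro mult_left_mono) (auto simp: max_def)
  finally have "(1 + norm z) ^ M * cmod (\<phi> z) \<le> 2 ^ M * (1 + norm z ^ M) * cmod (\<phi> z)" by (rule mult_right_mono) simp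
  also have "... = 2 ^ M * (norm z ^ 0 * cmod (\<phi> z) + norm z ^ M * cmod (\<phi> z))" by (simp add: algebra_simps)
  also have "... \<le> 2 ^ M * (B 0 + B M)" by (intro mult_left_mono add_mono B) auto
  finally show ?thesis .
 qed
 then show ?thesis by (intro exI[of _ "max 1 (2 ^ M * (B 0 + B M))"]) (auto simp: le_max_iff_disj)
qed

lemma schwartz_continuous: "schwartz \<phi> ==> continuous_on UNIV \<phi>"
 unfolding schwartz_def by (blast intro: smooth_continuous)

lemma schwartz_weighted_nice:
 fixes \<phi> :: "'a::euclidean_space => complex"
 assumes \<phi>: "schwartz \<phi>" and e: "e \<ge> 0"
 shows "nice (\<lambda>z. cmod (\<phi> z) * (1 + norm z) powr e)"
proof -
 obtain M :: nat where M: "e + real DIM('a) + 1 \<le> real M" using real_arch_simple by blast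
 obtain C where C: "C > 0" "\<And>z. (1 + norm z) ^ M * cmod (\<phi> z) \<le> C" using schwartz_decay[OF \<phi>] by blast
 have [measurable]: "\<phi> \<in> \<B>" by (rule borel_measurable_continuous_onI[OF schwartz_continuous[OF \<phi>]])
 have le: "cmod (\<phi> z) * (1 + norm z) powr e \<le> C * (1 + norm z) powr (- (1 + real DIM('a)))" for z
 proof -
  have p: "1 + norm z > 0" by (simp add: add_pos_nonneg)
  have "cmod (\<phi> z) * (1 + norm z) powr e = ((1 + norm z) ^ M * cmod (\<phi> z)) * (1 + norm z) powr (e - real M)"
   using p by (simp add: powr_realpow[symmetric] powr_diff)
  also have "... \<le> C * (1 + norm z) powr (- (1 + real DIM('a)))"
   using M C by (intro mult_mono C powr_mono) auto
  finally show ?thesis .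
 qed
 show ?thesis
 proof (rule nice_decay[where a=1 and B=C and C=C])
  show "(\<lambda>z. cmod (\<phi> z) * (1 + norm z) powr e) \<in> \<B>" by measurable
  fix x :: 'a
  have "(1 + norm x) powr (- (1 + real DIM('a))) \<le> (1 + norm x) powr 0" by (intro powr_mono) auto
  then have "C * (1 + norm x) powr (- (1 + real DIM('a))) \<le> C * 1" using C(1) by (intro mult_left_mono) (auto simp: add_nonneg_eq_0_iff split: if_splits)
  then show "\<bar>cmod (\<phi> x) * (1 + norm x) powr e\<bar> \<le> C" using le[of x] by (simp add: abs_mult)
  assume "x \<noteq> 0"
  then have "(1 + norm x) powr (- (1 + real DIM('a))) \<le> norm x powr (- (1 + real DIM('a)))" by (intro powr_mono2') auto
  then have "C * (1 + norm x) powr (- (1 + real DIM('a))) \<le> C * norm x powr (- (1 + real DIM('a)))" using C(1) by (intro mult_left_mono) auto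
  then show "\<bar>cmod (\<phi> x) * (1 + norm x) powr e\<bar> \<le> C * norm x powr (- 1 - real DIM('a))" using le[of x] by (simp add: abs_mult algebra_simps)
 qed simp
qed

lemma schwartz_nice: "schwartz \<phi> ==> nice (\<lambda>z. cmod (\<phi> z))"
 using schwartz_weighted_nice[of \<phi> 0] by (simp add: add_nonneg_eq_0_iff split: if_splits)

lemma schwartz_integrable: "schwartz \<phi> ==> L1 \<phi>"
 using schwartz_nice[of \<phi>] borel_measurable_continuous_onI[OF schwartz_continuous[of \<phi>]]
 by (simp add: nice_def integrable_norm_iff)

section \<open>Multipliers acting on distributions\<close>

lemma osc_ker:
 assumes m: "L1 m" "\<And>\<xi>. m (- \<xi>) = m \<xi>"
 shows "(LINT \<xi>. ex (y \<bullet> \<xi>) * cr (m \<xi>)) = cr ((2 * pi) ^ DIM('a) * ker m (y::'a::euclidean_space))"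
 using ker_complex[OF m, of y] by (simp add: inv_fourier_def divide_simps)

text \<open>The transposed multiplier, which acts on test functions, is convolution with the kernel.\<close>

lemma fourier_mult_conv:
 fixes m :: "'a::euclidean_space => real" and \<phi> :: "'a => complex"
 assumes m: "L1 m" "\<And>\<xi>. m (- \<xi>) = m \<xi>" and \<phi>: "L1 \<phi>"
 shows "fourier (\<lambda>\<xi>. cr (m \<xi>) * inv_fourier \<phi> \<xi>) x = (LINT z. \<phi> z * cr (ker m (z - x)))"
  and "L1 (\<lambda>z. \<phi> z * cr (ker m (z - x)))"
proof -
 let ?c = "(2 * pi) ^ DIM('a)"
 have c: "?c > 0" by simp
 have [measurable]: "m \<in> \<B>" using m borel_measurable_integrable by auto
 have im: "L1 (\<lambda>\<xi>. ex ((- x) \<bullet> \<xi>) * cr (m \<xi>))"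
  using m by (intro osc_integrable) simp
 have inner: "(LINT \<xi>. ex (\<xi> \<bullet> z) * (ex ((- x) \<bullet> \<xi>) * cr (m \<xi>))) = cr (?c * ker m (z - x))" for z
 proof -
  have "(LINT \<xi>. ex (\<xi> \<bullet> z) * (ex ((- x) \<bullet> \<xi>) * cr (m \<xi>)))
   = (LINT \<xi>. ex ((z - x) \<bullet> \<xi>) * cr (m \<xi>))"
  proof (rule Bochner_Integration.integral_cong)
   fix \<xi>
   have "ex (\<xi> \<bullet> z) * ex ((- x) \<bullet> \<xi>) = ex ((z - x) \<bullet> \<xi>)"
    unfolding exp_add[symmetric] by (simp add: inner_diff_left inner_diff_right inner_commute right_diff_distrib)
   then show "ex (\<xi> \<bullet> z) * (ex ((- x) \<bullet> \<xi>) * cr (m \<xi>)) = ex ((z - x) \<bullet> \<xi>) * cr (m \<xi>)"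
    by (simp only: mult.assoc[symmetric])
  qed simp
  then show ?thesis using osc_ker[OF m, of "z - x"] by simp
 qed
 note F = osc_fubini[OF im \<phi>, of "\<lambda>\<xi> z. \<xi> \<bullet> z", unfolded inner]
 have M: "(\<lambda>(\<xi>, z). \<xi> \<bullet> z) \<in> borel_measurable (borel \<Otimes>\<^sub>M (borel :: 'a measure))" by measurable
 have "fourier (\<lambda>\<xi>. cr (m \<xi>) * inv_fourier \<phi> \<xi>) x = (LINT \<xi>. cr (1 / ?c) * (ex ((- x) \<bullet> \<xi>) * cr (m \<xi>) * (LINT z. ex (\<xi> \<bullet> z) * \<phi> z)))"
  unfolding fourier_osc osc_def inv_fourier_def by (simp add: mult_ac)
 also have "... = cr (1 / ?c) * (LINT z. \<phi> z * cr (?c * ker m (z - x)))"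
  by (subst integral_mult_right_zero) (simp only: F(1)[OF M])
 also have "... = cr (1 / ?c) * (LINT z. cr ?c * (\<phi> z * cr (ker m (z - x))))"
  by (simp only: of_real_mult mult_ac)
 also have "... = cr (1 / ?c) * (cr ?c * (LINT z. \<phi> z * cr (ker m (z - x))))"
  by (simp only: integral_mult_right_zero)
 also have "... = cr (1 / ?c * ?c) * (LINT z. \<phi> z * cr (ker m (z - x)))"
  by (simp only: of_real_mult mult.assoc)
 also have "1 / ?c * ?c = 1" using c by simp
 finally show "fourier (\<lambda>\<xi>. cr (m \<xi>) * inv_fourier \<phi> \<xi>) x = (LINT z. \<phi> z * cr (ker m (z - x)))" by simp
 have "L1 (\<lambda>z. cr (1 / ?c) * (\<phi> z * cr (?c * ker m (z - x))))"
  using F(2)[OF M] by (rule integrable_mult_right)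
 moreover have "(\<lambda>z. cr (1 / ?c) * (\<phi> z * cr (?c * ker m (z - x)))) = (\<lambda>z. \<phi> z * cr (ker m (z - x)))"
  using c by (auto simp: fun_eq_iff)
 ultimately show "L1 (\<lambda>z. \<phi> z * cr (ker m (z - x)))" by simp
qed

text \<open>The kernel of a smooth symbol is a Schwartz function, up to a constant the Fourier transform of the symbol.
 Inversion gives the symbol back, and convolution with the other kernel multiplies it by the other symbol.\<close>

lemma conv_ker_ker:
 fixes m1 m2 :: "'a::euclidean_space => real"
 assumes m1: "L1 m1" "\<And>\<xi>. m1 (- \<xi>) = m1 \<xi>"
  and m2: "smooth m2" "csupp R m2" "\<And>\<xi>. m2 (- \<xi>) = m2 \<xi>" and z: "\<And>\<xi>. m1 \<xi> * m2 \<xi> = 0"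
 shows "conv (ker m1) (ker m2) x = 0"
proof -
 let ?c = "(2 * pi) ^ DIM('a)"
 let ?M = "\<lambda>\<xi>. cr (m2 \<xi>)"
 have i2: "L1 m2" by (rule smooth_csupp_integrable[OF m2(1,2)])
 have iM: "L1 ?M" using i2 by simp
 have sM: "smooth ?M" "csupp R ?M" using m2 by (auto intro: smooth_of_real csupp_of_real)
 have nk: "nice (ker m2)" by (rule nice_ker[OF m2(1,2)])
 have iF: "L1 (fourier ?M)" by (rule schwartz_integrable[OF schwartz_fourier[OF sM]])
 obtain B where B: "\<And>x. cmod (?M x) \<le> B * ind (cball 0 R) x" "B > 0" using csupp_bounded[OF sM(2) smooth_continuous[OF sM(1)]] by blast
 have B': "cmod (?M x) \<le> B" for x using B(1)[of x] B(2) by (cases "x \<in> cball 0 R") auto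
 have ke: "cr (ker m2 y) = inv_fourier ?M y" for y using ker_complex[OF i2 m2(3)] by simp
 have kf: "(\<lambda>y. cr (ker m2 y)) = (\<lambda>y. cr (1 / ?c) * fourier ?M y)"
 proof
  fix y
  have "cr (ker m2 y) = cr (ker m2 (- y))" using ker_even[OF i2 m2(3), of y] by simp
  then show "cr (ker m2 y) = cr (1 / ?c) * fourier ?M y"
   unfolding ke by (simp add: inv_fourier_osc fourier_osc)
 qed
 have "inv_fourier (\<lambda>y. cr (ker m2 y)) \<xi> = cr (1 / ?c) * inv_fourier (fourier ?M) \<xi>" for \<xi>
  unfolding kf inv_fourier_osc osc_def by (simp add: mult.left_commute)
 then have inv: "inv_fourier (\<lambda>y. cr (ker m2 y)) \<xi> = cr (1 / ?c) * ?M \<xi>" for \<xi>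
  using fourier_inversion[OF smooth_continuous[OF sM(1)] B' iM iF] by simp
 have "(LINT z. cr (ker m2 z) * cr (ker m1 (z - x))) = fourier (\<lambda>\<xi>. cr (m1 \<xi>) * inv_fourier (\<lambda>y. cr (ker m2 y)) \<xi>) x"
  using nk by (intro fourier_mult_conv(1)[OF m1, symmetric]) simp
 also have "(\<lambda>\<xi>. cr (m1 \<xi>) * inv_fourier (\<lambda>y. cr (ker m2 y)) \<xi>) = (\<lambda>\<xi>. 0)"
 proof
  fix \<xi>
  have "cr (m1 \<xi>) * (cr (1 / ?c) * ?M \<xi>) = cr (1 / ?c) * cr (m1 \<xi> * m2 \<xi>)" by simp
  then show "cr (m1 \<xi>) * inv_fourier (\<lambda>y. cr (ker m2 y)) \<xi> = 0" unfolding inv by (simp add: z)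
 qed
 finally have "cr (LINT z. ker m2 z * ker m1 (z - x)) = 0"
  by (simp add: fourier_def flip: of_real_mult)
 moreover have "ker m1 (z - x) = ker m1 (x - z)" for z using ker_even[OF m1, of "x - z"] by simp
 ultimately show ?thesis by (simp add: conv_def mult.commute)
qed

lemma norm_powr_csupp_integrable:
 fixes m :: "'a::euclidean_space => real"
 assumes m: "smooth m" "csupp R m" and s: "s > 0"
 shows "L1 (\<lambda>\<xi>. norm \<xi> powr s * m \<xi>)" "continuous_on UNIV (\<lambda>\<xi>. norm \<xi> powr s * m \<xi>)"
proof -
 show c: "continuous_on UNIV (\<lambda>\<xi>. norm \<xi> powr s * m \<xi>)"
  using s by (intro continuous_on_mult smooth_continuous[OF m(1)] continuous_on_powr' continuous_intros) auto
 show "L1 (\<lambda>\<xi>. norm \<xi> powr s * m \<xi>)"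
  by (rule csupp_integrable[OF _ c, of R]) (use m(2) in \<open>auto simp: csupp_def\<close>)
qed

text \<open>The weight $(1+|x|)^{-e}$ changes under translation by at most a factor independent of the base point.\<close>

lemma weight_submult:
 fixes x z :: "'a::real_normed_vector"
 assumes "e \<ge> 0"
 shows "(1 + norm (z - x)) powr (- e) \<le> (1 + norm z) powr e * (1 + norm x) powr (- e)"
proof -
 have n: "norm x \<le> norm z + norm (z - x)" using norm_triangle_ineq4[of z "z - x"] by simp
 have "1 + norm x \<le> (1 + norm z) * (1 + norm (z - x))"
 proof -
  have "(1 + norm z) * (1 + norm (z - x)) = 1 + norm z + norm (z - x) + norm z * norm (z - x)" by (simp add: algebra_simps)
  moreover have "0 \<le> norm z * norm (z - x)" by simp
  ultimately show ?thesis using n by linarith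
 qed
 then have "(1 + norm x) powr e \<le> ((1 + norm z) * (1 + norm (z - x))) powr e" using assms by (intro powr_mono2) auto
 also have "... = (1 + norm z) powr e * (1 + norm (z - x)) powr e" by (rule powr_mult)
 finally have "(1 + norm x) powr e / (1 + norm (z - x)) powr e \<le> (1 + norm z) powr e"
  by (simp add: divide_le_eq add_pos_nonneg)
 then have "(1 + norm (z - x)) powr (- e) * (1 + norm x) powr e \<le> (1 + norm z) powr e"
  by (simp add: powr_minus divide_inverse mult.commute)
 moreover have "(1 + norm x) powr e > 0" by (simp add: add_pos_nonneg add_nonneg_eq_0_iff)
 ultimately show ?thesis by (simp add: powr_minus divide_inverse[symmetric] pos_le_divide_eq)
qed

text \<open>The multiplier $|\xi|^sm(\xi)$ acts on the test function as convolution with \<open>K\<close>; Fubini's theorem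
 moves it to \<open>f\<close>. Absolute convergence: \<open>K\<close> decays only polynomially, but its decay is
 exactly what the weighted integrability of \<open>f\<close> compensates, and the test function absorbs the
 growth caused by translation.\<close>

lemma multiplier_represents:
 fixes m :: "'a::euclidean_space => real" and f :: "'a => complex" and s e C :: real
 defines "K \<equiv> ker (\<lambda>\<xi>. norm \<xi> powr s * m \<xi>)"
 assumes m: "smooth m" "csupp R m" "\<And>\<xi>. m (- \<xi>) = m \<xi>" and s: "s > 0"
  and K: "\<And>y. \<bar>K y\<bar> \<le> C * (1 + norm y) powr (- e)" and e: "e \<ge> 0"
  and f[measurable]: "f \<in> \<B>" and fw: "L1 (\<lambda>x. cmod (f x) * (1 + norm x) powr (- e))"
 shows "represents (fourier_multiplier m (Dpow s (distr_of f))) (\<lambda>z. LINT x. cr (K (z - x)) * f x)"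
proof -
 let ?ms = "\<lambda>\<xi>. norm \<xi> powr s * m \<xi>"
 have im: "L1 m" by (rule smooth_csupp_integrable[OF m(1,2)])
 note ims = norm_powr_csupp_integrable(1)[OF m(1,2) s]
 have mse: "?ms (- \<xi>) = ?ms \<xi>" for \<xi> using m(3) by simp
 have [measurable]: "K \<in> \<B>" unfolding K_def by (rule borel_measurable_continuous_onI[OF continuous_ker[OF ims]])
 have [measurable]: "(\<lambda>z. LINT x. cr (K (z - x)) * f x) \<in> \<B>"
  by (intro lborel.borel_measurable_lebesgue_integral) measurable
 show ?thesis unfolding represents_def
 proof (intro conjI allI impI)
  fix \<phi> :: "'a => complex" assume \<phi>: "schwartz \<phi>"
  have i\<phi>: "L1 \<phi>" by (rule schwartz_integrable[OF \<phi>])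
  have [measurable]: "\<phi> \<in> \<B>" by (rule borel_measurable_continuous_onI[OF schwartz_continuous[OF \<phi>]])
  let ?f = "\<lambda>x. cmod (f x) * (1 + norm x) powr (- e)" and ?p = "\<lambda>z. cmod (\<phi> z) * (1 + norm z) powr e"
  let ?h = "\<lambda>x z. f x * (\<phi> z * cr (K (z - x)))"
  let ?c = "conv (\<lambda>y. \<bar>ker m y\<bar>) (\<lambda>z. cmod (\<phi> z))"
  let ?D = "fourier_multiplier m (Dpow s (distr_of f)) \<phi>"
  define g where "g \<xi> = cr (m \<xi>) * inv_fourier \<phi> \<xi>" for \<xi>
  have cinv: "continuous_on UNIV (inv_fourier \<phi>)"
   unfolding inv_fourier_osc[abs_def] by (intro continuous_on_mult continuous_on_const continuous_osc i\<phi>)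
  have gc: "continuous_on UNIV g" unfolding g_def[abs_def]
   by (intro continuous_on_mult continuous_on_of_real smooth_continuous[OF m(1)] cinv)
  have gs: "csupp R g" using m(2) by (auto simp: g_def csupp_def)
  have ig: "L1 g" by (rule csupp_integrable[OF gs gc])
  obtain B where B: "\<And>x. cmod (g x) \<le> B * ind (cball 0 R) x" "B > 0" using csupp_bounded[OF gs gc] by blast
  have B': "cmod (g x) \<le> B" for x using B(1)[of x] B(2) by (cases "x \<in> cball 0 R") auto
  have Fg: "fourier g x = (LINT z. \<phi> z * cr (ker m (z - x)))" for x
   unfolding g_def[abs_def] by (rule fourier_mult_conv(1)[OF im m(3) i\<phi>])
  have "L1 (fourier g)"
  proof (rule Bochner_Integration.integrable_bound)
   have "nice (?c)"
    using nice_ker[OF m(1,2)] schwartz_nice[OF \<phi>] by (intro conv_nice) (auto simp: nice_def)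
   then show "L1 (?c)" by simp
   show "fourier g \<in> borel_measurable lborel"
    using ig continuous_osc[OF ig] unfolding fourier_osc[abs_def]
    by (simp add: borel_measurable_continuous_onI continuous_on_compose2[OF continuous_osc[OF ig]] continuous_intros)
   show "AE x in lborel. cmod (fourier g x) \<le> norm (?c x)"
   proof (rule AE_I2)
    fix x
    have "cmod (fourier g x) \<le> (LINT z. cmod (\<phi> z * cr (ker m (z - x))))"
     unfolding Fg by (rule integral_norm_bound)
    also have "... = ?c x"
     unfolding conv_def
    proof (rule Bochner_Integration.integral_cong)
     fix z
     have "ker m (z - x) = ker m (x - z)" using ker_even[OF im m(3), of "x - z"] by simp
     then show "cmod (\<phi> z * cr (ker m (z - x))) = \<bar>ker m (x - z)\<bar> * cmod (\<phi> z)" by (simp add: norm_mult)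
    qed simp
    finally show "cmod (fourier g x) \<le> norm (?c x)" by simp
   qed
  qed
  then have inv: "inv_fourier (fourier g) \<xi> = g \<xi>" for \<xi> by (rule fourier_inversion[OF gc B' ig])
  have T: "?D = (LINT x. f x * (LINT z. \<phi> z * cr (K (z - x))))"
  proof -
   have "?D = distr_of f (fourier (\<lambda>\<xi>. cr (norm \<xi> powr s) * inv_fourier (fourier g) \<xi>))"
    by (simp add: fourier_multiplier_def Dpow_def distr_inv_fourier_def distr_mult_def distr_fourier_def g_def[abs_def])
   also have "(\<lambda>\<xi>. cr (norm \<xi> powr s) * inv_fourier (fourier g) \<xi>) = (\<lambda>\<xi>. cr (?ms \<xi>) * inv_fourier \<phi> \<xi>)"
    unfolding inv by (auto simp: g_def)
   also have "distr_of f (fourier (\<lambda>\<xi>. cr (?ms \<xi>) * inv_fourier \<phi> \<xi>)) = (LINT x. f x * (LINT z. \<phi> z * cr (K (z - x))))"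
    unfolding distr_of_def K_def by (simp only: fourier_mult_conv(1)[OF ims mse i\<phi>])
   finally show ?thesis .
  qed
  have I: "integrable (lborel \<Otimes>\<^sub>M lborel) (\<lambda>(x, z). ?h x z)"
  proof (rule Bochner_Integration.integrable_bound)
   show "integrable (lborel \<Otimes>\<^sub>M lborel) (\<lambda>(x, z). C * (?f x * ?p z))"
   proof (rule lborel_pair.Fubini_integrable)
    have G: "L1 (\<lambda>z. ?p z)" using schwartz_weighted_nice[OF \<phi> e] by simp
    show "AE x in lborel. L1 (\<lambda>z. case (x, z) of (x, z) => C * (?f x * ?p z))"
     using G by (intro AE_I2) (auto intro!: integrable_mult_right simp del: integrable_mult_right_iff)
    have "L1 (\<lambda>x. (\<bar>C\<bar> * (LINT z. ?p z)) * ?f x)"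
     using fw by (rule integrable_mult_right)
    then show "L1 (\<lambda>x. LINT z. norm (case (x, z) of (x, z) => C * (?f x * ?p z)))"
    proof -
     have "(LINT z. norm (C * (?f x * ?p z))) = (\<bar>C\<bar> * (LINT z. ?p z)) * ?f x" for x
     proof -
      have "(LINT z. norm (C * (?f x * ?p z))) = (LINT z. (\<bar>C\<bar> * ?f x) * ?p z)"
       by (intro Bochner_Integration.integral_cong) (auto simp: abs_mult)
      also have "... = (\<bar>C\<bar> * ?f x) * (LINT z. ?p z)"
       by (rule integral_mult_right_zero)
      finally show ?thesis by (simp only: mult_ac)
     qed
     with \<open>L1 (\<lambda>x. (\<bar>C\<bar> * _) * _)\<close> show ?thesis by simp
    qed
   qed measurable
   show "(\<lambda>(x, z). ?h x z) \<in> borel_measurable (lborel \<Otimes>\<^sub>M lborel)" by measurable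
   show "AE w in lborel \<Otimes>\<^sub>M lborel. norm (case w of (x, z) => ?h x z) \<le> norm (case w of (x, z) => C * (?f x * ?p z))"
   proof (rule AE_I2, clarify)
    fix x z
    have C0: "C \<ge> 0" using K[of 0] by simp
    have "\<bar>K (z - x)\<bar> \<le> C * ((1 + norm z) powr e * (1 + norm x) powr (- e))"
     using K[of "z - x"] mult_left_mono[OF weight_submult[OF e, of z x] C0] by linarith
    then have "cmod (f x) * (cmod (\<phi> z) * \<bar>K (z - x)\<bar>) \<le> cmod (f x) * (cmod (\<phi> z) * (C * ((1 + norm z) powr e * (1 + norm x) powr (- e))))"
     by (intro mult_left_mono) auto
    then show "norm (?h x z) \<le> norm (C * (?f x * ?p z))"
     using C0 by (simp add: norm_mult abs_mult mult_ac)
   qed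
  qed
  have sw: "(LINT x. ?h x z) = (LINT x. cr (K (z - x)) * f x) * \<phi> z" for z
   by (subst integral_mult_left_zero[symmetric]) (simp only: mult_ac)
  have "L1 (\<lambda>z. LINT x. ?h x z)"
   using lborel_pair.integrable_snd[OF I] by simp
  then show "L1 (\<lambda>z. (LINT x. cr (K (z - x)) * f x) * \<phi> z)" by (simp only: sw)
  have "?D = (LINT x. LINT z. ?h x z)"
   unfolding T by simp
  also have "... = (LINT z. LINT x. ?h x z)"
   using lborel_pair.Fubini_integral[OF I] by simp
  finally show "?D = distr_of (\<lambda>z. LINT x. cr (K (z - x)) * f x) \<phi>"
   unfolding distr_of_def by (simp only: sw)
 qed simp
qed

text \<open>The hypothesis is applied to the Schwartz function $z\mapsto$ \<open>ker b\<close>$(x-z)$. It is the Fourier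
 transform of $e^{ix\cdot\xi}b(\xi)/(2\pi)^d$, so that $D^s$ multiplies the symbol \<open>b\<close> by $|\xi|^s$.\<close>

lemma representation_identity:
 fixes b :: "'a::euclidean_space => real" and u v :: "'a => complex"
 assumes b: "smooth b" "csupp R b" "\<And>\<xi>. b (- \<xi>) = b \<xi>" and s: "s > 0"
  and rep: "represents (Dpow s (distr_of u)) v"
 shows "(LINT z. u z * cr (ker (\<lambda>\<xi>. norm \<xi> powr s * b \<xi>) (x - z))) = (LINT z. v z * cr (ker b (x - z)))"
proof -
 let ?c = "cr (1 / (2 * pi) ^ DIM('a))"
 let ?bs = "\<lambda>\<xi>. norm \<xi> powr s * b \<xi>"
 define a where "a \<xi> = ?c * (ex (x \<bullet> \<xi>) * cr (b \<xi>))" for \<xi>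
 have as: "smooth a" unfolding a_def[abs_def] by (intro smooth_mult smooth_const smooth_iexp smooth_of_real b)
 have ac: "csupp R a" using b(2) by (simp add: csupp_def a_def)
 have ib: "L1 b" by (rule smooth_csupp_integrable[OF b(1,2)])
 note ibs = norm_powr_csupp_integrable(1)[OF b(1,2) s]
 have bse: "?bs (- \<xi>) = ?bs \<xi>" for \<xi> using b(3) by simp
 have ia: "L1 a" by (rule smooth_csupp_integrable[OF as ac])
 have key: "fourier (\<lambda>\<xi>. ?c * (ex (x \<bullet> \<xi>) * cr (m \<xi>))) z = cr (ker m (x - z))"
  if m: "L1 m" "\<And>\<xi>. m (- \<xi>) = m \<xi>" for m :: "'a => real" and z
 proof -
  have "fourier (\<lambda>\<xi>. ?c * (ex (x \<bullet> \<xi>) * cr (m \<xi>))) z = (LINT \<xi>. ?c * (ex ((x - z) \<bullet> \<xi>) * cr (m \<xi>)))"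
   unfolding fourier_def
  proof (rule Bochner_Integration.integral_cong)
   fix \<xi>
   have "exp (- (\<i> * cr (\<xi> \<bullet> z))) * ex (x \<bullet> \<xi>) = ex ((x - z) \<bullet> \<xi>)"
    unfolding exp_add[symmetric] by (simp add: inner_diff_left inner_diff_right inner_commute right_diff_distrib)
   moreover have "A * (k * (B * D)) = k * ((A * B) * D)" for A k B D :: complex by (simp only: mult_ac)
   ultimately show "exp (- (\<i> * cr (\<xi> \<bullet> z))) * (?c * (ex (x \<bullet> \<xi>) * cr (m \<xi>))) = ?c * (ex ((x - z) \<bullet> \<xi>) * cr (m \<xi>))"
    by (simp only:)
  qed simp
  also have "... = inv_fourier (\<lambda>\<xi>. cr (m \<xi>)) (x - z)" unfolding inv_fourier_def by (simp only: integral_mult_right_zero)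
  also have "... = cr (ker m (x - z))" by (rule ker_complex[OF m])
  finally show ?thesis .
 qed
 have \<phi>: "fourier a = (\<lambda>z. cr (ker b (x - z)))"
  unfolding a_def[abs_def] by (rule ext) (rule key[OF ib b(3)])
 have sch: "schwartz (fourier a)" by (rule schwartz_fourier[OF as ac])
 obtain B where B: "\<And>x. cmod (a x) \<le> B * ind (cball 0 R) x" "B > 0" using csupp_bounded[OF ac smooth_continuous[OF as]] by blast
 have B': "cmod (a x) \<le> B" for x using B(1)[of x] B(2) by (cases "x \<in> cball 0 R") auto
 have inv: "inv_fourier (fourier a) \<xi> = a \<xi>" for \<xi>
  by (rule fourier_inversion[OF smooth_continuous[OF as] B' ia schwartz_integrable[OF sch]])
 have "Dpow s (distr_of u) (fourier a) = distr_of v (fourier a)"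
  using rep sch unfolding represents_def by blast
 moreover have "Dpow s (distr_of u) (fourier a) = distr_of u (fourier (\<lambda>\<xi>. cr (norm \<xi> powr s) * a \<xi>))"
  by (simp add: fourier_multiplier_def Dpow_def distr_inv_fourier_def distr_mult_def distr_fourier_def inv)
 moreover have "fourier (\<lambda>\<xi>. cr (norm \<xi> powr s) * a \<xi>) = (\<lambda>z. cr (ker ?bs (x - z)))"
 proof (rule ext)
  fix z
  have "(\<lambda>\<xi>. cr (norm \<xi> powr s) * a \<xi>) = (\<lambda>\<xi>. ?c * (ex (x \<bullet> \<xi>) * cr (?bs \<xi>)))"
   by (auto simp: a_def fun_eq_iff mult_ac)
  then show "fourier (\<lambda>\<xi>. cr (norm \<xi> powr s) * a \<xi>) z = cr (ker ?bs (x - z))"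
   using key[OF ibs bse] by simp
 qed
 ultimately show ?thesis by (simp add: \<phi> distr_of_def)
qed

section \<open>Almost orthogonality\<close>

lemma orth_sum_sq:
 fixes w :: "'i => 'a::euclidean_space => real"
 assumes I: "finite I" and w: "\<And>k. k \<in> I ==> nice (w k)"
  and orth: "\<And>j k. j \<in> I ==> k \<in> I ==> j \<noteq> k ==> (LINT x. w j x * w k x) = 0"
 shows "(LINT x. (\<Sum>k\<in>I. w k x)\<^sup>2) = (\<Sum>k\<in>I. LINT x. (w k x)\<^sup>2)"
proof -
 have "(LINT x. (\<Sum>k\<in>I. w k x)\<^sup>2) = (LINT x. (\<Sum>j\<in>I. \<Sum>k\<in>I. w j x * w k x))"
  by (simp add: power2_eq_square sum_product)
 also have "... = (\<Sum>j\<in>I. \<Sum>k\<in>I. LINT x. w j x * w k x)"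
  using w by (subst Bochner_Integration.integral_sum) (auto intro!: Bochner_Integration.integrable_sum sum.cong Bochner_Integration.integral_sum nice_integrable nice_mult nice_sum)
 also have "... = (\<Sum>j\<in>I. \<Sum>k\<in>I. if k = j then LINT x. (w j x)\<^sup>2 else 0)"
  using orth by (intro sum.cong refl) (auto simp: power2_eq_square)
 also have "... = (\<Sum>k\<in>I. LINT x. (w k x)\<^sup>2)" using I by simp
 finally show ?thesis .
qed

lemma young_L2:
 fixes K f :: "'a::euclidean_space => real"
 assumes K: "nice K" and f: "nice f" and b: "(LINT x. \<bar>K x\<bar>) \<le> b"
 shows "(LINT x. (conv K f x)\<^sup>2) \<le> b\<^sup>2 * (LINT x. (f x)\<^sup>2)"
proof -
 have i: "L1 (\<lambda>x. (conv K f x)\<^sup>2)" "L1 (\<lambda>x. (f x)\<^sup>2)"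
  using nice_mult[OF conv_nice[OF K f] conv_nice[OF K f]] nice_mult[OF f f] by (auto simp: power2_eq_square)
 have "en (LINT x. (conv K f x)\<^sup>2) \<le> en ((LINT x. \<bar>K x\<bar>)\<^sup>2 * (LINT x. (f x)\<^sup>2))"
  using nn_young_L2[OF K f] i by (simp add: nn_integral_eq_integral ennreal_mult)
 then have "(LINT x. (conv K f x)\<^sup>2) \<le> (LINT x. \<bar>K x\<bar>)\<^sup>2 * (LINT x. (f x)\<^sup>2)"
  by (subst (asm) ennreal_le_iff) auto
 also have "... \<le> b\<^sup>2 * (LINT x. (f x)\<^sup>2)"
  using b by (intro mult_right_mono power_mono) auto
 finally show ?thesis .
qed

text \<open>Since the pieces are orthogonal, signs do not matter. The sum of their squared norms is the pairing of
 \<open>g\<close> with $\sum_k\psi_k*\psi_k*g$, whose pieces are orthogonal again and bounded by those of the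
 first sum.\<close>

lemma orthogonal_family_L2:
 fixes \<psi> :: "nat => 'a::euclidean_space => real" and \<epsilon> :: "nat => real"
 assumes I: "finite I" and \<psi>: "\<And>k. nice (\<psi> k)" "\<And>k x. \<psi> k (- x) = \<psi> k x" "\<And>k. (LINT x. \<bar>\<psi> k x\<bar>) \<le> b" and b: "b > 0"
  and orth: "\<And>j k x. j \<in> I ==> k \<in> I ==> j \<noteq> k ==> conv (\<psi> j) (\<psi> k) x = 0"
  and \<epsilon>: "\<And>k. (\<epsilon> k)\<^sup>2 = 1" and g: "nice g"
 shows "(LINT x. (\<Sum>k\<in>I. \<epsilon> k * conv (\<psi> k) g x)\<^sup>2) \<le> b\<^sup>2 * (LINT x. (g x)\<^sup>2)"
proof -
 define w where "w k = conv (\<psi> k) g" for k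
 have w: "nice (w k)" for k unfolding w_def by (rule conv_nice[OF \<psi>(1) g])
 have cc: "conv (\<psi> j) (conv (\<psi> k) h) x = 0" if "j \<in> I" "k \<in> I" "j \<noteq> k" "nice h" for j k h x
  using conv_assoc[OF \<psi>(1) \<psi>(1) that(4), of j k x] orth[OF that(1-3)] by (simp add: conv_def)
 have o1: "(LINT x. w j x * w k x) = 0" if "j \<in> I" "k \<in> I" "j \<noteq> k" for j k
  unfolding w_def[of j] using conv_adjoint[OF \<psi>(1,2) g w, of j k] cc[OF that g] by (simp add: w_def)
 have "(LINT x. (\<Sum>k\<in>I. \<epsilon> k * w k x)\<^sup>2) = (\<Sum>k\<in>I. LINT x. (\<epsilon> k * w k x)\<^sup>2)"
 proof (rule orth_sum_sq[OF I])
  show "nice (\<lambda>x. \<epsilon> k * w k x)" for k by (rule nice_cmult[OF w])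
  fix j k assume jk: "j \<in> I" "k \<in> I" "j \<noteq> k"
  have "(\<lambda>x. \<epsilon> j * w j x * (\<epsilon> k * w k x)) = (\<lambda>x. (\<epsilon> j * \<epsilon> k) * (w j x * w k x))" by (auto simp: fun_eq_iff)
  then show "(LINT x. \<epsilon> j * w j x * (\<epsilon> k * w k x)) = 0" using o1[OF jk] by simp
 qed
 also have "... = (\<Sum>k\<in>I. LINT x. (w k x)\<^sup>2)" by (simp add: power_mult_distrib \<epsilon>)
 finally have e1: "(LINT x. (\<Sum>k\<in>I. \<epsilon> k * w k x)\<^sup>2) = (\<Sum>k\<in>I. LINT x. (w k x)\<^sup>2)" .
 define A where "A = (\<Sum>k\<in>I. LINT x. (w k x)\<^sup>2)"
 define H where "H x = (\<Sum>k\<in>I. conv (\<psi> k) (w k) x)" for x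
 have cw: "nice (conv (\<psi> k) (w k))" for k by (rule conv_nice[OF \<psi>(1) w])
 have nH: "nice H" unfolding H_def[abs_def] by (rule nice_sum[OF cw])
 have "A = (\<Sum>k\<in>I. LINT x. g x * conv (\<psi> k) (w k) x)"
  unfolding A_def power2_eq_square
 proof (intro sum.cong refl)
  fix k show "(LINT x. w k x * w k x) = (LINT x. g x * conv (\<psi> k) (w k) x)"
   using conv_adjoint[OF \<psi>(1,2) g w, of k k] by (simp add: w_def[of k, symmetric])
 qed
 also have "... = (LINT x. g x * H x)"
  unfolding H_def sum_distrib_left by (intro Bochner_Integration.integral_sum[symmetric] nice_integrable nice_mult g cw)
 finally have A1: "A = (LINT x. g x * H x)" .
 have "(LINT x. (H x)\<^sup>2) = (\<Sum>k\<in>I. LINT x. (conv (\<psi> k) (w k) x)\<^sup>2)"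
  unfolding H_def
 proof (rule orth_sum_sq[OF I cw])
  fix j k assume jk: "j \<in> I" "k \<in> I" "j \<noteq> k"
  have "(LINT x. conv (\<psi> j) (w j) x * conv (\<psi> k) (w k) x) = (LINT x. w j x * conv (\<psi> j) (conv (\<psi> k) (w k)) x)"
   by (rule conv_adjoint[OF \<psi>(1,2) w cw])
  also have "... = 0" using cc[OF jk w] by simp
  finally show "(LINT x. conv (\<psi> j) (w j) x * conv (\<psi> k) (w k) x) = 0" .
 qed
 also have "... \<le> (\<Sum>k\<in>I. b\<^sup>2 * (LINT x. (w k x)\<^sup>2))"
  by (intro sum_mono young_L2 \<psi> w)
 finally have H2: "(LINT x. (H x)\<^sup>2) \<le> b\<^sup>2 * A" by (simp add: A_def sum_distrib_left)
 have i2: "L1 (\<lambda>x. (g x)\<^sup>2)" "L1 (\<lambda>x. (H x)\<^sup>2)" "L1 (\<lambda>x. g x * H x)"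
  using nice_mult[OF g g] nice_mult[OF nH nH] nice_mult[OF g nH] by (auto simp: power2_eq_square)
 have "A \<le> (LINT x. b\<^sup>2 / 2 * (g x)\<^sup>2 + 1 / (2 * b\<^sup>2) * (H x)\<^sup>2)"
  unfolding A1
 proof (rule integral_mono)
  fix x
  have "0 \<le> (b * g x - H x / b)\<^sup>2" by simp
  also have "... = b\<^sup>2 * (g x)\<^sup>2 - 2 * (g x * H x) + (H x)\<^sup>2 / b\<^sup>2"
   using b by (simp add: power2_diff power_mult_distrib power_divide)
  finally show "g x * H x \<le> b\<^sup>2 / 2 * (g x)\<^sup>2 + 1 / (2 * b\<^sup>2) * (H x)\<^sup>2" by (simp add: field_simps)
 qed (use i2 in auto)
 also have "... = b\<^sup>2 / 2 * (LINT x. (g x)\<^sup>2) + 1 / (2 * b\<^sup>2) * (LINT x. (H x)\<^sup>2)"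
  using i2 by simp
 also have "... \<le> b\<^sup>2 / 2 * (LINT x. (g x)\<^sup>2) + 1 / (2 * b\<^sup>2) * (b\<^sup>2 * A)"
  using H2 by (intro add_left_mono mult_left_mono) auto
 also have "1 / (2 * b\<^sup>2) * (b\<^sup>2 * A) = A / 2" using b by simp
 finally have "A \<le> b\<^sup>2 * (LINT x. (g x)\<^sup>2)" by simp
 then show ?thesis using e1 by (simp add: A_def w_def)
qed

section \<open>Littlewood-Paley kernels\<close>

lemma norm_LINT_le:
 fixes f :: "'b => 'c::{banach, second_countable_topology}"
 shows "en (norm (LINT x|M. f x)) \<le> (\<integral>\<^sup>+x. en (norm (f x)) \<partial>M)"
proof (cases "integrable M f")
 case True
 then show ?thesis by (rule integral_norm_bound_ennreal)
qed (simp add: not_integrable_integral_eq)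

text \<open>At distance less than $1/c$ the bound is $Ac^d$ times the indicator of a ball; beyond, it is at most
 $A|y|^{-d-1}/c$ and is cut into dyadic shells.\<close>

lemma kernel_le_mx:
 "\<exists>C>0. \<forall>(K :: 'a::euclidean_space => real) A c f x. c > 0 --> A \<ge> 0 --> f \<in> \<B> --> K \<in> \<B> -->
  (\<forall>y. \<bar>K y\<bar> \<le> A * c ^ DIM('a) / (1 + c * norm y) ^ (DIM('a) + 1)) -->
  (\<integral>y. en \<bar>K (x - y)\<bar> * f y) \<le> en (C * A) * mx f x"
proof -
 obtain Cf where Cf: "Cf > 0" "\<And>f \<rho> (x::'a). f \<in> \<B> ==> \<rho> > 0 ==>
  (\<integral>z. en (dist x z powr (- 1 - DIM('a))) * ind (- ball x \<rho>) z * f z) \<le> en (Cf * \<rho> powr (- 1)) * mx f x"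
  using mx_far[of 1, where 'a='a] by auto
 define w where "w = ubv TYPE('a)"
 have w: "w > 0" by (simp add: w_def ubv_pos)
 show ?thesis
 proof (intro exI[of _ "w + Cf"] conjI allI impI)
  show "w + Cf > 0" using w Cf by simp
  fix K :: "'a => real" and A c :: real and f :: "'a => ennreal" and x :: 'a
  assume c: "c > 0" and A: "A \<ge> 0" and [measurable]: "f \<in> \<B>" "K \<in> \<B>"
   and K: "\<forall>y. \<bar>K y\<bar> \<le> A * c ^ DIM('a) / (1 + c * norm y) ^ (DIM('a) + 1)"
  have pt: "en \<bar>K (x - y)\<bar> * f y \<le> en (A * c ^ DIM('a)) * (f y * ind (ball x (1 / c)) y)
    + en (A / c) * (en (dist x y powr (- 1 - DIM('a))) * ind (- ball x (1 / c)) y * f y)" for y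
  proof (cases "y \<in> ball x (1 / c)")
   case True
   have "A * c ^ DIM('a) / (1 + c * norm (x - y)) ^ (DIM('a) + 1) \<le> A * c ^ DIM('a) / 1"
    using A c by (intro divide_left_mono one_le_power mult_nonneg_nonneg) (auto simp: add_pos_nonneg)
   then have "\<bar>K (x - y)\<bar> \<le> A * c ^ DIM('a)" using K[rule_format, of "x - y"] by simp
   then have "en \<bar>K (x - y)\<bar> * f y \<le> en (A * c ^ DIM('a)) * f y" by (intro mult_right_mono ennreal_leI) auto
   then show ?thesis using True by simp
  next
   case False
   then have d: "dist x y \<ge> 1 / c" by simp
   then have dp: "dist x y > 0" using c by (meson divide_pos_pos less_le_trans zero_less_one)
   have "A * c ^ DIM('a) / (1 + c * norm (x - y)) ^ (DIM('a) + 1) \<le> A * c ^ DIM('a) / (c * dist x y) ^ (DIM('a) + 1)"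
    using A c dp by (intro divide_left_mono power_mono mult_nonneg_nonneg mult_pos_pos) (auto simp: dist_norm add_pos_nonneg)
   also have "... = A / c * dist x y powr (- 1 - DIM('a))"
   proof -
    have "dist x y powr (- 1 - DIM('a)) = 1 / dist x y ^ (DIM('a) + 1)"
    proof -
     have "dist x y powr (- 1 - DIM('a)) = dist x y powr (- real (DIM('a) + 1))" by (simp add: algebra_simps)
     also have "... = 1 / dist x y ^ (DIM('a) + 1)" unfolding powr_minus powr_realpow[OF dp] by (simp add: divide_inverse)
     finally show ?thesis .
    qed
    then show ?thesis using c by (simp add: power_mult_distrib)
   qed
   finally have "\<bar>K (x - y)\<bar> \<le> A / c * dist x y powr (- 1 - DIM('a))" using K[rule_format, of "x - y"] by simp
   then have "en \<bar>K (x - y)\<bar> * f y \<le> en (A / c * dist x y powr (- 1 - DIM('a))) * f y" by (intro mult_right_mono ennreal_leI) auto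
   also have "... = en (A / c) * (en (dist x y powr (- 1 - DIM('a))) * f y)"
    using A c by (subst ennreal_mult) (auto simp: mult.assoc)
   finally show ?thesis using False by simp
  qed
  have "(\<integral>y. en \<bar>K (x - y)\<bar> * f y) \<le> (\<integral>y. en (A * c ^ DIM('a)) * (f y * ind (ball x (1 / c)) y)
    + en (A / c) * (en (dist x y powr (- 1 - DIM('a))) * ind (- ball x (1 / c)) y * f y))"
   by (intro nn_integral_mono pt)
  also have "... = en (A * c ^ DIM('a)) * (\<integral>y. f y * ind (ball x (1 / c)) y)
    + en (A / c) * (\<integral>y. en (dist x y powr (- 1 - DIM('a))) * ind (- ball x (1 / c)) y * f y)"
   by (subst nn_integral_add) (auto simp: nn_integral_cmult)
  also have "... \<le> en (A * c ^ DIM('a)) * (en (w * (1 / c) ^ DIM('a)) * mx f x) + en (A / c) * (en (Cf * (1 / c) powr (- 1)) * mx f x)"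
   unfolding w_def using c by (intro add_mono mult_left_mono mx_ball Cf(2)) auto
  also have "... = en (w * A) * mx f x + en (Cf * A) * mx f x"
  proof -
   have e1: "A * c ^ DIM('a) * (w * (1 / c) ^ DIM('a)) = w * A" using c by (simp add: power_divide)
   have e2: "A / c * (Cf * (1 / c) powr (- 1)) = Cf * A" using c by (simp add: powr_minus)
   have e3: "en a * (en b * m) = en (a * b) * m" if "a \<ge> 0" "b \<ge> 0" for a b m
    using that by (simp add: ennreal_mult mult.assoc)
   have p: "0 \<le> A * c ^ DIM('a)" "0 \<le> w * (1 / c) ^ DIM('a)" "0 \<le> A / c" "0 \<le> Cf * (1 / c) powr (- 1)"
    using A c w Cf(1) by auto
   show ?thesis by (simp only: e3[OF p(1,2)] e3[OF p(3,4)] e1 e2)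
  qed
  also have "... = en ((w + Cf) * A) * mx f x"
   using A w Cf(1) by (simp add: distrib_right[symmetric] flip: ennreal_plus)
  finally show "(\<integral>y. en \<bar>K (x - y)\<bar> * f y) \<le> en ((w + Cf) * A) * mx f x" .
 qed
qed

locale littlewood_paley =
 fixes \<eta> :: "'a::euclidean_space => real"
 assumes bump: "lp_bump \<eta>"
begin

abbreviation chi :: "'a => real" where "chi \<equiv> lp_chi \<eta>"

lemma eta_smooth: "smooth \<eta>" using bump by (simp add: lp_bump_def)

lemma eta_even: "\<eta> (- \<xi>) = \<eta> \<xi>"
proof -
 have "\<forall>\<xi> \<zeta>. norm \<xi> = norm \<zeta> --> \<eta> \<xi> = \<eta> \<zeta>" using bump unfolding lp_bump_def by blast
 then show ?thesis by (metis norm_minus_cancel)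
qed

lemma eta_one: "norm \<xi> \<le> 1 ==> \<eta> \<xi> = 1"
proof -
 have "\<forall>\<xi>\<in>cball 0 1. \<eta> \<xi> = 1" using bump unfolding lp_bump_def by blast
 then show "norm \<xi> \<le> 1 ==> \<eta> \<xi> = 1" by simp
qed

lemma eta_csupp: "csupp (11/10) \<eta>"
 unfolding csupp_def
proof (intro allI impI)
 fix \<xi> :: 'a assume n: "norm \<xi> > 11/10"
 have "closure {\<xi>. \<eta> \<xi> \<noteq> 0} \<subseteq> cball 0 (11 / 10)" using bump unfolding lp_bump_def by blast
 with closure_subset have "{\<xi>. \<eta> \<xi> \<noteq> 0} \<subseteq> cball 0 (11 / 10)" by (rule order_trans)
 then have "\<eta> \<xi> \<noteq> 0 ==> norm \<xi> \<le> 11/10" by fastforce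
 then show "\<eta> \<xi> = 0" using n by fastforce
qed

lemma chi_smooth: "smooth chi"
proof (rule Cn_imp_smooth)
 fix n
 have "Cn n (\<lambda>\<xi>. \<eta> \<xi> + (- 1) * \<eta> (2 *\<^sub>R \<xi>))"
  by (rule Cn_add[OF smooth_imp_Cn[OF eta_smooth] Cn_mult[OF Cn_const smooth_imp_Cn[OF smooth_dilate[OF eta_smooth]]]])
 then show "Cn n chi" by (simp add: lp_chi_def[abs_def])
qed

lemma chi_csupp: "csupp (11/10) chi"
 using eta_csupp by (auto simp: csupp_def lp_chi_def)

lemma chi_even: "chi (- \<xi>) = chi \<xi>"
 by (simp add: lp_chi_def eta_even)

lemma chi_zero: "norm \<xi> \<le> 1/2 ==> chi \<xi> = 0"
 by (simp add: lp_chi_def eta_one)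

text \<open>As $|\xi|^\sigma$ is homogeneous, the symbols \<open>dil\<close> localised at $|\xi|\sim2^j$ are multiples of
 dilates of this one, whose kernel is controlled once and for all.\<close>

definition prof :: "real => 'a => real" where
 "prof \<sigma> \<xi> = norm \<xi> powr \<sigma> * chi \<xi>"

definition dil :: "real => int => 'a => real" where
 "dil \<sigma> j \<xi> = norm \<xi> powr \<sigma> * chi ((1 / 2 powr j) *\<^sub>R \<xi>)"

lemma prof_smooth: "smooth (prof \<sigma>)"
 unfolding prof_def[abs_def]
 by (rule Cn_imp_smooth, rule Cn_norm_powr[of "1/2"]) (auto intro: smooth_imp_Cn chi_smooth chi_zero)

lemma prof_csupp: "csupp (11/10) (prof \<sigma>)"
 using chi_csupp by (auto simp: csupp_def prof_def)

lemma prof_measurable [measurable]: "prof \<sigma> \<in> \<B>"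
 by (rule borel_measurable_continuous_onI[OF smooth_continuous[OF prof_smooth]])

lemma dil_prof: "dil \<sigma> j \<xi> = 2 powr (j * \<sigma>) * prof \<sigma> ((1 / 2 powr j) *\<^sub>R \<xi>)"
proof -
 have "norm ((1 / 2 powr j) *\<^sub>R \<xi>) powr \<sigma> = (1 / 2 powr j) powr \<sigma> * norm \<xi> powr \<sigma>"
  by (simp add: powr_divide powr_mult)
 also have "(1 / 2 powr j) powr \<sigma> = 1 / 2 powr (j * \<sigma>)" by (simp add: powr_divide powr_powr)
 finally show ?thesis by (simp add: dil_def prof_def)
qed

lemma dil_smooth: "smooth (dil \<sigma> j)"
 unfolding dil_prof[abs_def] by (rule smooth_mult[OF smooth_const smooth_dilate[OF prof_smooth]])

lemma dil_csupp: "csupp (11/10 * 2 powr j) (dil \<sigma> j)"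
 unfolding csupp_def
proof (intro allI impI)
 fix x :: 'a assume "norm x > 11/10 * 2 powr j"
 then have "norm ((1 / 2 powr j) *\<^sub>R x) > 11/10" by (simp only: norm_scaleR) (simp add: less_divide_eq)
 then show "dil \<sigma> j x = 0" using chi_csupp by (simp add: dil_def csupp_def)
qed

lemma dil_even: "dil \<sigma> j (- \<xi>) = dil \<sigma> j \<xi>"
 by (simp add: dil_def chi_even)

lemma ker_dil:
 fixes \<sigma> :: real and j :: int
 shows "ker (dil \<sigma> j) x = 2 powr (j * (DIM('a) + \<sigma>)) * ker (prof \<sigma>) (2 powr j *\<^sub>R x)"
proof -
 have "ker (dil \<sigma> j) x = 2 powr (j * \<sigma>) * ker (\<lambda>\<xi>. prof \<sigma> ((1 / 2 powr j) *\<^sub>R \<xi>)) x"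
  unfolding dil_prof[abs_def] by (rule ker_cmult)
 also have "ker (\<lambda>\<xi>. prof \<sigma> ((1 / 2 powr j) *\<^sub>R \<xi>)) x = (2 powr j) ^ DIM('a) * ker (prof \<sigma>) (2 powr j *\<^sub>R x)"
  by (rule ker_dilate) auto
 also have "(2 powr j) ^ DIM('a) = 2 powr (j * DIM('a))" by (simp add: powr_realpow[symmetric] powr_powr)
 finally show ?thesis by (simp add: distrib_left powr_add mult_ac)
qed

text \<open>By scaling, the kernel of index \<open>j\<close> is at most $2^{j(d+\sigma)}(1+2^j|x|)^{-N}$, up to a constant,
 and its differences gain $2^j|h|$; both are then summed over \<open>j\<close>.\<close>

lemma dyadic_kernel_sum:
 fixes \<sigma> :: real
 assumes \<sigma>: "DIM('a) + \<sigma> > 0"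
 shows "\<exists>C>0. \<forall>J::int set. finite J -->
  (\<forall>x. x \<noteq> 0 --> (\<Sum>j\<in>J. \<bar>ker (dil \<sigma> j) x\<bar>) \<le> C * norm x powr (- \<sigma> - DIM('a))) \<and>
  (\<forall>x h. x \<noteq> 0 --> 2 * norm h \<le> norm x --> (\<Sum>j\<in>J. \<bar>ker (dil \<sigma> j) (x + h) - ker (dil \<sigma> j) x\<bar>) \<le> C * norm h * norm x powr (- \<sigma> - 1 - DIM('a)))"
proof -
 obtain N :: nat where N: "DIM('a) + \<sigma> + 1 < real N" using reals_Archimedean2 by blast
 obtain A where A: "A > 0" "\<And>x. \<bar>ker (prof \<sigma>) x\<bar> \<le> A / (1 + norm x) ^ N" using ker_decay[OF prof_smooth prof_csupp] by blast
 obtain B where B: "B > 0" "\<And>x h. 2 * norm h \<le> norm x ==> \<bar>ker (prof \<sigma>) (x + h) - ker (prof \<sigma>) x\<bar> \<le> B * norm h / (1 + norm x) ^ N"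
  using ker_diff_decay[OF prof_smooth prof_csupp] by blast
 obtain C1 where C1: "C1 > 0" "\<And>(J::int set) r. finite J ==> r > 0 ==> (\<Sum>j\<in>J. 2 powr (j * (DIM('a) + \<sigma>)) / (1 + 2 powr j * r) ^ N) \<le> C1 * r powr (- (DIM('a) + \<sigma>))"
  using dyadic_sum[of "DIM('a) + \<sigma>" N] \<sigma> N by auto
 obtain C2 where C2: "C2 > 0" "\<And>(J::int set) r. finite J ==> r > 0 ==> (\<Sum>j\<in>J. 2 powr (j * (DIM('a) + \<sigma> + 1)) / (1 + 2 powr j * r) ^ N) \<le> C2 * r powr (- (DIM('a) + \<sigma> + 1))"
  using dyadic_sum[of "DIM('a) + \<sigma> + 1" N] \<sigma> N by auto
 show ?thesis
 proof (intro exI[of _ "A * C1 + B * C2"] conjI allI impI)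
  show "A * C1 + B * C2 > 0" using A B C1 C2 by (intro add_pos_pos mult_pos_pos) auto
  fix J :: "int set" assume J: "finite J"
  {
   fix x :: 'a assume x: "x \<noteq> 0"
   have "(\<Sum>j\<in>J. \<bar>ker (dil \<sigma> j) x\<bar>) \<le> (\<Sum>j\<in>J. A * (2 powr (j * (DIM('a) + \<sigma>)) / (1 + 2 powr j * norm x) ^ N))"
   proof (rule sum_mono)
    fix j
    have "\<bar>ker (dil \<sigma> j) x\<bar> = 2 powr (j * (DIM('a) + \<sigma>)) * \<bar>ker (prof \<sigma>) (2 powr j *\<^sub>R x)\<bar>" by (simp add: ker_dil abs_mult)
    also have "... \<le> 2 powr (j * (DIM('a) + \<sigma>)) * (A / (1 + norm (2 powr j *\<^sub>R x)) ^ N)" by (intro mult_left_mono A) auto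
    finally show "\<bar>ker (dil \<sigma> j) x\<bar> \<le> A * (2 powr (j * (DIM('a) + \<sigma>)) / (1 + 2 powr j * norm x) ^ N)" by (simp add: mult_ac)
   qed
   also have "... = A * (\<Sum>j\<in>J. 2 powr (j * (DIM('a) + \<sigma>)) / (1 + 2 powr j * norm x) ^ N)" by (simp only: sum_distrib_left)
   also have "... \<le> A * (C1 * norm x powr (- (DIM('a) + \<sigma>)))" using A x by (intro mult_left_mono C1(2) J) auto
   also have "... \<le> (A * C1 + B * C2) * norm x powr (- \<sigma> - DIM('a))" using B C2 by (simp add: algebra_simps)
   finally show "(\<Sum>j\<in>J. \<bar>ker (dil \<sigma> j) x\<bar>) \<le> (A * C1 + B * C2) * norm x powr (- \<sigma> - DIM('a))" .
  }
  fix x h :: 'a assume x: "x \<noteq> 0" and h: "2 * norm h \<le> norm x"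
  have "(\<Sum>j\<in>J. \<bar>ker (dil \<sigma> j) (x + h) - ker (dil \<sigma> j) x\<bar>) \<le> (\<Sum>j\<in>J. B * norm h * (2 powr (j * (DIM('a) + \<sigma> + 1)) / (1 + 2 powr j * norm x) ^ N))"
  proof (rule sum_mono)
   fix j
   have "\<bar>ker (dil \<sigma> j) (x + h) - ker (dil \<sigma> j) x\<bar> = 2 powr (j * (DIM('a) + \<sigma>)) * \<bar>ker (prof \<sigma>) (2 powr j *\<^sub>R x + 2 powr j *\<^sub>R h) - ker (prof \<sigma>) (2 powr j *\<^sub>R x)\<bar>"
    by (simp add: ker_dil abs_mult scaleR_add_right flip: right_diff_distrib)
   also have "... \<le> 2 powr (j * (DIM('a) + \<sigma>)) * (B * norm (2 powr j *\<^sub>R h) / (1 + norm (2 powr j *\<^sub>R x)) ^ N)"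
    using h by (intro mult_left_mono B) auto
   also have "... = B * norm h * ((2 powr (j * (DIM('a) + \<sigma>)) * 2 powr j) / (1 + 2 powr j * norm x) ^ N)" by (simp add: mult_ac)
   also have "2 powr (j * (DIM('a) + \<sigma>)) * 2 powr j = 2 powr (j * (DIM('a) + \<sigma> + 1))" by (simp add: powr_add[symmetric] algebra_simps)
   finally show "\<bar>ker (dil \<sigma> j) (x + h) - ker (dil \<sigma> j) x\<bar> \<le> B * norm h * (2 powr (j * (DIM('a) + \<sigma> + 1)) / (1 + 2 powr j * norm x) ^ N)" .
  qed
  also have "... = B * norm h * (\<Sum>j\<in>J. 2 powr (j * (DIM('a) + \<sigma> + 1)) / (1 + 2 powr j * norm x) ^ N)" by (simp only: sum_distrib_left)
  also have "... \<le> B * norm h * (C2 * norm x powr (- (DIM('a) + \<sigma> + 1)))" using B x by (intro mult_left_mono C2(2) J) auto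
  also have "- (DIM('a) + \<sigma> + 1) = - \<sigma> - 1 - DIM('a)" by simp
  also have "B * norm h * (C2 * norm x powr (- \<sigma> - 1 - DIM('a))) = B * C2 * norm h * norm x powr (- \<sigma> - 1 - DIM('a))" by simp
  also have "... \<le> (A * C1 + B * C2) * norm h * norm x powr (- \<sigma> - 1 - DIM('a))" using A C1 by (intro mult_right_mono) auto
  finally show "(\<Sum>j\<in>J. \<bar>ker (dil \<sigma> j) (x + h) - ker (dil \<sigma> j) x\<bar>) \<le> (A * C1 + B * C2) * norm h * norm x powr (- \<sigma> - 1 - DIM('a))" .
 qed
qed

definition mul :: "nat => 'a => real" where
 "mul k = (if k = 0 then \<eta> else (\<lambda>\<xi>. chi (\<xi> /\<^sub>R 2 ^ k)))"

lemma mul_Suc: "mul (Suc k) = dil 0 (int (Suc k))"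
proof
 fix \<xi> :: 'a
 have "2 powr real_of_int (int (Suc k)) = 2 ^ Suc k" using powr_realpow[of 2 "Suc k"] by simp
 then show "mul (Suc k) \<xi> = dil 0 (int (Suc k)) \<xi>"
  by (cases "\<xi> = 0") (simp_all add: mul_def dil_def inverse_eq_divide chi_zero del: of_int_of_nat_eq)
qed

lemma mul_smooth: "smooth (mul k)"
 by (cases k) (simp_all add: mul_Suc dil_smooth, simp add: mul_def eta_smooth)

lemma mul_even: "mul k (- \<xi>) = mul k \<xi>"
 by (simp add: mul_def eta_even chi_even)

lemma mul_csupp: "csupp (11/10 * 2 ^ k) (mul k)"
proof (cases k)
 case (Suc n)
 then show ?thesis using dil_csupp[of "int (Suc n)" 0] powr_realpow[of 2 "Suc n"] by (simp only: mul_Suc) simp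
qed (use eta_csupp in \<open>simp add: mul_def\<close>)

definition \<psi> :: "nat => 'a => real" where "\<psi> k = ker (mul k)"

lemma psi_nice: "nice (\<psi> k)"
 unfolding \<psi>_def by (rule nice_ker[OF mul_smooth mul_csupp])

lemma mul_integrable: "L1 (mul k)"
 by (rule smooth_csupp_integrable[OF mul_smooth mul_csupp])

lemma psi_even: "\<psi> k (- x) = \<psi> k x"
 unfolding \<psi>_def by (rule ker_even[OF mul_integrable mul_even])

lemma psi_L1: "(LINT x. \<bar>\<psi> (Suc k) x\<bar>) = (LINT x. \<bar>ker (prof 0) x\<bar>)"
proof -
 let ?c = "2 powr real (Suc k)"
 have [measurable]: "ker (prof 0) \<in> \<B>"
  by (rule borel_measurable_continuous_onI[OF continuous_ker[OF smooth_csupp_integrable[OF prof_smooth prof_csupp]]])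
 have "(LINT x. \<bar>ker (prof 0) x\<bar>) = \<bar>?c\<bar> ^ DIM('a) *\<^sub>R (LINT x. \<bar>ker (prof 0) (0 + ?c *\<^sub>R x)\<bar>)"
  by (rule integral_lborel_affine) auto
 also have "\<bar>?c\<bar> ^ DIM('a) = 2 powr (real (Suc k) * DIM('a))" by (subst powr_realpow[symmetric]) (auto simp: powr_powr)
 also have "2 powr (real (Suc k) * DIM('a)) *\<^sub>R (LINT x. \<bar>ker (prof 0) (0 + ?c *\<^sub>R x)\<bar>) = (LINT x. \<bar>\<psi> (Suc k) x\<bar>)"
  by (simp add: \<psi>_def mul_Suc ker_dil abs_mult)
 finally show ?thesis ..
qed

text \<open>The symbols of indices that differ by at least two have disjoint supports, those with neighbouring indices may
 overlap since $\chi$ lives on $1/2\le|\xi|\le1.1$.\<close>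

lemma psi_orthogonal:
 assumes "j + 2 \<le> k"
 shows "conv (\<psi> j) (\<psi> k) x = 0" "conv (\<psi> k) (\<psi> j) x = 0"
proof -
 have z: "mul j \<xi> * mul k \<xi> = 0" for \<xi>
 proof (cases "norm \<xi> > 11/10 * 2 ^ j")
  case True
  then show ?thesis using mul_csupp[of j] by (simp add: csupp_def)
 next
  case False
  have "2 ^ j * 4 \<le> (2::real) ^ k" using assms power_increasing[of "j + 2" k "2::real"] by (simp add: power_add)
  moreover have "norm \<xi> \<le> 2 * 2 ^ j" using False by (rule order_trans[OF leI]) simp
  ultimately have "norm \<xi> * 2 \<le> 2 ^ k" by linarith
  then have "norm (\<xi> /\<^sub>R 2 ^ k) \<le> 1/2" by (simp only: norm_scaleR) (simp add: field_simps)
  then have "mul k \<xi> = 0" using assms chi_zero[of "\<xi> /\<^sub>R 2 ^ k"] by (simp add: mul_def)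
  then show ?thesis by simp
 qed
 show "conv (\<psi> j) (\<psi> k) x = 0" unfolding \<psi>_def
  by (rule conv_ker_ker[OF mul_integrable mul_even mul_smooth mul_csupp mul_even z])
 show "conv (\<psi> k) (\<psi> j) x = 0" unfolding \<psi>_def
  by (rule conv_ker_ker[OF mul_integrable mul_even mul_smooth mul_csupp mul_even]) (use z in \<open>simp add: mult.commute\<close>)
qed

text \<open>For the $L^2$ bound, even and odd indices are orthogonal families each. Regularity is the sum of the dyadic
 estimates; index $0$, which is not a dilate of the others, contributes its own rapid decay.\<close>

lemma psi_cz: "\<exists>A>0. \<forall>N B. cz_kernel A (\<lambda>x. \<Sum>k<N. sgnset B k * \<psi> k x)"
proof -
 define b where "b = (LINT x. \<bar>ker (prof 0) x\<bar>) + (LINT x. \<bar>\<psi> 0 x\<bar>) + 1"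
 have b: "b > 0" by (simp add: b_def add_nonneg_pos)
 let ?P = "\<lambda>x. norm x powr (- 1 - DIM('a))"
 obtain C where C: "C > 0" "\<And>(J::int set) x h. finite J ==> x \<noteq> 0 ==> 2 * norm h \<le> norm x ==> (\<Sum>j\<in>J. \<bar>ker (dil 0 j) (x + h) - ker (dil 0 j) x\<bar>) \<le> C * norm h * ?P x"
  using dyadic_kernel_sum[of 0] by auto
 obtain D where D: "D > 0" "\<And>x h. 2 * norm h \<le> norm x ==> \<bar>\<psi> 0 (x + h) - \<psi> 0 x\<bar> \<le> D * norm h / (1 + norm x) ^ (DIM('a) + 1)"
  using ker_diff_decay[OF mul_smooth[of 0] mul_csupp[of 0]] unfolding \<psi>_def by blast
 define A where "A = max (4 * b\<^sup>2) (D + C)"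
 have A: "A > 0" "4 * b\<^sup>2 \<le> A" "D + C \<le> A" using C(1) D(1) by (auto simp: A_def)
 have "cz_kernel A (\<lambda>x. \<Sum>k<N. sgnset B k * \<psi> k x)" for N B
  unfolding cz_kernel_def
 proof (intro conjI allI impI)
  let ?e = "\<lambda>k. sgnset B k"
  let ?T = "\<lambda>x. \<Sum>k<N. ?e k * \<psi> k x"
  show "nice ?T" by (intro nice_sum nice_cmult psi_nice)
  fix g :: "'a => real" assume g: "nice g"
  have e2: "(?e k)\<^sup>2 = 1" for k by (simp add: sgnset_def)
  have bnd: "(LINT x. \<bar>\<psi> k x\<bar>) \<le> b" for k
   by (cases k) (simp_all add: psi_L1 b_def add_increasing add_increasing2)
  let ?w = "\<lambda>k x. ?e k * conv (\<psi> k) g x"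
  have L: "(LINT x. (\<Sum>k\<in>I. ?w k x)\<^sup>2) \<le> b\<^sup>2 * (LINT x. (g x)\<^sup>2)"
   if I: "finite I" "\<And>j k. j \<in> I ==> k \<in> I ==> j \<noteq> k ==> j + 2 \<le> k \<or> k + 2 \<le> j" for I
  proof (rule orthogonal_family_L2[OF I(1) psi_nice psi_even bnd b _ e2 g])
   fix j k x assume "j \<in> I" "k \<in> I" "j \<noteq> k"
   then show "conv (\<psi> j) (\<psi> k) x = 0"
    using I(2)[of j k] psi_orthogonal[of j k] psi_orthogonal[of k j] by auto
  qed
  define E where "E x = (\<Sum>k\<in>{k. k < N \<and> even k}. ?w k x)" for x
  define H where "H x = (\<Sum>k\<in>{k. k < N \<and> odd k}. ?w k x)" for x
  have nE: "nice E" unfolding E_def[abs_def] by (intro nice_sum nice_cmult conv_nice psi_nice g)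
  have nH: "nice H" unfolding H_def[abs_def] by (intro nice_sum nice_cmult conv_nice psi_nice g)
  have parity: "j + 2 \<le> k \<or> k + 2 \<le> j" if "even j = even k" "j \<noteq> k" for j k :: nat
   using that by presburger
  have LE: "(LINT x. (E x)\<^sup>2) \<le> b\<^sup>2 * (LINT x. (g x)\<^sup>2)" unfolding E_def by (intro L parity) auto
  have LH: "(LINT x. (H x)\<^sup>2) \<le> b\<^sup>2 * (LINT x. (g x)\<^sup>2)" unfolding H_def by (intro L parity) auto
  have EH: "conv ?T g x = E x + H x" for x
  proof -
   have "conv ?T g x = (\<Sum>k<N. ?w k x)" using psi_nice g by (intro conv_kernel_sum) auto
   also have "... = (\<Sum>k\<in>{k. k < N \<and> even k} \<union> {k. k < N \<and> odd k}. ?w k x)" by (rule sum.cong) auto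
   also have "... = E x + H x" unfolding E_def H_def by (rule sum.union_disjoint) auto
   finally show ?thesis .
  qed
  have i: "L1 (\<lambda>x. (E x)\<^sup>2)" "L1 (\<lambda>x. (H x)\<^sup>2)" "L1 (\<lambda>x. (g x)\<^sup>2)" "L1 (\<lambda>x. (E x + H x)\<^sup>2)"
   using nice_mult[OF nE nE] nice_mult[OF nH nH] nice_mult[OF g g] nice_mult[OF nice_add[OF nE nH] nice_add[OF nE nH]] by (auto simp: power2_eq_square)
  have "(LINT x. (E x + H x)\<^sup>2) \<le> (LINT x. 2 * (E x)\<^sup>2 + 2 * (H x)\<^sup>2)"
  proof (rule integral_mono)
   fix x show "(E x + H x)\<^sup>2 \<le> 2 * (E x)\<^sup>2 + 2 * (H x)\<^sup>2"
    using zero_le_power2[of "E x - H x"] by (simp add: power2_sum power2_diff)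
  qed (use i in auto)
  also have "... = 2 * (LINT x. (E x)\<^sup>2) + 2 * (LINT x. (H x)\<^sup>2)" using i by simp
  also have "... \<le> 4 * b\<^sup>2 * (LINT x. (g x)\<^sup>2)" using LE LH by simp
  also have "... \<le> A * (LINT x. (g x)\<^sup>2)" using A by (intro mult_right_mono) auto
  finally show "(\<integral>x. en ((conv ?T g x)\<^sup>2)) \<le> en A * (\<integral>x. en ((g x)\<^sup>2))"
   unfolding EH using i A(1) by (simp add: nn_integral_eq_integral ennreal_leI flip: ennreal_mult)
 next
  fix x h :: 'a assume xh: "x \<noteq> 0" "2 * norm h \<le> norm x"
  let ?d = "\<lambda>k. \<bar>\<psi> k (x + - h) - \<psi> k x\<bar>"
  have "\<bar>(\<Sum>k<N. sgnset B k * \<psi> k (x - h)) - (\<Sum>k<N. sgnset B k * \<psi> k x)\<bar> = \<bar>\<Sum>k<N. sgnset B k * (\<psi> k (x + - h) - \<psi> k x)\<bar>"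
   by (simp add: sum_subtractf right_diff_distrib)
  also have "... \<le> (\<Sum>k<N. \<bar>sgnset B k * (\<psi> k (x + - h) - \<psi> k x)\<bar>)" by (rule sum_abs)
  also have "... = (\<Sum>k<N. ?d k)" by (intro sum.cong refl) (simp add: sgnset_def abs_mult)
  also have "... \<le> (\<Sum>k<Suc N. ?d k)" by simp
  also have "... = ?d 0 + (\<Sum>k<N. ?d (Suc k))" by (rule sum.lessThan_Suc_shift)
  also have "(\<Sum>k<N. ?d (Suc k)) = (\<Sum>j\<in>(\<lambda>k. int (Suc k)) ` {..<N}. \<bar>ker (dil 0 j) (x + - h) - ker (dil 0 j) x\<bar>)"
   by (subst sum.reindex) (auto simp: inj_on_def \<psi>_def mul_Suc)
  also have "... \<le> C * norm (- h) * ?P x" using xh by (intro C(2)) auto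
  also have "?d 0 \<le> D * norm h * ?P x"
  proof -
   have "1 / (1 + norm x) ^ (DIM('a) + 1) \<le> norm x powr (- (1 + real DIM('a)))" using xh by (intro inverse_power_le_powr) auto
   then have "D * norm h * (1 / (1 + norm x) ^ (DIM('a) + 1)) \<le> D * norm h * ?P x" using D(1) by (intro mult_left_mono) auto
   then show ?thesis using D(2)[of "- h" x] xh by simp
  qed
  also have "D * norm h * ?P x + C * norm (- h) * ?P x = (D + C) * norm h * ?P x" by (simp add: algebra_simps)
  also have "... \<le> A * norm h * ?P x" using A by (intro mult_right_mono) auto
  finally show "\<bar>(\<Sum>k<N. sgnset B k * \<psi> k (x - h)) - (\<Sum>k<N. sgnset B k * \<psi> k x)\<bar> \<le> A * norm h * ?P x" by simp
 qed
 then show ?thesis using A(1) by blast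
qed

lemma square_function_real:
 fixes q :: real
 assumes q: "q > 1"
 shows "\<exists>C>0. \<forall>v :: 'a => real. lq q v -->
  (\<integral>x. epow (\<Sum>k. en ((conv (\<psi> k) v x)\<^sup>2)) (q / 2)) \<le> en C * (\<integral>x. en (\<bar>v x\<bar> powr q))"
proof -
 obtain A where "A > 0" "\<And>N B. cz_kernel A (\<lambda>x. \<Sum>k<N. sgnset B k * \<psi> k x)" using psi_cz by blast
 then show ?thesis using q by (intro square_function_lq psi_nice psi_even)
qed

end

section \<open>The kernels of the fractional Littlewood-Paley pieces\<close>

text \<open>Fourier inversion at the origin.\<close>

lemma ker_integral:
 fixes m :: "'a::euclidean_space => real"
 assumes m: "L1 m" "\<And>\<xi>. m (- \<xi>) = m \<xi>" "continuous_on UNIV m" "\<And>\<xi>. \<bar>m \<xi>\<bar> \<le> B"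
  and K: "L1 (ker m)"
 shows "(LINT x. ker m x) = m 0"
proof -
 let ?M = "\<lambda>\<xi>. cr (m \<xi>)"
 have ke: "inv_fourier ?M y = cr (ker m y)" for y by (rule ker_complex[OF m(1,2)])
 have fe: "fourier ?M = (\<lambda>y. cr ((2 * pi) ^ DIM('a)) * cr (ker m y))"
 proof
  fix y
  have "cr (ker m y) = inv_fourier ?M (- y)" using ke[of "- y"] ker_even[OF m(1,2), of y] by simp
  then show "fourier ?M y = cr ((2 * pi) ^ DIM('a)) * cr (ker m y)"
   by (simp add: inv_fourier_osc fourier_osc)
 qed
 have "fourier (inv_fourier ?M) 0 = ?M 0"
 proof (rule fourier_inversion')
  show "continuous_on UNIV ?M" by (intro continuous_intros m)
  show "cmod (?M x) \<le> B" for x using m(4) by simp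
  show "L1 ?M" using m(1) by simp
  show "L1 (fourier ?M)" unfolding fe using K by simp
 qed
 then have "cr (LINT x. ker m x) = cr (m 0)"
  by (simp add: fourier_def ke[abs_def])
 then show ?thesis by (simp only: of_real_eq_iff)
qed

context littlewood_paley
begin

text \<open>The symbol of the piece with index \<open>0\<close> is not smooth at the origin, so that its kernel
 decays only like $|x|^{-d-s}$; it is the sum of the dyadic pieces of all negative indices.\<close>

definition Ks :: "real => nat => 'a => real" where
 "Ks s k = ker (\<lambda>\<xi>. norm \<xi> powr s * mul k \<xi>)"

lemma Ks_Suc: "Ks s (Suc k) = ker (dil s (int (Suc k)))"
proof -
 have "(\<lambda>\<xi>. norm \<xi> powr s * dil 0 (int (Suc k)) \<xi>) = dil s (int (Suc k))"
  by (auto simp: fun_eq_iff dil_def)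
 then show ?thesis by (simp only: Ks_def mul_Suc)
qed

context
 fixes s :: real
 assumes s: "s > 0"
begin

lemma symbol_integrable: "L1 (\<lambda>\<xi>. norm \<xi> powr s * mul k \<xi>)"
 by (rule norm_powr_csupp_integrable(1)[OF mul_smooth mul_csupp s])

lemma lowpass_smooth: "smooth (\<lambda>\<xi>. \<eta> (c *\<^sub>R \<xi>))"
 by (rule smooth_dilate[OF eta_smooth])

lemma lowpass_csupp: "c > 0 ==> csupp (11/10 / c) (\<lambda>\<xi>. \<eta> (c *\<^sub>R \<xi>))"
 using eta_csupp unfolding csupp_def
proof (intro allI impI)
 fix \<xi> :: 'a assume c: "c > 0" and "\<forall>x. 11/10 < norm x --> \<eta> x = 0" "11/10 / c < norm \<xi>"
 moreover have "norm (c *\<^sub>R \<xi>) = c * norm \<xi>" using c by simp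
 ultimately show "\<eta> (c *\<^sub>R \<xi>) = 0" by (metis mult.commute pos_divide_less_eq)
qed

text \<open>$\eta(\xi)=\sum_{n<M}\chi(2^n\xi)+\eta(2^M\xi)$.\<close>

lemma Ks_zero_telescope:
 "Ks s 0 x = (\<Sum>n<M. ker (dil s (- int n)) x) + ker (\<lambda>\<xi>. norm \<xi> powr s * \<eta> ((2 ^ M) *\<^sub>R \<xi>)) x"
proof (induction M)
 case 0
 then show ?case by (simp add: Ks_def mul_def)
next
 case (Suc M)
 have i: "L1 (\<lambda>\<xi>. norm \<xi> powr s * \<eta> ((2 ^ n) *\<^sub>R \<xi>))" for n
  by (rule norm_powr_csupp_integrable(1)[OF lowpass_smooth lowpass_csupp s]) simp
 have "dil s (- int M) = (\<lambda>\<xi>. norm \<xi> powr s * \<eta> ((2 ^ M) *\<^sub>R \<xi>) - norm \<xi> powr s * \<eta> ((2 ^ Suc M) *\<^sub>R \<xi>))"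
 proof
  fix \<xi> :: 'a
  have "1 / 2 powr real_of_int (- int M) = 2 ^ M" using powr_realpow[of 2 M] by (simp add: powr_minus inverse_eq_divide)
  then show "dil s (- int M) \<xi> = norm \<xi> powr s * \<eta> ((2 ^ M) *\<^sub>R \<xi>) - norm \<xi> powr s * \<eta> ((2 ^ Suc M) *\<^sub>R \<xi>)"
   by (simp only: dil_def lp_chi_def) (simp add: right_diff_distrib)
 qed
 then have "ker (dil s (- int M)) x = ker (\<lambda>\<xi>. norm \<xi> powr s * \<eta> ((2 ^ M) *\<^sub>R \<xi>)) x - ker (\<lambda>\<xi>. norm \<xi> powr s * \<eta> ((2 ^ Suc M) *\<^sub>R \<xi>)) x"
  by (simp only: ker_diff[OF i i])
 then show ?case using Suc by simp
qed

text \<open>The remaining symbol lives on $|\xi|\lesssim2^{-M}$, where $|\xi|^s$ is small.\<close>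

lemma lowpass_ker_small:
 "\<bar>ker (\<lambda>\<xi>. norm \<xi> powr s * \<eta> ((2 ^ M) *\<^sub>R \<xi>)) x\<bar> \<le> (1 / 2 powr s) ^ M * (LINT \<xi>. \<bar>norm \<xi> powr s * mul 0 \<xi>\<bar>)"
proof -
 let ?m = "\<lambda>\<xi>. norm \<xi> powr s * mul 0 \<xi>" and ?c = "1 / 2 ^ M :: real"
 have [measurable]: "?m \<in> \<B>" using borel_measurable_integrable[OF symbol_integrable[of 0]] by simp
 have "(2 ^ M) powr s = (2 powr s) ^ M" by (simp add: powr_realpow[symmetric] powr_powr mult.commute)
 then have "(\<lambda>\<xi>. norm \<xi> powr s * \<eta> ((2 ^ M) *\<^sub>R \<xi>)) = (\<lambda>\<xi>. (1 / 2 powr s) ^ M * ?m ((1 / ?c) *\<^sub>R \<xi>))"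
  by (simp add: fun_eq_iff mul_def powr_mult power_one_over)
 then have "ker (\<lambda>\<xi>. norm \<xi> powr s * \<eta> ((2 ^ M) *\<^sub>R \<xi>)) x = (1 / 2 powr s) ^ M * ker (\<lambda>\<xi>. ?m ((1 / ?c) *\<^sub>R \<xi>)) x"
  by (simp only: ker_cmult)
 also have "ker (\<lambda>\<xi>. ?m ((1 / ?c) *\<^sub>R \<xi>)) x = ?c ^ DIM('a) * ker ?m (?c *\<^sub>R x)"
  by (rule ker_dilate) auto
 finally have "\<bar>ker (\<lambda>\<xi>. norm \<xi> powr s * \<eta> ((2 ^ M) *\<^sub>R \<xi>)) x\<bar> = (1 / 2 powr s) ^ M * (?c ^ DIM('a) * \<bar>ker ?m (?c *\<^sub>R x)\<bar>)"
  by (simp add: abs_mult)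
 also have "... \<le> (1 / 2 powr s) ^ M * (1 * (LINT \<xi>. \<bar>?m \<xi>\<bar>))"
  by (intro mult_left_mono mult_mono ker_bounded symbol_integrable power_le_one) auto
 finally show ?thesis by simp
qed

text \<open>The pieces of positive index are dyadic. The piece of index $0$ is the limit of the sums of dyadic pieces of
 indices $0,-1,\dots$, and hence obeys the same bound.\<close>

lemma Ks_sum: "\<exists>C>0. \<forall>x M. x \<noteq> 0 --> (\<Sum>k<M. \<bar>Ks s k x\<bar>) \<le> C * norm x powr (- s - DIM('a))"
proof -
 have "DIM('a) + s > 0" using s by (simp add: add_nonneg_pos)
 then obtain C where C: "C > 0" "\<And>(J::int set) x. finite J ==> x \<noteq> 0 ==> (\<Sum>j\<in>J. \<bar>ker (dil s j) x\<bar>) \<le> C * norm x powr (- s - DIM('a))"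
  using dyadic_kernel_sum[of s] by meson
 have "(\<Sum>k<M. \<bar>Ks s k x\<bar>) \<le> (2 * C) * norm x powr (- s - DIM('a))" if x: "x \<noteq> 0" for x M
 proof -
  let ?W = "C * norm x powr (- s - DIM('a))" and ?B = "LINT \<xi>. \<bar>norm \<xi> powr s * mul 0 \<xi>\<bar>"
  have "\<bar>Ks s 0 x\<bar> \<le> ?W + (1 / 2 powr s) ^ n * ?B" for n
  proof -
   have "\<bar>Ks s 0 x\<bar> \<le> \<bar>\<Sum>m<n. ker (dil s (- int m)) x\<bar> + \<bar>ker (\<lambda>\<xi>. norm \<xi> powr s * \<eta> ((2 ^ n) *\<^sub>R \<xi>)) x\<bar>"
    unfolding Ks_zero_telescope[of x n] by (rule abs_triangle_ineq)
   also have "... \<le> (\<Sum>m<n. \<bar>ker (dil s (- int m)) x\<bar>) + (1 / 2 powr s) ^ n * ?B"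
    by (intro add_mono sum_abs lowpass_ker_small)
   also have "(\<Sum>m<n. \<bar>ker (dil s (- int m)) x\<bar>) = (\<Sum>j\<in>(\<lambda>m. - int m) ` {..<n}. \<bar>ker (dil s j) x\<bar>)"
    by (subst sum.reindex) (auto simp: inj_on_def)
   also have "... \<le> ?W" by (intro C(2) x) auto
   finally show ?thesis by simp
  qed
  moreover have "(\<lambda>n. ?W + (1 / 2 powr s) ^ n * ?B) \<longlonglongrightarrow> ?W + 0 * ?B"
   using s by (intro tendsto_add tendsto_mult tendsto_const LIMSEQ_realpow_zero) auto
  ultimately have K0: "\<bar>Ks s 0 x\<bar> \<le> ?W" using LIMSEQ_le_const[of _ ?W "\<bar>Ks s 0 x\<bar>"] by auto
  have "(\<Sum>k<M. \<bar>Ks s k x\<bar>) \<le> (\<Sum>k<Suc M. \<bar>Ks s k x\<bar>)" by simp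
  also have "... = \<bar>Ks s 0 x\<bar> + (\<Sum>k<M. \<bar>ker (dil s (int (Suc k))) x\<bar>)"
   by (subst sum.lessThan_Suc_shift) (simp add: Ks_Suc del: of_nat_Suc)
  also have "(\<Sum>k<M. \<bar>ker (dil s (int (Suc k))) x\<bar>) = (\<Sum>j\<in>(\<lambda>k. int (Suc k)) ` {..<M}. \<bar>ker (dil s j) x\<bar>)"
   by (subst sum.reindex) (auto simp: inj_on_def)
  also have "... \<le> ?W" by (intro C(2) x) auto
  finally show ?thesis using K0 by simp
 qed
 then show ?thesis using C(1) by (intro exI[of _ "2 * C"]) auto
qed

lemma Ks_single: "\<exists>C>0. \<forall>k x. x \<noteq> 0 --> \<bar>Ks s k x\<bar> \<le> C * norm x powr (- s - DIM('a))"
proof -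
 obtain C where C: "C > 0" "\<And>x M. x \<noteq> 0 ==> (\<Sum>k<M. \<bar>Ks s k x\<bar>) \<le> C * norm x powr (- s - DIM('a))"
  using Ks_sum by meson
 have "\<bar>Ks s k x\<bar> \<le> C * norm x powr (- s - DIM('a))" if "x \<noteq> 0" for k x
  using member_le_sum[of k "{..<Suc k}" "\<lambda>k. \<bar>Ks s k x\<bar>"] C(2)[OF that, of "Suc k"] by (simp del: sum.lessThan_Suc)
 then show ?thesis using C(1) by auto
qed

lemma Ks_measurable [measurable]: "Ks s k \<in> \<B>"
 unfolding Ks_def by (rule borel_measurable_continuous_onI[OF continuous_ker[OF symbol_integrable]])

lemma Ks_bounded: "\<bar>Ks s k x\<bar> \<le> (LINT \<xi>. \<bar>norm \<xi> powr s * mul k \<xi>\<bar>)"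
 unfolding Ks_def by (rule ker_bounded[OF symbol_integrable])

lemma Ks_nice: "nice (Ks s k)"
proof -
 obtain C where C: "\<And>k x. x \<noteq> 0 ==> \<bar>Ks s k x\<bar> \<le> C * norm x powr (- s - DIM('a))" using Ks_single by meson
 show ?thesis by (rule nice_decay[OF _ Ks_bounded s]) (use C in auto)
qed

lemma Ks_weight: "\<exists>C>0. \<forall>y. \<bar>Ks s k y\<bar> \<le> C * (1 + norm y) powr (- (s + DIM('a)))"
proof -
 obtain C where C: "C > 0" "\<And>k x. x \<noteq> 0 ==> \<bar>Ks s k x\<bar> \<le> C * norm x powr (- s - DIM('a))" using Ks_single by meson
 define B where "B = (LINT \<xi>. \<bar>norm \<xi> powr s * mul k \<xi>\<bar>)"
 let ?e = "s + DIM('a)"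
 have B: "B \<ge> 0" by (simp add: B_def)
 have e: "?e > 0" using s by (simp add: add_pos_nonneg)
 have two: "r powr (- ?e) \<le> 2 powr ?e * (1 + n) powr (- ?e)" if "r > 0" "1 + n \<le> 2 * r" "n \<ge> 0" for r n :: real
 proof -
  have "(1 + n) powr ?e \<le> 2 powr ?e * r powr ?e" using that e powr_mono2[of ?e "1 + n" "2 * r"] by (simp add: powr_mult)
  then show ?thesis using that unfolding powr_minus by (simp add: field_simps)
 qed
 have "\<bar>Ks s k y\<bar> \<le> ((B + C) * 2 powr ?e) * (1 + norm y) powr (- ?e)" for y
 proof (cases "norm y \<le> 1")
  case True
  have "\<bar>Ks s k y\<bar> \<le> B * 1" using Ks_bounded by (simp add: B_def)
  also have "... \<le> B * (2 powr ?e * (1 + norm y) powr (- ?e))" using two[of 1 "norm y"] True B by (intro mult_left_mono) auto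
  also have "... \<le> ((B + C) * 2 powr ?e) * (1 + norm y) powr (- ?e)" using C by (simp add: algebra_simps)
  finally show ?thesis .
 next
  case False
  then have "y \<noteq> 0" by auto
  then have "\<bar>Ks s k y\<bar> \<le> C * norm y powr (- s - DIM('a))" by (rule C(2))
  also have "- s - DIM('a) = - ?e" by simp
  also have "C * norm y powr (- ?e) \<le> C * (2 powr ?e * (1 + norm y) powr (- ?e))" using two[of "norm y" "norm y"] False C \<open>y \<noteq> 0\<close> by (intro mult_left_mono) auto
  also have "... \<le> ((B + C) * 2 powr ?e) * (1 + norm y) powr (- ?e)" using B by (simp add: algebra_simps)
  finally show ?thesis .
 qed
 moreover have "(B + C) * 2 powr ?e > 0" using B C by simp
 ultimately show ?thesis by blast
qed

text \<open>The symbol $|\xi|^s$ vanishes at the origin: this is the cancellation on which the whole argument rests.\<close>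

lemma Ks_integral: "(LINT x. Ks s k x) = 0"
proof -
 have c: "continuous_on UNIV (\<lambda>\<xi>. norm \<xi> powr s * mul k \<xi>)" by (rule norm_powr_csupp_integrable(2)[OF mul_smooth mul_csupp s])
 have cs: "csupp (11/10 * 2 ^ k) (\<lambda>\<xi>. norm \<xi> powr s * mul k \<xi>)" using mul_csupp by (auto simp: csupp_def)
 obtain B where B: "\<And>\<xi>. norm (norm \<xi> powr s * mul k \<xi>) \<le> B * ind (cball 0 (11/10 * 2 ^ k)) \<xi>" "B > 0"
  using csupp_bounded[OF cs c] by blast
 have "\<bar>norm \<xi> powr s * mul k \<xi>\<bar> \<le> B" for \<xi>
  using B(1)[of \<xi>] B(2) by (cases "\<xi> \<in> cball 0 (11/10 * 2 ^ k)") auto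
 then have "(LINT x. Ks s k x) = norm (0::'a) powr s * mul k 0"
  unfolding Ks_def by (intro ker_integral[OF symbol_integrable _ c]) (use Ks_nice in \<open>auto simp: mul_even Ks_def\<close>)
 then show ?thesis by simp
qed

end

end

section \<open>Convolutions of complex Lebesgue functions with real kernels\<close>

definition cconv :: "('a::euclidean_space => real) => ('a => complex) => 'a => complex" where
 "cconv K f x = (LINT z. f z * cr (K (x - z)))"

lemma in_Lp_lq:
 assumes "in_Lp q f" "q > 0"
 shows "lq q (\<lambda>x. Re (f x))" "lq q (\<lambda>x. Im (f x))" "lq q (\<lambda>x. cmod (f x))"
proof -
 have [measurable]: "f \<in> \<B>" using assms by (simp add: in_Lp_def)
 have fin: "(\<integral>x. en (cmod (f x) powr q)) < \<top>"
  using assms by (subst nn_integral_eq_integral) (auto simp: in_Lp_def)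
 have le: "(\<integral>x. en (\<bar>g (f x)\<bar> powr q)) < \<top>" if "\<And>z. \<bar>g z\<bar> \<le> cmod z" for g
  using that assms(2) by (intro le_less_trans[OF nn_integral_mono fin] ennreal_leI powr_mono2) auto
 show "lq q (\<lambda>x. Re (f x))" using le[of Re] by (simp add: lq_def abs_Re_le_cmod)
 show "lq q (\<lambda>x. Im (f x))" using le[of Im] by (simp add: lq_def abs_Im_le_cmod)
 show "lq q (\<lambda>x. cmod (f x))" using fin by (simp add: lq_def)
qed

lemma in_Lp_integral:
 assumes "in_Lp q f" "q > 0"
 shows "(\<integral>x. epow (en (cmod (f x))) q) = en (Lp_norm q f powr q)"
proof -
 have "(\<integral>x. epow (en (cmod (f x))) q) = en (LINT x. cmod (f x) powr q)"
  using assms by (simp add: epow_ennreal in_Lp_def nn_integral_eq_integral)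
 also have "(LINT x. cmod (f x) powr q) = Lp_norm q f powr q"
  using assms(2) by (simp add: Lp_norm_def powr_powr)
 finally show ?thesis .
qed

lemma cconv_lq:
 assumes K: "nice K" and f: "in_Lp q f" and q: "q > 1"
 shows cconv_integrable: "L1 (\<lambda>z. f z * cr (K (x - z)))"
  and Re_cconv: "Re (cconv K f x) = conv K (\<lambda>z. Re (f z)) x"
  and Im_cconv: "Im (cconv K f x) = conv K (\<lambda>z. Im (f z)) x"
proof -
 have q0: "q > 0" using q by simp
 have [measurable]: "f \<in> \<B>" using f by (simp add: in_Lp_def)
 have [measurable]: "K \<in> \<B>" by (rule nice_measurable[OF K])
 have "L1 (\<lambda>z. K (x - z) * cmod (f z))" by (rule conv_lq_bound(1)[OF K in_Lp_lq(3)[OF f q0] q])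
 then have "L1 (\<lambda>z. norm (K (x - z) * cmod (f z)))" by (rule integrable_norm)
 then show i: "L1 (\<lambda>z. f z * cr (K (x - z)))"
  by (rule Bochner_Integration.integrable_bound) (auto simp: norm_mult mult.commute)
 show "Re (cconv K f x) = conv K (\<lambda>z. Re (f z)) x"
  unfolding cconv_def conv_def by (subst integral_Re[OF i, symmetric]) (simp add: mult.commute)
 show "Im (cconv K f x) = conv K (\<lambda>z. Im (f z)) x"
  unfolding cconv_def conv_def by (subst integral_Im[OF i, symmetric]) (simp add: mult.commute)
qed

section \<open>Pointwise control of differences\<close>

lemma epow_less_cancel:
 assumes "epow y q < epow (en e) q" "q > 0" shows "y < en e"
 using epow_mono[of "en e" y q] assms by (meson not_le)

lemma conv_dilated_kernel:
 fixes K g :: "'a::euclidean_space => real"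
 assumes [measurable]: "K \<in> \<B>" "g \<in> \<B>" and c: "c > 0"
 shows "conv (\<lambda>x. c ^ DIM('a) * K (c *\<^sub>R x)) g x = (LINT z. K z * g (x - (1 / c) *\<^sub>R z))"
proof -
 have "conv (\<lambda>x. c ^ DIM('a) * K (c *\<^sub>R x)) g x = \<bar>- (1 / c)\<bar> ^ DIM('a) *\<^sub>R (LINT z. c ^ DIM('a) * K (c *\<^sub>R (x - (x + (- (1 / c)) *\<^sub>R z))) * g (x + (- (1 / c)) *\<^sub>R z))"
  unfolding conv_def using c by (intro integral_lborel_affine) auto
 also have "... = (1 / c) ^ DIM('a) * (LINT z. c ^ DIM('a) * (K z * g (x - (1 / c) *\<^sub>R z)))"
  using c by (simp add: mult.assoc)
 also have "... = (1 / c) ^ DIM('a) * c ^ DIM('a) * (LINT z. K z * g (x - (1 / c) *\<^sub>R z))"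
  by simp
 also have "(1 / c) ^ DIM('a) * c ^ DIM('a) = 1" using c by (simp add: power_one_over)
 finally show ?thesis by simp
qed

text \<open>After rescaling, all the functions are averaged with the same weight \<open>K\<close>, and dominated convergence
 applies.\<close>

lemma conv_approximate_identity:
 fixes K g :: "'a::euclidean_space => real"
 assumes K: "nice K" "(LINT x. K x) = 1" and g: "nice g" "continuous_on UNIV g"
 shows "(\<lambda>J. conv (\<lambda>x. (2 ^ J) ^ DIM('a) * K (2 ^ J *\<^sub>R x)) g x) \<longlonglongrightarrow> g x"
proof -
 obtain B where B: "B > 0" "\<And>x. \<bar>g x\<bar> \<le> B" using nice_bound[OF g(1)] by blast
 note [measurable] = nice_measurable[OF K(1)] nice_measurable[OF g(1)]
 have "(\<lambda>J. LINT z. K z * g (x - (1 / 2 ^ J) *\<^sub>R z)) \<longlonglongrightarrow> (LINT z. K z * g x)"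
 proof (rule integral_dominated_convergence[where w="\<lambda>z. \<bar>K z\<bar> * B"])
  show "L1 (\<lambda>z. \<bar>K z\<bar> * B)" using nice_integrable[OF K(1)] by simp
  show "AE z in lborel. (\<lambda>J. K z * g (x - (1 / 2 ^ J) *\<^sub>R z)) \<longlonglongrightarrow> K z * g x"
  proof (rule AE_I2)
   fix z :: 'a
   have "(\<lambda>J. (1 / 2 ^ J) *\<^sub>R z) \<longlonglongrightarrow> 0 *\<^sub>R z"
    using LIMSEQ_realpow_zero[of "1/2"] by (intro tendsto_scaleR) (auto simp: power_one_over)
   then have "(\<lambda>J. x - (1 / 2 ^ J) *\<^sub>R z) \<longlonglongrightarrow> x - 0" by (intro tendsto_diff tendsto_const) simp
   then have "(\<lambda>J. g (x - (1 / 2 ^ J) *\<^sub>R z)) \<longlonglongrightarrow> g (x - 0)"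
    using g(2) by (intro isCont_tendsto_compose[of _ g]) (auto simp: continuous_on_eq_continuous_at)
   then show "(\<lambda>J. K z * g (x - (1 / 2 ^ J) *\<^sub>R z)) \<longlonglongrightarrow> K z * g x" by (intro tendsto_mult tendsto_const) simp
  qed
  show "AE z in lborel. norm (K z * g (x - (1 / 2 ^ J) *\<^sub>R z)) \<le> \<bar>K z\<bar> * B" for J
   by (rule AE_I2) (simp add: abs_mult mult_left_mono B)
 qed measurable
 moreover have "(LINT z. K z * g x) = g x" using K by simp
 moreover have "conv (\<lambda>x. (2 ^ J) ^ DIM('a) * K (2 ^ J *\<^sub>R x)) g x = (LINT z. K z * g (x - (1 / 2 ^ J) *\<^sub>R z))" for J
  by (rule conv_dilated_kernel) auto
 ultimately show ?thesis by (simp only:)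
qed

context littlewood_paley
begin

text \<open>The kernel of the smooth cutoff to frequencies below \<open>c\<close>; the dilates of $\psi_0$.\<close>

definition lowpass :: "real => 'a => real" where
 "lowpass c = ker (\<lambda>\<xi>. \<eta> ((1 / c) *\<^sub>R \<xi>))"

lemma lowpass_eq: "c > 0 ==> lowpass c = (\<lambda>x. c ^ DIM('a) * \<psi> 0 (c *\<^sub>R x))"
 unfolding lowpass_def \<psi>_def mul_def using borel_measurable_continuous_onI[OF smooth_continuous[OF eta_smooth]]
 by (simp add: fun_eq_iff ker_dilate)

lemma lowpass_symbol_integrable: "c > 0 ==> L1 (\<lambda>\<xi>. \<eta> ((1 / c) *\<^sub>R \<xi>))"
 by (rule smooth_csupp_integrable[OF lowpass_smooth lowpass_csupp]) auto

lemma lowpass_nice: "c > 0 ==> nice (lowpass c)"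
 unfolding lowpass_def by (rule nice_ker[OF lowpass_smooth lowpass_csupp]) auto

lemma lowpass_decay: "\<exists>A>0. \<forall>c>0. \<forall>y. \<bar>lowpass c y\<bar> \<le> A * c ^ DIM('a) / (1 + c * norm y) ^ (DIM('a) + 1)"
proof -
 obtain A where A: "A > 0" "\<And>x. \<bar>\<psi> 0 x\<bar> \<le> A / (1 + norm x) ^ (DIM('a) + 1)"
  using ker_decay[OF mul_smooth[of 0] mul_csupp[of 0]] unfolding \<psi>_def by blast
 have "\<bar>lowpass c y\<bar> \<le> A * c ^ DIM('a) / (1 + c * norm y) ^ (DIM('a) + 1)" if c: "c > 0" for c y
 proof -
  have "\<bar>lowpass c y\<bar> = c ^ DIM('a) * \<bar>\<psi> 0 (c *\<^sub>R y)\<bar>" using c by (simp add: lowpass_eq abs_mult)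
  also have "... \<le> c ^ DIM('a) * (A / (1 + norm (c *\<^sub>R y)) ^ (DIM('a) + 1))" using c by (intro mult_left_mono A) auto
  finally show ?thesis using c by (simp add: mult.commute)
 qed
 then show ?thesis using A(1) by blast
qed

lemma psi_zero_integral: "(LINT x. \<psi> 0 x) = 1"
proof -
 obtain B where B: "\<And>\<xi>. norm (mul 0 \<xi>) \<le> B * ind (cball 0 (11/10 * 2 ^ 0)) \<xi>" "B > 0"
  using csupp_bounded[OF mul_csupp smooth_continuous[OF mul_smooth]] by blast
 have "(LINT x. \<psi> 0 x) = mul 0 0"
  unfolding \<psi>_def
 proof (rule ker_integral[OF mul_integrable mul_even smooth_continuous[OF mul_smooth]])
  show "\<bar>mul 0 \<xi>\<bar> \<le> B" for \<xi> using B(1)[of \<xi>] B(2) by (cases "\<xi> \<in> cball 0 (11/10 * 2 ^ 0)") auto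
  show "L1 (ker (mul 0))" using psi_nice[of 0] by (simp add: \<psi>_def)
 qed
 then show ?thesis by (simp add: mul_def eta_one)
qed

text \<open>The smoothings are dominated by the maximal function uniformly in the scale. For approximants \<open>g n\<close>
 of \<open>u\<close>, both $u-g_n$ and its maximal function have small norm; the infimum over \<open>n\<close> of
 their powers thus has integral zero. At a point where it vanishes, the claim follows from that for the
 continuous approximants.\<close>

lemma lowpass_converges:
 fixes u :: "'a => real"
 assumes u: "lq t u" and t: "t > 1"
 shows "AE x in lborel. (\<lambda>J. conv (lowpass (2 ^ J)) u x) \<longlonglongrightarrow> u x"
proof -
 have [measurable]: "u \<in> \<B>" using u by (simp add: lq_def)
 obtain A where A: "A > 0" "\<And>c y. c > 0 ==> \<bar>lowpass c y\<bar> \<le> A * c ^ DIM('a) / (1 + c * norm y) ^ (DIM('a) + 1)"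
  using lowpass_decay by blast
 obtain C3 where C3: "C3 > 0" "\<And>(K :: 'a => real) A c f x. c > 0 ==> A \<ge> 0 ==> f \<in> \<B> ==> K \<in> \<B> ==>
  (\<forall>y. \<bar>K y\<bar> \<le> A * c ^ DIM('a) / (1 + c * norm y) ^ (DIM('a) + 1)) ==>
  (\<integral>y. en \<bar>K (x - y)\<bar> * f y) \<le> en (C3 * A) * mx f x"
  using kernel_le_mx[where 'a='a] by blast
 obtain C2 where C2: "C2 > 0" "\<And>f :: 'a => ennreal. f \<in> \<B> ==>
  (\<integral>x. epow (mx f x) t) \<le> en C2 * (\<integral>x. epow (f x) t)"
  using mx_strong_type[OF t, where 'a='a] by blast
 define D where "D = C3 * A"
 have D: "D > 0" using C3(1) A(1) by (simp add: D_def)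
 have "\<exists>g. nice g \<and> continuous_on UNIV g \<and> (\<integral>x. en (\<bar>u x - g x\<bar> powr t)) < en (1 / real (Suc n))" for n
  using t by (intro lq_dense[OF u]) auto
 then obtain g where g: "\<And>n. nice (g n)" "\<And>n. continuous_on UNIV (g n)" "\<And>n. (\<integral>x. en (\<bar>u x - g n x\<bar> powr t)) < en (1 / real (Suc n))"
  by metis
 note [measurable] = nice_measurable[OF g(1)]
 define w where "w n x = en \<bar>u x - g n x\<bar>" for n x
 have [measurable]: "w n \<in> \<B>" for n unfolding w_def[abs_def] by measurable
 define h where "h n x = epow (mx (w n) x) t + epow (w n x) t" for n x
 have [measurable]: "h n \<in> \<B>" for n unfolding h_def[abs_def] by measurable
 have wI: "(\<integral>x. epow (w n x) t) \<le> en (1 / real (Suc n))" for n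
  using g(3)[of n] by (simp add: w_def epow_ennreal less_imp_le)
 have hI: "(\<integral>x. h n x) \<le> en ((C2 + 1) / real (Suc n))" for n
 proof -
  have "(\<integral>x. h n x) = (\<integral>x. epow (mx (w n) x) t) + (\<integral>x. epow (w n x) t)"
   unfolding h_def by (rule nn_integral_add) measurable
  also have "... \<le> en C2 * en (1 / real (Suc n)) + en (1 / real (Suc n))"
   by (intro add_mono order_trans[OF C2(2)] mult_left_mono wI) auto
  also have "... = en (C2 * (1 / real (Suc n)) + 1 / real (Suc n))"
   using C2(1) by (subst ennreal_plus, simp, simp, subst ennreal_mult) auto
  finally show ?thesis by (simp add: add_divide_distrib)
 qed
 define H where "H x = (INF n. h n x)" for x
 have [measurable]: "H \<in> \<B>" unfolding H_def[abs_def] by measurable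
 have "(\<integral>x. H x) \<le> 0"
 proof (rule LIMSEQ_le_const)
  have "(\<lambda>n. (C2 + 1) * (1 / real (Suc n))) \<longlonglongrightarrow> (C2 + 1) * 0"
   by (intro tendsto_mult tendsto_const LIMSEQ_Suc lim_1_over_n)
  then show "(\<lambda>n. en ((C2 + 1) / real (Suc n))) \<longlonglongrightarrow> 0"
   using tendsto_ennrealI by fastforce
  show "\<exists>N. \<forall>n\<ge>N. (\<integral>x. H x) \<le> en ((C2 + 1) / real (Suc n))"
   by (intro exI[of _ 0] allI impI order_trans[OF nn_integral_mono hI]) (auto simp: H_def intro!: INF_lower)
 qed
 then have "AE x in lborel. H x = 0" by (simp add: nn_integral_0_iff_AE)
 then show ?thesis
 proof (rule AE_mp, intro AE_I2 impI)
  fix x assume Hx: "H x = 0"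
  show "(\<lambda>J. conv (lowpass (2 ^ J)) u x) \<longlonglongrightarrow> u x"
  proof (rule LIMSEQ_I)
   fix e :: real assume e: "e > 0"
   define d where "d = e / 2 / (D + 1)"
   have d: "d > 0" using e D by (simp add: d_def)
   have "H x < epow (en d) t" using d by (simp add: Hx epow_ennreal)
   then obtain n where n: "h n x < epow (en d) t" unfolding H_def INF_less_iff by blast
   have "epow (mx (w n) x) t \<le> h n x" "epow (w n x) t \<le> h n x" by (auto simp: h_def)
   then have m: "mx (w n) x < en d" "w n x < en d"
    using n t by (auto intro: epow_less_cancel[of _ t] le_less_trans)
   have g1: "(\<lambda>J. conv (lowpass (2 ^ J)) (g n) x) \<longlonglongrightarrow> g n x"
    using conv_approximate_identity[OF psi_nice psi_zero_integral g(1,2), of n x] by (simp add: lowpass_eq)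
   then obtain N where N: "\<And>J. J \<ge> N ==> \<bar>conv (lowpass (2 ^ J)) (g n) x - g n x\<bar> < e / 2"
    using LIMSEQ_D[OF g1, of "e / 2"] e by auto
   have "\<bar>conv (lowpass (2 ^ J)) u x - u x\<bar> < e" if J: "J \<ge> N" for J
   proof -
    let ?L = "lowpass (2 ^ J)"
    have L: "nice ?L" by (rule lowpass_nice) simp
    note [measurable] = nice_measurable[OF L]
    have lg: "L1 (\<lambda>y. ?L (x - y) * g n y)" by (rule conv_integrable[OF L nice_integrable[OF g(1)]])
    have lu: "L1 (\<lambda>y. ?L (x - y) * u y)" by (rule conv_lq_bound(1)[OF L u t])
    have "en \<bar>conv ?L u x - conv ?L (g n) x\<bar> = en (norm (LINT y. ?L (x - y) * (u y - g n y)))"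
     unfolding conv_def using lu lg by (simp add: right_diff_distrib)
    also have "... \<le> (\<integral>y. en \<bar>?L (x - y)\<bar> * w n y)"
     using norm_LINT_le[of lborel "\<lambda>y. ?L (x - y) * (u y - g n y)"] by (simp add: w_def abs_mult ennreal_mult)
    also have "... \<le> en D * mx (w n) x"
     unfolding D_def using A by (intro C3(2)[of "2 ^ J"]) auto
    also have "... \<le> en D * en d" by (intro mult_left_mono less_imp_le[OF m(1)]) simp
    also have "... = en (D * d)" using D d by (simp add: ennreal_mult)
    finally have "\<bar>conv ?L u x - conv ?L (g n) x\<bar> \<le> D * d" using D d by (subst (asm) ennreal_le_iff) auto
    moreover have "\<bar>u x - g n x\<bar> < d" using m(2) d unfolding w_def by (subst (asm) ennreal_less_iff) auto
    moreover have "D * d + d = e / 2"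
    proof -
     have "D + 1 \<noteq> 0" using D by simp
     then have "d * (D + 1) = e / 2" by (rule iffD1[OF nonzero_eq_divide_eq d_def])
     then show ?thesis by (simp add: algebra_simps)
    qed
    ultimately show ?thesis using N[OF J] by linarith
   qed
   then show "\<exists>N. \<forall>J\<ge>N. norm (conv (lowpass (2 ^ J)) u x - u x) < e" by auto
  qed
 qed
qed

text \<open>Hoelder's inequality: the $L^{t'}$ norm of the kernel at scale \<open>c\<close> is a multiple of $c^{d/t}$,
 where \<open>t'\<close> is the exponent conjugate to \<open>t\<close>. Here it matters that \<open>u\<close>
 lies in a Lebesgue space, so that no low frequencies are lost.\<close>

lemma lowpass_vanishes:
 fixes u :: "'a => real"
 assumes u: "lq t u" and t: "t > 1"
 shows "(\<lambda>J. conv (lowpass (1 / 2 ^ J)) u x) \<longlonglongrightarrow> 0"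
proof -
 define r where "r = t / (t - 1)"
 have r: "r > 0" using t by (simp add: r_def)
 define M where "M = (\<integral>y. en (\<bar>\<psi> 0 y\<bar> powr r))"
 have M: "M < \<top>" unfolding M_def r_def by (rule conv_lq_bound(3)[OF psi_nice u t])
 define U where "U = (\<integral>y. en (\<bar>u y\<bar> powr t))"
 have U: "U < \<top>" using u by (simp add: U_def lq_def)
 note [measurable] = nice_measurable[OF psi_nice]
 define B where "B = enn2real (epow M ((t - 1) / t) * epow U (1 / t))"
 have B: "epow M ((t - 1) / t) * epow U (1 / t) = en B"
  unfolding B_def using M U by (intro ennreal_enn2real[symmetric]) (simp add: ennreal_mult_less_top)
 have "\<bar>conv (lowpass c) u x\<bar> \<le> c powr (DIM('a) / t) * B" if c: "c > 0" for c
 proof -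
  have "(\<integral>y. en (\<bar>lowpass c y\<bar> powr r)) = (\<integral>y. en (c powr (DIM('a) * r)) * en (\<bar>\<psi> 0 (c *\<^sub>R y)\<bar> powr r))"
  proof (rule nn_integral_cong)
   fix y
   have "(c ^ DIM('a)) powr r = c powr (DIM('a) * r)" using c by (simp add: powr_realpow[symmetric] powr_powr)
   then show "en (\<bar>lowpass c y\<bar> powr r) = en (c powr (DIM('a) * r)) * en (\<bar>\<psi> 0 (c *\<^sub>R y)\<bar> powr r)"
    using c by (simp add: lowpass_eq abs_mult powr_mult ennreal_mult)
  qed
  also have "... = en (c powr (DIM('a) * r)) * (\<integral>y. en (\<bar>\<psi> 0 (c *\<^sub>R y)\<bar> powr r))"
   by (rule nn_integral_cmult) measurable
  also have "c powr (DIM('a) * r) = c powr (DIM('a) * (r - 1)) * c ^ DIM('a)"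
   using c by (simp add: powr_realpow[symmetric] powr_add[symmetric] algebra_simps)
  also have "en (c powr (DIM('a) * (r - 1)) * c ^ DIM('a)) * (\<integral>y. en (\<bar>\<psi> 0 (c *\<^sub>R y)\<bar> powr r)) = en (c powr (DIM('a) * (r - 1))) * M"
   unfolding M_def using nn_integral_lborel_affine[of "\<lambda>y. en (\<bar>\<psi> 0 y\<bar> powr r)" c 0] c by (simp add: ennreal_mult mult.assoc)
  finally have I: "(\<integral>y. en (\<bar>lowpass c y\<bar> powr r)) = en (c powr (DIM('a) * (r - 1))) * M" .
  have "r - 1 = 1 / (t - 1)" using t by (simp add: r_def field_simps)
  then have "DIM('a) * (r - 1) * ((t - 1) / t) = DIM('a) / t" using t by simp
  then have p: "(c powr (DIM('a) * (r - 1))) powr ((t - 1) / t) = c powr (DIM('a) / t)" by (simp only: powr_powr)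
  have "en \<bar>conv (lowpass c) u x\<bar> \<le> epow (en (c powr (DIM('a) * (r - 1))) * M) ((t - 1) / t) * epow U (1 / t)"
   using conv_lq_bound(2)[OF lowpass_nice[OF c] u t, of x] unfolding I[unfolded r_def] r_def U_def .
  also have "... = en (c powr (DIM('a) / t)) * en B"
   using t by (simp add: epow_mult epow_ennreal p mult.assoc flip: B)
  also have "... = en (c powr (DIM('a) / t) * B)" by (simp add: ennreal_mult B_def)
  finally show ?thesis by (subst (asm) ennreal_le_iff) (auto simp: B_def)
 qed
 then have b: "\<bar>conv (lowpass (1 / 2 ^ J)) u x\<bar> \<le> (1 / 2 ^ J) powr (DIM('a) / t) * B" for J by simp
 have "(\<lambda>J. (1 / 2 ^ J) powr (DIM('a) / t) * B) \<longlonglongrightarrow> 0 powr (DIM('a) / t) * B"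
  using t LIMSEQ_realpow_zero[of "1/2"] by (intro tendsto_mult tendsto_const tendsto_powr') (auto simp: power_one_over)
 then have "(\<lambda>J. (1 / 2 ^ J) powr (DIM('a) / t) * B) \<longlonglongrightarrow> 0" by simp
 then show ?thesis by (rule Lim_null_comparison[rotated]) (use b in auto)
qed

text \<open>Let $r=|x-y|$. For $|x-z|<2r$ both kernels are bounded by their size $|\cdot|^{s-d}$, which integrates to $r^s$.
 For $|x-z|\ge2r$ their difference gains $r/|x-z|$, and $r|x-z|^{s-1-d}$ integrates to $r^s$ as $s<1$.\<close>

lemma kernel_difference_integral:
 assumes s: "0 < s" "s < 1"
 shows "\<exists>C>0. \<forall>(J :: int set) x y f. finite J --> x \<noteq> y --> f \<in> \<B> -->
  (\<integral>z. en (\<Sum>j\<in>J. \<bar>ker (dil (- s) j) (x - z) - ker (dil (- s) j) (y - z)\<bar>) * f z) \<le> en (C * dist x y powr s) * (mx f x + mx f y)"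
proof -
 have D1: "1 \<le> real DIM('a)" using DIM_positive[where 'a='a] by linarith
 obtain C0 where C0: "C0 > 0" "\<And>(J :: int set) x. finite J ==> x \<noteq> 0 ==> (\<Sum>j\<in>J. \<bar>ker (dil (- s) j) x\<bar>) \<le> C0 * norm x powr (s - DIM('a))"
  "\<And>(J :: int set) x h. finite J ==> x \<noteq> 0 ==> 2 * norm h \<le> norm x ==> (\<Sum>j\<in>J. \<bar>ker (dil (- s) j) (x + h) - ker (dil (- s) j) x\<bar>) \<le> C0 * norm h * norm x powr (s - 1 - DIM('a))"
  using dyadic_kernel_sum[of "- s"] s D1 by auto
 obtain Cn where Cn: "Cn > 0" "\<And>f \<rho> (x::'a). f \<in> \<B> ==> \<rho> > 0 ==>
  (\<integral>z. en (dist x z powr (s - DIM('a))) * ind (ball x \<rho>) z * f z) \<le> en (Cn * \<rho> powr s) * mx f x"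
  using mx_near[of s, where 'a='a] s D1 by auto
 obtain Cf where Cf: "Cf > 0" "\<And>f \<rho> (x::'a). f \<in> \<B> ==> \<rho> > 0 ==>
  (\<integral>z. en (dist x z powr (- (1 - s) - DIM('a))) * ind (- ball x \<rho>) z * f z) \<le> en (Cf * \<rho> powr (- (1 - s))) * mx f x"
  using mx_far[of "1 - s", where 'a='a] s by auto
 define C where "C = C0 * (Cn * 3 powr s + Cf)"
 show ?thesis
 proof (intro exI[of _ C] conjI allI impI)
  show "C > 0" using C0 Cn Cf by (simp add: C_def add_pos_pos)
  fix J :: "int set" and x y :: 'a and f :: "'a => ennreal"
  assume J: "finite J" and xy: "x \<noteq> y" and f[measurable]: "f \<in> \<B>"
  define r where "r = dist x y"
  have r: "r > 0" using xy by (simp add: r_def)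
  define k where "k z = (\<Sum>j\<in>J. \<bar>ker (dil (- s) j) (x - z) - ker (dil (- s) j) (y - z)\<bar>)" for z
  define n where "n w \<rho> z = en (dist w z powr (s - DIM('a))) * ind (ball w \<rho>) z * f z" for w z :: 'a and \<rho>
  define m where "m z = en (dist x z powr (- (1 - s) - DIM('a))) * ind (- ball x (2 * r)) z * f z" for z
  have [measurable]: "n w \<rho> \<in> \<B>" "m \<in> \<B>" for w \<rho>
   unfolding n_def[abs_def] m_def[abs_def] by measurable
  have pt: "en (k z) * f z \<le> en C0 * (n x (2 * r) z + n y (3 * r) z) + en (C0 * r) * m z" if z: "z \<noteq> x" "z \<noteq> y" for z
  proof (cases "dist x z < 2 * r")
   case True
   have "k z \<le> (\<Sum>j\<in>J. \<bar>ker (dil (- s) j) (x - z)\<bar> + \<bar>ker (dil (- s) j) (y - z)\<bar>)"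
    unfolding k_def by (intro sum_mono abs_triangle_ineq4)
   also have "... \<le> C0 * dist x z powr (s - DIM('a)) + C0 * dist y z powr (s - DIM('a))"
    using C0(2)[OF J, of "x - z"] C0(2)[OF J, of "y - z"] z by (simp add: sum.distrib dist_norm)
   finally have "en (k z) * f z \<le> en (C0 * dist x z powr (s - DIM('a)) + C0 * dist y z powr (s - DIM('a))) * f z"
    by (intro mult_right_mono ennreal_leI) auto
   also have "... = en C0 * (en (dist x z powr (s - DIM('a))) * f z + en (dist y z powr (s - DIM('a))) * f z)"
    using C0(1) by (simp add: ennreal_plus ennreal_mult distrib_left distrib_right mult.assoc)
   also have "en (dist x z powr (s - DIM('a))) * f z = n x (2 * r) z" using True by (simp add: n_def)
   also have "en (dist y z powr (s - DIM('a))) * f z = n y (3 * r) z"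
   proof -
    have "dist y z < 3 * r" using True dist_triangle[of y z x] by (simp add: r_def dist_commute)
    then show ?thesis by (simp add: n_def)
   qed
   finally show ?thesis by (rule order_trans) simp
  next
   case False
   have "k z = (\<Sum>j\<in>J. \<bar>ker (dil (- s) j) (x - z + (y - x)) - ker (dil (- s) j) (x - z)\<bar>)"
    unfolding k_def by (intro sum.cong refl) (simp add: abs_minus_commute)
   also have "... \<le> C0 * norm (y - x) * norm (x - z) powr (s - 1 - DIM('a))"
    using False z by (intro C0(3)[OF J]) (auto simp: r_def dist_norm norm_minus_commute)
   also have "... = C0 * r * dist x z powr (- (1 - s) - DIM('a))" by (simp add: r_def dist_norm norm_minus_commute)
   finally have "en (k z) * f z \<le> en (C0 * r * dist x z powr (- (1 - s) - DIM('a))) * f z"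
    by (intro mult_right_mono ennreal_leI) auto
   also have "... = en (C0 * r) * (en (dist x z powr (- (1 - s) - DIM('a))) * f z)"
    using C0(1) r by (subst ennreal_mult) (auto simp: mult.assoc)
   also have "en (dist x z powr (- (1 - s) - DIM('a))) * f z = m z" using False by (simp add: m_def)
   finally show ?thesis by (rule order_trans) simp
  qed
  have "(\<integral>z. en (k z) * f z) \<le> (\<integral>z. en C0 * (n x (2 * r) z + n y (3 * r) z) + en (C0 * r) * m z)"
  proof (rule nn_integral_mono_AE)
   show "AE z in lborel. en (k z) * f z \<le> en C0 * (n x (2 * r) z + n y (3 * r) z) + en (C0 * r) * m z"
    using AE_lborel_singleton[of x] AE_lborel_singleton[of y] by eventually_elim (rule pt)
  qed
  also have "... = en C0 * ((\<integral>z. n x (2 * r) z) + (\<integral>z. n y (3 * r) z)) + en (C0 * r) * (\<integral>z. m z)"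
   by (simp add: nn_integral_add nn_integral_cmult)
  also have "... \<le> en C0 * (en (Cn * (3 * r) powr s) * mx f x + en (Cn * (3 * r) powr s) * mx f y) + en (C0 * r) * (en (Cf * r powr (- (1 - s))) * mx f x)"
  proof (intro add_mono mult_left_mono)
   have "(\<integral>z. n x (2 * r) z) \<le> (\<integral>z. n x (3 * r) z)"
    unfolding n_def by (intro nn_integral_mono mult_right_mono mult_left_mono) (use r in \<open>auto simp: indicator_def\<close>)
   also have "... \<le> en (Cn * (3 * r) powr s) * mx f x" unfolding n_def using r by (intro Cn(2)) auto
   finally show "(\<integral>z. n x (2 * r) z) \<le> en (Cn * (3 * r) powr s) * mx f x" .
   show "(\<integral>z. n y (3 * r) z) \<le> en (Cn * (3 * r) powr s) * mx f y" unfolding n_def using r by (intro Cn(2)) auto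
   have "(\<integral>z. m z) \<le> en (Cf * (2 * r) powr (- (1 - s))) * mx f x" unfolding m_def using r by (intro Cf(2)) auto
   also have "... \<le> en (Cf * r powr (- (1 - s))) * mx f x"
    using r s Cf(1) by (intro mult_right_mono ennreal_leI mult_left_mono powr_mono2') auto
   finally show "(\<integral>z. m z) \<le> en (Cf * r powr (- (1 - s))) * mx f x" .
  qed auto
  also have "... \<le> en (C * r powr s) * (mx f x + mx f y)"
  proof -
   have e1: "en C0 * (en (Cn * (3 * r) powr s) * M) = en (C0 * Cn * 3 powr s * r powr s) * M" for M
    using C0(1) Cn(1) r by (simp add: powr_mult ennreal_mult mult.assoc)
   have "r * r powr (- (1 - s)) = r powr s" using r by (simp add: powr_mult_base)
   then have "C0 * r * (Cf * r powr (- (1 - s))) = C0 * Cf * r powr s" by (metis mult.assoc mult.left_commute)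
   moreover have "en (C0 * r) * (en (Cf * r powr (- (1 - s))) * M) = en (C0 * r * (Cf * r powr (- (1 - s)))) * M" for M
    using C0(1) Cf(1) r by (subst ennreal_mult) (auto simp: mult.assoc)
   ultimately have e2: "en (C0 * r) * (en (Cf * r powr (- (1 - s))) * M) = en (C0 * Cf * r powr s) * M" for M
    by (simp only:)
   have C': "en (C * r powr s) = en (C0 * Cn * 3 powr s * r powr s) + en (C0 * Cf * r powr s)"
    using C0(1) Cn(1) Cf(1) by (subst ennreal_plus[symmetric]) (auto simp: C_def algebra_simps)
   show ?thesis unfolding distrib_left[of "en C0"] e1 e2 C' distrib_right distrib_left
    by (simp add: add_ac add_increasing)
  qed
  finally show "(\<integral>z. en (\<Sum>j\<in>J. \<bar>ker (dil (- s) j) (x - z) - ker (dil (- s) j) (y - z)\<bar>) * f z) \<le> en (C * dist x y powr s) * (mx f x + mx f y)"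
   by (simp add: k_def r_def)
 qed
qed

lemma cconv_diff_kernel:
 assumes "nice K" "nice L" "in_Lp q f" "q > 1"
 shows "cconv K f x - cconv L f x = cconv (\<lambda>z. K z - L z) f x"
 unfolding cconv_def using cconv_integrable[OF assms(1,3,4)] cconv_integrable[OF assms(2,3,4)]
 by (subst Bochner_Integration.integral_diff[symmetric]) (auto simp: right_diff_distrib)

text \<open>The pieces $P_j u$ equal the convolutions of $v = D^s u$ with the kernels of
 $|\xi|^{-s}\chi(2^{-j}\xi)$, and they add up telescopically to a difference of two smoothings of $u$.\<close>

lemma lowpass_telescope:
 assumes s: "s > 0" and t: "t > 1" and q: "q > 1" and u: "in_Lp t u" and v: "in_Lp q v" and rep: "represents (Dpow s (distr_of u)) v"
 shows "cconv (lowpass (2 ^ J)) u x - cconv (lowpass (1 / 2 ^ J)) u x = (\<Sum>j\<in>{- int J<..int J}. cconv (ker (dil (- s) j)) v x)"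
proof -
 define F where "F i = cconv (lowpass (2 powr real_of_int (int i - int J))) u x" for i
 have step: "F (Suc i) - F i = cconv (ker (dil (- s) (int (Suc i) - int J))) v x" for i
 proof -
  define j where "j = int (Suc i) - int J"
  have j1: "int i - int J = j - 1" by (simp add: j_def)
  have "(\<lambda>z. lowpass (2 powr j) z - lowpass (2 powr (j - 1)) z) = ker (dil 0 j)"
  proof
   fix z
   have "dil 0 j = (\<lambda>\<xi>. \<eta> ((1 / 2 powr j) *\<^sub>R \<xi>) - \<eta> ((1 / 2 powr (j - 1)) *\<^sub>R \<xi>))"
   proof
    fix \<xi> :: 'a
    have "2 *\<^sub>R (1 / 2 powr j) *\<^sub>R \<xi> = (1 / 2 powr (j - 1)) *\<^sub>R \<xi>" by (simp add: powr_diff)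
    then show "dil 0 j \<xi> = \<eta> ((1 / 2 powr j) *\<^sub>R \<xi>) - \<eta> ((1 / 2 powr (j - 1)) *\<^sub>R \<xi>)"
     unfolding dil_def lp_chi_def by (cases "\<xi> = 0") simp_all
   qed
   then show "lowpass (2 powr j) z - lowpass (2 powr (j - 1)) z = ker (dil 0 j) z"
    unfolding lowpass_def by (simp only:) (rule ker_diff[symmetric], (rule lowpass_symbol_integrable, simp)+)
  qed
  then have "F (Suc i) - F i = cconv (ker (dil 0 j)) u x"
   unfolding F_def j1 j_def[symmetric] by (subst cconv_diff_kernel[OF lowpass_nice lowpass_nice u t]) auto
  also have "dil 0 j = (\<lambda>\<xi>. norm \<xi> powr s * dil (- s) j \<xi>)"
   by (auto simp: dil_def fun_eq_iff powr_minus)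
  also have "cconv (ker (\<lambda>\<xi>. norm \<xi> powr s * dil (- s) j \<xi>)) u x = cconv (ker (dil (- s) j)) v x"
   unfolding cconv_def by (rule representation_identity[OF dil_smooth dil_csupp dil_even s rep])
  finally show ?thesis by (simp only: j_def)
 qed
 have e: "F (2 * J) = cconv (lowpass (2 ^ J)) u x" "F 0 = cconv (lowpass (1 / 2 ^ J)) u x"
  using powr_realpow[of 2 J] by (simp_all add: F_def powr_minus inverse_eq_divide)
 have "(\<Sum>j\<in>{- int J<..int J}. cconv (ker (dil (- s) j)) v x) = (\<Sum>i<2 * J. cconv (ker (dil (- s) (int (Suc i) - int J))) v x)"
  by (rule sum.reindex_bij_witness[where i="\<lambda>i. int (Suc i) - int J" and j="\<lambda>j. nat (j + int J - 1)"]) auto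
 also have "... = (\<Sum>i<2 * J. F (Suc i) - F i)" by (simp only: step)
 also have "... = F (2 * J) - F 0" by (rule sum_lessThan_telescope)
 finally show ?thesis by (simp add: e)
qed

text \<open>Almost everywhere \<open>u\<close> is the limit of $u_J-u_{-J}$, where $u_j$ is its smoothing at scale $2^{-j}$,
 and this difference is a convolution of \<open>v\<close> with a kernel whose differences are controlled
 uniformly in \<open>J\<close>. The set \<open>G\<close> where the limit exists does not depend on the pair of
 points.\<close>

lemma difference_estimate:
 assumes s: "0 < s" "s < 1" and t: "t > 1" and q: "q > 1"
 shows "\<exists>C>0. \<forall>u v :: 'a => complex. in_Lp t u --> in_Lp q v --> represents (Dpow s (distr_of u)) v -->
  (\<exists>G. (AE x in lborel. x \<in> G) \<and> (\<forall>x\<in>G. \<forall>y\<in>G. en (cmod (u x - u y)) \<le>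
   en (C * dist x y powr s) * (mx (\<lambda>z. en (cmod (v z))) x + mx (\<lambda>z. en (cmod (v z))) y)))"
proof -
 obtain C where C: "C > 0" "\<And>(J :: int set) x y f. finite J ==> x \<noteq> y ==> f \<in> \<B> ==>
  (\<integral>z. en (\<Sum>j\<in>J. \<bar>ker (dil (- s) j) (x - z) - ker (dil (- s) j) (y - z)\<bar>) * f z) \<le> en (C * dist x y powr s) * (mx f x + mx f y)"
  using kernel_difference_integral[OF s] by meson
 show ?thesis
 proof (intro exI[of _ C] conjI allI impI)
  fix u v :: "'a => complex"
  assume u: "in_Lp t u" and v: "in_Lp q v" and rep: "represents (Dpow s (distr_of u)) v"
  have [measurable]: "v \<in> \<B>" using v by (simp add: in_Lp_def)
  have t0: "t > 0" using t by simp
  define A where "A J x = cconv (lowpass (2 ^ J)) u x" for J x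
  define B where "B J x = cconv (lowpass (1 / 2 ^ J)) u x" for J x
  define G where "G = {x. (\<lambda>J. A J x) \<longlonglongrightarrow> u x}"
  have ln: "nice (lowpass (2 ^ J))" "nice (lowpass (1 / 2 ^ J))" for J by (rule lowpass_nice; simp)+
  have B0: "(\<lambda>J. B J x) \<longlonglongrightarrow> 0" for x
   unfolding B_def tendsto_complex_iff Re_cconv[OF ln(2) u t] Im_cconv[OF ln(2) u t]
   using lowpass_vanishes[OF in_Lp_lq(1)[OF u t0] t, of x] lowpass_vanishes[OF in_Lp_lq(2)[OF u t0] t, of x] by simp
  have AEG: "AE x in lborel. x \<in> G"
   using lowpass_converges[OF in_Lp_lq(1)[OF u t0] t] lowpass_converges[OF in_Lp_lq(2)[OF u t0] t]
   by eventually_elim (simp add: G_def A_def tendsto_complex_iff Re_cconv[OF ln(1) u t] Im_cconv[OF ln(1) u t])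
  have est: "en (cmod (u x - u y)) \<le> en (C * dist x y powr s) * (mx (\<lambda>z. en (cmod (v z))) x + mx (\<lambda>z. en (cmod (v z))) y)" (is "_ \<le> ?R")
   if x: "x \<in> G" and y: "y \<in> G" for x y
  proof (cases "x = y")
   case False
   have "(\<lambda>J. (A J x - B J x) - (A J y - B J y)) \<longlonglongrightarrow> (u x - 0) - (u y - 0)"
    using x y by (intro tendsto_diff B0) (auto simp: G_def)
   then have lim: "(\<lambda>J. en (cmod ((A J x - B J x) - (A J y - B J y)))) \<longlonglongrightarrow> en (cmod (u x - u y))"
    by (intro tendsto_ennrealI tendsto_norm) simp
   have "en (cmod ((A J x - B J x) - (A J y - B J y))) \<le> ?R" for J
   proof -
    let ?I = "{- int J<..int J}" and ?k = "\<lambda>j. ker (dil (- s) j)"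
    have kn: "nice (?k j)" for j by (rule nice_ker[OF dil_smooth dil_csupp])
    note [measurable] = nice_measurable[OF kn]
    have "(A J x - B J x) - (A J y - B J y) = (\<Sum>j\<in>?I. cconv (?k j) v x - cconv (?k j) v y)"
     unfolding A_def B_def lowpass_telescope[OF s(1) t q u v rep] by (rule sum_subtractf[symmetric])
    also have "... = (\<Sum>j\<in>?I. LINT z. v z * cr (?k j (x - z) - ?k j (y - z)))"
     unfolding cconv_def
     by (intro sum.cong refl) (subst Bochner_Integration.integral_diff[symmetric], auto intro!: cconv_integrable[OF kn v q] simp: right_diff_distrib)
    also have "... = (LINT z. (\<Sum>j\<in>?I. v z * cr (?k j (x - z) - ?k j (y - z))))"
    proof (rule Bochner_Integration.integral_sum[symmetric])
     fix j
     show "L1 (\<lambda>z. v z * cr (?k j (x - z) - ?k j (y - z)))"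
      using Bochner_Integration.integrable_diff[OF cconv_integrable[OF kn v q, of j x] cconv_integrable[OF kn v q, of j y]]
      by (simp add: right_diff_distrib)
    qed
    finally have "en (cmod ((A J x - B J x) - (A J y - B J y))) \<le> (\<integral>z. en (cmod (\<Sum>j\<in>?I. v z * cr (?k j (x - z) - ?k j (y - z)))))"
     by (simp only: norm_LINT_le)
    also have "... \<le> (\<integral>z. en (\<Sum>j\<in>?I. \<bar>?k j (x - z) - ?k j (y - z)\<bar>) * en (cmod (v z)))"
    proof (intro nn_integral_mono)
     fix z
     have "cmod (\<Sum>j\<in>?I. v z * cr (?k j (x - z) - ?k j (y - z))) \<le> (\<Sum>j\<in>?I. cmod (v z * cr (?k j (x - z) - ?k j (y - z))))"
      by (rule norm_sum)
     also have "... = (\<Sum>j\<in>?I. \<bar>?k j (x - z) - ?k j (y - z)\<bar>) * cmod (v z)"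
      by (simp only: norm_mult norm_of_real sum_distrib_left mult.commute[of _ "cmod (v z)"])
     finally show "en (cmod (\<Sum>j\<in>?I. v z * cr (?k j (x - z) - ?k j (y - z)))) \<le> en (\<Sum>j\<in>?I. \<bar>?k j (x - z) - ?k j (y - z)\<bar>) * en (cmod (v z))"
      by (subst ennreal_mult[symmetric]) (auto intro: sum_nonneg)
    qed
    also have "... \<le> ?R" by (rule C(2)) (use False in auto)
    finally show ?thesis .
   qed
   then show ?thesis by (intro LIMSEQ_le_const2[OF lim]) auto
  qed simp
  show "\<exists>G. (AE x in lborel. x \<in> G) \<and> (\<forall>x\<in>G. \<forall>y\<in>G. en (cmod (u x - u y)) \<le>
   en (C * dist x y powr s) * (mx (\<lambda>z. en (cmod (v z))) x + mx (\<lambda>z. en (cmod (v z))) y))"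
   using AEG est by blast
 qed (rule C(1))
qed

end

section \<open>The Taylor remainder of the nonlinearity\<close>

text \<open>Taylor's formula of second order; the interval stays away from the singularity at $-1$.\<close>

lemma powr_taylor:
 fixes r :: real
 assumes r: "r > 0"
 shows "\<exists>C>0. \<forall>x\<in>{-3/4..5/4}. \<bar>(1 + x) powr r - 1 - r * x\<bar> \<le> C * x\<^sup>2"
proof -
 define M where "M = r * \<bar>r - 1\<bar> * (16 * (9/4) powr r)"
 have M: "M \<ge> 0" using r by (simp add: M_def)
 let ?S = "{-3/4..5/4::real}"
 have d2: "\<bar>r * (1 + x) powr (r - 1) - r\<bar> \<le> M * \<bar>x\<bar>" if x: "x \<in> ?S" for x
 proof -
  have "norm ((r * (1 + x) powr (r - 1) - r) - (r * (1 + 0) powr (r - 1) - r)) \<le> M * norm (x - 0)"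
  proof (rule field_differentiable_bound[of ?S "\<lambda>x. r * (1 + x) powr (r - 1) - r" "\<lambda>x. r * ((r - 1) * (1 + x) powr (r - 2))"])
   fix z assume z: "z \<in> ?S"
   then show "((\<lambda>x. r * (1 + x) powr (r - 1) - r) has_field_derivative r * ((r - 1) * (1 + z) powr (r - 2))) (at z within ?S)"
    by (auto intro!: derivative_eq_intros)
   have "(1 + z) powr (r - 2) = (1 + z) powr r / (1 + z)\<^sup>2" using z by (simp add: powr_diff powr_numeral)
   also have "... \<le> (9/4) powr r / (1/4)\<^sup>2" using z r by (intro frac_le powr_mono2 power_mono) auto
   finally have "(1 + z) powr (r - 2) \<le> 16 * (9/4) powr r" by (simp add: power2_eq_square)
   then have "r * \<bar>r - 1\<bar> * (1 + z) powr (r - 2) \<le> M" unfolding M_def using r by (intro mult_left_mono) auto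
   then show "norm (r * ((r - 1) * (1 + z) powr (r - 2))) \<le> M" using r by (simp add: abs_mult mult.assoc)
  qed (use x in auto)
  then show ?thesis by simp
 qed
 have "\<bar>(1 + x) powr r - 1 - r * x\<bar> \<le> (M + 1) * x\<^sup>2" if x: "x \<in> ?S" for x
 proof -
  have sub: "closed_segment 0 x \<subseteq> ?S" using x by (intro closed_segment_subset) auto
  have "norm (((1 + x) powr r - 1 - r * x) - ((1 + 0) powr r - 1 - r * 0)) \<le> (M * \<bar>x\<bar>) * norm (x - 0)"
  proof (rule field_differentiable_bound[of "closed_segment 0 x" "\<lambda>x. (1 + x) powr r - 1 - r * x" "\<lambda>x. r * (1 + x) powr (r - 1) - r"])
   fix z assume z: "z \<in> closed_segment 0 x"
   then have zS: "z \<in> ?S" using sub by blast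
   then show "((\<lambda>x. (1 + x) powr r - 1 - r * x) has_field_derivative r * (1 + z) powr (r - 1) - r) (at z within closed_segment 0 x)"
    by (auto intro!: derivative_eq_intros)
   have "\<bar>z\<bar> \<le> \<bar>x\<bar>" using z by (auto simp: closed_segment_eq_real_ivl split: if_splits)
   then show "norm (r * (1 + z) powr (r - 1) - r) \<le> M * \<bar>x\<bar>" using d2[OF zS] M by (simp add: order_trans[OF _ mult_left_mono])
  qed auto
  also have "M * \<bar>x\<bar> * norm (x - 0) = M * x\<^sup>2" by (simp add: power2_eq_square abs_mult[symmetric] mult.assoc)
  also have "... \<le> (M + 1) * x\<^sup>2" by (intro mult_right_mono) auto
  finally show ?thesis by simp
 qed
 then show ?thesis using M by (intro exI[of _ "M + 1"]) auto
qed

text \<open>The real differential of $|z|^p$ at \<open>a\<close>, applied to \<open>h\<close>.\<close>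

definition power_diff :: "real => complex => complex => real" where
 "power_diff p a h = p * cmod a powr (p - 2) * Re (cnj a * h)"

lemma power_diff_bound:
 assumes "p > 1" shows "\<bar>power_diff p a h\<bar> \<le> p * cmod a powr (p - 1) * cmod h"
proof -
 have "\<bar>Re (cnj a * h)\<bar> \<le> cmod a * cmod h" using abs_Re_le_cmod[of "cnj a * h"] by (simp add: norm_mult)
 then have "\<bar>power_diff p a h\<bar> \<le> p * cmod a powr (p - 2) * (cmod a * cmod h)"
  using assms unfolding power_diff_def by (simp add: abs_mult mult_left_mono)
 also have "cmod a powr (p - 2) * cmod a = cmod a powr (p - 1)"
  by (cases "a = 0") (auto simp: powr_mult_base mult.commute)
 then have "p * cmod a powr (p - 2) * (cmod a * cmod h) = p * cmod a powr (p - 1) * cmod h"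
  by (simp only: mult.assoc[symmetric]) (simp only: mult.assoc)
 finally show ?thesis .
qed

definition power_rem :: "real => complex => complex => real" where
 "power_rem p a b = cmod b powr p - cmod a powr p - power_diff p a (b - a)"

text \<open>If $|b-a|\ge|a|/2$ every term is dominated by the maximum; otherwise $|b|^2=|a|^2(1+\tau)$ with
 $|\tau|\lesssim|b-a|/|a|$ and the remainder is quadratic in $\tau$, which can only be improved upon by
 lowering the exponent $2$ to $1+\epsilon$.\<close>

lemma power_rem_bound:
 fixes p \<epsilon> :: real
 assumes p: "p > 1" and \<epsilon>: "0 < \<epsilon>" "\<epsilon> \<le> 1" "\<epsilon> \<le> p - 1"
 shows "\<exists>C>0. \<forall>a b. \<bar>power_rem p a b\<bar> \<le> C * (cmod (a - b) powr (1 + \<epsilon>) * max (cmod a) (cmod b) powr (p - 1 - \<epsilon>))"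
proof -
 define r where "r = p / 2"
 have r: "r > 0" using p by (simp add: r_def)
 obtain C0 where C0: "C0 > 0" "\<And>x. x \<in> {-3/4..5/4} ==> \<bar>(1 + x) powr r - 1 - r * x\<bar> \<le> C0 * x\<^sup>2"
  using powr_taylor[OF r] by blast
 define C where "C = (2 + 2 * p) * 9 + (C0 * (25/4) + r)"
 have "\<bar>power_rem p a b\<bar> \<le> C * (cmod (a - b) powr (1 + \<epsilon>) * max (cmod a) (cmod b) powr (p - 1 - \<epsilon>))" for a b
 proof -
  define h where "h = b - a"
  define m where "m = max (cmod a) (cmod b)"
  have m: "m \<ge> 0" "cmod a \<le> m" "cmod b \<le> m" by (auto simp: m_def le_max_iff_disj)
  have h: "cmod h \<le> cmod a + cmod b" "cmod b \<le> cmod a + cmod h" "cmod a \<le> cmod b + cmod h"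
   using norm_triangle_ineq4[of b a] norm_triangle_ineq[of a h] norm_triangle_ineq4[of b h] by (auto simp: h_def)
  let ?T = "cmod h powr (1 + \<epsilon>) * m powr (p - 1 - \<epsilon>)"
  have T: "?T \<ge> 0" by simp
  have "\<bar>power_rem p a b\<bar> \<le> C * ?T"
  proof (cases "cmod h \<ge> cmod a / 2")
   case True
   have "cmod a \<le> 3 * cmod h" "cmod b \<le> 3 * cmod h" using True h(2) norm_ge_zero[of h] by linarith+
   then have m3: "m \<le> 3 * cmod h" by (simp add: m_def)
   have "\<bar>power_rem p a b\<bar> \<le> cmod b powr p + cmod a powr p + \<bar>power_diff p a h\<bar>"
    unfolding power_rem_def h_def[symmetric] by (smt (verit) powr_ge_zero)
   also have "... \<le> m powr p + m powr p + p * m powr (p - 1) * (2 * m)"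
    using m p h(1) by (intro add_mono powr_mono2 order_trans[OF power_diff_bound] mult_mono) auto
   also have "p * m powr (p - 1) * (2 * m) = 2 * p * m powr p"
    using m(1) powr_mult_base[of m "p - 1"] by (simp add: mult.assoc mult.commute)
   also have "m powr p + m powr p + 2 * p * m powr p = (2 + 2 * p) * m powr p" by (simp add: algebra_simps)
   also have "m powr p = m powr (1 + \<epsilon>) * m powr (p - 1 - \<epsilon>)" by (simp add: powr_add[symmetric])
   also have "... \<le> (3 * cmod h) powr (1 + \<epsilon>) * m powr (p - 1 - \<epsilon>)"
    using m3 m \<epsilon> by (intro mult_right_mono powr_mono2) auto
   also have "(3 * cmod h) powr (1 + \<epsilon>) = 3 powr (1 + \<epsilon>) * cmod h powr (1 + \<epsilon>)" by (simp add: powr_mult)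
   also have "... \<le> 9 * cmod h powr (1 + \<epsilon>)"
    using powr_mono[of "1 + \<epsilon>" 2 3] \<epsilon> by (intro mult_right_mono) (auto simp: powr_numeral)
   finally have "\<bar>power_rem p a b\<bar> \<le> (2 + 2 * p) * (9 * cmod h powr (1 + \<epsilon>) * m powr (p - 1 - \<epsilon>))"
    using p by (simp add: mult_left_mono mult_right_mono)
   also have "... = (2 + 2 * p) * 9 * ?T" by simp
   also have "... \<le> C * ?T" using C0(1) r by (intro mult_right_mono) (auto simp: C_def)
   finally show ?thesis .
  next
   case False
   then have a: "cmod a > 0" and hs: "cmod h < cmod a / 2" by auto
   define X where "X = (cmod a)\<^sup>2"
   have X: "X > 0" using a by (simp add: X_def)
   define \<tau> where "\<tau> = (2 * Re (cnj a * h) + (cmod h)\<^sup>2) / X"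
   define g where "g = cmod h / cmod a"
   have g: "0 \<le> g" "g \<le> 1/2" using a hs by (auto simp: g_def pos_divide_le_eq)
   have b2: "(cmod b)\<^sup>2 = X * (1 + \<tau>)"
   proof -
    have "b = a + h" by (simp add: h_def)
    then have "(cmod b)\<^sup>2 = (cmod a)\<^sup>2 + 2 * Re (cnj a * h) + (cmod h)\<^sup>2"
     by (simp add: cmod_power2) (simp add: power2_eq_square algebra_simps)
    then show ?thesis using X by (simp add: \<tau>_def X_def field_simps)
   qed
   have g2: "(cmod h)\<^sup>2 / X = g\<^sup>2" by (simp add: g_def X_def power_divide)
   have "\<bar>Re (cnj a * h)\<bar> \<le> cmod a * cmod h" using abs_Re_le_cmod[of "cnj a * h"] by (simp add: norm_mult)
   then have "\<bar>2 * Re (cnj a * h) / X\<bar> \<le> 2 * (cmod a * cmod h) / X" using X by (simp add: divide_right_mono abs_mult)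
   also have "... = 2 * g" using a by (simp add: X_def g_def power2_eq_square)
   finally have "\<bar>\<tau>\<bar> \<le> 2 * g + g\<^sup>2" unfolding \<tau>_def add_divide_distrib g2 by (simp add: order_trans[OF abs_triangle_ineq])
   moreover have "g\<^sup>2 \<le> g / 2" using g mult_left_mono[of g "1/2" g] by (simp add: power2_eq_square)
   ultimately have \<tau>1: "\<bar>\<tau>\<bar> \<le> 5/2 * g" by simp
   have "cmod a / 2 \<le> cmod b" using h(3) hs by simp
   then have "(cmod a / 2)\<^sup>2 \<le> X * (1 + \<tau>)" unfolding b2[symmetric] by (intro power_mono) auto
   then have "X * (1/4) \<le> X * (1 + \<tau>)" by (simp add: X_def power_divide)
   then have \<tau>2: "\<tau> \<in> {-3/4..5/4}" using X \<tau>1 g by (auto simp: mult_le_cancel_left_pos)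
   have bp: "cmod b powr p = cmod a powr p * (1 + \<tau>) powr r"
   proof -
    have "cmod b powr p = ((cmod b)\<^sup>2) powr r" by (simp add: r_def powr_powr flip: powr_numeral)
    also have "... = X powr r * (1 + \<tau>) powr r" unfolding b2 using X \<tau>2 by (simp add: powr_mult)
    also have "X powr r = cmod a powr p" by (simp add: X_def r_def powr_powr flip: powr_numeral)
    finally show ?thesis .
   qed
   have dp: "power_diff p a h = cmod a powr p * (r * (\<tau> - g\<^sup>2))"
   proof -
    have "cmod a powr (p - 2) = cmod a powr p / X" using a by (simp add: powr_diff X_def powr_numeral)
    moreover have "\<tau> - g\<^sup>2 = 2 * Re (cnj a * h) / X" unfolding \<tau>_def g2[symmetric] by (simp add: diff_divide_distrib[symmetric])
    moreover have "p * (A / X) * R = A * (p / 2 * (2 * R / X))" for A R by simp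
    ultimately show ?thesis by (simp only: power_diff_def r_def)
   qed
   have "power_rem p a b = cmod a powr p * (((1 + \<tau>) powr r - 1 - r * \<tau>) + r * g\<^sup>2)"
    unfolding power_rem_def h_def[symmetric] bp dp by (simp add: algebra_simps)
   then have "\<bar>power_rem p a b\<bar> = cmod a powr p * \<bar>((1 + \<tau>) powr r - 1 - r * \<tau>) + r * g\<^sup>2\<bar>" by (simp add: abs_mult)
   also have "... \<le> cmod a powr p * (C0 * (25/4 * g\<^sup>2) + r * g\<^sup>2)"
   proof (intro mult_left_mono order_trans[OF abs_triangle_ineq] add_mono)
    have "\<bar>\<tau>\<bar>\<^sup>2 \<le> (5/2 * g)\<^sup>2" by (rule power_mono[OF \<tau>1]) simp
    then have "C0 * \<tau>\<^sup>2 \<le> C0 * (25/4 * g\<^sup>2)" using C0(1) by (intro mult_left_mono) (auto simp: power2_eq_square)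
    then show "\<bar>(1 + \<tau>) powr r - 1 - r * \<tau>\<bar> \<le> C0 * (25/4 * g\<^sup>2)" using C0(2)[OF \<tau>2] by linarith
   qed (use r in auto)
   also have "... = (C0 * (25/4) + r) * (cmod a powr p * g\<^sup>2)" by (simp add: algebra_simps)
   also have "... \<le> (C0 * (25/4) + r) * ?T"
   proof (intro mult_left_mono)
    have "g\<^sup>2 \<le> g powr (1 + \<epsilon>)"
    proof (cases "g = 0")
     case False
     have "g powr 2 \<le> g powr (1 + \<epsilon>)" using False g \<epsilon> by (intro powr_mono') auto
     then show ?thesis using False g by (simp add: powr_numeral)
    qed simp
    then have "cmod a powr p * g\<^sup>2 \<le> cmod a powr p * g powr (1 + \<epsilon>)" by (intro mult_left_mono) auto
    also have "... = cmod h powr (1 + \<epsilon>) * (cmod a powr p / cmod a powr (1 + \<epsilon>))"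
     by (simp add: g_def powr_divide)
    also have "cmod a powr p / cmod a powr (1 + \<epsilon>) = cmod a powr (p - 1 - \<epsilon>)" using a by (simp add: powr_diff[symmetric] algebra_simps)
    also have "cmod h powr (1 + \<epsilon>) * cmod a powr (p - 1 - \<epsilon>) \<le> ?T" using \<epsilon> m by (intro mult_left_mono powr_mono2) auto
    finally show "cmod a powr p * g\<^sup>2 \<le> ?T" .
   qed (use C0(1) r in auto)
   also have "... \<le> C * ?T" using p by (intro mult_right_mono) (auto simp: C_def)
   finally show ?thesis .
  qed
  then show ?thesis by (simp add: h_def m_def norm_minus_commute)
 qed
 moreover have "C > 0" using p C0(1) r by (simp add: C_def add_pos_pos)
 ultimately show ?thesis by blast
qed

section \<open>Integrating the remainder\<close>

text \<open>The \<open>L\<^sup>q\<close> functions that control the remainder: \<open>hv \<epsilon> V\<close> dominates \<open>V\<close>, and the average of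
 $V^{1+\epsilon}$ over any ball around \<open>x\<close> is at most its power $1+\epsilon$ at \<open>x\<close>.\<close>

definition hv :: "real => ('a::euclidean_space => ennreal) => 'a => ennreal" where
 "hv \<epsilon> V x = epow (epow (V x) (1 + \<epsilon>) + mx (\<lambda>z. epow (V z) (1 + \<epsilon>)) x) (1 / (1 + \<epsilon>))"

text \<open>The half of the bound for the remainder in which \<open>u x\<close> is the larger value. The other half is its
 reflection.\<close>

definition lower_rem :: "real => real => real => ('a::euclidean_space => complex) => 'a => 'a => ennreal" where
 "lower_rem p s \<epsilon> u x z = en (cmod (u x - u z) powr (1 + \<epsilon>) * cmod (u x) powr (p - 1 - \<epsilon>) * dist x z powr (- s - DIM('a)))
   * ind {z. cmod (u z) \<le> cmod (u x)} z"

lemma hv_measurable [measurable]: "V \<in> \<B> ==> hv \<epsilon> V \<in> \<B>"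
 unfolding hv_def[abs_def] by (intro measurable_compose[OF _ epow_measurable] borel_measurable_add mx_measurable) measurable

text \<open>With $a=|u(x)|$, the near part is $a^{p-1-\epsilon}$ times the integral of
 $|x-z|^{s\epsilon-d}(V(x)+V(z))^{1+\epsilon}$ over a ball, and the far part $a^p$ times that of $|x-z|^{-s-d}$
 over its complement. The exponent $s\epsilon>0$ makes the first one converge, which is why an improvement over a
 first order estimate is needed.\<close>

lemma lower_rem_integral:
 fixes s \<epsilon> p C1 :: real
 assumes s: "0 < s" "s < 1" and \<epsilon>: "0 < \<epsilon>" "\<epsilon> \<le> 1" and C1: "C1 > 0"
 shows "\<exists>C>0. \<forall>(u :: 'a::euclidean_space => complex) V G x. u \<in> \<B> --> V \<in> \<B> -->
  (AE z in lborel. z \<in> G) --> (\<forall>x\<in>G. \<forall>y\<in>G. en (cmod (u x - u y)) \<le> en (C1 * dist x y powr s) * (V x + V y)) --> x \<in> G -->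
  (\<integral>z. lower_rem p s \<epsilon> u x z) \<le> en C * (en (cmod (u x) powr (p - 1)) * hv \<epsilon> V x)"
proof -
 have D1: "1 \<le> real DIM('a)" using DIM_positive[where 'a='a] by linarith
 have se: "0 < s * \<epsilon>" "s * \<epsilon> \<le> DIM('a)" using s \<epsilon> D1 mult_le_one[of s \<epsilon>] by (auto intro: order_trans)
 obtain Cn where Cn: "Cn > 0" "\<And>f \<rho> (x::'a). f \<in> \<B> ==> \<rho> > 0 ==>
  (\<integral>z. en (dist x z powr (s * \<epsilon> - DIM('a))) * ind (ball x \<rho>) z * f z) \<le> en (Cn * \<rho> powr (s * \<epsilon>)) * mx f x"
  using mx_near[OF se] by auto
 obtain Cf where Cf: "Cf > 0" "\<And>f \<rho> (x::'a). f \<in> \<B> ==> \<rho> > 0 ==>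
  (\<integral>z. en (dist x z powr (- s - DIM('a))) * ind (- ball x \<rho>) z * f z) \<le> en (Cf * \<rho> powr (- s)) * mx f x"
  using mx_far[OF s(1), where 'a='a] by auto
 define c where "c = (2 * C1) powr (1 + \<epsilon>)"
 have c: "c > 0" using C1 by (simp add: c_def)
 define C where "C = c * Cn + 2 powr (1 + \<epsilon>) * Cf"
 have C: "C > 0" using c Cn Cf by (simp add: C_def add_pos_pos)
 show ?thesis
 proof (intro exI[of _ C] conjI allI impI C)
  fix u :: "'a => complex" and V :: "'a => ennreal" and G and x :: 'a
  assume [measurable]: "u \<in> \<B>" "V \<in> \<B>" and AEG: "AE z in lborel. z \<in> G"
   and est: "\<forall>x\<in>G. \<forall>y\<in>G. en (cmod (u x - u y)) \<le> en (C1 * dist x y powr s) * (V x + V y)" and x: "x \<in> G"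
  define E where "E z = epow (V z) (1 + \<epsilon>)" for z
  have [measurable]: "E \<in> \<B>" unfolding E_def[abs_def] by measurable
  define a where "a = cmod (u x)"
  define Y where "Y = E x + mx E x"
  have hvY: "hv \<epsilon> V x = epow Y (1 / (1 + \<epsilon>))" by (simp add: hv_def Y_def E_def[abs_def])
  let ?L = "(\<integral>z. lower_rem p s \<epsilon> u x z)"
  show "?L \<le> en C * (en (cmod (u x) powr (p - 1)) * hv \<epsilon> V x)"
  proof (cases "a = 0")
   case True
   have "lower_rem p s \<epsilon> u x z = 0" for z
    using True by (auto simp: lower_rem_def a_def indicator_def)
   then show ?thesis by simp
  next
   case False
   then have a: "a > 0" by (simp add: a_def)
   have main: "?L \<le> en (C * a powr (p - 1) * w)" if w: "w > 0" "Y \<le> en (w powr (1 + \<epsilon>))" for w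
   proof -
    (* This radius makes the near and the far part equal up to constants. It requires w > 0,
       whereas hv may vanish at x; hence w decreases to that value afterwards. *)
    define \<rho> where "\<rho> = (a / w) powr (1 / s)"
    have \<rho>: "\<rho> > 0" using a w by (simp add: \<rho>_def)
    have \<rho>s: "\<rho> powr s = a / w" using a w s by (simp add: \<rho>_def powr_powr)
    let ?c1 = "a powr (p - 1 - \<epsilon>) * c"
    let ?c2 = "2 powr (1 + \<epsilon>) * a powr p"
    let ?n = "Cn * \<rho> powr (s * \<epsilon>)"
    let ?m = "Cf * \<rho> powr (- s)"
    define n where "n f z = en (dist x z powr (s * \<epsilon> - DIM('a))) * ind (ball x \<rho>) z * f z" for f :: "'a => ennreal" and z
    define m where "m z = en (dist x z powr (- s - DIM('a))) * ind (- ball x \<rho>) z * 1" for z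
    have [measurable]: "m \<in> \<B>" "f \<in> \<B> ==> n f \<in> \<B>" for f
     unfolding m_def[abs_def] n_def[abs_def] by measurable
    have pt: "lower_rem p s \<epsilon> u x z \<le> en ?c1 * (n (\<lambda>z. E x) z + n E z) + en ?c2 * m z"
     if z: "z \<in> G" "z \<noteq> x" for z
    proof (cases "cmod (u z) \<le> a")
     case True
     let ?r = "dist x z"
     have r: "?r > 0" using z by simp
     have lr: "lower_rem p s \<epsilon> u x z = en (cmod (u x - u z) powr (1 + \<epsilon>) * a powr (p - 1 - \<epsilon>) * ?r powr (- s - DIM('a)))"
      using True by (simp add: lower_rem_def a_def)
     show ?thesis
     proof (cases "?r < \<rho>")
      case near: True
      have "en (cmod (u x - u z) powr (1 + \<epsilon>)) = epow (en (cmod (u x - u z))) (1 + \<epsilon>)" by (simp add: epow_ennreal)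
      also have "... \<le> epow (en (C1 * ?r powr s) * (V x + V z)) (1 + \<epsilon>)"
       using est x z \<epsilon> by (intro epow_mono) auto
      also have "... = en ((C1 * ?r powr s) powr (1 + \<epsilon>)) * epow (V x + V z) (1 + \<epsilon>)"
       using \<epsilon> C1 by (simp add: epow_mult epow_ennreal)
      also have "... \<le> en ((C1 * ?r powr s) powr (1 + \<epsilon>)) * (en (2 powr (1 + \<epsilon>)) * (E x + E z))"
       unfolding E_def using \<epsilon> by (intro mult_left_mono epow_sum_le) auto
      also have "... = en (c * ?r powr (s * (1 + \<epsilon>))) * (E x + E z)"
       using C1 by (subst mult.assoc[symmetric], subst ennreal_mult[symmetric]) (auto simp: c_def powr_mult powr_powr mult_ac)
      finally have k: "en (cmod (u x - u z) powr (1 + \<epsilon>)) \<le> en (c * ?r powr (s * (1 + \<epsilon>))) * (E x + E z)" .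
      have "lower_rem p s \<epsilon> u x z = en (a powr (p - 1 - \<epsilon>) * ?r powr (- s - DIM('a))) * en (cmod (u x - u z) powr (1 + \<epsilon>))"
       unfolding lr by (subst ennreal_mult[symmetric]) (auto simp: mult_ac)
      also have "... \<le> en (a powr (p - 1 - \<epsilon>) * ?r powr (- s - DIM('a))) * (en (c * ?r powr (s * (1 + \<epsilon>))) * (E x + E z))"
       by (intro mult_left_mono k) auto
      also have "... = en (?c1 * (?r powr (- s - DIM('a)) * ?r powr (s * (1 + \<epsilon>)))) * (E x + E z)"
       using c by (subst mult.assoc[symmetric], subst ennreal_mult[symmetric]) (auto simp: mult_ac)
      also have "?r powr (- s - DIM('a)) * ?r powr (s * (1 + \<epsilon>)) = ?r powr (s * \<epsilon> - DIM('a))"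
       by (simp add: powr_add[symmetric] algebra_simps)
      also have "en (?c1 * ?r powr (s * \<epsilon> - DIM('a))) * (E x + E z) = en ?c1 * (n (\<lambda>z. E x) z + n E z)"
       using near c by (subst ennreal_mult) (auto simp: n_def distrib_left mult.assoc)
      finally show ?thesis by (rule order_trans) simp
     next
      case far: False
      have "cmod (u x - u z) \<le> 2 * a" using True norm_triangle_ineq4[of "u x" "u z"] by (simp add: a_def)
      then have "cmod (u x - u z) powr (1 + \<epsilon>) \<le> (2 * a) powr (1 + \<epsilon>)" using \<epsilon> by (intro powr_mono2) auto
      also have "(2 * a) powr (1 + \<epsilon>) = 2 powr (1 + \<epsilon>) * a powr (1 + \<epsilon>)" by (simp add: powr_mult)
      finally have "cmod (u x - u z) powr (1 + \<epsilon>) * a powr (p - 1 - \<epsilon>) \<le> 2 powr (1 + \<epsilon>) * a powr (1 + \<epsilon>) * a powr (p - 1 - \<epsilon>)"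
       by (intro mult_right_mono) auto
      also have "... = 2 powr (1 + \<epsilon>) * a powr p" by (simp add: mult.assoc powr_add[symmetric])
      finally have "lower_rem p s \<epsilon> u x z \<le> en (2 powr (1 + \<epsilon>) * a powr p * ?r powr (- s - DIM('a)))"
       unfolding lr by (intro ennreal_leI mult_right_mono) auto
      also have "... = en ?c2 * m z"
       using far by (subst ennreal_mult) (auto simp: m_def)
      finally show ?thesis by (rule order_trans) simp
     qed
    qed (simp add: lower_rem_def a_def)
    have "?L \<le> (\<integral>z. en ?c1 * (n (\<lambda>z. E x) z + n E z) + en ?c2 * m z)"
    proof (rule nn_integral_mono_AE)
     show "AE z in lborel. lower_rem p s \<epsilon> u x z \<le> en ?c1 * (n (\<lambda>z. E x) z + n E z) + en ?c2 * m z"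
      using AEG AE_lborel_singleton[of x] by eventually_elim (rule pt)
    qed
    also have "... = en ?c1 * ((\<integral>z. n (\<lambda>z. E x) z) + (\<integral>z. n E z)) + en ?c2 * (\<integral>z. m z)"
     by (simp add: nn_integral_add nn_integral_cmult)
    also have "... \<le> en ?c1 * (en ?n * E x + en ?n * mx E x) + en ?c2 * (en ?m * 1)"
    proof (intro add_mono mult_left_mono)
     show "(\<integral>z. n (\<lambda>z. E x) z) \<le> en ?n * E x"
      unfolding n_def using \<rho> by (intro order_trans[OF Cn(2)] mult_left_mono mx_const_le) auto
     show "(\<integral>z. n E z) \<le> en ?n * mx E x" unfolding n_def using \<rho> by (intro Cn(2)) auto
     show "(\<integral>z. m z) \<le> en ?m * 1"
      unfolding m_def using \<rho> by (intro order_trans[OF Cf(2)] mult_left_mono mx_const_le) auto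
    qed auto
    also have "en ?n * E x + en ?n * mx E x = en ?n * Y"
     by (simp add: Y_def distrib_left)
    also have "en ?c1 * (en ?n * Y) + en ?c2 * (en ?m * 1)
     \<le> en ?c1 * (en ?n * en (w powr (1 + \<epsilon>))) + en ?c2 * (en ?m * 1)"
     by (intro add_mono mult_left_mono w(2)) auto
    also have "... = en (?c1 * (Cn * \<rho> powr (s * \<epsilon>) * w powr (1 + \<epsilon>)) + 2 powr (1 + \<epsilon>) * a powr p * ?m)"
     using c Cn(1) Cf(1) by (simp add: ennreal_mult ennreal_plus)
    also have "?c1 * (Cn * \<rho> powr (s * \<epsilon>) * w powr (1 + \<epsilon>)) + 2 powr (1 + \<epsilon>) * a powr p * ?m = C * a powr (p - 1) * w"
    proof -
     have e1: "\<rho> powr (s * \<epsilon>) = a powr \<epsilon> / w powr \<epsilon>" using \<rho>s a w by (simp add: powr_powr[symmetric] powr_divide)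
     have e2: "\<rho> powr (- s) = w / a" using \<rho>s by (simp add: powr_minus)
     have e3: "w powr (1 + \<epsilon>) = w * w powr \<epsilon>" using w by (simp add: powr_add)
     have e4: "a powr (p - 1 - \<epsilon>) = a powr (p - 1) / a powr \<epsilon>" by (simp add: powr_diff)
     have e5: "a powr p = a powr (p - 1) * a" using a by (simp add: powr_diff)
     have "w powr \<epsilon> > 0" "a powr \<epsilon> > 0" using a w by auto
     then show ?thesis unfolding e1 e2 e3 e4 e5 C_def using a by (simp add: field_simps)
    qed
    finally show ?thesis .
   qed
   show ?thesis
   proof (cases "Y = \<top>")
    case True
    then show ?thesis using C a by (simp add: hvY ennreal_mult_top flip: a_def)
   next
    case False
    then obtain y where y: "Y = en y" "y \<ge> 0" by (cases Y) auto
    define b where "b = y powr (1 / (1 + \<epsilon>))"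
    have b: "b \<ge> 0" "b powr (1 + \<epsilon>) = y" using y \<epsilon> by (auto simp: b_def powr_powr)
    have "?L \<le> en (C * a powr (p - 1) * (b + 1 / real (Suc n)))" for n
    proof (rule main)
     have "b powr (1 + \<epsilon>) \<le> (b + 1 / real (Suc n)) powr (1 + \<epsilon>)" using b \<epsilon> by (intro powr_mono2) auto
     then show "Y \<le> en ((b + 1 / real (Suc n)) powr (1 + \<epsilon>))" unfolding y(1) b(2) by (rule ennreal_leI)
    qed (use b in \<open>simp add: add_nonneg_pos\<close>)
    moreover have "(\<lambda>n. en (C * a powr (p - 1) * (b + 1 / real (Suc n)))) \<longlonglongrightarrow> en (C * a powr (p - 1) * (b + 0))"
     by (intro tendsto_ennrealI tendsto_mult tendsto_add tendsto_const LIMSEQ_Suc lim_1_over_n)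
    ultimately have "?L \<le> en (C * a powr (p - 1) * (b + 0))" by (intro LIMSEQ_le_const) auto
    also have "... = en C * (en (cmod (u x) powr (p - 1)) * hv \<epsilon> V x)"
     using C b by (simp add: hvY y epow_ennreal ennreal_mult mult.assoc a_def b_def)
    finally show ?thesis .
   qed
  qed
 qed
qed

text \<open>The kernel $|x-z|^{-d-s}$ and the bound for the remainder are symmetric, so that the part with $|u(x)|<|u(z)|$
 reduces to the other by Fubini's theorem.\<close>

lemma power_rem_double_integral:
 fixes s \<epsilon> p C1 :: real
 assumes s: "0 < s" "s < 1" and p: "p > 1" and \<epsilon>: "0 < \<epsilon>" "\<epsilon> \<le> 1" "\<epsilon> \<le> p - 1" and C1: "C1 > 0"
 shows "\<exists>C>0. \<forall>(u :: 'a::euclidean_space => complex) V G. u \<in> \<B> --> V \<in> \<B> -->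
  (AE z in lborel. z \<in> G) --> (\<forall>x\<in>G. \<forall>y\<in>G. en (cmod (u x - u y)) \<le> en (C1 * dist x y powr s) * (V x + V y)) -->
  (\<integral>x. (\<integral>z. en (\<bar>power_rem p (u x) (u z)\<bar> * dist x z powr (- s - DIM('a)))))
   \<le> en C * (\<integral>x. en (cmod (u x) powr (p - 1)) * hv \<epsilon> V x)"
proof -
 obtain C2 where C2: "C2 > 0" "\<And>a b. \<bar>power_rem p a b\<bar> \<le> C2 * (cmod (a - b) powr (1 + \<epsilon>) * max (cmod a) (cmod b) powr (p - 1 - \<epsilon>))"
  using power_rem_bound[OF p \<epsilon>] by blast
 obtain C3 where C3: "C3 > 0" "\<And>(u :: 'a => complex) V G x. u \<in> \<B> ==> V \<in> \<B> ==>
  (AE z in lborel. z \<in> G) ==> (\<forall>x\<in>G. \<forall>y\<in>G. en (cmod (u x - u y)) \<le> en (C1 * dist x y powr s) * (V x + V y)) ==> x \<in> G ==>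
  (\<integral>z. lower_rem p s \<epsilon> u x z) \<le> en C3 * (en (cmod (u x) powr (p - 1)) * hv \<epsilon> V x)"
  using lower_rem_integral[OF s \<epsilon>(1,2) C1, of p, where 'a='a] by meson
 show ?thesis
 proof (intro exI[of _ "2 * C2 * C3"] conjI allI impI)
  show "2 * C2 * C3 > 0" using C2 C3 by simp
  fix u :: "'a => complex" and V :: "'a => ennreal" and G
  assume [measurable]: "u \<in> \<B>" "V \<in> \<B>" and AEG: "AE z in lborel. z \<in> G"
   and est: "\<forall>x\<in>G. \<forall>y\<in>G. en (cmod (u x - u y)) \<le> en (C1 * dist x y powr s) * (V x + V y)"
  let ?Q = "lower_rem p s \<epsilon> u"
  let ?R = "\<lambda>x z. en (\<bar>power_rem p (u x) (u z)\<bar> * dist x z powr (- s - DIM('a)))"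
  let ?M = "\<lambda>x z. en (cmod (u x - u z) powr (1 + \<epsilon>) * max (cmod (u x)) (cmod (u z)) powr (p - 1 - \<epsilon>) * dist x z powr (- s - DIM('a)))"
  let ?H = "(\<integral>x. en (cmod (u x) powr (p - 1)) * hv \<epsilon> V x)"
  let ?I = "(\<integral>x. (\<integral>z. ?Q x z))"
  have [measurable]: "(\<lambda>(x, z). ?Q x z) \<in> borel_measurable (borel \<Otimes>\<^sub>M borel)"
   unfolding lower_rem_def by measurable
  have pt: "?R x z \<le> en C2 * (?Q x z + ?Q z x)" for x z
  proof -
   have "?R x z
    \<le> en (C2 * (cmod (u x - u z) powr (1 + \<epsilon>) * max (cmod (u x)) (cmod (u z)) powr (p - 1 - \<epsilon>)) * dist x z powr (- s - DIM('a)))"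
    by (intro ennreal_leI mult_right_mono C2(2)) auto
   also have "... = en C2 * ?M x z"
    using C2(1) by (subst ennreal_mult[symmetric]) (auto simp: mult_ac)
   also have "... \<le> en C2 * (?Q x z + ?Q z x)"
   proof (intro mult_left_mono)
    show "?M x z \<le> ?Q x z + ?Q z x"
    proof (cases "cmod (u z) \<le> cmod (u x)")
     case True
     then have "?M x z = ?Q x z"
      by (simp add: lower_rem_def max_def)
     then show ?thesis by simp
    next
     case False
     then have "?M x z = ?Q z x"
      by (simp add: lower_rem_def max_def norm_minus_commute dist_commute)
     then show ?thesis by simp
    qed
   qed simp
   finally show ?thesis .
  qed
  have inner: "?I \<le> en C3 * ?H"
  proof -
   have "?I \<le> (\<integral>x. en C3 * (en (cmod (u x) powr (p - 1)) * hv \<epsilon> V x))"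
   proof (rule nn_integral_mono_AE)
    show "AE x in lborel. (\<integral>z. ?Q x z) \<le> en C3 * (en (cmod (u x) powr (p - 1)) * hv \<epsilon> V x)"
     using AEG by eventually_elim (rule C3(2)[OF _ _ AEG est], auto)
   qed
   then show ?thesis by (simp add: nn_integral_cmult)
  qed
  have "(\<integral>x. (\<integral>z. ?R x z))
   \<le> (\<integral>x. (\<integral>z. en C2 * (?Q x z + ?Q z x)))"
   by (intro nn_integral_mono pt)
  also have "... = en C2 * (?I + (\<integral>x. (\<integral>z. ?Q z x)))"
   by (simp add: nn_integral_add nn_integral_cmult)
  also have "(\<integral>x. (\<integral>z. ?Q z x)) = ?I"
   by (rule lborel_pair.Fubini') simp
  also have "en C2 * (?I + ?I) = en (2 * C2) * ?I"
   using C2(1) by (simp add: ennreal_mult mult_2[symmetric] mult_ac)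
  also have "... \<le> en (2 * C2) * (en C3 * ?H)"
   by (intro mult_left_mono inner) simp
  also have "... = en (2 * C2 * C3) * ?H"
   using C2(1) C3(1) by (subst mult.assoc[symmetric], subst ennreal_mult[symmetric]) auto
  finally show "(\<integral>x. (\<integral>z. ?R x z))
   \<le> en (2 * C2 * C3) * ?H" .
 qed
qed

text \<open>$1+\epsilon<q$, so that the maximal theorem holds at the exponent $q/(1+\epsilon)$.\<close>

lemma hv_strong_type:
 fixes \<epsilon> q :: real
 assumes \<epsilon>: "\<epsilon> > 0" "1 + \<epsilon> < q"
 shows "\<exists>C>0. \<forall>f :: 'a::euclidean_space => ennreal. f \<in> \<B> -->
  (\<integral>x. epow (hv \<epsilon> (mx f) x) q) \<le> en C * (\<integral>x. epow (f x) q)"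
proof -
 define r where "r = q / (1 + \<epsilon>)"
 have r: "r > 1" "r > 0" "(1 + \<epsilon>) * r = q" "1 / (1 + \<epsilon>) * q = r" using \<epsilon> by (auto simp: r_def)
 have q: "q > 1" using \<epsilon> by simp
 obtain A where A: "A > 0" "\<And>f :: 'a => ennreal. f \<in> \<B> ==> (\<integral>x. epow (mx f x) q) \<le> en A * (\<integral>x. epow (f x) q)"
  using mx_strong_type[OF q, where 'a='a] by blast
 obtain B where B: "B > 0" "\<And>f :: 'a => ennreal. f \<in> \<B> ==> (\<integral>x. epow (mx f x) r) \<le> en B * (\<integral>x. epow (f x) r)"
  using mx_strong_type[OF r(1), where 'a='a] by blast
 show ?thesis
 proof (intro exI[of _ "2 powr r * ((1 + B) * A)"] conjI allI impI)
  show "2 powr r * ((1 + B) * A) > 0" using A B by simp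
  fix f :: "'a => ennreal" assume [measurable]: "f \<in> \<B>"
  define E where "E z = epow (mx f z) (1 + \<epsilon>)" for z
  have [measurable]: "mx f \<in> \<B>" by (rule mx_measurable)
  have [measurable]: "E \<in> \<B>" unfolding E_def[abs_def] by measurable
  have [measurable]: "mx E \<in> \<B>" by (rule mx_measurable)
  have Er: "epow (E x) r = epow (mx f x) q" for x by (simp only: E_def epow_epow r(3))
  have "(\<integral>x. epow (hv \<epsilon> (mx f) x) q) = (\<integral>x. epow (E x + mx E x) r)"
   by (simp only: hv_def epow_epow r(4) E_def[abs_def])
  also have "... \<le> (\<integral>x. en (2 powr r) * (epow (E x) r + epow (mx E x) r))"
   by (intro nn_integral_mono epow_sum_le r)
  also have "... = en (2 powr r) * ((\<integral>x. epow (E x) r) + (\<integral>x. epow (mx E x) r))"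
   by (simp add: nn_integral_cmult nn_integral_add)
  also have "... \<le> en (2 powr r) * ((\<integral>x. epow (E x) r) + en B * (\<integral>x. epow (E x) r))"
   by (intro mult_left_mono add_left_mono B(2)) auto
  also have "... = en (2 powr r * (1 + B)) * (\<integral>x. epow (mx f x) q)"
   using B(1) by (simp add: Er ennreal_mult ennreal_plus distrib_left distrib_right mult.assoc)
  also have "... \<le> en (2 powr r * (1 + B)) * (en A * (\<integral>x. epow (f x) q))"
   by (intro mult_left_mono A(2)) auto
  also have "... = en (2 powr r * ((1 + B) * A)) * (\<integral>x. epow (f x) q)"
   using A(1) B(1) by (subst mult.assoc[symmetric], subst ennreal_mult[symmetric]) (auto simp: mult.assoc)
  finally show "(\<integral>x. epow (hv \<epsilon> (mx f) x) q) \<le> en (2 powr r * ((1 + B) * A)) * (\<integral>x. epow (f x) q)" .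
 qed
qed

lemma hoelder_power:
 fixes u :: "'a::euclidean_space => complex" and p t q :: real
 assumes p: "p > 1" and t: "t > 1" and q: "q > 1" and pq: "1 = (p - 1) / t + 1 / q" and u: "in_Lp t u"
  and H[measurable]: "H \<in> \<B>"
 shows "(\<integral>x. en (cmod (u x) powr (p - 1)) * H x) \<le> en (Lp_norm t u powr (p - 1)) * epow (\<integral>x. epow (H x) q) (1 / q)"
proof -
 have [measurable]: "u \<in> \<B>" using u by (simp add: in_Lp_def)
 have "(\<integral>x. en (cmod (u x) powr (p - 1)) * H x)
  \<le> epow (\<integral>x. epow (en (cmod (u x) powr (p - 1))) (t / (p - 1))) (1 / (t / (p - 1))) * epow (\<integral>x. epow (H x) q) (1 / q)"
  using p t q pq by (intro nn_hoelder) auto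
 also have "(\<integral>x. epow (en (cmod (u x) powr (p - 1))) (t / (p - 1))) = (\<integral>x. epow (en (cmod (u x))) t)"
  using p by (simp add: epow_ennreal powr_powr)
 also have "... = en (Lp_norm t u powr t)" using t by (intro in_Lp_integral u) simp
 also have "epow (en (Lp_norm t u powr t)) (1 / (t / (p - 1))) = en (Lp_norm t u powr (p - 1))"
  using t by (simp add: epow_ennreal powr_powr)
 finally show ?thesis .
qed

section \<open>Assembling the estimate\<close>

lemma ennreal_sqrt_epow: "ennreal_sqrt y = epow y (1 / 2)"
proof (cases y)
 case (real r)
 then show ?thesis by (simp add: ennreal_sqrt_def epow_ennreal powr_half_sqrt)
qed (simp add: ennreal_sqrt_def)

lemma epow_two: "epow x 2 = x * x"
 by (cases x) (auto simp: epow_ennreal powr_numeral power2_eq_square ennreal_mult)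

text \<open>Of the two contributions only the first has to be summed in $\ell^2$; $\beta$ is summed in $\ell^1$, which
 dominates. The constant is not optimal.\<close>

lemma l2_sum_bound:
 fixes G w :: "nat => real"
 assumes G: "\<And>k. 0 \<le> G k" and w: "\<And>k. 0 \<le> w k" and c: "c \<ge> 0"
  and le: "\<And>k. en (G k) \<le> en c * en (w k) + \<beta> k"
 shows "epow (\<Sum>k. en ((G k)\<^sup>2)) (1 / 2) \<le> en 4 * (en c * epow (\<Sum>k. en ((w k)\<^sup>2)) (1 / 2) + (\<Sum>k. \<beta> k))"
proof -
 define B where "B = (\<Sum>k. \<beta> k)"
 define W where "W = (\<Sum>k. en ((w k)\<^sup>2))"
 have bB: "\<beta> k \<le> B" for k unfolding B_def using sum_le_suminf[of \<beta> "{k}"] by simp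
 have "en ((G k)\<^sup>2) \<le> en 4 * (en (c\<^sup>2) * en ((w k)\<^sup>2) + \<beta> k * B)" for k
 proof -
  have "en ((G k)\<^sup>2) = epow (en (G k)) 2" using G by (simp add: epow_ennreal powr_numeral)
  also have "... \<le> epow (en c * en (w k) + \<beta> k) 2" by (intro epow_mono le) simp
  also have "... \<le> en (2 powr 2) * (epow (en c * en (w k)) 2 + epow (\<beta> k) 2)" by (rule epow_sum_le) simp
  also have "epow (en c * en (w k)) 2 = en (c\<^sup>2) * en ((w k)\<^sup>2)"
   using c w by (simp add: epow_mult epow_ennreal powr_numeral)
  also have "epow (\<beta> k) 2 \<le> \<beta> k * B" unfolding epow_two by (intro mult_left_mono bB) simp
  finally show ?thesis by (simp add: powr_numeral add_left_mono mult_left_mono)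
 qed
 then have "(\<Sum>k. en ((G k)\<^sup>2)) \<le> (\<Sum>k. en 4 * (en (c\<^sup>2) * en ((w k)\<^sup>2) + \<beta> k * B))"
  by (intro suminf_le) auto
 also have "... = en 4 * (en (c\<^sup>2) * W + B * B)"
  unfolding W_def B_def ennreal_suminf_cmult ennreal_suminf_multc[symmetric] by (subst suminf_add[symmetric]) (auto simp: ennreal_suminf_cmult)
 finally have "epow (\<Sum>k. en ((G k)\<^sup>2)) (1 / 2) \<le> epow (en 4 * (en (c\<^sup>2) * W + epow B 2)) (1 / 2)"
  unfolding epow_two by (intro epow_mono) auto
 also have "... = epow (en 4) (1 / 2) * epow (en (c\<^sup>2) * W + epow B 2) (1 / 2)" by (rule epow_mult) simp
 also have "... \<le> epow (en 4) (1 / 2) * (en (2 powr (1 / 2)) * (epow (en (c\<^sup>2) * W) (1 / 2) + epow (epow B 2) (1 / 2)))"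
  by (intro mult_left_mono epow_sum_le) auto
 also have "epow (epow B 2) (1 / 2) = B" by (simp add: epow_epow)
 also have "epow (en (c\<^sup>2) * W) (1 / 2) = en c * epow W (1 / 2)"
  using c by (simp add: epow_mult epow_ennreal powr_half_sqrt)
 also have "epow (en 4) (1 / 2) * (en (2 powr (1 / 2)) * (en c * epow W (1 / 2) + B)) \<le> en 2 * (en 2 * (en c * epow W (1 / 2) + B))"
 proof (intro mult_mono ennreal_leI)
  have "epow (en 4) (1 / 2) = en (4 powr (1 / 2))" by (rule epow_ennreal) simp
  then show "epow (en 4) (1 / 2) \<le> en 2" by (simp add: powr_half_sqrt)
  show "(2::real) powr (1 / 2) \<le> 2" using powr_mono[of "1/2" 1 2] by simp
 qed auto
 also have "... = en 4 * (en c * epow W (1 / 2) + B)"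
  by (subst mult.assoc[symmetric], subst ennreal_mult[symmetric]) auto
 finally show ?thesis by (simp add: B_def W_def)
qed

lemma power_rem_measurable [measurable]:
 assumes [measurable]: "f \<in> borel_measurable M" "g \<in> borel_measurable M"
 shows "(\<lambda>x. power_rem p (f x) (g x)) \<in> borel_measurable M"
proof -
 have "Re (cnj a * h) = Re a * Re h + Im a * Im h" for a h :: complex by simp
 then show ?thesis unfolding power_rem_def power_diff_def by (simp only:) measurable
qed

lemma weight_nice:
 fixes e :: real
 assumes "e > 0"
 shows "nice (\<lambda>x::'a::euclidean_space. (1 + norm x) powr (- (e + DIM('a))))"
proof (rule nice_decay[where a=e and B=1 and C=1])
 show "\<bar>(1 + norm x) powr (- (e + DIM('a)))\<bar> \<le> 1" for x :: 'a
  using assms powr_mono2'[of "- (e + DIM('a))" 1 "1 + norm x"] by simp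
 show "\<bar>(1 + norm x) powr (- (e + DIM('a)))\<bar> \<le> 1 * norm x powr (- e - DIM('a))" if "x \<noteq> 0" for x :: 'a
  using assms that powr_mono2'[of "- (e + DIM('a))" "norm x" "1 + norm x"] by simp
qed (use assms in auto)

lemma suminf_ennreal_le:
 fixes f :: "nat => real"
 assumes "\<And>k. 0 \<le> f k" "\<And>M. (\<Sum>k<M. f k) \<le> c"
 shows "(\<Sum>k. en (f k)) \<le> en c"
proof (rule LIMSEQ_le_const2[OF summable_LIMSEQ])
 show "\<exists>N. \<forall>n\<ge>N. (\<Sum>k<n. en (f k)) \<le> en c"
  using assms by (auto simp: sum_ennreal intro!: ennreal_leI)
qed simp

context littlewood_paley
begin

text \<open>Real and imaginary parts are treated separately, the kernels being real.\<close>

lemma square_function_complex: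
 fixes q :: real
 assumes q: "q > 1"
 shows "\<exists>C>0. \<forall>v :: 'a => complex. in_Lp q v -->
  (\<integral>x. epow (\<Sum>k. en ((cmod (cconv (\<psi> k) v x))\<^sup>2)) (q / 2)) \<le> en C * (\<integral>x. epow (en (cmod (v x))) q)"
proof -
 obtain C where C: "C > 0" "\<And>v :: 'a => real. lq q v ==>
  (\<integral>x. epow (\<Sum>k. en ((conv (\<psi> k) v x)\<^sup>2)) (q / 2)) \<le> en C * (\<integral>x. en (\<bar>v x\<bar> powr q))"
  using square_function_real[OF q] by blast
 have q2: "q / 2 > 0" using q by simp
 show ?thesis
 proof (intro exI[of _ "2 powr (q / 2) * (2 * C)"] conjI allI impI)
  show "2 powr (q / 2) * (2 * C) > 0" using C by simp
  fix v :: "'a => complex" assume v: "in_Lp q v"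
  have q0: "q > 0" using q by simp
  have [measurable]: "v \<in> \<B>" using v by (simp add: in_Lp_def)
  note [measurable] = nice_measurable[OF psi_nice]
  let ?r = "\<lambda>z. Re (v z)" and ?i = "\<lambda>z. Im (v z)"
  define S where "S f x = (\<Sum>k. en ((conv (\<psi> k) f x)\<^sup>2))" for f :: "'a => real" and x
  have [measurable]: "S f \<in> \<B>" if [measurable]: "f \<in> \<B>" for f
   unfolding S_def[abs_def] conv_def[abs_def] by measurable
  let ?V = "(\<integral>x. epow (en (cmod (v x))) q)"
  have le: "(\<integral>x. epow (S f x) (q / 2)) \<le> en C * ?V" if "lq q f" "\<And>x. \<bar>f x\<bar> \<le> cmod (v x)" for f
   unfolding S_def using that q
   by (intro order_trans[OF C(2)] mult_left_mono nn_integral_mono) (auto simp: epow_ennreal intro!: ennreal_leI powr_mono2)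
  have "(\<Sum>k. en ((cmod (cconv (\<psi> k) v x))\<^sup>2)) = S ?r x + S ?i x" for x
   unfolding S_def by (subst suminf_add) (auto simp: cmod_power2 Re_cconv[OF psi_nice v q] Im_cconv[OF psi_nice v q] ennreal_plus)
  then have "(\<integral>x. epow (\<Sum>k. en ((cmod (cconv (\<psi> k) v x))\<^sup>2)) (q / 2)) \<le> (\<integral>x. en (2 powr (q / 2)) * (epow (S ?r x) (q / 2) + epow (S ?i x) (q / 2)))"
   by (simp only:) (intro nn_integral_mono epow_sum_le q2)
  also have "... = en (2 powr (q / 2)) * ((\<integral>x. epow (S ?r x) (q / 2)) + (\<integral>x. epow (S ?i x) (q / 2)))"
   by (simp add: nn_integral_cmult nn_integral_add)
  also have "... \<le> en (2 powr (q / 2)) * (en C * ?V + en C * ?V)"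
   by (intro mult_left_mono add_mono le in_Lp_lq[OF v q0] abs_Re_le_cmod abs_Im_le_cmod) simp
  also have "... = en (2 powr (q / 2) * (2 * C)) * ?V"
  proof -
   have "en (2 powr (q / 2) * (2 * C)) = en (2 powr (q / 2)) * en (C + C)" using C(1) by (subst ennreal_mult[symmetric]) auto
   also have "en (C + C) = en C + en C" using C(1) by (intro ennreal_plus) auto
   finally show ?thesis by (simp only: distrib_right distrib_left mult.assoc)
  qed
  finally show "(\<integral>x. epow (\<Sum>k. en ((cmod (cconv (\<psi> k) v x))\<^sup>2)) (q / 2)) \<le> en (2 powr (q / 2) * (2 * C)) * ?V" .
 qed
qed

text \<open>The operator with kernel \<open>K\<close> of integral zero is applied to the Taylor expansion of $|u|^p$ at the
 point of evaluation: constants disappear, the linear part passes through the operator, and there the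
 fractional derivative is moved from the kernel to \<open>u\<close>.\<close>

lemma piece_bound:
 fixes p s t q :: real and u v :: "'a => complex"
 assumes p: "p > 1" and s: "s > 0" and t: "t > 1" and q: "q > 1" and u: "in_Lp t u" and v: "in_Lp q v"
  and rep: "represents (Dpow s (distr_of u)) v"
  and fi: "L1 (\<lambda>z. Ks s k (x - z) * cmod (u z) powr p)"
 shows "en \<bar>LINT z. Ks s k (x - z) * cmod (u z) powr p\<bar>
  \<le> en (p * cmod (u x) powr (p - 1)) * en (cmod (cconv (\<psi> k) v x))
   + (\<integral>z. en (\<bar>Ks s k (x - z)\<bar> * \<bar>power_rem p (u x) (u z)\<bar>))"
proof -
 let ?K = "\<lambda>z. Ks s k (x - z)"
 define \<kappa> where "\<kappa> = cr (p * cmod (u x) powr (p - 2)) * cnj (u x)"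
 have pd: "power_diff p (u x) h = Re (\<kappa> * h)" for h by (simp add: power_diff_def \<kappa>_def algebra_simps)
 have Ki: "L1 ?K" by (rule integrable_lborel_reflect[OF nice_integrable[OF Ks_nice[OF s]]])
 have K0: "(LINT z. ?K z) = 0"
  using integral_lborel_reflect[OF Ks_measurable[OF s], of k x] Ks_integral[OF s] by simp
 have ui: "L1 (\<lambda>z. u z * cr (?K z))" by (rule cconv_integrable[OF Ks_nice[OF s] u t])
 have Kc: "L1 (\<lambda>z. cr (?K z))" using Ki by (rule integrable_of_real)
 then have Kci: "L1 (\<lambda>z. u x * cr (?K z))" by simp
 have hi: "L1 (\<lambda>z. \<kappa> * (u z * cr (?K z) - u x * cr (?K z)))"
  by (rule integrable_mult_right[OF Bochner_Integration.integrable_diff[OF ui Kci]])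
 have pdK: "?K z * power_diff p (u x) (u z - u x) = Re (\<kappa> * (u z * cr (?K z) - u x * cr (?K z)))" for z
  by (simp add: pd algebra_simps)
 have di: "L1 (\<lambda>z. ?K z * power_diff p (u x) (u z - u x))" unfolding pdK using hi by (rule integrable_Re)
 have "(LINT z. ?K z * power_diff p (u x) (u z - u x)) = Re (\<kappa> * (cconv (Ks s k) u x - u x * cr (LINT z. ?K z)))"
  unfolding pdK cconv_def using ui Kc Kci hi by (subst integral_Re) (simp_all)
 also have "... = power_diff p (u x) (cconv (Ks s k) u x)" by (simp add: K0 pd)
 also have "cconv (Ks s k) u x = cconv (\<psi> k) v x"
  unfolding cconv_def Ks_def \<psi>_def by (rule representation_identity[OF mul_smooth mul_csupp mul_even s rep])
 finally have d: "(LINT z. ?K z * power_diff p (u x) (u z - u x)) = power_diff p (u x) (cconv (\<psi> k) v x)" .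
 have R: "?K z * power_rem p (u x) (u z) = ?K z * cmod (u z) powr p - ?K z * cmod (u x) powr p - ?K z * power_diff p (u x) (u z - u x)" for z
  by (simp add: power_rem_def right_diff_distrib)
 have "(LINT z. ?K z * power_rem p (u x) (u z)) = (LINT z. ?K z * cmod (u z) powr p) - power_diff p (u x) (cconv (\<psi> k) v x)"
  unfolding R using fi Ki di d K0 by simp
 then have e: "(LINT z. ?K z * cmod (u z) powr p) = power_diff p (u x) (cconv (\<psi> k) v x) + (LINT z. ?K z * power_rem p (u x) (u z))" by simp
 have "en \<bar>LINT z. ?K z * cmod (u z) powr p\<bar> \<le> en (\<bar>power_diff p (u x) (cconv (\<psi> k) v x)\<bar> + \<bar>LINT z. ?K z * power_rem p (u x) (u z)\<bar>)"
  unfolding e by (intro ennreal_leI abs_triangle_ineq)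
 also have "... = en \<bar>power_diff p (u x) (cconv (\<psi> k) v x)\<bar> + en \<bar>LINT z. ?K z * power_rem p (u x) (u z)\<bar>"
  by (simp add: ennreal_plus)
 also have "... \<le> en (p * cmod (u x) powr (p - 1) * cmod (cconv (\<psi> k) v x)) + (\<integral>z. en (norm (?K z * power_rem p (u x) (u z))))"
  using norm_LINT_le[of lborel "\<lambda>z. ?K z * power_rem p (u x) (u z)"] by (intro add_mono ennreal_leI power_diff_bound[OF p]) simp
 also have "... = en (p * cmod (u x) powr (p - 1)) * en (cmod (cconv (\<psi> k) v x)) + (\<integral>z. en (\<bar>?K z\<bar> * \<bar>power_rem p (u x) (u z)\<bar>))"
  using p by (simp add: abs_mult ennreal_mult)
 finally show ?thesis .
qed

text \<open>Finiteness of the remainder integral at a single point already bounds the growth of $|u|^p$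
 in the mean, so that the kernels may be applied to it.\<close>

lemma power_weight_integrable:
 fixes p s t :: real and u :: "'a => complex"
 assumes p: "p > 1" and s: "s > 0" and t: "t > 1" and u: "in_Lp t u"
  and fin: "(\<integral>z. en (\<bar>power_rem p (u x0) (u z)\<bar> * dist x0 z powr (- s - DIM('a)))) < \<top>"
 shows "L1 (\<lambda>z. cmod (u z) powr p * (1 + norm z) powr (- (s + DIM('a))))"
proof -
 let ?e = "s + DIM('a)"
 let ?\<omega> = "\<lambda>z::'a. (1 + norm z) powr (- ?e)"
 define a where "a = cmod (u x0)"
 have e: "?e > 0" using s by (simp add: add_pos_nonneg)
 have [measurable]: "u \<in> \<B>" using u by (simp add: in_Lp_def)
 have t0: "t > 0" using t by simp
 have wi: "L1 ?\<omega>" by (rule nice_integrable[OF weight_nice[OF s]])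
 have "L1 (\<lambda>z. ?\<omega> (0 - z) * cmod (u z))" by (rule conv_lq_bound(1)[OF weight_nice[OF s] in_Lp_lq(3)[OF u t0] t])
 then have ui: "L1 (\<lambda>z. ?\<omega> z * cmod (u z))" by simp
 have Ri: "L1 (\<lambda>z. \<bar>power_rem p (u x0) (u z)\<bar> * dist x0 z powr (- s - DIM('a)))"
  using fin by (intro integrableI_nonneg) auto
 let ?G = "\<lambda>z. (1 + norm x0) powr ?e * (\<bar>power_rem p (u x0) (u z)\<bar> * dist x0 z powr (- s - DIM('a))) + (a powr p + p * a powr (p - 1) * a) * ?\<omega> z + p * a powr (p - 1) * (?\<omega> z * cmod (u z))"
 show ?thesis
 proof (rule Bochner_Integration.integrable_bound[of _ ?G])
  show "L1 ?G" using Ri wi ui by auto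
  show "AE z in lborel. norm (cmod (u z) powr p * ?\<omega> z) \<le> norm (?G z)"
   using AE_lborel_singleton[of x0]
  proof eventually_elim
   case (elim z)
   have "\<bar>power_diff p (u x0) (u z - u x0)\<bar> \<le> p * a powr (p - 1) * cmod (u z - u x0)" unfolding a_def by (rule power_diff_bound[OF p])
   also have "... \<le> p * a powr (p - 1) * (cmod (u z) + a)"
    using p norm_triangle_ineq4[of "u z" "u x0"] by (intro mult_left_mono) (auto simp: a_def)
   finally have "cmod (u z) powr p \<le> \<bar>power_rem p (u x0) (u z)\<bar> + a powr p + p * a powr (p - 1) * (cmod (u z) + a)"
    unfolding power_rem_def a_def by linarith
   then have "cmod (u z) powr p * ?\<omega> z \<le> (\<bar>power_rem p (u x0) (u z)\<bar> + a powr p + p * a powr (p - 1) * (cmod (u z) + a)) * ?\<omega> z"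
    by (intro mult_right_mono) auto
   also have "... = \<bar>power_rem p (u x0) (u z)\<bar> * ?\<omega> z + (a powr p + p * a powr (p - 1) * a) * ?\<omega> z + p * a powr (p - 1) * (?\<omega> z * cmod (u z))"
    by (simp add: algebra_simps)
   also have "\<bar>power_rem p (u x0) (u z)\<bar> * ?\<omega> z \<le> \<bar>power_rem p (u x0) (u z)\<bar> * ((1 + norm x0) powr ?e * dist x0 z powr (- s - DIM('a)))"
   proof (intro mult_left_mono)
    have "?\<omega> z \<le> (1 + norm x0) powr ?e * (1 + norm (x0 - z)) powr (- ?e)"
     using weight_submult[of ?e x0 "x0 - z"] e by simp
    also have "(1 + norm (x0 - z)) powr (- ?e) \<le> dist x0 z powr (- ?e)"
     using elim e by (intro powr_mono2') (auto simp: dist_norm)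
    finally show "?\<omega> z \<le> (1 + norm x0) powr ?e * dist x0 z powr (- s - DIM('a))" by (simp add: mult_left_mono)
   qed simp
   finally show "norm (cmod (u z) powr p * ?\<omega> z) \<le> norm (?G z)" by (simp add: mult_ac)
  qed
 qed measurable
qed

theorem power_estimate:
 fixes p s t q :: real
 assumes p: "p > 1" and s: "0 < s" "s < 1" and t: "t > 1" and q: "q > 1" and pq: "1 = (p - 1) / t + 1 / q"
 shows "\<exists>C>0. \<forall>(u :: 'a => complex) v. in_Lp t u --> in_Lp q v --> represents (Dpow s (distr_of u)) v -->
  F012_norm \<eta> (Dpow s (distr_of (\<lambda>x. power_nl p (u x)))) \<le> en (C * Lp_norm t u powr (p - 1) * Lp_norm q v)"
proof -
 (* The gain over first order: at most 1 and p - 1 for the remainder bound, and small enough that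
   the maximal theorem is available at the exponent q / (1 + eps) > 1. *)
 define \<epsilon> where "\<epsilon> = min (min 1 (p - 1)) ((q - 1) / 2)"
 have \<epsilon>: "0 < \<epsilon>" "\<epsilon> \<le> 1" "\<epsilon> \<le> p - 1" "1 + \<epsilon> < q" proof -
  have "\<epsilon> \<le> (q - 1) / 2" unfolding \<epsilon>_def by (rule min.cobounded2)
  then show "1 + \<epsilon> < q" using q by simp
 qed (use p q in \<open>auto simp: \<epsilon>_def\<close>)
 have q0: "q > 0" using q by simp
 obtain C1 where C1: "C1 > 0" "\<And>u v :: 'a => complex. in_Lp t u ==> in_Lp q v ==> represents (Dpow s (distr_of u)) v ==>
  (\<exists>G. (AE x in lborel. x \<in> G) \<and> (\<forall>x\<in>G. \<forall>y\<in>G. en (cmod (u x - u y)) \<le>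
   en (C1 * dist x y powr s) * (mx (\<lambda>z. en (cmod (v z))) x + mx (\<lambda>z. en (cmod (v z))) y)))"
  using difference_estimate[OF s t q] by meson
 obtain C2 where C2: "C2 > 0" "\<And>(u :: 'a => complex) V G. u \<in> \<B> ==> V \<in> \<B> ==>
  (AE z in lborel. z \<in> G) ==> (\<forall>x\<in>G. \<forall>y\<in>G. en (cmod (u x - u y)) \<le> en (C1 * dist x y powr s) * (V x + V y)) ==>
  (\<integral>x. (\<integral>z. en (\<bar>power_rem p (u x) (u z)\<bar> * dist x z powr (- s - DIM('a)))))
   \<le> en C2 * (\<integral>x. en (cmod (u x) powr (p - 1)) * hv \<epsilon> V x)"
  using power_rem_double_integral[OF s p \<epsilon>(1-3) C1(1), where 'a='a] by meson
 obtain C3 where C3: "C3 > 0" "\<And>f :: 'a => ennreal. f \<in> \<B> ==>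
  (\<integral>x. epow (hv \<epsilon> (mx f) x) q) \<le> en C3 * (\<integral>x. epow (f x) q)"
  using hv_strong_type[OF \<epsilon>(1,4), where 'a='a] by meson
 obtain C4 where C4: "C4 > 0" "\<And>v :: 'a => complex. in_Lp q v ==>
  (\<integral>x. epow (\<Sum>k. en ((cmod (cconv (\<psi> k) v x))\<^sup>2)) (q / 2)) \<le> en C4 * (\<integral>x. epow (en (cmod (v x))) q)"
  using square_function_complex[OF q] by meson
 obtain C5 where C5: "C5 > 0" "\<And>x M. x \<noteq> 0 ==> (\<Sum>k<M. \<bar>Ks s k x\<bar>) \<le> C5 * norm x powr (- s - DIM('a))"
  using Ks_sum[OF s(1)] by meson
 define C where "C = 4 * (p * C4 powr (1 / q) + C5 * (C2 * C3 powr (1 / q)))"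
 show ?thesis
 proof (intro exI[of _ C] conjI allI impI)
  show "C > 0" using p C2 C3 C4 C5 by (auto simp: C_def intro!: add_pos_pos mult_pos_pos)
  fix u v :: "'a => complex"
  assume u: "in_Lp t u" and v: "in_Lp q v" and rep: "represents (Dpow s (distr_of u)) v"
  have [measurable]: "u \<in> \<B>" "v \<in> \<B>" using u v by (simp_all add: in_Lp_def)
  have [measurable]: "Ks s k \<in> \<B>" for k by (rule Ks_measurable[OF s(1)])
  note [measurable] = nice_measurable[OF psi_nice]
  let ?R = "\<lambda>x z. en (\<bar>power_rem p (u x) (u z)\<bar> * dist x z powr (- s - DIM('a)))"
  let ?u = "\<lambda>x. en (cmod (u x) powr (p - 1))"
  let ?\<omega> = "\<lambda>z::'a. (1 + norm z) powr (- (s + DIM('a)))"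
  define V where "V = mx (\<lambda>z. en (cmod (v z)))"
  have [measurable]: "V \<in> \<B>" unfolding V_def by (rule mx_measurable)
  obtain G where G: "AE x in lborel. x \<in> G" "\<forall>x\<in>G. \<forall>y\<in>G. en (cmod (u x - u y)) \<le> en (C1 * dist x y powr s) * (V x + V y)"
   using C1(2)[OF u v rep] unfolding V_def by blast
  define I where "I x = (\<integral>z. ?R x z)" for x
  have [measurable]: "I \<in> \<B>"
  proof -
   have [measurable]: "(\<lambda>(x, z). ?R x z) \<in> borel_measurable (borel \<Otimes>\<^sub>M borel)"
    by measurable
   show ?thesis unfolding I_def[abs_def] by measurable
  qed
  let ?U = "Lp_norm t u powr (p - 1)" and ?N = "Lp_norm q v"
  have N0: "?N \<ge> 0" by (simp add: Lp_norm_def)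
  have vI: "(\<integral>x. epow (en (cmod (v x))) q) = en (?N powr q)" by (rule in_Lp_integral[OF v q0])
  have root: "epow J (1 / q) \<le> en (D powr (1 / q) * ?N)" if "J \<le> en D * en (?N powr q)" "D > 0" for J D
  proof -
   have "epow J (1 / q) \<le> epow (en (D * ?N powr q)) (1 / q)" using that q by (intro epow_mono) (auto simp: ennreal_mult)
   also have "... = en (D powr (1 / q) * ?N)" using that q N0 by (simp add: epow_ennreal powr_mult powr_powr)
   finally show ?thesis .
  qed
  have rem: "(\<integral>x. I x) \<le> en (C2 * C3 powr (1 / q) * ?U * ?N)"
  proof -
   have "(\<integral>x. I x) \<le> en C2 * (\<integral>x. ?u x * hv \<epsilon> V x)"
    unfolding I_def by (rule C2(2)[OF _ _ G]) auto
   also have "... \<le> en C2 * (en ?U * epow (\<integral>x. epow (hv \<epsilon> V x) q) (1 / q))"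
    by (intro mult_left_mono hoelder_power[OF p t q pq u]) auto
   also have "... \<le> en C2 * (en ?U * en (C3 powr (1 / q) * ?N))"
    using C3(2)[of "\<lambda>z. en (cmod (v z))"] C3(1) unfolding vI V_def[symmetric] by (intro mult_left_mono root) auto
   also have "... = en (C2 * C3 powr (1 / q) * ?U * ?N)"
    using C2(1) N0 by (simp add: ennreal_mult[symmetric] mult_ac)
   finally show ?thesis .
  qed
  define S where "S x = (\<Sum>k. en ((cmod (cconv (\<psi> k) v x))\<^sup>2))" for x
  have [measurable]: "S \<in> \<B>" unfolding S_def[abs_def] cconv_def by measurable
  have sq: "(\<integral>x. ?u x * epow (S x) (1 / 2)) \<le> en (C4 powr (1 / q) * ?U * ?N)"
  proof -
   have "(\<integral>x. ?u x * epow (S x) (1 / 2)) \<le> en ?U * epow (\<integral>x. epow (epow (S x) (1 / 2)) q) (1 / q)"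
    by (intro hoelder_power[OF p t q pq u]) auto
   also have "... \<le> en ?U * en (C4 powr (1 / q) * ?N)"
    using C4(2)[OF v] C4(1) unfolding vI S_def[symmetric] by (intro mult_left_mono root) (auto simp: epow_epow)
   also have "... = en (C4 powr (1 / q) * ?U * ?N)" using N0 by (simp add: ennreal_mult[symmetric] mult_ac)
   finally show ?thesis .
  qed
  define f where "f x = power_nl p (u x)" for x
  have cf: "cmod (f x) = cmod (u x) powr p" for x by (simp add: f_def power_nl_def)
  have [measurable]: "f \<in> \<B>" unfolding f_def[abs_def] power_nl_def by measurable
  have "(\<integral>x. I x) \<noteq> \<infinity>" using rem by (auto simp: top_unique)
  then have "AE x in lborel. I x \<noteq> \<infinity>" by (intro nn_integral_PInf_AE) auto
  (* At one such point the remainder is integrable, which makes |u|^p integrable against the weight.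
    Only then are the pieces of $D^s|u|^p$ known to be given by convolution integrals. *)
  then obtain x0 where "I x0 \<noteq> \<infinity>"
   using eventually_happens'[of "ae_filter (lborel :: 'a measure)"] by (auto simp: ae_filter_eq_bot_iff)
  then have x0: "I x0 < \<top>" by (simp add: less_top)
  have fw: "L1 (\<lambda>z. cmod (f z) * ?\<omega> z)"
   unfolding cf by (rule power_weight_integrable[OF p s(1) t u x0[unfolded I_def]])
  define g where "g k z = (LINT x. cr (Ks s k (z - x)) * f x)" for k z
  have e0: "s + DIM('a) \<ge> 0" using s by simp
  have grep: "represents (lp_proj \<eta> k (Dpow s (distr_of f))) (g k)" for k
  proof -
   obtain D where "\<And>y. \<bar>Ks s k y\<bar> \<le> D * (1 + norm y) powr (- (s + DIM('a)))" using Ks_weight[OF s(1)] by meson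
   then have "represents (fourier_multiplier (mul k) (Dpow s (distr_of f))) (g k)"
    unfolding g_def[abs_def] Ks_def by (intro multiplier_represents[OF mul_smooth mul_csupp mul_even s(1) _ e0 _ fw]) auto
   then show ?thesis by (simp only: lp_proj_def mul_def)
  qed
  have pt: "epow (\<Sum>k. en ((cmod (g k x))\<^sup>2)) (1 / 2) \<le> en 4 * (en (p * cmod (u x) powr (p - 1)) * epow (S x) (1 / 2) + en C5 * I x)" for x
  proof -
   define \<beta> where "\<beta> k = (\<integral>z. en (\<bar>Ks s k (x - z)\<bar> * \<bar>power_rem p (u x) (u z)\<bar>))" for k
   have le: "en (cmod (g k x)) \<le> en (p * cmod (u x) powr (p - 1)) * en (cmod (cconv (\<psi> k) v x)) + \<beta> k" for k
   proof -
    obtain D where D: "D > 0" "\<And>y. \<bar>Ks s k y\<bar> \<le> D * (1 + norm y) powr (- (s + DIM('a)))" using Ks_weight[OF s(1)] by meson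
    have "L1 (\<lambda>z. Ks s k (x - z) * cmod (u z) powr p)"
    proof (rule Bochner_Integration.integrable_bound)
     show "L1 (\<lambda>z. D * (1 + norm x) powr (s + DIM('a)) * (cmod (f z) * ?\<omega> z))"
      using fw by simp
     show "AE z in lborel. norm (Ks s k (x - z) * cmod (u z) powr p) \<le> norm (D * (1 + norm x) powr (s + DIM('a)) * (cmod (f z) * ?\<omega> z))"
     proof (rule AE_I2)
      fix z
      have "\<bar>Ks s k (x - z)\<bar> \<le> D * ((1 + norm x) powr (s + DIM('a)) * ?\<omega> z)"
       using D(1) weight_submult[OF e0, of x z] by (intro order_trans[OF D(2)] mult_left_mono) auto
      then have "\<bar>Ks s k (x - z)\<bar> * cmod (u z) powr p \<le> D * ((1 + norm x) powr (s + DIM('a)) * ?\<omega> z) * cmod (u z) powr p"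
       by (intro mult_right_mono) auto
      then show "norm (Ks s k (x - z) * cmod (u z) powr p) \<le> norm (D * (1 + norm x) powr (s + DIM('a)) * (cmod (f z) * ?\<omega> z))"
       using D(1) by (simp add: abs_mult cf mult_ac)
     qed
    qed measurable
    note b = piece_bound[OF p s(1) t q u v rep this]
    have "g k x = cr (LINT z. Ks s k (x - z) * cmod (u z) powr p)"
     unfolding g_def f_def power_nl_def by (simp flip: of_real_mult)
    then show ?thesis using b by (simp add: \<beta>_def)
   qed
   have "(\<Sum>k. \<beta> k) = (\<integral>z. (\<Sum>k. en (\<bar>Ks s k (x - z)\<bar> * \<bar>power_rem p (u x) (u z)\<bar>)))"
    unfolding \<beta>_def by (rule nn_integral_suminf[symmetric]) measurable
   also have "... \<le> (\<integral>z. en C5 * ?R x z)"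
   proof (rule nn_integral_mono_AE)
    show "AE z in lborel. (\<Sum>k. en (\<bar>Ks s k (x - z)\<bar> * \<bar>power_rem p (u x) (u z)\<bar>)) \<le> en C5 * ?R x z"
     using AE_lborel_singleton[of x]
    proof eventually_elim
     case (elim z)
     have "(\<Sum>k. en (\<bar>Ks s k (x - z)\<bar> * \<bar>power_rem p (u x) (u z)\<bar>)) \<le> en (C5 * dist x z powr (- s - DIM('a)) * \<bar>power_rem p (u x) (u z)\<bar>)"
      using elim C5(2)[of "x - z"] by (intro suminf_ennreal_le) (auto simp: dist_norm sum_distrib_right[symmetric] intro!: mult_right_mono)
     also have "... = en C5 * ?R x z"
      using C5(1) by (simp add: ennreal_mult[symmetric] mult_ac)
     finally show ?case .
    qed
   qed
   also have "... = en C5 * I x" unfolding I_def by (rule nn_integral_cmult) measurable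
   finally have \<beta>: "(\<Sum>k. \<beta> k) \<le> en C5 * I x" .
   have "epow (\<Sum>k. en ((cmod (g k x))\<^sup>2)) (1 / 2) \<le> en 4 * (en (p * cmod (u x) powr (p - 1)) * epow (S x) (1 / 2) + (\<Sum>k. \<beta> k))"
    unfolding S_def using p by (intro l2_sum_bound le) auto
   also have "... \<le> en 4 * (en (p * cmod (u x) powr (p - 1)) * epow (S x) (1 / 2) + en C5 * I x)"
    by (intro mult_left_mono add_left_mono \<beta>) simp
   finally show ?thesis .
  qed
  have "F012_norm \<eta> (Dpow s (distr_of f)) \<le> (\<integral>x. ennreal_sqrt (\<Sum>k. en ((cmod (g k x))\<^sup>2)))"
   unfolding F012_norm_def using grep by (intro INF_lower) simp
  also have "... \<le> (\<integral>x. en 4 * (en p * (?u x * epow (S x) (1 / 2)) + en C5 * I x))"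
  proof (rule nn_integral_mono)
   fix x
   have "en (p * cmod (u x) powr (p - 1)) = en p * ?u x" using p by (simp add: ennreal_mult)
   then show "ennreal_sqrt (\<Sum>k. en ((cmod (g k x))\<^sup>2)) \<le> en 4 * (en p * (?u x * epow (S x) (1 / 2)) + en C5 * I x)"
    using pt[of x] by (simp only: ennreal_sqrt_epow mult.assoc)
  qed
  also have "... = en 4 * (en p * (\<integral>x. ?u x * epow (S x) (1 / 2)) + en C5 * (\<integral>x. I x))"
   by (simp add: nn_integral_cmult nn_integral_add)
  also have "... \<le> en 4 * (en p * en (C4 powr (1 / q) * ?U * ?N) + en C5 * en (C2 * C3 powr (1 / q) * ?U * ?N))"
   by (intro mult_left_mono add_mono sq rem) auto
  also have "... = en (4 * (p * (C4 powr (1 / q) * ?U * ?N) + C5 * (C2 * C3 powr (1 / q) * ?U * ?N)))"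
   using p C2(1) C5(1) N0 by (simp add: ennreal_mult ennreal_plus)
  also have "4 * (p * (C4 powr (1 / q) * ?U * ?N) + C5 * (C2 * C3 powr (1 / q) * ?U * ?N)) = C * ?U * ?N"
   by (simp add: C_def algebra_simps)
  finally show "F012_norm \<eta> (Dpow s (distr_of (\<lambda>x. power_nl p (u x)))) \<le> en (C * ?U * ?N)"
   by (simp only: f_def[abs_def])
 qed
qed

end

theorem lemma2p8:
  fixes \<eta> :: "'a::euclidean_space \<Rightarrow> real" and p s t q :: real
  assumes "lp_bump \<eta>"
    and "p \<ge> 1"
    and "0 < s" and "s < 1"
    and "1 < t" and "1 < q"
    and "1 = (p - 1) / t + 1 / q"
  shows "\<exists>C>0. \<forall>(u :: 'a \<Rightarrow> complex) v.
           in_Lp t u \<longrightarrow> in_Lp q v \<longrightarrow> represents (Dpow s (distr_of u)) v \<longrightarrow>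
           F012_norm \<eta> (Dpow s (distr_of (\<lambda>x. power_nl p (u x))))
             \<le> ennreal (C * Lp_norm t u powr (p - 1) * Lp_norm q v)"
proof -
  interpret littlewood_paley \<eta> by unfold_locales (rule assms(1))
  have "p \<noteq> 1" using assms by auto
  then show ?thesis using assms by (intro power_estimate) auto
qed

end
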